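(* Let $\alpha>0$ and consider the self-similar fragmentation process $X$ with index $\alpha$ and offspring $\{\xi_j\}_{j\in\mathbb N}$, started from a single particle of unit size. Suppose that $\xi_j\in[0,1]$ for all $j$, that $\mathbb E\,\#\{j:\xi_j>0\}>1$, that $\mathbb P(\xi_1=1)<1$, that the Malthusian exponent $\beta^*>0$ exists and satisfies $\beta^*>\beta_a$, that $\mathbb E\big(\sum_j\xi_j^{\beta^*}\big)^2<\infty$, and that the structural measure $\sigma$ is nonarithmetic. Let $M_\infty$ be the terminal value of the intrinsic martingale $M_n=\sum_{|u|=n}\xi_u^{\beta^*}$, and let $\rho$ be the probability measure on $]0,\infty[$ uniquely determined by $$\int_0^\infty x^{k\alpha}\rho(\mathrm dx)=\frac{(k-1)!}{\alpha\,\psi'(\beta^* )}\prod_{j=1}^{k-1}\frac1{\psi(\beta^*+\alpha j)},\qquad k=1,2,\dots$$ Then for any bounded continuous function $f$ on $]0,\infty[$, $$L^2\text{-}\lim_{t\to\infty}\ \sum_jX_j^{\beta^*}(t)\,f\big(t^{1/\alpha}X_j(t)\big)=M_\infty\int_0^\infty f(x)\,\rho(\mathrm dx).$$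
   Context: Reproduction law: the law of a random sequence $\{\xi_j\}_{j\in\mathbb N}$ of nonnegative reals ranked in decreasing order ($\xi_j=0$ when $j$ exceeds the number of children). The structural measure is $\sigma(B)=\mathbb E\,\#\{j:\xi_j\in B\}$, $B\subset\,]0,1]$, and the characteristic function is $\phi(\beta)=\int_0^1x^\beta\sigma(\mathrm dx)=\mathbb E\sum_j\xi_j^\beta$ (sums run over $j$ with $\xi_j>0$); $\beta_a\in[-\infty,\infty]$ is the abscissa of convergence of this integral, and $\psi=1-\phi$. The Malthusian exponent is the (necessarily unique) real $\beta^*>0$ with $\phi(\beta^* )=1$. The measure $\sigma$ is arithmetic if it is a discrete measure supported by a geometric sequence $\{r^k:k=0,1,2,\dots\}$ for some $r\in\,]0,1[$; otherwise it is nonarithmetic. Fragmentation process: each particle of size $x>0$ lives, without changing size, an exponential time with parameter $x^\alpha$, and is then replaced by particles of sizes $x\tilde\xi_j$, where $\{\tilde\xi_j\}$ is distributed according to the reproduction law, independently of the lifetime; distinct particles evolve independently. Genealogical construction: let $\mathcal U=\bigcup_{n\ge0}\mathbb N^n$, $\mathbb N^0=\{\emptyset\}$, and $|u|=n$ for $u\in\mathbb N^n$. For $u=(u_1,\dots,u_n)$, $n\ge1$, let $u-=(u_1,\dots,u_{n-1})$. Each node $u$ carries a mark $(\xi_u,g_u,d_u)$ (size, birth time, death time): $(\xi_\emptyset,g_\emptyset,d_\emptyset)=(1,0,\mathbf e_\emptyset)$ and, for $|u|\ge1$, $\xi_u=\xi_{u-}\tilde\xi_u$, $g_u=d_{u-}$,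 $d_u=g_u+\xi_u^{-\alpha}\mathbf e_u$, where the sequences $(\tilde\xi_{v,i})_{i\in\mathbb N}$, $v\in\mathcal U$, are i.i.d. with the reproduction law and the $\mathbf e_u$, $u\in\mathcal U$, are i.i.d. standard exponential variables independent of these sequences. Nodes with $\xi_u=0$ do not correspond to particles and contribute nothing to any sum. The configuration $X(t)=\{X_j(t)\}_j$ is the collection (with multiplicity) of the sizes $\xi_u>0$ of the nodes with $g_u\le t<d_u$. Under the hypotheses of the claim, $(M_n)_{n\ge0}$ is a martingale (in the generation index $n$) bounded in $L^2$; $M_\infty$ denotes its limit. The measure $\rho$ exists and is the weak limit as $t\to\infty$ of the probability measures $\sigma_t^*$ on $]0,\infty[$ given by $\int f\,\mathrm d\sigma_t^*=\mathbb E\sum_jf(t^{1/\alpha}X_j(t))X_j^{\beta^*}(t)$. *)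

theory Defs
  imports "HOL-Probability.Probability"
begin

section \<open>Reproduction laws\<close>

abbreviation seq_space :: "(nat \<Rightarrow> real) measure" where
  "seq_space \<equiv> Pi\<^sub>M UNIV (\<lambda>_. borel)"

text \<open>
  The children are numbered from 0, so the largest child is \<open>\<xi> 0\<close>; \<open>\<xi> j = 0\<close> means that
  there is no child number \<open>j\<close>.
\<close>

locale reproduction_law = prob_space \<nu> for \<nu> :: "(nat \<Rightarrow> real) measure" +
  assumes sets_law: "sets \<nu> = sets seq_space"
    and ranked: "AE \<xi> in \<nu>. decseq \<xi> \<and> (\<forall>j. 0 \<le> \<xi> j)"

definition structural_measure :: "(nat \<Rightarrow> real) measure \<Rightarrow> real measure" where
  "structural_measure \<nu> =
     measure_of {0<..1} (sets (restrict_space borel {0<..1}))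
       (\<lambda>B. \<integral>\<^sup>+ \<xi>. emeasure (count_space UNIV) {j. \<xi> j \<in> B} \<partial>\<nu>)"

definition char_fun :: "(nat \<Rightarrow> real) measure \<Rightarrow> real \<Rightarrow> ennreal" where
  "char_fun \<nu> \<beta> = (\<integral>\<^sup>+ x. ennreal (x powr \<beta>) \<partial>structural_measure \<nu>)"

text \<open>\<open>Inf {} = \<infinity>\<close> covers the case where the integral diverges for every exponent.\<close>

definition abscissa :: "(nat \<Rightarrow> real) measure \<Rightarrow> ereal" where
  "abscissa \<nu> = Inf (ereal ` {\<beta>. char_fun \<nu> \<beta> < \<infinity>})"

text \<open>Only meaningful for arguments where \<open>char_fun \<nu>\<close> is finite, e.g. above the abscissa.\<close>

definition psi :: "(nat \<Rightarrow> real) measure \<Rightarrow> real \<Rightarrow> real" where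
  "psi \<nu> \<beta> = 1 - enn2real (char_fun \<nu> \<beta>)"

definition malthusian_exponent :: "(nat \<Rightarrow> real) measure \<Rightarrow> real \<Rightarrow> bool" where
  "malthusian_exponent \<nu> \<beta> \<longleftrightarrow> 0 < \<beta> \<and> char_fun \<nu> \<beta> = 1"

definition arithmetic :: "real measure \<Rightarrow> bool" where
  "arithmetic \<mu> \<longleftrightarrow> (\<exists>r. 0 < r \<and> r < 1 \<and> (AE x in \<mu>. \<exists>k::nat. x = r ^ k))"

lemma emeasure_structural_measure:
  assumes \<nu>: "sets \<nu> = sets seq_space"
    and B: "B \<in> sets (restrict_space borel {0<..1})"
  shows "emeasure (structural_measure \<nu>) B =
           (\<integral>\<^sup>+ \<xi>. emeasure (count_space UNIV) {j. \<xi> j \<in> B} \<partial>\<nu>)"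
proof -
  let ?\<mu> = "\<lambda>B. \<integral>\<^sup>+ \<xi>. emeasure (count_space UNIV) {j. \<xi> j \<in> B} \<partial>\<nu>"
  let ?A = "sets (restrict_space borel {0<..1::real})"
  have count: "emeasure (count_space UNIV) {j. \<xi> j \<in> C} = (\<Sum>j. indicator C (\<xi> j) :: ennreal)"
    for \<xi> :: "nat \<Rightarrow> real" and C
    by (subst nn_integral_count_space_nat[symmetric])
       (simp add: nn_integral_indicator[symmetric] indicator_def del: nn_integral_indicator)
  have borel: "C \<in> sets borel" if "C \<in> ?A" for C
    using that by (auto simp: sets_restrict_space_iff)
  have meas: "(\<lambda>\<xi>. indicator C (\<xi> j) :: ennreal) \<in> borel_measurable \<nu>" if "C \<in> ?A" for C j
    using borel[OF that] measurable_component_singleton[of j UNIV "\<lambda>_. borel :: real measure"]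
    by (subst measurable_cong_sets[OF \<nu> refl]) (auto intro: borel_measurable_indicator')
  have add: "countably_additive ?A ?\<mu>"
    unfolding countably_additive_def
  proof (intro allI impI)
    fix C :: "nat \<Rightarrow> real set"
    assume C: "range C \<subseteq> ?A" "disjoint_family C"
    have "(\<Sum>i. ?\<mu> (C i)) = (\<integral>\<^sup>+ \<xi>. (\<Sum>i. \<Sum>j. indicator (C i) (\<xi> j)) \<partial>\<nu>)"
      unfolding count using C meas by (subst nn_integral_suminf) auto
    also have "\<dots> = (\<integral>\<^sup>+ \<xi>. emeasure (count_space UNIV) {j. \<xi> j \<in> (\<Union>i. C i)} \<partial>\<nu>)"
    proof (rule nn_integral_cong)
      fix \<xi> :: "nat \<Rightarrow> real"
      have "(\<Sum>i. emeasure (count_space UNIV) {j. \<xi> j \<in> C i})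
          = emeasure (count_space UNIV) (\<Union>i. {j. \<xi> j \<in> C i})"
        using C(2) by (intro suminf_emeasure) (auto simp: disjoint_family_on_def)
      moreover have "(\<Union>i. {j. \<xi> j \<in> C i}) = {j. \<xi> j \<in> (\<Union>i. C i)}" by auto
      ultimately show "(\<Sum>i. \<Sum>j. indicator (C i) (\<xi> j))
          = emeasure (count_space UNIV) {j. \<xi> j \<in> (\<Union>i. C i)}"
        by (simp add: count)
    qed
    finally show "(\<Sum>i. ?\<mu> (C i)) = ?\<mu> (\<Union>i. C i)" .
  qed
  show ?thesis
    unfolding structural_measure_def
  proof (rule emeasure_measure_of_sigma)
    show "sigma_algebra {0<..1::real} ?A"
      using sets.sigma_algebra_axioms[of "restrict_space borel {0<..1::real}"]
      by (simp add: space_restrict_space)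
  qed (use add B in \<open>auto simp: positive_def\<close>)
qed


section \<open>Genealogical construction of the fragmentation\<close>

text \<open>
  A node \<open>(u\<^sub>1, \<dots>, u\<^sub>n)\<close> is the list \<open>[u\<^sub>n, \<dots>, u\<^sub>1]\<close>: the root is \<open>[]\<close> and
  \<open>i # v\<close> is the child number \<open>i\<close> of \<open>v\<close>.  The ratios of the children of \<open>v\<close> to their parent
  form the sequence \<open>\<eta> v\<close>; \<open>e u\<close> is the normalised lifetime of \<open>u\<close>.
  Independence of the two families is stated for the generated sigma-algebras because
  \<open>indep_var\<close> requires both variables to have the same type.
\<close>

type_synonym node = "nat list"

locale offspring_and_lifetimes =
  prob_space M + reproduction: reproduction_law \<nu>
  for M :: "'a measure" and \<nu> :: "(nat \<Rightarrow> real) measure"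
    and \<eta> :: "node \<Rightarrow> 'a \<Rightarrow> nat \<Rightarrow> real" and e :: "node \<Rightarrow> 'a \<Rightarrow> real" +
  assumes offspring_measurable: "\<And>v. \<eta> v \<in> measurable M seq_space"
    and offspring_law: "\<And>v. distr M seq_space (\<eta> v) = \<nu>"
    and offspring_indep: "indep_vars (\<lambda>_. seq_space) \<eta> UNIV"
    and lifetime_law: "\<And>u. distributed M lborel (e u) (exponential_density 1)"
    and lifetime_indep: "indep_vars (\<lambda>_. borel) e UNIV"
    and offspring_lifetime_indep:
      "indep_set
         (sets (vimage_algebra (space M) (\<lambda>\<omega> v. \<eta> v \<omega>) (Pi\<^sub>M UNIV (\<lambda>_. seq_space))))
         (sets (vimage_algebra (space M) (\<lambda>\<omega> u. e u \<omega>) (Pi\<^sub>M UNIV (\<lambda>_. borel))))"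

primrec node_size :: "(node \<Rightarrow> 'a \<Rightarrow> nat \<Rightarrow> real) \<Rightarrow> node \<Rightarrow> 'a \<Rightarrow> real" where
  "node_size \<eta> [] \<omega> = 1"
| "node_size \<eta> (i # v) \<omega> = node_size \<eta> v \<omega> * \<eta> v \<omega> i"

text \<open>
  Nodes of size 0 do not correspond to particles; the value \<open>0 powr (- \<alpha>) = 0\<close> that enters
  their times is never used.
\<close>

primrec birth_time ::
  "real \<Rightarrow> (node \<Rightarrow> 'a \<Rightarrow> nat \<Rightarrow> real) \<Rightarrow> (node \<Rightarrow> 'a \<Rightarrow> real) \<Rightarrow> node \<Rightarrow> 'a \<Rightarrow> real" where
  "birth_time \<alpha> \<eta> e [] \<omega> = 0"
| "birth_time \<alpha> \<eta> e (i # v) \<omega> = birth_time \<alpha> \<eta> e v \<omega> + node_size \<eta> v \<omega> powr (- \<alpha>) * e v \<omega>"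

definition death_time ::
  "real \<Rightarrow> (node \<Rightarrow> 'a \<Rightarrow> nat \<Rightarrow> real) \<Rightarrow> (node \<Rightarrow> 'a \<Rightarrow> real) \<Rightarrow> node \<Rightarrow> 'a \<Rightarrow> real" where
  "death_time \<alpha> \<eta> e u \<omega> = birth_time \<alpha> \<eta> e u \<omega> + node_size \<eta> u \<omega> powr (- \<alpha>) * e u \<omega>"

text \<open>
  The configuration at time \<open>t\<close> is the family of sizes indexed by the particles alive at \<open>t\<close>,
  so a sum over its members with multiplicity is a sum over this set of nodes.
\<close>

definition alive ::
  "real \<Rightarrow> (node \<Rightarrow> 'a \<Rightarrow> nat \<Rightarrow> real) \<Rightarrow> (node \<Rightarrow> 'a \<Rightarrow> real) \<Rightarrow> real \<Rightarrow> 'a \<Rightarrow> node set" where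
  "alive \<alpha> \<eta> e t \<omega> =
     {u. 0 < node_size \<eta> u \<omega> \<and> birth_time \<alpha> \<eta> e u \<omega> \<le> t \<and> t < death_time \<alpha> \<eta> e u \<omega>}"

definition config_sum ::
  "real \<Rightarrow> (node \<Rightarrow> 'a \<Rightarrow> nat \<Rightarrow> real) \<Rightarrow> (node \<Rightarrow> 'a \<Rightarrow> real) \<Rightarrow> real \<Rightarrow> (real \<Rightarrow> real) \<Rightarrow> 'a \<Rightarrow> real" where
  "config_sum \<alpha> \<eta> e t h \<omega> = (\<Sum>\<^sub>\<infinity>u\<in>alive \<alpha> \<eta> e t \<omega>. h (node_size \<eta> u \<omega>))"

definition intrinsic_martingale ::
  "(node \<Rightarrow> 'a \<Rightarrow> nat \<Rightarrow> real) \<Rightarrow> real \<Rightarrow> nat \<Rightarrow> 'a \<Rightarrow> real" where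
  "intrinsic_martingale \<eta> \<beta> n \<omega> = (\<Sum>\<^sub>\<infinity>u\<in>{u. length u = n}. node_size \<eta> u \<omega> powr \<beta>)"

definition terminal_value :: "(node \<Rightarrow> 'a \<Rightarrow> nat \<Rightarrow> real) \<Rightarrow> real \<Rightarrow> 'a \<Rightarrow> real" where
  "terminal_value \<eta> \<beta> \<omega> = lim (\<lambda>n. intrinsic_martingale \<eta> \<beta> n \<omega>)"


section \<open>Limits in \<open>L\<^sup>2\<close>\<close>

definition in_L2 :: "'a measure \<Rightarrow> ('a \<Rightarrow> real) \<Rightarrow> bool" where
  "in_L2 M Y \<longleftrightarrow> Y \<in> borel_measurable M \<and> integrable M (\<lambda>\<omega>. (Y \<omega>)\<^sup>2)"

definition L2_tendsto ::
  "'a measure \<Rightarrow> ('i \<Rightarrow> 'a \<Rightarrow> real) \<Rightarrow> ('a \<Rightarrow> real) \<Rightarrow> 'i filter \<Rightarrow> bool" where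
  "L2_tendsto M Y Z F \<longleftrightarrow>
     (\<forall>\<^sub>F t in F. in_L2 M (Y t)) \<and> in_L2 M Z \<and>
     ((\<lambda>t. \<integral>\<omega>. (Y t \<omega> - Z \<omega>)\<^sup>2 \<partial>M) \<longlongrightarrow> 0) F"

end

theory Submission
  imports Defs
begin

text \<open>
  Everything lives on the tree of marks \<open>(\<eta> v, e v)\<close>, whose subtrees above the children of
  the root are independent copies of the whole, independent of the mark of the root.

  First moments: the law of a fragment tagged with probability proportional to
  \<open>x\<^sup>\<beta>\<close> has moments \<open>m p t\<close> that satisfy
  \<open>d/dt m p = - \<psi>(\<beta> + p) m (p + \<alpha>)\<close>.  Hence \<open>t\<^sup>k m (k \<alpha>) t\<close> is bounded, and
  \<open>Q t = t m \<alpha> t\<close> is nearly harmonic for multiplication by \<open>Z\<^sup>\<alpha>\<close>, with \<open>Z\<close> of the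
  size-biased law.  As \<open>E (Q (Z\<^sup>\<alpha> t) - Q t)\<^sup>2\<close> tends to 0 and the law is
  nonarithmetic, \<open>Q\<close> varies slowly.  Along a sequence on which \<open>Q\<close> converges to some \<open>q\<close>,
  all rescaled moments converge to those of \<open>\<rho>\<close> up to a common factor, which a bound on one
  negative moment (this is where \<open>\<beta>\<close> has to exceed the abscissa) forces to be 1.  So \<open>q\<close>
  does not depend on the sequence, and no renewal theorem is needed.  The same argument determines
  the constant in front of the moments of \<open>\<rho>\<close>, so \<open>deriv (psi \<nu>) \<beta>\<close> is never computed.

  Second moments: for \<open>D k t = E (A t - c M\<^sub>k)\<^sup>2\<close>, where \<open>A t\<close> is the weighted sum over the
  fragments and \<open>c\<close> its limiting mean, conditioning on the mark of the root gives
  \<open>limsup D (k + 1) \<le> \<phi>(2\<beta>) limsup D k\<close>, since the cross terms only involve the differences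
  of means, which vanish in the limit.  As \<open>\<phi>(2\<beta>) < 1\<close> and \<open>M\<^sub>k\<close> converges in \<open>L\<^sup>2\<close>, letting
  \<open>k\<close> tend to infinity finishes the proof.
\<close>

subsection \<open>Slow variation of asymptotically harmonic functions\<close>

text \<open>The obstacle is that the recursion at the root leaves the curve on which the theorem is
  stated. A child of ratio x, born at time e, sees time x^\<alpha> (t - e) and scale t^(1/\<alpha>)
  x, and this scale is no longer the power of that time. So time and scale are separate arguments in
  the second half, and every limit is proved along all pairs of sequences (T, r) with r /
  T^(1/\<alpha>) tending to 1; this class is stable under passing to a child.

  Slow variation rests on a convexity identity: the mean square E (Q(W t) - Q(t))^2, W = Z^\<alpha>,
  is up to o(1) the gain of Q^2 under averaging, and the gains of n successive averagings add up to
  at most sup Q^2.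

  Moments of order k \<ge> 1 cannot see an atom at 0, which is why a common factor is left open at
  first; their growth, of order k! K^k, lets the transforms be continued through the half-plane Re z
  \<le> 0 in steps of a fixed length.

  The backward equation comes from the root; the forward equation is derived from it by showing that
  its integrated right-hand side solves the backward equation, whose solution is unique by a maximum
  argument.\<close>

locale multiplicative_kernel = prob_space K for K :: "real measure" +
  assumes sets_K [measurable_cong]: "sets K = sets borel"
    and K_pos: "AE w in K. 0 < w"
begin

definition avg :: "(real \<Rightarrow> real) \<Rightarrow> real \<Rightarrow> real" where
  "avg g t = (\<integral>w. g (w * t) \<partial>K)"

lemma avg_measurable [measurable]:
  assumes [measurable]: "g \<in> borel_measurable borel"
  shows "avg g \<in> borel_measurable borel"
  unfolding avg_def by measurable

lemma avg_integrable:
  assumes [measurable]: "g \<in> borel_measurable borel" and "\<And>x. \<bar>g x\<bar> \<le> (B::real)"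
  shows "integrable K (\<lambda>w. g (w * t))"
  by (rule integrable_const_bound[where B = B]) (use assms in auto)

lemma avg_bound:
  assumes [measurable]: "g \<in> borel_measurable borel" and "\<And>x. \<bar>g x\<bar> \<le> (B::real)"
  shows "\<bar>avg g t\<bar> \<le> B"
proof -
  have "\<bar>avg g t\<bar> \<le> (\<integral>w. \<bar>g (w * t)\<bar> \<partial>K)"
    unfolding avg_def by (rule integral_abs_bound)
  also have "\<dots> \<le> (\<integral>w. B \<partial>K)"
    by (intro integral_mono integrable_abs avg_integrable[OF assms]) (use assms in auto)
  finally show ?thesis by (simp add: prob_space)
qed

lemma avg_tendsto_0:
  assumes [measurable]: "g \<in> borel_measurable borel" and "\<And>x. \<bar>g x\<bar> \<le> (B::real)"
    and lim: "(g \<longlongrightarrow> 0) at_top"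
  shows "(avg g \<longlongrightarrow> 0) at_top"
proof -
  have "((\<lambda>t. \<integral>w. g (w * t) \<partial>K) \<longlongrightarrow> (\<integral>w. 0 \<partial>K)) at_top"
  proof (rule integral_dominated_convergence_at_top)
    show "AE w in K. ((\<lambda>t. g (w * t)) \<longlongrightarrow> 0) at_top"
      using K_pos
    proof eventually_elim
      case (elim w)
      have "filterlim (\<lambda>t. w * t) at_top at_top"
        by (rule filterlim_tendsto_pos_mult_at_top[OF tendsto_const elim filterlim_ident])
      then show ?case by (rule filterlim_compose[OF lim])
    qed
    show "\<forall>\<^sub>F t in at_top. AE w in K. norm (g (w * t)) \<le> B"
      using assms by auto
  qed auto
  then show ?thesis by (simp add: avg_def[abs_def])
qed

text \<open>The mean square v(t) equals, up to a vanishing error, the gain of Q^2 under one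
  averaging; and near-harmonicity with convexity bounds v by its own average up to a vanishing
  error. Summing n gains telescopes, so n v(t) is at most sup Q^2 plus a term that vanishes for
  fixed n.\<close>

lemma variation_tendsto_0:
  assumes Q[measurable]: "Q \<in> borel_measurable borel" and B: "\<And>x. \<bar>Q x\<bar> \<le> B"
    and harm: "((\<lambda>t. avg Q t - Q t) \<longlongrightarrow> 0) at_top"
  shows "((\<lambda>t. \<integral>w. (Q (w * t) - Q t)\<^sup>2 \<partial>K) \<longlongrightarrow> 0) at_top"
proof -
  have B0: "0 \<le> B" using B[of 0] by linarith
  define D where "D t = Q t - avg Q t" for t
  define v where "v t = (\<integral>w. (Q (w * t) - Q t)\<^sup>2 \<partial>K)" for t
  have D[measurable]: "D \<in> borel_measurable borel" unfolding D_def by measurable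
  have v[measurable]: "v \<in> borel_measurable borel" unfolding v_def by measurable
  have D0: "(D \<longlongrightarrow> 0) at_top" using tendsto_minus[OF harm] by (simp add: D_def[abs_def])
  have DB: "\<bar>D t\<bar> \<le> 2 * B" for t
    using B[of t] avg_bound[OF Q B, of t] unfolding D_def by linarith
  have Q2: "\<bar>(Q x)\<^sup>2\<bar> \<le> B\<^sup>2" for x using B[of x] by (simp add: abs_le_square_iff[symmetric] B0)
  have sqb: "\<bar>(Q x - Q y)\<^sup>2\<bar> \<le> (2 * B)\<^sup>2" for x y
  proof -
    have "\<bar>Q x - Q y\<bar> \<le> \<bar>2 * B\<bar>" using B[of x] B[of y] B0 by linarith
    then show ?thesis by (simp only: abs_le_square_iff abs_power2)
  qed
  have vint: "integrable K (\<lambda>w. (Q (w * t) - Q s)\<^sup>2)" for t s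
    by (rule integrable_const_bound[where B = "(2 * B)\<^sup>2"]) (use sqb in auto)
  have v0: "0 \<le> v t" for t unfolding v_def by simp
  have vB: "\<bar>v t\<bar> \<le> (2 * B)\<^sup>2" for t
  proof -
    have "v t \<le> (\<integral>w. (2 * B)\<^sup>2 \<partial>K)"
      unfolding v_def using sqb by (intro integral_mono vint) auto
    then show ?thesis using v0 by (simp add: prob_space)
  qed
  have v_eq: "v t = avg (\<lambda>x. (Q x)\<^sup>2) t - (Q t)\<^sup>2 + 2 * Q t * D t" for t
  proof -
    have "v t = (\<integral>w. (Q (w * t))\<^sup>2 - 2 * Q t * Q (w * t) + (Q t)\<^sup>2 \<partial>K)"
      unfolding v_def by (simp add: power2_eq_square algebra_simps)
    also have "\<dots> = avg (\<lambda>x. (Q x)\<^sup>2) t - 2 * Q t * avg Q t + (Q t)\<^sup>2"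
      unfolding avg_def
      using avg_integrable[OF Q B, of t] avg_integrable[of "\<lambda>x. (Q x)\<^sup>2", OF _ Q2, of t]
      by (simp add: prob_space)
    finally show ?thesis by (simp add: D_def power2_eq_square algebra_simps)
  qed
  define err where "err t = 8 * B * (avg (\<lambda>x. \<bar>D x\<bar>) t + \<bar>D t\<bar>)" for t
  have err[measurable]: "err \<in> borel_measurable borel" unfolding err_def by measurable
  have absD0: "((\<lambda>t. \<bar>D t\<bar>) \<longlongrightarrow> 0) at_top" using D0 by (rule tendsto_rabs_zero)
  have absDB: "\<bar>\<bar>D t\<bar>\<bar> \<le> 2 * B" for t using DB by simp
  have err0: "(err \<longlongrightarrow> 0) at_top"
    unfolding err_def
    by (intro tendsto_mult_right_zero tendsto_add_zero absD0
        avg_tendsto_0[of "\<lambda>x. \<bar>D x\<bar>", OF _ absDB absD0]) simp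
  have errB: "\<bar>err t\<bar> \<le> 8 * B * (4 * B)" for t
  proof -
    have "\<bar>avg (\<lambda>x. \<bar>D x\<bar>) t + \<bar>D t\<bar>\<bar> \<le> 4 * B"
      using avg_bound[of "\<lambda>x. \<bar>D x\<bar>", OF _ absDB, of t] DB[of t] by simp
    then show ?thesis unfolding err_def abs_mult using B0 by (intro mult_mono) auto
  qed
  \<comment> \<open>In the difference Q(w t) - Q(t) replace Q by its average, at a cost controlled
    by D, and move the square inside the averaging by Cauchy-Schwarz. Since multiplications commute,
    what remains is the average of v.\<close>
  have v_le: "v t \<le> avg v t + err t" for t
  proof -
    have cs: "(avg Q (w * t) - avg Q t)\<^sup>2 \<le> (\<integral>y. (Q (w * (y * t)) - Q (y * t))\<^sup>2 \<partial>K)" for w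
    proof -
      let ?h = "\<lambda>y. Q (w * (y * t)) - Q (y * t)"
      have hb: "\<bar>?h y\<bar> \<le> 2 * B" for y using B[of "w * (y * t)"] B[of "y * t"] by linarith
      have hi: "integrable K ?h"
        by (rule integrable_const_bound[where B = "2 * B"]) (use hb in auto)
      have h2i: "integrable K (\<lambda>y. (?h y)\<^sup>2)"
        by (rule integrable_const_bound[where B = "(2 * B)\<^sup>2"]) (use sqb in auto)
      have eq: "avg Q (w * t) - avg Q t = (\<integral>y. ?h y \<partial>K)"
        unfolding avg_def
        using avg_integrable[OF Q B, of "w * t"] avg_integrable[OF Q B, of t]
        by (simp add: mult.left_commute)
      define c where "c = (\<integral>y. ?h y \<partial>K)"
      have "0 \<le> (\<integral>y. (?h y - c)\<^sup>2 \<partial>K)" by simp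
      also have "\<dots> = (\<integral>y. (?h y)\<^sup>2 - 2 * c * ?h y + c\<^sup>2 \<partial>K)"
        by (simp add: power2_eq_square algebra_simps)
      also have "\<dots> = (\<integral>y. (?h y)\<^sup>2 \<partial>K) - 2 * c * c + c\<^sup>2"
        using hi h2i by (subst Bochner_Integration.integral_add Bochner_Integration.integral_diff; simp add: prob_space c_def)+
      finally show ?thesis unfolding eq c_def[symmetric] by (simp add: power2_eq_square)
    qed
    have pt: "(Q (w * t) - Q t)\<^sup>2 \<le> (avg Q (w * t) - avg Q t)\<^sup>2 + 8 * B * (\<bar>D (w * t)\<bar> + \<bar>D t\<bar>)" for w
    proof -
      let ?x = "Q (w * t) - Q t" and ?y = "avg Q (w * t) - avg Q t"
      have "?x\<^sup>2 - ?y\<^sup>2 = (?x + ?y) * (?x - ?y)" by (simp add: power2_eq_square algebra_simps)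
      also have "\<dots> \<le> \<bar>?x + ?y\<bar> * \<bar>?x - ?y\<bar>" by (metis abs_ge_self abs_mult)
      also have "\<bar>?x + ?y\<bar> * \<bar>?x - ?y\<bar> \<le> (8 * B) * (\<bar>D (w * t)\<bar> + \<bar>D t\<bar>)"
      proof (rule mult_mono)
        show "\<bar>?x + ?y\<bar> \<le> 8 * B"
          using B[of "w * t"] B[of t] avg_bound[OF Q B, of "w * t"] avg_bound[OF Q B, of t] by linarith
        show "\<bar>?x - ?y\<bar> \<le> \<bar>D (w * t)\<bar> + \<bar>D t\<bar>" unfolding D_def by linarith
      qed (use B0 in auto)
      finally show ?thesis by simp
    qed
    have int1: "integrable K (\<lambda>w. \<integral>y. (Q (w * (y * t)) - Q (y * t))\<^sup>2 \<partial>K)"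
    proof (rule integrable_const_bound[where B = "(2 * B)\<^sup>2"])
      show "AE w in K. norm (\<integral>y. (Q (w * (y * t)) - Q (y * t))\<^sup>2 \<partial>K) \<le> (2 * B)\<^sup>2"
      proof (rule AE_I2)
        fix w
        have "(\<integral>y. (Q (w * (y * t)) - Q (y * t))\<^sup>2 \<partial>K) \<le> (\<integral>y. (2 * B)\<^sup>2 \<partial>K)"
          by (intro integral_mono integrable_const_bound[where B = "(2 * B)\<^sup>2"]) (use sqb in auto)
        then show "norm (\<integral>y. (Q (w * (y * t)) - Q (y * t))\<^sup>2 \<partial>K) \<le> (2 * B)\<^sup>2"
          by (simp add: prob_space)
      qed
    qed measurable
    have int2: "integrable K (\<lambda>w. 8 * B * (\<bar>D (w * t)\<bar> + \<bar>D t\<bar>))"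
      using avg_integrable[of "\<lambda>x. \<bar>D x\<bar>", OF _ absDB, of t] by simp
    have "v t \<le> (\<integral>w. (\<integral>y. (Q (w * (y * t)) - Q (y * t))\<^sup>2 \<partial>K) + 8 * B * (\<bar>D (w * t)\<bar> + \<bar>D t\<bar>) \<partial>K)"
      unfolding v_def
      by (intro integral_mono vint Bochner_Integration.integrable_add int1 int2)
         (use pt cs add_right_mono order_trans in blast)
    also have "\<dots> = (\<integral>w. \<integral>y. (Q (w * (y * t)) - Q (y * t))\<^sup>2 \<partial>K \<partial>K) + err t"
      using int1 int2 avg_integrable[of "\<lambda>x. \<bar>D x\<bar>", OF _ absDB, of t]
      by (simp add: err_def avg_def prob_space)
    also have "(\<integral>w. \<integral>y. (Q (w * (y * t)) - Q (y * t))\<^sup>2 \<partial>K \<partial>K) = avg v t"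
    proof -
      interpret pair_prob_space K K ..
      have "integrable (K \<Otimes>\<^sub>M K) (\<lambda>(w, y). (Q (w * (y * t)) - Q (y * t))\<^sup>2)"
        by (rule P.integrable_const_bound[where B = "(2 * B)\<^sup>2"]) (use sqb in auto)
      from Fubini_integral[OF this] show ?thesis
        unfolding avg_def v_def by simp
    qed
    finally show ?thesis .
  qed
  \<comment> \<open>Here g is the n-fold average of Q^2 and e collects the errors; the bound B^2 on
    g is the same for all n. In the induction step the averaged inequality is added to
    \<open>v_eq\<close>, and the average of Q^2 cancels.\<close>
  have main: "\<exists>g e. g \<in> borel_measurable borel \<and> (\<forall>t. \<bar>g t\<bar> \<le> B\<^sup>2) \<and> e \<in> borel_measurable borel
      \<and> (\<exists>C. \<forall>t. \<bar>e t\<bar> \<le> C) \<and> (e \<longlongrightarrow> 0) at_top \<and> (\<forall>t. real n * v t \<le> g t - (Q t)\<^sup>2 + e t)" for n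
  proof (induction n)
    case 0
    show ?case
      by (rule exI[of _ "\<lambda>t. (Q t)\<^sup>2"], rule exI[of _ "\<lambda>t. 0"]) (use Q2 in auto)
  next
    case (Suc n)
    then obtain g e C where g[measurable]: "g \<in> borel_measurable borel" and gB: "\<And>t. \<bar>g t\<bar> \<le> B\<^sup>2"
      and e[measurable]: "e \<in> borel_measurable borel" and eC: "\<And>t. \<bar>e t\<bar> \<le> C"
      and e0: "(e \<longlongrightarrow> 0) at_top" and ineq: "\<And>t. real n * v t \<le> g t - (Q t)\<^sup>2 + e t" by blast
    define e' where "e' t = avg e t + real n * err t + 2 * Q t * D t" for t
    have "real (Suc n) * v t \<le> avg g t - (Q t)\<^sup>2 + e' t" for t
    proof -
      have "real n * avg v t \<le> avg g t - avg (\<lambda>x. (Q x)\<^sup>2) t + avg e t"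
      proof -
        have "real n * avg v t = (\<integral>w. real n * v (w * t) \<partial>K)" unfolding avg_def by simp
        also have "\<dots> \<le> (\<integral>w. g (w * t) - (Q (w * t))\<^sup>2 + e (w * t) \<partial>K)"
          by (intro integral_mono ineq Bochner_Integration.integrable_add Bochner_Integration.integrable_diff
              integrable_mult_right avg_integrable[OF v vB] avg_integrable[OF g gB] avg_integrable[OF e eC]
              avg_integrable[of "\<lambda>x. (Q x)\<^sup>2", OF _ Q2]) auto
        also have "\<dots> = avg g t - avg (\<lambda>x. (Q x)\<^sup>2) t + avg e t"
          unfolding avg_def
          using avg_integrable[OF g gB] avg_integrable[OF e eC]
              avg_integrable[of "\<lambda>x. (Q x)\<^sup>2", OF _ Q2] by simp
        finally show ?thesis .
      qed
      moreover have "real n * v t \<le> real n * avg v t + real n * err t"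
        using mult_left_mono[OF v_le, of "real n" t] by (simp add: algebra_simps)
      moreover have "real (Suc n) * v t = real n * v t + v t" by (simp add: algebra_simps)
      ultimately show ?thesis using v_eq[of t] unfolding e'_def by linarith
    qed
    moreover have "\<bar>e' t\<bar> \<le> C + real n * (8 * B * (4 * B)) + 2 * (B * (2 * B))" for t
    proof -
      have "\<bar>Q t * D t\<bar> \<le> B * (2 * B)"
        unfolding abs_mult using B DB B0 by (intro mult_mono) auto
      moreover have "\<bar>real n * err t\<bar> \<le> real n * (8 * B * (4 * B))"
        unfolding abs_mult using errB by (intro mult_mono) auto
      ultimately show ?thesis unfolding e'_def using avg_bound[OF e eC, of t] by linarith
    qed
    moreover have "(e' \<longlongrightarrow> 0) at_top"
    proof -
      have "((\<lambda>t. Q t * D t) \<longlongrightarrow> 0) at_top"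
      proof (rule tendsto_rabs_zero_cancel, rule tendsto_sandwich[OF _ _ tendsto_const])
        show "((\<lambda>t. B * \<bar>D t\<bar>) \<longlongrightarrow> 0) at_top" using tendsto_mult_right_zero[OF absD0] .
      qed (use B in \<open>auto simp: abs_mult intro!: mult_right_mono always_eventually\<close>)
      from tendsto_mult_right_zero[OF this, of 2]
      have "((\<lambda>t. 2 * Q t * D t) \<longlongrightarrow> 0) at_top" by (simp add: mult.assoc)
      from tendsto_add[OF tendsto_add[OF avg_tendsto_0[OF e eC e0] tendsto_mult_right_zero[OF err0, of "real n"]] this]
      show ?thesis by (simp add: e'_def[abs_def])
    qed
    moreover have "e' \<in> borel_measurable borel" unfolding e'_def by measurable
    ultimately show ?case
      using avg_bound[OF g gB] avg_measurable[OF g] by blast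
  qed
  have "((\<lambda>t. v t) \<longlongrightarrow> 0) at_top"
  proof (rule tendstoI)
    fix \<epsilon> :: real assume \<epsilon>: "0 < \<epsilon>"
    obtain n :: nat where n: "B\<^sup>2 + 1 < real n * \<epsilon>"
      using ex_less_of_nat_mult[OF \<epsilon>, of "B\<^sup>2 + 1"] by blast
    have n0: "0 < n"
    proof (rule ccontr)
      assume "\<not> 0 < n"
      then show False using n zero_le_power2[of B] by (simp del: zero_le_power2)
    qed
    obtain g e where gB: "\<And>t. \<bar>g t\<bar> \<le> B\<^sup>2" and e0: "(e \<longlongrightarrow> 0) at_top"
      and ineq: "\<And>t. real n * v t \<le> g t - (Q t)\<^sup>2 + e t" using main[of n] by blast
    have "\<forall>\<^sub>F t in at_top. dist (e t) 0 < 1" using e0 by (rule tendstoD) simp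
    then show "\<forall>\<^sub>F t in at_top. dist (v t) 0 < \<epsilon>"
    proof eventually_elim
      case (elim t)
      have "real n * v t \<le> B\<^sup>2 + 1"
        using ineq[of t] gB[of t] elim zero_le_power2[of "Q t"] unfolding dist_real_def by linarith
      then have "real n * v t < real n * \<epsilon>" using n by linarith
      then show ?case using n0 v0[of t] by (simp add: dist_real_def)
    qed
  qed
  then show ?thesis unfolding v_def .
qed

text \<open>The complement of the support is a union of null balls, and by Lindelof countably many
  of them already cover it.\<close>

lemma AE_in_support: "AE w in K. \<forall>\<delta>>0. 0 < measure K (ball w \<delta>)"
proof -
  define F where "F = {ball w \<delta> | w \<delta>. measure K (ball w \<delta>) = 0}"
  have "\<And>S. S \<in> F \<Longrightarrow> open S" by (auto simp: F_def)
  from Lindelof[OF this] obtain F' where F': "F' \<subseteq> F" "countable F'" "\<Union>F' = \<Union>F" by auto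
  have "(\<Union>S\<in>F'. S) \<in> null_sets K"
  proof (rule null_sets_UN'[OF F'(2)])
    fix S assume "S \<in> F'"
    then obtain w \<delta> where "S = ball w \<delta>" "measure K (ball w \<delta>) = 0" using F'(1) by (auto simp: F_def)
    then show "S \<in> null_sets K" by (auto simp: null_sets_def emeasure_eq_measure sets_K)
  qed
  then have "\<Union>F \<in> null_sets K" using F'(3) by simp
  then have "AE w in K. w \<notin> \<Union>F" by (rule AE_not_in)
  then show ?thesis
  proof eventually_elim
    case (elim w)
    show ?case
    proof (intro allI impI)
      fix \<delta> :: real assume "0 < \<delta>"
      then have "w \<in> ball w \<delta>" by simp
      then have "ball w \<delta> \<notin> F" using elim by blast
      then have "measure K (ball w \<delta>) \<noteq> 0" unfolding F_def by blast
      then show "0 < measure K (ball w \<delta>)" using measure_nonneg[of K "ball w \<delta>"] by linarith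
    qed
  qed
qed

text \<open>The shifts h for which the conclusion holds form an additive subgroup H of the reals.
  The logarithmic Lipschitz bound makes H closed and lets the mean-square statement
  \<open>variation_tendsto_0\<close> put the logarithm of almost every w into H. A closed subgroup
  that is contained in no lattice d Z is the whole line.\<close>

lemma slowly_varying:
  assumes Q[measurable]: "Q \<in> borel_measurable borel" and B: "\<And>x. \<bar>Q x\<bar> \<le> B"
    and harm: "((\<lambda>t. avg Q t - Q t) \<longlongrightarrow> 0) at_top"
    and lip: "\<And>s t. T \<le> s \<Longrightarrow> s \<le> t \<Longrightarrow> \<bar>Q t - Q s\<bar> \<le> C * ln (t / s)" and T: "0 < T"
    and nonarith: "\<And>d::real. 0 < d \<Longrightarrow> \<not> (AE w in K. \<exists>k::int. ln w = d * k)"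
  shows "((\<lambda>t. Q (exp h * t) - Q t) \<longlongrightarrow> 0) at_top"
proof -
  have C0: "0 \<le> C"
    using lip[of T "T * exp 1"] T by (simp add: mult_le_cancel_left1)
  define H where "H = {h. ((\<lambda>t. Q (exp h * t) - Q t) \<longlongrightarrow> 0) at_top}"
  have scale: "filterlim (\<lambda>t. exp a * t) at_top at_top" for a :: real
    by (rule filterlim_tendsto_pos_mult_at_top[OF tendsto_const _ filterlim_ident]) simp
  have lip': "\<bar>Q (exp a * t) - Q (exp b * t)\<bar> \<le> C * \<bar>a - b\<bar>"
    if "T \<le> exp a * t" "T \<le> exp b * t" for a b t
  proof -
    have t: "0 < t" using that(1) T by (meson exp_gt_zero less_le_trans zero_less_mult_pos)
    have *: "\<bar>Q (exp a * t) - Q (exp b * t)\<bar> \<le> C * (a - b)" if "T \<le> exp b * t" "b \<le> a" for a b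
    proof -
      have "exp a * t / (exp b * t) = exp (a - b)" using t by (simp add: exp_diff)
      then show ?thesis using lip[of "exp b * t" "exp a * t"] that t by simp
    qed
    show ?thesis
      using *[of b a] *[of a b] that by (cases "b \<le> a") (auto simp: abs_minus_commute)
  qed
  have Hdiff: "a - b \<in> H" if "a \<in> H" "b \<in> H" for a b
  proof -
    have "((\<lambda>t. (Q (exp a * (exp (- b) * t)) - Q (exp (- b) * t)) - (Q (exp b * (exp (- b) * t)) - Q (exp (- b) * t))) \<longlongrightarrow> 0 - 0) at_top"
      using that unfolding H_def
      by (intro tendsto_diff) (auto intro: filterlim_compose[OF _ scale[of "- b"]])
    moreover have "exp b * (exp (- b) * t) = t" "exp a * (exp (- b) * t) = exp (a - b) * t" for t
      by (simp_all add: exp_minus exp_diff field_simps)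
    ultimately show ?thesis unfolding H_def by simp
  qed
  have H0: "0 \<in> H" unfolding H_def by simp
  have Hneg: "- a \<in> H" if "a \<in> H" for a using Hdiff[OF H0 that] by simp
  have Hadd: "a + b \<in> H" if "a \<in> H" "b \<in> H" for a b using Hdiff[OF that(1) Hneg[OF that(2)]] by simp
  have Hnat: "real n * a \<in> H" if "a \<in> H" for a n
  proof (induction n)
    case (Suc n)
    have "real (Suc n) * a = a + real n * a" by (simp add: algebra_simps)
    then show ?case using Hadd[OF that Suc] by simp
  qed (simp add: H0)
  have Hint: "real_of_int k * a \<in> H" if "a \<in> H" for a k
  proof (cases "0 \<le> k")
    case True
    then show ?thesis using Hnat[OF that, of "nat k"] by simp
  next
    case False
    then have "real_of_int k * a = - (real (nat (- k)) * a)" by simp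
    then show ?thesis using Hneg[OF Hnat[OF that, of "nat (- k)"]] by simp
  qed
  have Hclosed: "x \<in> H" if dense: "\<And>\<epsilon>. 0 < \<epsilon> \<Longrightarrow> \<exists>a\<in>H. \<bar>a - x\<bar> < \<epsilon>" for x
    unfolding H_def
  proof (safe, rule tendstoI)
    fix \<epsilon> :: real assume \<epsilon>: "0 < \<epsilon>"
    define \<delta> where "\<delta> = \<epsilon> / (2 * (C + 1))"
    have \<delta>: "0 < \<delta>" "C * \<delta> < \<epsilon> / 2" using \<epsilon> C0 by (auto simp: \<delta>_def field_simps)
    obtain a where a: "a \<in> H" "\<bar>a - x\<bar> < \<delta>" using dense[OF \<delta>(1)] by blast
    have "((\<lambda>t. Q (exp a * t) - Q t) \<longlongrightarrow> 0) at_top" using a(1) unfolding H_def by simp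
    then have "\<forall>\<^sub>F t in at_top. dist (Q (exp a * t) - Q t) 0 < \<epsilon> / 2"
      by (rule tendstoD) (use \<epsilon> in simp)
    moreover have "\<forall>\<^sub>F t in at_top. T \<le> exp a * t" "\<forall>\<^sub>F t in at_top. T \<le> exp x * t"
      using scale unfolding filterlim_at_top by blast+
    ultimately show "\<forall>\<^sub>F t in at_top. dist (Q (exp x * t) - Q t) 0 < \<epsilon>"
    proof eventually_elim
      case (elim t)
      have "\<bar>Q (exp a * t) - Q (exp x * t)\<bar> \<le> C * \<delta>"
        using lip'[OF elim(2,3)] mult_left_mono[OF less_imp_le[OF a(2)] C0] by linarith
      then show ?case using elim(1) \<delta>(2) unfolding dist_real_def by linarith
    qed
  qed
  \<comment> \<open>If |Q(w t) - Q(t)| were at least \<epsilon>, the Lipschitz bound would keep |Q(x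
    t) - Q(t)| above \<epsilon>/2 for all x in a small ball around w; the positive mass p of that
    ball contradicts the vanishing of the mean square.\<close>
  have supp: "ln w \<in> H" if w: "0 < w" and pos: "\<And>\<delta>. 0 < \<delta> \<Longrightarrow> 0 < measure K (ball w \<delta>)" for w
    unfolding H_def
  proof (safe, rule tendstoI)
    fix \<epsilon> :: real assume \<epsilon>: "0 < \<epsilon>"
    define \<eta> where "\<eta> = \<epsilon> / (4 * (C + 1))"
    have \<eta>: "0 < \<eta>" "C * \<eta> < \<epsilon> / 4" using \<epsilon> C0 by (auto simp: \<eta>_def field_simps)
    have "((\<lambda>x. ln x) \<longlongrightarrow> ln w) (nhds w)"
      using w by (intro tendsto_ln filterlim_ident) auto
    from tendstoD[OF this \<eta>(1)]
    obtain \<delta>1 where \<delta>1: "0 < \<delta>1" "\<And>x. \<bar>x - w\<bar> < \<delta>1 \<Longrightarrow> \<bar>ln x - ln w\<bar> < \<eta>"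
      unfolding eventually_nhds_metric dist_real_def by auto
    define \<delta> where "\<delta> = min \<delta>1 (w / 2)"
    have \<delta>: "0 < \<delta>" using \<delta>1 w by (simp add: \<delta>_def)
    have near: "w / 2 < x" "\<bar>ln x - ln w\<bar> < \<eta>" if "x \<in> ball w \<delta>" for x
    proof -
      have "\<bar>w - x\<bar> < \<delta>1" "\<bar>w - x\<bar> < w / 2" using that by (auto simp: \<delta>_def dist_real_def)
      then show "w / 2 < x" "\<bar>ln x - ln w\<bar> < \<eta>" using \<delta>1(2)[of x] by (linarith, simp add: abs_minus_commute)
    qed
    define p where "p = measure K (ball w \<delta>)"
    have p: "0 < p" using pos[OF \<delta>] by (simp add: p_def)
    have "\<forall>\<^sub>F t in at_top. dist (\<integral>x. (Q (x * t) - Q t)\<^sup>2 \<partial>K) 0 < p * (\<epsilon> / 2)\<^sup>2"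
      using variation_tendsto_0[OF Q B harm] by (rule tendstoD) (use p \<epsilon> in auto)
    moreover have "\<forall>\<^sub>F t in at_top. max (2 * T / w) 1 \<le> t" by (rule eventually_ge_at_top)
    ultimately show "\<forall>\<^sub>F t in at_top. dist (Q (exp (ln w) * t) - Q t) 0 < \<epsilon>"
    proof eventually_elim
      case (elim t)
      have t: "0 < t" "T \<le> w / 2 * t" using elim(2) w by (auto simp: field_simps)
      show ?case
      proof (rule ccontr)
        assume "\<not> ?case"
        then have big: "\<epsilon> \<le> \<bar>Q (w * t) - Q t\<bar>" using w by (simp add: dist_real_def)
        have "(\<epsilon> / 2)\<^sup>2 * indicator (ball w \<delta>) x \<le> (Q (x * t) - Q t)\<^sup>2" for x
        proof (cases "x \<in> ball w \<delta>")
          case True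
          have x: "w / 2 < x" "\<bar>ln x - ln w\<bar> < \<eta>" using near[OF True] by auto
          have "T \<le> x * t" "T \<le> w * t"
            using t x w mult_right_mono[of "w / 2" x t] mult_right_mono[of "w / 2" w t] by linarith+
          moreover have "0 < x" using x(1) w by linarith
          ultimately have "T \<le> exp (ln x) * t" "T \<le> exp (ln w) * t" using w by simp_all
          from lip'[OF this] have "\<bar>Q (x * t) - Q (w * t)\<bar> \<le> C * \<bar>ln x - ln w\<bar>" using \<open>0 < x\<close> w by simp
          also have "\<dots> \<le> C * \<eta>" using x(2) C0 by (intro mult_left_mono) auto
          finally have "\<epsilon> / 2 \<le> \<bar>Q (x * t) - Q t\<bar>" using big \<eta>(2) \<epsilon> by linarith
          then have "\<bar>\<epsilon> / 2\<bar> \<le> \<bar>Q (x * t) - Q t\<bar>" using \<epsilon> by simp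
          then have "(\<epsilon> / 2)\<^sup>2 \<le> (Q (x * t) - Q t)\<^sup>2" by (simp only: abs_le_square_iff)
          then show ?thesis using True by simp
        qed simp
        then have "(\<integral>x. (\<epsilon> / 2)\<^sup>2 * indicator (ball w \<delta>) x \<partial>K) \<le> (\<integral>x. (Q (x * t) - Q t)\<^sup>2 \<partial>K)"
        proof (intro integral_mono)
          have "\<bar>Q x - Q y\<bar> \<le> \<bar>2 * B\<bar>" for x y using B[of x] B[of y] by linarith
          then have "\<bar>(Q x - Q y)\<^sup>2\<bar> \<le> (2 * B)\<^sup>2" for x y by (simp only: abs_le_square_iff abs_power2)
          then show "integrable K (\<lambda>x. (Q (x * t) - Q t)\<^sup>2)"
            by (intro integrable_const_bound[where B = "(2 * B)\<^sup>2"]) auto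
        qed (auto simp: sets_K emeasure_eq_measure)
        moreover have "(\<integral>x. (\<epsilon> / 2)\<^sup>2 * indicator (ball w \<delta>) x \<partial>K) = p * (\<epsilon> / 2)\<^sup>2"
          by (simp add: p_def sets_K)
        moreover have "(\<integral>x. (Q (x * t) - Q t)\<^sup>2 \<partial>K) < p * (\<epsilon> / 2)\<^sup>2"
          using elim(1) by (simp add: dist_real_def)
        ultimately show False by linarith
      qed
    qed
  qed
  have AEH: "AE w in K. ln w \<in> H"
    using AE_in_support K_pos by eventually_elim (use supp in blast)
  \<comment> \<open>Without arbitrarily small positive elements, H is trivial or generated by its
    least positive element, and almost every ln w would lie on a lattice.\<close>
  have small: "\<exists>a\<in>H. 0 < a \<and> a < \<epsilon>" if \<epsilon>: "0 < \<epsilon>" for \<epsilon>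
  proof (rule ccontr)
    assume none: "\<not> (\<exists>a\<in>H. 0 < a \<and> a < \<epsilon>)"
    have "\<exists>d::real. 0 < d \<and> (\<forall>a\<in>H. \<exists>k::int. a = d * k)"
    proof (cases "\<exists>a\<in>H. 0 < a")
      case False
      then have "a = 0" if "a \<in> H" for a using that Hneg[OF that] by (metis linorder_less_linear neg_0_less_iff_less)
      then show ?thesis by (intro exI[of _ 1]) force
    next
      case True
      define S where "S = {a \<in> H. 0 < a}"
      have Sne: "S \<noteq> {}" using True by (auto simp: S_def)
      have Sge: "\<epsilon> \<le> a" if "a \<in> S" for a using none that by (auto simp: S_def not_less)
      have bdd: "bdd_below S" using Sge by (rule bdd_belowI)
      define d where "d = Inf S"
      have d\<epsilon>: "\<epsilon> \<le> d" unfolding d_def by (rule cInf_greatest[OF Sne Sge])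
      have dS: "d \<in> S"
      proof -
        \<comment> \<open>Two distinct elements of S below d + \<epsilon> would have a positive
          difference in H smaller than \<epsilon>; hence the infimum is attained.\<close>
        obtain a where a: "a \<in> S" "a < d + \<epsilon>" using cInf_lessD[OF Sne, of "d + \<epsilon>"] \<epsilon> d_def by auto
        have "a = d"
        proof (rule ccontr)
          assume "a \<noteq> d"
          then have "d < a" using cInf_lower[OF a(1) bdd] d_def by simp
          then obtain b where b: "b \<in> S" "b < a" using cInf_lessD[OF Sne, of a] d_def by auto
          have "a - b \<in> S" using Hdiff a(1) b by (auto simp: S_def)
          then show False using Sge[of "a - b"] a(2) cInf_lower[OF b(1) bdd] d_def by simp
        qed
        then show ?thesis using a(1) by simp
      qed
      have "\<exists>k::int. a = d * k" if "a \<in> H" for a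
      proof -
        define k where "k = \<lfloor>a / d\<rfloor>"
        have d0: "0 < d" using d\<epsilon> \<epsilon> by linarith
        have "a - k * d \<in> H" using Hdiff[OF that Hint] dS by (auto simp: S_def)
        moreover have "0 \<le> a - k * d" "a - k * d < d"
          using d0 floor_divide_lower[OF d0, of a] floor_divide_upper[OF d0, of a] by (auto simp: k_def algebra_simps)
        ultimately have "a - k * d = 0"
          using cInf_lower[OF _ bdd, of "a - k * d"] d_def by (fastforce simp: S_def)
        then show ?thesis by (intro exI[of _ k]) (simp add: algebra_simps)
      qed
      then show ?thesis using d\<epsilon> \<epsilon> by (intro exI[of _ d]) auto
    qed
    then obtain d :: real where d: "0 < d" "\<And>a. a \<in> H \<Longrightarrow> \<exists>k::int. a = d * k" by blast
    have "AE w in K. \<exists>k::int. ln w = d * k"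
      using AEH by eventually_elim (use d(2) in blast)
    then show False using nonarith[OF d(1)] by blast
  qed
  have "h \<in> H"
  proof (rule Hclosed)
    fix \<epsilon> :: real assume "0 < \<epsilon>"
    then obtain a where a: "a \<in> H" "0 < a" "a < \<epsilon>" using small by blast
    have "\<bar>real_of_int \<lfloor>h / a\<rfloor> * a - h\<bar> < \<epsilon>"
      using floor_divide_lower[OF a(2), of h] floor_divide_upper[OF a(2), of h] a(3) by (simp add: algebra_simps)
    then show "\<exists>b\<in>H. \<bar>b - h\<bar> < \<epsilon>" using Hint[OF a(1)] by blast
  qed
  then show ?thesis unfolding H_def by simp
qed

end

subsection \<open>Convergence of moments\<close>

text \<open>The constants C and K are parameters so that a whole sequence of measures can share
  them: radius and remainder of the Taylor expansion of the Laplace transform then depend on C and K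
  only.\<close>

locale exponential_moments = prob_space M for M :: "real measure" +
  fixes C K :: real
  assumes sets_M [measurable_cong]: "sets M = sets borel"
    and nonneg: "AE v in M. 0 \<le> v"
    and moment_integrable: "\<And>k. integrable M (\<lambda>v. v ^ k)"
    and moment_bound: "\<And>k. (\<integral>v. v ^ k \<partial>M) \<le> C * fact k * K ^ k"
begin

text \<open>The k-th derivative of the Laplace transform. On the half-plane Re z \<le> 0 the
  exponential has modulus at most 1 almost everywhere, so the moments dominate; negative real z give
  Laplace transforms and imaginary z give characteristic functions.\<close>

definition emom :: "nat \<Rightarrow> complex \<Rightarrow> complex" where
  "emom k z = (\<integral>v. complex_of_real (v ^ k) * exp (z * complex_of_real v) \<partial>M)"

lemma emom_integrable:
  assumes "Re z \<le> 0"
  shows "integrable M (\<lambda>v. complex_of_real (v ^ k) * exp (z * complex_of_real v))"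
proof (rule Bochner_Integration.integrable_bound[OF moment_integrable[of k]])
  show "AE v in M. norm (complex_of_real (v ^ k) * exp (z * complex_of_real v)) \<le> norm (v ^ k)"
    using nonneg
  proof eventually_elim
    case (elim v)
    have "Re z * v \<le> 0" using assms elim by (simp add: mult_le_0_iff)
    then have "exp (Re z * v) \<le> 1" by simp
    then show ?case by (simp add: norm_mult norm_power mult_left_le power_abs)
  qed
qed measurable

lemma emom_0: "emom k 0 = complex_of_real (\<integral>v. v ^ k \<partial>M)"
  unfolding emom_def by (simp del: of_real_power)

text \<open>The remainder is at most |h|^(N+1) / N! times the moment of order k + N + 1. Its
  factorial is split off by a binomial coefficient, itself at most 2^(k+N+1), and |h| \<le> 1/(4K)
  then leaves the factor (1/2)^(N+1).\<close>

lemma emom_taylor: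
  assumes z: "Re z \<le> 0" and h: "Re (z + h) \<le> 0" and K: "0 < K" "norm h \<le> 1 / (4 * K)" and C: "0 \<le> C"
  shows "norm (emom k (z + h) - (\<Sum>i\<le>N. h ^ i / fact i * emom (k + i) z))
    \<le> C * fact (Suc k) * (2 * K) ^ k * (1 / 2) ^ Suc N"
proof -
  have pt: "norm (exp ((z + h) * complex_of_real v) - (\<Sum>i\<le>N. h ^ i / fact i * (of_real (v ^ i) * exp (z * of_real v))))
      \<le> v ^ Suc N * norm h ^ Suc N / fact N" if v: "0 \<le> v" for v :: real
  proof -
    have "norm ((\<lambda>i w. of_real (v ^ i) * exp (w * of_real v)) 0 (z + h) -
        (\<Sum>i\<le>N. (\<lambda>i w. of_real (v ^ i) * exp (w * of_real v)) i z * (z + h - z) ^ i / fact i))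
        \<le> v ^ Suc N * norm (z + h - z) ^ Suc N / fact N"
    proof (rule complex_Taylor[where S = "{w. Re w \<le> 0}"])
      show "convex {w. Re w \<le> 0}" by (rule convex_halfspace_Re_le)
      show "((\<lambda>w. of_real (v ^ i) * exp (w * of_real v)) has_field_derivative of_real (v ^ Suc i) * exp (x * of_real v))
          (at x within {w. Re w \<le> 0})" for i x
        by (auto intro!: derivative_eq_intros)
      show "norm (of_real (v ^ Suc N) * exp (w * complex_of_real v)) \<le> v ^ Suc N" if "w \<in> {w. Re w \<le> 0}" for w
      proof -
        have "Re w * v \<le> 0" using that v by (simp add: mult_le_0_iff)
        then have "exp (Re w * v) \<le> 1" by simp
        then show ?thesis using v by (simp add: norm_mult norm_power mult_left_le del: power_Suc)
      qed
    qed (use z h in auto)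
    then show ?thesis by (simp add: mult_ac)
  qed
  have "emom k (z + h) - (\<Sum>i\<le>N. h ^ i / fact i * emom (k + i) z)
     = (\<integral>v. of_real (v ^ k) * (exp ((z + h) * of_real v) - (\<Sum>i\<le>N. h ^ i / fact i * (of_real (v ^ i) * exp (z * of_real v)))) \<partial>M)"
  proof -
    have "(\<Sum>i\<le>N. h ^ i / fact i * emom (k + i) z)
       = (\<integral>v. (\<Sum>i\<le>N. h ^ i / fact i * (of_real (v ^ (k + i)) * exp (z * of_real v))) \<partial>M)"
      unfolding emom_def
      by (subst Bochner_Integration.integral_sum) (auto intro!: integrable_mult_right emom_integrable z simp del: of_real_power)
    moreover have "integrable M (\<lambda>v. (\<Sum>i\<le>N. h ^ i / fact i * (of_real (v ^ (k + i)) * exp (z * of_real v))))"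
      by (intro Bochner_Integration.integrable_sum integrable_mult_right emom_integrable z)
    ultimately have "emom k (z + h) - (\<Sum>i\<le>N. h ^ i / fact i * emom (k + i) z)
        = (\<integral>v. of_real (v ^ k) * exp ((z + h) * of_real v) - (\<Sum>i\<le>N. h ^ i / fact i * (of_real (v ^ (k + i)) * exp (z * of_real v))) \<partial>M)"
      using emom_integrable[OF h] by (simp add: emom_def)
    also have "\<dots> = (\<integral>v. of_real (v ^ k) * (exp ((z + h) * of_real v) - (\<Sum>i\<le>N. h ^ i / fact i * (of_real (v ^ i) * exp (z * of_real v)))) \<partial>M)"
      by (simp add: right_diff_distrib sum_distrib_left power_add mult_ac)
    finally show ?thesis .
  qed
  also have "norm \<dots> \<le> (\<integral>v. norm h ^ Suc N / fact N * v ^ (k + Suc N) \<partial>M)"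
  proof (rule order_trans[OF integral_norm_bound integral_mono_AE])
    show "AE v in M. norm (of_real (v ^ k) * (exp ((z + h) * of_real v) - (\<Sum>i\<le>N. h ^ i / fact i * (of_real (v ^ i) * exp (z * of_real v)))))
        \<le> norm h ^ Suc N / fact N * v ^ (k + Suc N)"
      using nonneg
    proof eventually_elim
      case (elim v)
      have "v ^ k * norm (exp ((z + h) * complex_of_real v) - (\<Sum>i\<le>N. h ^ i / fact i * (of_real (v ^ i) * exp (z * of_real v))))
          \<le> v ^ k * (v ^ Suc N * norm h ^ Suc N / fact N)"
        by (rule mult_left_mono[OF pt[OF elim]]) (use elim in simp)
      then show ?case using elim by (simp add: norm_mult norm_power power_add mult_ac)
    qed
    show "integrable M (\<lambda>v. norm (of_real (v ^ k) * (exp ((z + h) * of_real v) - (\<Sum>i\<le>N. h ^ i / fact i * (of_real (v ^ i) * exp (z * of_real v))))))"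
    proof -
      have "integrable M (\<lambda>v. of_real (v ^ k) * exp ((z + h) * of_real v) - (\<Sum>i\<le>N. h ^ i / fact i * (of_real (v ^ (k + i)) * exp (z * of_real v))))"
        by (intro Bochner_Integration.integrable_diff Bochner_Integration.integrable_sum integrable_mult_right emom_integrable z h)
      from integrable_norm[OF this] show ?thesis by (simp add: right_diff_distrib sum_distrib_left power_add mult_ac)
    qed
  qed (intro integrable_mult_right moment_integrable)
  also have "\<dots> = norm h ^ Suc N / fact N * (\<integral>v. v ^ (k + Suc N) \<partial>M)" by simp
  also have "\<dots> \<le> (1 / (4 * K)) ^ Suc N / fact N * (C * (2 ^ (k + Suc N) * fact (Suc k) * fact N) * K ^ (k + Suc N))"
  proof (rule mult_mono)
    show "norm h ^ Suc N / fact N \<le> (1 / (4 * K)) ^ Suc N / fact N"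
      using K by (intro divide_right_mono power_mono) auto
    have "fact (k + Suc N) = fact (Suc k) * fact N * real ((k + Suc N) choose N)"
    proof -
      have "k + Suc N - N = Suc k" by simp
      then have "fact N * fact (Suc k) * ((k + Suc N) choose N) = (fact (k + Suc N) :: nat)"
        using binomial_fact_lemma[of N "k + Suc N"] by (simp only: le_add2 le_SucI add_Suc_right)
      then have "real (fact N * fact (Suc k) * ((k + Suc N) choose N)) = real (fact (k + Suc N))"
        by (simp only:)
      then show ?thesis by (simp only: of_nat_mult of_nat_fact mult.commute mult.left_commute mult.assoc)
    qed
    also have "\<dots> \<le> fact (Suc k) * fact N * 2 ^ (k + Suc N)"
    proof -
      have "((k + Suc N) choose N) \<le> 2 ^ (k + Suc N)" by (rule binomial_le_pow2)
      then have "real ((k + Suc N) choose N) \<le> 2 ^ (k + Suc N)" by (metis of_nat_le_iff of_nat_numeral of_nat_power)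
      then show ?thesis by (intro mult_left_mono) auto
    qed
    finally have "C * fact (k + Suc N) * K ^ (k + Suc N) \<le> C * (2 ^ (k + Suc N) * fact (Suc k) * fact N) * K ^ (k + Suc N)"
      using C K by (intro mult_right_mono mult_left_mono) (auto simp: mult_ac)
    then show "(\<integral>v. v ^ (k + Suc N) \<partial>M) \<le> C * (2 ^ (k + Suc N) * fact (Suc k) * fact N) * K ^ (k + Suc N)"
      using moment_bound[of "k + Suc N"] by linarith
    show "0 \<le> (\<integral>v. v ^ (k + Suc N) \<partial>M)" using nonneg by (intro integral_nonneg_AE) auto
  qed (use K in auto)
  also have "\<dots> = C * fact (Suc k) * (2 * K) ^ k * (1 / 2) ^ Suc N"
  proof -
    have "(1 / (4 * K)) ^ Suc N * 2 ^ Suc N * K ^ Suc N = (1 / 2) ^ Suc N"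
      using K by (simp only: power_mult_distrib[symmetric]) (simp add: field_simps)
    moreover have "x / f * (C * (2 ^ k * y * g * f) * (K ^ k * w)) = C * g * (2 * K) ^ k * (x * y * w)"
      if "f \<noteq> 0" for x y w f g :: real
      using that by (simp add: power_mult_distrib)
    ultimately show ?thesis by (simp only: power_add fact_nonzero not_False_eq_True)
  qed
  finally show ?thesis .
qed

end

text \<open>The term 0^k is the transform of the unit mass at 0: moments of order k \<ge> 1 do not
  see such an atom, while the moment of order 0 is always 1, so the limit is the transform of (1 -
  c) delta_0 + c \<rho>. Convergence of all derivatives at one point extends to points within 1/(4K)
  by the uniform Taylor bound, and finitely many such moves lead from 0 to z.\<close>

lemma emom_tendsto:
  fixes \<mu> :: "nat \<Rightarrow> real measure"
  assumes \<mu>: "\<And>n. exponential_moments (\<mu> n) C K" and \<rho>: "exponential_moments \<rho> C K" and K: "0 < K"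
    and conv: "\<And>k. 1 \<le> k \<Longrightarrow> (\<lambda>n. \<integral>v. v ^ k \<partial>\<mu> n) \<longlonglongrightarrow> c * (\<integral>v. v ^ k \<partial>\<rho>)"
    and z: "Re z \<le> 0"
  shows "(\<lambda>n. exponential_moments.emom (\<mu> n) k z)
    \<longlonglongrightarrow> (1 - of_real c) * 0 ^ k + of_real c * exponential_moments.emom \<rho> k z"
proof -
  interpret \<rho>: exponential_moments \<rho> C K by fact
  interpret \<mu>: exponential_moments "\<mu> n" C K for n by fact
  have C: "0 \<le> C" using \<rho>.moment_bound[of 0] by (simp add: \<rho>.prob_space)
  define R where "R k z = (1 - of_real c) * 0 ^ k + of_real c * \<rho>.emom k z" for k z
  define good where "good z \<longleftrightarrow> Re z \<le> 0 \<and> (\<forall>k. (\<lambda>n. \<mu>.emom n k z) \<longlonglongrightarrow> R k z)" for z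
  have good0: "good 0"
  proof -
    have "(\<lambda>n. \<mu>.emom n k 0) \<longlonglongrightarrow> R k 0" for k
    proof (cases "k = 0")
      case True
      then show ?thesis by (simp add: R_def \<mu>.emom_0 \<rho>.emom_0 \<mu>.prob_space \<rho>.prob_space)
    next
      case False
      have "(\<lambda>n. complex_of_real (\<integral>v. v ^ k \<partial>\<mu> n)) \<longlonglongrightarrow> complex_of_real (c * (\<integral>v. v ^ k \<partial>\<rho>))"
        using conv[of k] False by (intro tendsto_of_real) auto
      then show ?thesis using False by (simp add: R_def \<mu>.emom_0 \<rho>.emom_0 power_0_left)
    qed
    then show ?thesis by (simp add: good_def)
  qed
  have step: "good (z + h)" if g: "good z" and h: "norm h \<le> 1 / (4 * K)" "Re (z + h) \<le> 0" for z h
  proof -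
    have z: "Re z \<le> 0" using g by (simp add: good_def)
    have "(\<lambda>n. \<mu>.emom n k (z + h)) \<longlonglongrightarrow> R k (z + h)" for k
    proof (rule LIMSEQ_I)
      fix \<epsilon> :: real assume \<epsilon>: "0 < \<epsilon>"
      define b where "b N = C * fact (Suc k) * (2 * K) ^ k * (1 / 2) ^ Suc N" for N
      have "b \<longlonglongrightarrow> C * fact (Suc k) * (2 * K) ^ k * 0"
        unfolding b_def by (intro tendsto_mult_left LIMSEQ_Suc LIMSEQ_power_zero) auto
      then have "(\<lambda>N. (1 + \<bar>c\<bar>) * b N) \<longlonglongrightarrow> 0" by (auto intro: tendsto_mult_right_zero)
      then obtain N where N: "(1 + \<bar>c\<bar>) * b N < \<epsilon> / 2"
        using \<epsilon> by (metis (no_types, lifting) LIMSEQ_D[of _ 0 "\<epsilon> / 2"] abs_less_iff diff_zero half_gt_zero order_refl real_norm_def)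
      define T where "T F = (\<Sum>i\<le>N. h ^ i / fact i * F (k + i))" for F :: "nat \<Rightarrow> complex"
      have b\<mu>: "norm (\<mu>.emom n k (z + h) - T (\<lambda>j. \<mu>.emom n j z)) \<le> b N" for n
        unfolding T_def b_def by (rule \<mu>.emom_taylor[OF z h(2) K h(1) C])
      have b\<rho>: "norm (\<rho>.emom k (z + h) - T (\<lambda>j. \<rho>.emom j z)) \<le> b N"
        unfolding T_def b_def by (rule \<rho>.emom_taylor[OF z h(2) K h(1) C])
      \<comment> \<open>The transform of delta_0 is the constant 1, whose Taylor sums are
        exact.\<close>
      have T0: "T (\<lambda>j. 0 ^ j) = 0 ^ k"
      proof -
        have "T (\<lambda>j. 0 ^ j) = (\<Sum>i\<in>{0}. h ^ i / fact i * 0 ^ (k + i))"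
          unfolding T_def by (intro sum.mono_neutral_right) auto
        then show ?thesis by simp
      qed
      have "T (\<lambda>j. R j z) = (1 - of_real c) * T (\<lambda>j. 0 ^ j) + of_real c * T (\<lambda>j. \<rho>.emom j z)"
        unfolding T_def R_def sum_distrib_left sum.distrib[symmetric]
        by (intro sum.cong refl) (simp add: field_simps)
      then have "R k (z + h) - T (\<lambda>j. R j z) = of_real c * (\<rho>.emom k (z + h) - T (\<lambda>j. \<rho>.emom j z))"
        unfolding T0 by (simp add: R_def algebra_simps)
      then have bR: "norm (R k (z + h) - T (\<lambda>j. R j z)) \<le> \<bar>c\<bar> * b N"
        using b\<rho> by (simp add: norm_mult mult_left_mono)
      have "(\<lambda>n. T (\<lambda>j. \<mu>.emom n j z)) \<longlonglongrightarrow> T (\<lambda>j. R j z)"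
        unfolding T_def using g by (intro tendsto_sum tendsto_mult_left) (auto simp: good_def)
      from LIMSEQ_D[OF this half_gt_zero[OF \<epsilon>]] obtain n0 where
        n0: "\<And>n. n0 \<le> n \<Longrightarrow> norm (T (\<lambda>j. \<mu>.emom n j z) - T (\<lambda>j. R j z)) < \<epsilon> / 2" by blast
      have "norm (\<mu>.emom n k (z + h) - R k (z + h)) < \<epsilon>" if "n0 \<le> n" for n
      proof -
        have "norm (\<mu>.emom n k (z + h) - R k (z + h)) \<le> norm (\<mu>.emom n k (z + h) - T (\<lambda>j. \<mu>.emom n j z))
           + norm (T (\<lambda>j. \<mu>.emom n j z) - T (\<lambda>j. R j z)) + norm (R k (z + h) - T (\<lambda>j. R j z))"
          by (smt (verit) norm_triangle_ineq4 norm_triangle_ineq diff_add_cancel diff_diff_eq2 norm_minus_commute)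
        then show ?thesis using b\<mu>[of n] n0[OF that] bR N by (simp add: distrib_right)
      qed
      then show "\<exists>no. \<forall>n\<ge>no. norm (\<mu>.emom n k (z + h) - R k (z + h)) < \<epsilon>" by blast
    qed
    then show ?thesis using h(2) by (simp add: good_def)
  qed
  \<comment> \<open>The segment from 0 to z stays in the half-plane and is cut into m pieces of
    length at most 1/(4K).\<close>
  obtain m :: nat where m: "norm z * (4 * K) < real m" using reals_Archimedean2 by blast
  have m0: "0 < m" using m K by (metis gr0I mult_nonneg_nonneg norm_ge_zero not_less of_nat_0 less_imp_le zero_le_mult_iff zero_le_numeral)
  have "good (of_real (real j / real m) * z)" if "j \<le> m" for j
    using that
  proof (induction j)
    case 0
    then show ?case using good0 by simp
  next
    case (Suc j)
    have eq: "of_real (real (Suc j) / real m) * z = of_real (real j / real m) * z + of_real (1 / real m) * z"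
      using m0 by (simp add: field_simps)
    have nz: "norm (of_real (1 / real m) * z) \<le> 1 / (4 * K)"
    proof -
      have eq: "norm (of_real (1 / real m) * z) = norm z / real m" by (simp add: norm_divide)
      show ?thesis unfolding eq using m m0 K by (simp add: field_simps)
    qed
    have "Re (of_real (real (Suc j) / real m) * z) = real (Suc j) / real m * Re z"
      by (simp only: Re_complex_of_real Im_complex_of_real times_complex.simps)
    also have "\<dots> \<le> 0" using z by (intro mult_nonneg_nonpos) auto
    finally show ?case
      using step[OF Suc.IH nz] Suc.prems unfolding eq by simp
  qed
  from this[of m] have "good z" using m0 by simp
  then show ?thesis by (simp add: good_def R_def)
qed

text \<open>The Laplace transforms at l tend to 1 - c plus c times that of \<rho>, and this tends to
  1 - c as l grows, since \<rho> has no atom at 0. The negative moment bounds all transforms at l by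
  a constant times l^(-p), so 1 - c = 0; then the Levy continuity theorem applies on the imaginary
  axis.\<close>

theorem moments_imp_weak_conv:
  fixes \<mu> :: "nat \<Rightarrow> real measure"
  assumes \<mu>: "\<And>n. exponential_moments (\<mu> n) C K" and \<rho>: "exponential_moments \<rho> C K" and K: "0 < K"
    and conv: "\<And>k. 1 \<le> k \<Longrightarrow> (\<lambda>n. \<integral>v. v ^ k \<partial>\<mu> n) \<longlonglongrightarrow> c * (\<integral>v. v ^ k \<partial>\<rho>)"
    and pos\<mu>: "\<And>n. AE v in \<mu> n. 0 < v" and pos\<rho>: "AE v in \<rho>. 0 < v"
    and p: "0 < p" "p \<le> 1" and neg: "\<And>n. (\<integral>\<^sup>+v. ennreal (v powr (- p)) \<partial>\<mu> n) \<le> ennreal B"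
  shows "c = 1" and "weak_conv_m \<mu> \<rho>"
proof -
  interpret \<rho>: exponential_moments \<rho> C K by fact
  interpret \<mu>: exponential_moments "\<mu> n" C K for n by fact
  have real_exp: "(\<integral>v. exp (- (l * v)) \<partial>M) = Re (exponential_moments.emom M 0 (- of_real l))"
    if "0 \<le> l" "exponential_moments M C K" for l M
  proof -
    interpret exponential_moments M C K by fact
    have "emom 0 (- of_real l) = (\<integral>v. complex_of_real (exp (- (l * v))) \<partial>M)"
      unfolding emom_def by (simp add: exp_of_real flip: of_real_mult of_real_minus)
    then show ?thesis by simp
  qed
  have lap: "(\<lambda>n. \<integral>v. exp (- (l * v)) \<partial>\<mu> n) \<longlonglongrightarrow> 1 - c + c * (\<integral>v. exp (- (l * v)) \<partial>\<rho>)" if "0 \<le> l" for l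
    using tendsto_Re[OF emom_tendsto[OF \<mu> \<rho> K conv, of "- of_real l" 0]] that
    by (simp add: real_exp \<mu> \<rho>)
  have lap\<mu>: "(\<integral>v. exp (- (l * v)) \<partial>\<mu> n) \<le> l powr (- p) * max 0 B" if l: "0 < l" for l n
  proof -
    have "(\<integral>\<^sup>+v. ennreal (exp (- (l * v))) \<partial>\<mu> n) \<le> (\<integral>\<^sup>+v. ennreal (l powr (- p)) * ennreal (v powr (- p)) \<partial>\<mu> n)"
    proof (rule nn_integral_mono_AE)
      show "AE v in \<mu> n. ennreal (exp (- (l * v))) \<le> ennreal (l powr (- p)) * ennreal (v powr (- p))"
        using pos\<mu>
      proof eventually_elim
        case (elim v)
        have x: "0 < l * v" using l elim by simp
        \<comment> \<open>For p \<le> 1 one has x^p \<le> 1 + x \<le> e^x, which trades the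
          exponential for the negative moment.\<close>
        have "(l * v) powr p \<le> 1 + l * v"
        proof (cases "l * v \<le> 1")
          case True
          then have "(l * v) powr p \<le> 1" using x p by (simp add: powr_le1)
          then show ?thesis using x by linarith
        next
          case False
          then have "(l * v) powr p \<le> (l * v) powr 1" using p by (intro powr_mono) auto
          then show ?thesis using x by simp
        qed
        also have "\<dots> \<le> exp (l * v)" by (rule exp_ge_add_one_self)
        finally have "exp (- (l * v)) \<le> (l * v) powr (- p)"
          using x unfolding exp_minus powr_minus by (intro le_imp_inverse_le) auto
        also have "\<dots> = l powr (- p) * v powr (- p)" using l elim by (simp add: powr_mult)
        finally show ?case by (simp flip: ennreal_mult)
      qed
    qed
    also have "\<dots> = ennreal (l powr (- p)) * (\<integral>\<^sup>+v. ennreal (v powr (- p)) \<partial>\<mu> n)"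
      by (intro nn_integral_cmult) measurable
    also have "\<dots> \<le> ennreal (l powr (- p)) * ennreal (max 0 B)"
      using neg[of n] by (intro mult_left_mono) (auto intro: order_trans[OF _ ennreal_leI])
    finally have "(\<integral>\<^sup>+v. ennreal (exp (- (l * v))) \<partial>\<mu> n) \<le> ennreal (l powr (- p) * max 0 B)"
      by (simp add: ennreal_mult)
    then show ?thesis
      by (subst integral_eq_nn_integral) (auto intro!: enn2real_leI)
  qed
  have up: "0 \<le> 1 - c + c * (\<integral>v. exp (- (l * v)) \<partial>\<rho>) \<and> 1 - c + c * (\<integral>v. exp (- (l * v)) \<partial>\<rho>) \<le> l powr (- p) * max 0 B"
    if l: "0 < l" for l
  proof
    have "0 \<le> (\<integral>v. exp (- (l * v)) \<partial>\<mu> n)" for n by simp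
    then show "0 \<le> 1 - c + c * (\<integral>v. exp (- (l * v)) \<partial>\<rho>)"
      using LIMSEQ_le_const[OF lap[OF less_imp_le[OF l]], of 0] by blast
    show "1 - c + c * (\<integral>v. exp (- (l * v)) \<partial>\<rho>) \<le> l powr (- p) * max 0 B"
      using LIMSEQ_le_const2[OF lap[OF less_imp_le[OF l]]] lap\<mu>[OF l] by blast
  qed
  have "(\<lambda>n. \<integral>v. exp (- (real (Suc n) * v)) \<partial>\<rho>) \<longlonglongrightarrow> (\<integral>v. 0 \<partial>\<rho>)"
  proof (rule integral_dominated_convergence[where w = "\<lambda>_. 1"])
    show "AE v in \<rho>. (\<lambda>n. exp (- (real (Suc n) * v))) \<longlonglongrightarrow> 0"
      using pos\<rho>
    proof eventually_elim
      case (elim v)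
      have "(\<lambda>n. exp (- v) ^ Suc n) \<longlonglongrightarrow> 0"
        using elim by (intro LIMSEQ_Suc LIMSEQ_power_zero) auto
      then show ?case unfolding exp_of_nat_mult[symmetric] by simp
    qed
    show "AE v in \<rho>. norm (exp (- (real (Suc n) * v))) \<le> 1" for n
      using pos\<rho> by eventually_elim auto
  qed auto
  then have "(\<lambda>n. 1 - c + c * (\<integral>v. exp (- (real (Suc n) * v)) \<partial>\<rho>)) \<longlonglongrightarrow> 1 - c + c * 0"
    by (intro tendsto_intros) simp
  moreover have "(\<lambda>n. 1 - c + c * (\<integral>v. exp (- (real (Suc n) * v)) \<partial>\<rho>)) \<longlonglongrightarrow> 0"
  proof (rule tendsto_sandwich[OF _ _ tendsto_const])
    have "(\<lambda>n. real (Suc n) powr (- p)) \<longlonglongrightarrow> 0"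
      using p by (intro tendsto_neg_powr filterlim_compose[OF filterlim_real_sequentially filterlim_Suc]) auto
    then show "(\<lambda>n. real (Suc n) powr (- p) * max 0 B) \<longlonglongrightarrow> 0" by (rule tendsto_mult_left_zero)
  qed (use up in auto)
  ultimately show c: "c = 1" using LIMSEQ_unique by fastforce
  show "weak_conv_m \<mu> \<rho>"
  proof (rule levy_continuity)
    show "real_distribution (\<mu> n)" for n
      by unfold_locales (auto simp: \<mu>.sets_M sets_eq_imp_space_eq[OF \<mu>.sets_M])
    show "real_distribution \<rho>"
      by unfold_locales (auto simp: \<rho>.sets_M sets_eq_imp_space_eq[OF \<rho>.sets_M])
    have ch: "char M t = exponential_moments.emom M 0 (\<i> * of_real t)" if "exponential_moments M C K" for M t
    proof -
      interpret exponential_moments M C K by fact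
      show ?thesis unfolding char_def emom_def by (simp add: mult.assoc)
    qed
    show "(\<lambda>n. char (\<mu> n) t) \<longlonglongrightarrow> char \<rho> t" for t
      using emom_tendsto[OF \<mu> \<rho> K conv, of "\<i> * of_real t" 0] by (simp add: ch \<mu> \<rho> c)
  qed
qed

subsection \<open>Moments of the tagged fragment\<close>

lemma bounded_borel_integrable_on:
  fixes f :: "real \<Rightarrow> real"
  assumes [measurable]: "f \<in> borel_measurable borel" and B: "\<And>x. x \<in> {a..b} \<Longrightarrow> \<bar>f x\<bar> \<le> B"
  shows "f integrable_on {a..b}"
proof -
  have "set_integrable lborel {a..b} f"
    unfolding set_integrable_def
    by (rule integrableI_bounded_set_indicator[where B = B]) (use B in \<open>auto simp: emeasure_lborel_Icc_eq\<close>)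
  then show ?thesis by (rule set_borel_integral_eq_integral(1))
qed

text \<open>
  Here \<open>K\<close> is the size-biased law \<open>x\<^sup>\<beta> \<sigma>(dx)\<close> and \<open>mom n p t\<close> is the mean of
  \<open>\<Sum> \<xi>\<^sub>u\<^bsup>\<beta> + p\<^esup>\<close> over the particles alive at \<open>t\<close> in the first \<open>n\<close> generations, so that
  \<open>law t\<close> is the law of the size of a tagged fragment.
\<close>

locale tagged_fragment = prob_space K for K :: "real measure" +
  fixes \<alpha> :: real and mom :: "nat \<Rightarrow> real \<Rightarrow> real \<Rightarrow> ennreal" and law :: "real \<Rightarrow> real measure"
  assumes \<alpha>: "0 < \<alpha>"
    and sets_K [measurable_cong]: "sets K = sets borel"
    and K_unit: "AE z in K. 0 < z \<and> z \<le> 1"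
    and nonarith: "\<not> (\<exists>r. 0 < r \<and> r < 1 \<and> (AE z in K. \<exists>k::nat. z = r ^ k))"
    and mom_measurable [measurable]: "\<And>n p. mom n p \<in> borel_measurable borel"
    and mom_0: "\<And>p t. mom 0 p t = 0"
    and mom_mono: "\<And>n p t. mom n p t \<le> mom (Suc n) p t"
    and mom_Suc: "\<And>n p t. 0 \<le> t \<Longrightarrow> mom (Suc n) p t = ennreal (exp (- t)) *
      (1 + (\<integral>\<^sup>+y. ennreal (exp y) * (\<integral>\<^sup>+z. ennreal (z powr p) * mom n p (z powr \<alpha> * y) \<partial>K) * indicator {0..t} y \<partial>lborel))"
    and law_moments: "\<And>p t. 0 \<le> t \<Longrightarrow> (\<integral>\<^sup>+y. ennreal (y powr p) \<partial>law t) = (SUP n. mom n p t)"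
    and sets_law [measurable_cong]: "\<And>t. sets (law t) = sets borel"
    and law_pos: "\<And>t. AE y in law t. 0 < y"
begin

text \<open>Freezing the argument at \<open>max 0 t\<close> extends the moment continuously to the
  whole line, so that continuity and boundedness can be stated without side conditions on
  time.\<close>

definition tmom :: "real \<Rightarrow> real \<Rightarrow> real" where
  "tmom p t = enn2real (SUP n. mom n p (max 0 t))"

text \<open>The function psi shifted by \<beta>: K is the size-biased law, so its moment of order p
  is the characteristic function at \<beta> + p.\<close>

definition psi0 :: "real \<Rightarrow> real" where
  "psi0 p = 1 - (\<integral>z. z powr p \<partial>K)"

text \<open>One step along the tagged line of descent: the size picks up the factor z and, by
  self-similarity, the remaining time y becomes z^\<alpha> y on the clock of the child.\<close>

definition step :: "real \<Rightarrow> (real \<Rightarrow> real) \<Rightarrow> real \<Rightarrow> real" where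
  "step p u y = (\<integral>z. z powr p * u (z powr \<alpha> * y) \<partial>K)"

lemma AE_powr_le_1: "0 \<le> p \<Longrightarrow> AE z in K. z powr p \<le> 1"
  using K_unit by eventually_elim (simp add: powr_le1)

lemma powr_integrable: "0 \<le> p \<Longrightarrow> integrable K (\<lambda>z. z powr p)"
  using AE_powr_le_1 by (intro integrable_const_bound[where B = 1]) auto

lemma mom_incseq: "incseq (\<lambda>n. mom n p t)"
  by (rule incseq_SucI) (rule mom_mono)

lemma SUP_mom_eq:
  assumes t: "0 \<le> t"
  shows "(SUP n. mom n p t) = ennreal (exp (- t)) *
      (1 + (\<integral>\<^sup>+y. ennreal (exp y) * (\<integral>\<^sup>+z. ennreal (z powr p) * (SUP n. mom n p (z powr \<alpha> * y)) \<partial>K) * indicator {0..t} y \<partial>lborel))"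
proof -
  define F where "F n y = ennreal (exp y) * (\<integral>\<^sup>+z. ennreal (z powr p) * mom n p (z powr \<alpha> * y) \<partial>K) * indicator {0..t} y"
    for n y
  have F[measurable]: "F n \<in> borel_measurable borel" for n
    unfolding F_def by measurable
  have "incseq F"
    unfolding F_def by (intro incseq_SucI le_funI mult_mono nn_integral_mono mult_left_mono mom_mono) auto
  then have inc: "incseq (\<lambda>n. \<integral>\<^sup>+y. F n y \<partial>lborel)"
    by (auto simp: incseq_def le_fun_def intro!: nn_integral_mono)
  have SF: "(SUP n. F n y) = ennreal (exp y) * (\<integral>\<^sup>+z. ennreal (z powr p) * (SUP n. mom n p (z powr \<alpha> * y)) \<partial>K) * indicator {0..t} y" for y
  proof -
    have "(\<integral>\<^sup>+z. ennreal (z powr p) * (SUP n. mom n p (z powr \<alpha> * y)) \<partial>K)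
       = (SUP n. \<integral>\<^sup>+z. ennreal (z powr p) * mom n p (z powr \<alpha> * y) \<partial>K)"
      unfolding SUP_mult_left_ennreal
      by (rule nn_integral_monotone_convergence_SUP) (auto intro!: incseq_SucI le_funI mult_left_mono mom_mono)
    then show ?thesis unfolding F_def by (simp add: SUP_mult_left_ennreal SUP_mult_right_ennreal)
  qed
  have "(SUP n. mom n p t) = (SUP n. mom (Suc n) p t)"
    using LIMSEQ_unique[OF LIMSEQ_Suc[OF LIMSEQ_SUP[OF mom_incseq]] LIMSEQ_SUP[of "\<lambda>n. mom (Suc n) p t"]]
      mom_incseq[of p t] by (auto simp: incseq_def)
  also have "\<dots> = (SUP n. ennreal (exp (- t)) * (1 + (\<integral>\<^sup>+y. F n y \<partial>lborel)))"
    by (simp add: mom_Suc[OF t] F_def)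
  also have "\<dots> = ennreal (exp (- t)) * (1 + (SUP n. \<integral>\<^sup>+y. F n y \<partial>lborel))"
    using ennreal_SUP_add[of "\<lambda>_. 1", OF _ inc] by (simp flip: SUP_mult_left_ennreal)
  also have "(SUP n. \<integral>\<^sup>+y. F n y \<partial>lborel) = (\<integral>\<^sup>+y. (SUP n. F n y) \<partial>lborel)"
    by (rule nn_integral_monotone_convergence_SUP[symmetric]) (use \<open>incseq F\<close> in auto)
  finally show ?thesis unfolding SF .
qed

lemma K_powr_integral_le: "0 \<le> p \<Longrightarrow> (\<integral>\<^sup>+z. ennreal (z powr p) \<partial>K) \<le> 1"
proof -
  assume p: "0 \<le> p"
  have "(\<integral>\<^sup>+z. ennreal (z powr p) \<partial>K) \<le> (\<integral>\<^sup>+z. 1 \<partial>K)"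
    using AE_powr_le_1[OF p] by (intro nn_integral_mono_AE) auto
  then show ?thesis by (simp add: emeasure_space_1)
qed

lemma nn_integral_exp_icc:
  assumes "0 \<le> t"
  shows "(\<integral>\<^sup>+y. ennreal (exp y) * indicator {0..t} y \<partial>lborel) = ennreal (exp t - 1)"
proof -
  have "((\<lambda>y. exp y) has_integral (exp t - exp 0)) {0..t}"
    using assms by (intro fundamental_theorem_of_calculus)
      (auto intro!: derivative_eq_intros simp flip: has_real_derivative_iff_has_vector_derivative)
  from nn_integral_has_integral_lebesgue'[OF _ this] show ?thesis by simp
qed

text \<open>The constant 1 is a supersolution of the recursion \<open>mom_Suc\<close>, because z^p
  \<le> 1 for 0 \<le> p.\<close>

lemma mom_le_1:
  assumes p: "0 \<le> p" and t: "0 \<le> t"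
  shows "mom n p t \<le> 1"
  using t
proof (induction n arbitrary: t)
  case 0
  then show ?case by (simp add: mom_0)
next
  case (Suc n)
  have "mom (Suc n) p t \<le> ennreal (exp (- t)) * (1 + (\<integral>\<^sup>+y. ennreal (exp y) * 1 * indicator {0..t} y \<partial>lborel))"
    unfolding mom_Suc[OF Suc.prems]
  proof (intro mult_left_mono add_left_mono nn_integral_mono)
    fix y
    show "ennreal (exp y) * (\<integral>\<^sup>+z. ennreal (z powr p) * mom n p (z powr \<alpha> * y) \<partial>K) * indicator {0..t} y
        \<le> ennreal (exp y) * 1 * indicator {0..t} y"
    proof (cases "y \<in> {0..t}")
      case True
      have "(\<integral>\<^sup>+z. ennreal (z powr p) * mom n p (z powr \<alpha> * y) \<partial>K) \<le> (\<integral>\<^sup>+z. ennreal (z powr p) * 1 \<partial>K)"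
        using True by (intro nn_integral_mono mult_left_mono Suc.IH) auto
      also have "\<dots> \<le> 1" using K_powr_integral_le[OF p] by simp
      finally show ?thesis using True by (intro mult_right_mono mult_left_mono) auto
    qed auto
  qed auto
  also have "\<dots> = ennreal (exp (- t)) * (1 + ennreal (exp t - 1))"
    using nn_integral_exp_icc[OF Suc.prems] by simp
  also have "\<dots> = ennreal (exp (- t)) * ennreal (exp t)"
    using Suc.prems by (subst ennreal_1[symmetric], subst ennreal_plus[symmetric]) auto
  also have "\<dots> = 1" by (simp flip: ennreal_mult exp_add)
  finally show ?case .
qed

lemma tmom_measurable [measurable]: "tmom p \<in> borel_measurable borel"
  unfolding tmom_def by measurable

lemma SUP_mom_le_1: "0 \<le> p \<Longrightarrow> 0 \<le> t \<Longrightarrow> (SUP n. mom n p t) \<le> 1"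
  using mom_le_1 by (auto intro: SUP_least)

lemma tmom_nonneg: "0 \<le> tmom p t"
  unfolding tmom_def by simp

lemma ennreal_tmom: "0 \<le> p \<Longrightarrow> 0 \<le> t \<Longrightarrow> ennreal (tmom p t) = (SUP n. mom n p t)"
  unfolding tmom_def using SUP_mom_le_1[of p t]
  by (subst ennreal_enn2real) (auto simp: le_less_trans[of _ 1] max_absorb2)

lemma tmom_le_1: "0 \<le> p \<Longrightarrow> tmom p t \<le> 1"
  unfolding tmom_def using SUP_mom_le_1[of p "max 0 t"] by (intro enn2real_leI) auto

lemma step_measurable [measurable]:
  assumes [measurable]: "u \<in> borel_measurable borel"
  shows "step p u \<in> borel_measurable borel"
  unfolding step_def by measurable

lemma step_integrable:
  assumes "0 \<le> p" and [measurable]: "u \<in> borel_measurable borel" and u: "\<And>x. \<bar>u x\<bar> \<le> B"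
  shows "integrable K (\<lambda>z. z powr p * u (z powr \<alpha> * y))"
proof (rule integrable_const_bound[where B = B])
  show "AE z in K. norm (z powr p * u (z powr \<alpha> * y)) \<le> B"
    using K_unit
  proof eventually_elim
    case (elim z)
    have "\<bar>z powr p\<bar> * \<bar>u (z powr \<alpha> * y)\<bar> \<le> 1 * B"
      using elim assms(1) u by (intro mult_mono) (auto simp: powr_le1)
    then show ?case by (simp add: abs_mult)
  qed
qed measurable

lemma step_tmom_nonneg: "0 \<le> step p (tmom q) y"
  unfolding step_def by (intro integral_nonneg_AE) (auto simp: tmom_nonneg)

lemma step_tmom_le:
  assumes "0 \<le> p" "0 \<le> q" shows "step p (tmom q) y \<le> 1"
proof -
  have "step p (tmom q) y \<le> (\<integral>z. 1 \<partial>K)"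
    unfolding step_def
  proof (rule integral_mono_AE)
    show "integrable K (\<lambda>z. z powr p * tmom q (z powr \<alpha> * y))"
      using assms tmom_le_1 tmom_nonneg by (intro step_integrable[where B = 1]) (auto simp: abs_le_iff order_trans[of _ 0])
    show "AE z in K. z powr p * tmom q (z powr \<alpha> * y) \<le> 1"
      using K_unit
      by eventually_elim (use assms tmom_le_1 in \<open>auto intro!: mult_le_one tmom_nonneg simp: powr_le1\<close>)
  qed simp
  then show ?thesis by (simp add: prob_space)
qed

text \<open>The monotone limit of the generation recursion is the backward equation in integrated
  form; the bound by 1 permits the passage from extended to real values.\<close>

lemma tmom_eq:
  assumes p: "0 \<le> p" and t: "0 \<le> t"
  shows "tmom p t = exp (- t) * (1 + integral {0..t} (\<lambda>y. exp y * step p (tmom p) y))"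
proof -
  have int: "(\<lambda>y. exp y * step p (tmom p) y) integrable_on {0..t}"
  proof (rule bounded_borel_integrable_on[where B = "exp t"])
    fix y assume "y \<in> {0..t}"
    then have "exp y * step p (tmom p) y \<le> exp t * 1"
      using step_tmom_le[OF p p] by (intro mult_mono) (auto intro: step_tmom_nonneg)
    then show "\<bar>exp y * step p (tmom p) y\<bar> \<le> exp t" using step_tmom_nonneg[of p p y] by (simp add: abs_mult)
  qed measurable
  have nn: "(\<integral>\<^sup>+y. ennreal (exp y * step p (tmom p) y) * indicator {0..t} y \<partial>lborel)
     = ennreal (integral {0..t} (\<lambda>y. exp y * step p (tmom p) y))"
    using int by (intro nn_integral_has_integral_lebesgue') (auto intro!: mult_nonneg_nonneg step_tmom_nonneg integrable_integral)
  have "(\<integral>\<^sup>+y. ennreal (exp y) * (\<integral>\<^sup>+z. ennreal (z powr p) * (SUP n. mom n p (z powr \<alpha> * y)) \<partial>K) * indicator {0..t} y \<partial>lborel)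
      = (\<integral>\<^sup>+y. ennreal (exp y * step p (tmom p) y) * indicator {0..t} y \<partial>lborel)"
  proof (rule nn_integral_cong)
    fix y :: real
    have "(\<integral>\<^sup>+z. ennreal (z powr p) * (SUP n. mom n p (z powr \<alpha> * y)) \<partial>K) = ennreal (step p (tmom p) y)" if "0 \<le> y"
    proof -
      have "(\<integral>\<^sup>+z. ennreal (z powr p) * (SUP n. mom n p (z powr \<alpha> * y)) \<partial>K)
        = (\<integral>\<^sup>+z. ennreal (z powr p * tmom p (z powr \<alpha> * y)) \<partial>K)"
        using that by (intro nn_integral_cong) (simp add: ennreal_mult ennreal_tmom[OF p] tmom_nonneg)
      also have "\<dots> = ennreal (step p (tmom p) y)"
        unfolding step_def
        by (intro nn_integral_eq_integral step_integrable[where B = 1] p)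
           (use tmom_le_1[OF p] tmom_nonneg in \<open>auto simp: abs_le_iff order_trans[of _ 0]\<close>)
      finally show ?thesis .
    qed
    then show "ennreal (exp y) * (\<integral>\<^sup>+z. ennreal (z powr p) * (SUP n. mom n p (z powr \<alpha> * y)) \<partial>K) * indicator {0..t} y
       = ennreal (exp y * step p (tmom p) y) * indicator {0..t} y"
      by (auto simp: ennreal_mult step_tmom_nonneg indicator_def)
  qed
  then have "ennreal (tmom p t) = ennreal (exp (- t)) *
      (1 + (\<integral>\<^sup>+y. ennreal (exp y * step p (tmom p) y) * indicator {0..t} y \<partial>lborel))"
    unfolding ennreal_tmom[OF p t] SUP_mom_eq[OF t] by simp
  also have "\<dots> = ennreal (exp (- t) * (1 + integral {0..t} (\<lambda>y. exp y * step p (tmom p) y)))"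
    unfolding nn using int
    by (simp add: ennreal_mult ennreal_plus integral_nonneg mult_nonneg_nonneg step_tmom_nonneg)
  finally show ?thesis
    using int by (subst (asm) ennreal_inj) (auto simp: tmom_nonneg intro!: mult_nonneg_nonneg add_nonneg_nonneg integral_nonneg step_tmom_nonneg)
qed

lemma tmom_continuous:
  assumes p: "0 \<le> p"
  shows "continuous_on UNIV (tmom p)"
proof -
  define F where "F y = exp y * step p (tmom p) y" for y
  have F[measurable]: "F \<in> borel_measurable borel" unfolding F_def by measurable
  have int: "F integrable_on {0..t}" for t
  proof (rule bounded_borel_integrable_on[where B = "exp t"])
    fix y assume "y \<in> {0..t}"
    then have "exp y * step p (tmom p) y \<le> exp t * 1"
      using step_tmom_le[OF p p] by (intro mult_mono) (auto intro: step_tmom_nonneg)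
    then show "\<bar>F y\<bar> \<le> exp t" using step_tmom_nonneg[of p p y] by (simp add: F_def abs_mult)
  qed measurable
  have "continuous_on {0..T} (\<lambda>t. exp (- t) * (1 + integral {0..t} F))" for T
    by (intro continuous_intros indefinite_integral_continuous_1 int)
  then have *: "continuous_on {0..T} (tmom p)" for T
    by (rule continuous_on_eq) (use tmom_eq[OF p] in \<open>auto simp: F_def[abs_def]\<close>)
  have "isCont (tmom p) x" for x
  proof -
    have "continuous_on {-(\<bar>x\<bar> + 1)..\<bar>x\<bar> + 1} (\<lambda>t. tmom p (max 0 t))"
      by (rule continuous_on_compose2[OF *[of "\<bar>x\<bar> + 1"]]) (auto intro!: continuous_intros)
    moreover have "tmom p (max 0 t) = tmom p t" for t by (simp add: tmom_def)
    moreover have "x \<in> interior {-(\<bar>x\<bar> + 1)..\<bar>x\<bar> + 1}" unfolding interior_atLeastAtMost_real by auto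
    ultimately show ?thesis using continuous_on_interior by fastforce
  qed
  then show ?thesis by (simp add: continuous_at_imp_continuous_on)
qed

lemma step_continuous:
  assumes p: "0 \<le> p" and u: "continuous_on UNIV u" and B: "\<And>x. \<bar>u x\<bar> \<le> B"
  shows "continuous_on UNIV (step p u)"
proof -
  have [measurable]: "u \<in> borel_measurable borel" using u by (rule borel_measurable_continuous_onI)
  have "isCont (step p u) x" for x
    unfolding continuous_at_sequentially comp_def step_def
  proof (intro allI impI)
    fix X assume X: "X \<longlonglongrightarrow> x"
    show "(\<lambda>n. \<integral>z. z powr p * u (z powr \<alpha> * X n) \<partial>K) \<longlonglongrightarrow> (\<integral>z. z powr p * u (z powr \<alpha> * x) \<partial>K)"
    proof (rule integral_dominated_convergence[where w = "\<lambda>_. B"])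
      show "AE z in K. (\<lambda>n. z powr p * u (z powr \<alpha> * X n)) \<longlonglongrightarrow> z powr p * u (z powr \<alpha> * x)"
      proof (rule AE_I2)
        fix z
        have "isCont u (z powr \<alpha> * x)" using u by (simp add: continuous_on_eq_continuous_at)
        then have "(\<lambda>n. u (z powr \<alpha> * X n)) \<longlonglongrightarrow> u (z powr \<alpha> * x)"
          by (rule isCont_tendsto_compose) (intro tendsto_intros X)
        then show "(\<lambda>n. z powr p * u (z powr \<alpha> * X n)) \<longlonglongrightarrow> z powr p * u (z powr \<alpha> * x)"
          by (rule tendsto_mult_left)
      qed
      show "AE z in K. norm (z powr p * u (z powr \<alpha> * X n)) \<le> B" for n
        using AE_powr_le_1[OF p]
      proof eventually_elim
        case (elim z)
        then have "\<bar>z powr p\<bar> * \<bar>u (z powr \<alpha> * X n)\<bar> \<le> 1 * B" using B by (intro mult_mono) auto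
        then show ?case by (simp add: abs_mult)
      qed
    qed auto
  qed
  then show ?thesis by (simp add: continuous_at_imp_continuous_on)
qed

lemma tmom_abs_le_1: "0 \<le> p \<Longrightarrow> \<bar>tmom p t\<bar> \<le> 1"
  using tmom_le_1[of p t] tmom_nonneg[of p t] by simp

lemma tmom_at_0: "0 \<le> p \<Longrightarrow> tmom p 0 = 1"
  using tmom_eq[of p 0] by simp

lemma tmom_deriv_backward:
  assumes p: "0 \<le> p" and t: "t \<in> {0..T}"
  shows "(tmom p has_real_derivative (step p (tmom p) t - tmom p t)) (at t within {0..T})"
proof -
  define F where "F y = exp y * step p (tmom p) y" for y
  have "continuous_on {0..T} F"
    unfolding F_def
    using step_continuous[OF p tmom_continuous[OF p] tmom_abs_le_1[OF p]]
    by (intro continuous_intros) (auto intro: continuous_on_subset)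
  from integral_has_real_derivative[OF this t]
  have "((\<lambda>t. exp (- t) * (1 + integral {0..t} F)) has_real_derivative
      (- exp (- t) * (1 + integral {0..t} F) + F t * exp (- t))) (at t within {0..T})"
    by (auto intro!: derivative_eq_intros)
  moreover have "tmom p x = exp (- x) * (1 + integral {0..x} F)" if "x \<in> {0..T}" for x
    using tmom_eq[OF p, of x] that by (simp add: F_def[abs_def])
  moreover have "F t * exp (- t) = step p (tmom p) t" by (simp add: F_def exp_minus)
  ultimately show ?thesis
    using t by (subst has_field_derivative_cong_eventually[where g = "\<lambda>t. exp (- t) * (1 + integral {0..t} F)"])
      (auto simp: eventually_at_filter)
qed

text \<open>The integrated right-hand side of the forward equation. It makes sense as soon as p +
  \<alpha> \<ge> 0, in particular for slightly negative p, where it will dominate the negative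
  moments.\<close>

definition forward :: "real \<Rightarrow> real \<Rightarrow> real" where
  "forward p t = 1 - psi0 p * integral {0..t} (tmom (p + \<alpha>))"

lemma tmom_integrable_on: "0 \<le> p \<Longrightarrow> tmom p integrable_on {a..b}"
  using tmom_continuous[of p] by (intro integrable_continuous_interval) (auto intro: continuous_on_subset)

lemma forward_deriv:
  assumes p: "0 \<le> p + \<alpha>" and t: "t \<in> {0..T}"
  shows "(forward p has_real_derivative - psi0 p * tmom (p + \<alpha>) t) (at t within {0..T})"
proof -
  have "continuous_on {0..T} (tmom (p + \<alpha>))" using tmom_continuous[OF p] by (auto intro: continuous_on_subset)
  from integral_has_real_derivative[OF this t] show ?thesis
    unfolding forward_def[abs_def] by (auto intro!: derivative_eq_intros)
qed

text \<open>The substitution s -> z^\<alpha> s turns \<open>step p\<close>, applied to the integral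
  of the moment of order p + \<alpha>, into the integral of \<open>step (p + \<alpha>)\<close>
  applied to that moment, and the backward equation of order p + \<alpha> evaluates the
  latter.\<close>

lemma forward_step:
  assumes p: "0 \<le> p + \<alpha>" and int: "integrable K (\<lambda>z. z powr p)" and y: "0 \<le> y"
  shows "integrable K (\<lambda>z. z powr p * forward p (z powr \<alpha> * y))" (is ?int)
    and "step p (forward p) y = forward p y - psi0 p * tmom (p + \<alpha>) y" (is ?eq)
proof -
  define v where "v = tmom (p + \<alpha>)"
  define G where "G x = integral {0..x} v" for x
  define H where "H = step (p + \<alpha>) v"
  have v[measurable]: "v \<in> borel_measurable borel" and v0: "\<And>x. 0 \<le> v x" and v1: "\<And>x. \<bar>v x\<bar> \<le> 1"
    and vint: "v integrable_on {0..x}" for x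
    using p by (auto simp: v_def tmom_nonneg tmom_le_1 tmom_integrable_on)
  have H0: "0 \<le> H s" for s unfolding H_def v_def by (rule step_tmom_nonneg)
  have H[measurable]: "H \<in> borel_measurable borel" unfolding H_def by measurable
  have Hc: "continuous_on UNIV H"
    unfolding H_def v_def by (intro step_continuous[where B = 1] p tmom_continuous tmom_abs_le_1)
  then have Hint: "H integrable_on {0..x}" for x
    by (intro integrable_continuous_interval) (auto intro: continuous_on_subset)
  have G0: "0 \<le> G x" for x unfolding G_def by (intro integral_nonneg vint v0)
  have Gmono: "G a \<le> G b" if "0 \<le> a" "a \<le> b" for a b
    unfolding G_def using that by (intro integral_subset_le vint) (auto simp: v0)
  have Gnn: "ennreal (G x) = (\<integral>\<^sup>+s. ennreal (v s) * indicator {0..x} s \<partial>lborel)" for x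
    unfolding G_def by (intro nn_integral_has_integral_lebesgue'[symmetric] v0 integrable_integral vint)
  have Gc: "continuous_on {0..T} G" for T
    unfolding G_def by (intro indefinite_integral_continuous_1 vint)
  have Gm[measurable]: "G \<in> borel_measurable borel"
  proof -
    have "mono G"
    proof (rule monoI)
      fix a b :: real assume "a \<le> b"
      then show "G a \<le> G b" using Gmono[of a b] G0[of b] by (cases "0 \<le> a") (auto simp: G_def)
    qed
    then show ?thesis by (rule borel_measurable_mono)
  qed
  have "(\<integral>\<^sup>+z. ennreal (z powr p * G (z powr \<alpha> * y)) \<partial>K)
      = (\<integral>\<^sup>+z. \<integral>\<^sup>+s. ennreal (z powr (p + \<alpha>) * v (z powr \<alpha> * s)) * indicator {0..y} s \<partial>lborel \<partial>K)"
  proof (rule nn_integral_cong_AE)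
    show "AE z in K. ennreal (z powr p * G (z powr \<alpha> * y))
       = (\<integral>\<^sup>+s. ennreal (z powr (p + \<alpha>) * v (z powr \<alpha> * s)) * indicator {0..y} s \<partial>lborel)"
      using K_unit
    proof eventually_elim
      case (elim z)
      define c where "c = z powr \<alpha>"
      have c: "0 < c" using elim by (simp add: c_def)
      have "ennreal (G (c * y)) = ennreal \<bar>c\<bar> * (\<integral>\<^sup>+s. ennreal (v (0 + c * s)) * indicator {0..c * y} (0 + c * s) \<partial>lborel)"
        unfolding Gnn using c by (intro nn_integral_real_affine) auto
      also have "\<dots> = (\<integral>\<^sup>+s. ennreal (c * v (c * s)) * indicator {0..y} s \<partial>lborel)"
        using c by (subst nn_integral_cmult[symmetric])
          (auto intro!: nn_integral_cong simp: ennreal_mult v0 indicator_def zero_le_mult_iff mult_ac)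
      finally have "ennreal (z powr p) * ennreal (G (c * y)) = (\<integral>\<^sup>+s. ennreal (z powr p) * (ennreal (c * v (c * s)) * indicator {0..y} s) \<partial>lborel)"
        by (simp add: nn_integral_cmult)
      then show ?case
        using c by (simp add: ennreal_mult v0 G0 powr_add c_def[symmetric] mult_ac)
    qed
  qed
  also have "\<dots> = (\<integral>\<^sup>+s. \<integral>\<^sup>+z. ennreal (z powr (p + \<alpha>) * v (z powr \<alpha> * s)) * indicator {0..y} s \<partial>K \<partial>lborel)"
  proof -
    interpret pair_sigma_finite K lborel ..
    show ?thesis by (rule Fubini'[symmetric]) measurable
  qed
  also have "\<dots> = (\<integral>\<^sup>+s. ennreal (H s) * indicator {0..y} s \<partial>lborel)"
  proof (rule nn_integral_cong)
    fix s :: real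
    have "(\<integral>\<^sup>+z. ennreal (z powr (p + \<alpha>) * v (z powr \<alpha> * s)) \<partial>K) = ennreal (H s)"
      unfolding H_def step_def by (intro nn_integral_eq_integral step_integrable[where B = 1] p v v1) (auto simp: v0)
    then show "(\<integral>\<^sup>+z. ennreal (z powr (p + \<alpha>) * v (z powr \<alpha> * s)) * indicator {0..y} s \<partial>K) = ennreal (H s) * indicator {0..y} s"
      by (simp add: nn_integral_multc)
  qed
  also have "\<dots> = ennreal (integral {0..y} H)"
    by (intro nn_integral_has_integral_lebesgue' H0 integrable_integral Hint)
  finally have nn: "(\<integral>\<^sup>+z. ennreal (z powr p * G (z powr \<alpha> * y)) \<partial>K) = ennreal (integral {0..y} H)" .
  have intG: "integrable K (\<lambda>z. z powr p * G (z powr \<alpha> * y))"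
    by (rule integrableI_nn_integral_finite[OF _ _ nn]) (auto simp: G0 intro!: integral_nonneg H0 Hint)
  have valG: "(\<integral>z. z powr p * G (z powr \<alpha> * y) \<partial>K) = integral {0..y} H"
    using integral_nonneg[OF Hint H0, of y] by (subst integral_eq_nn_integral) (auto simp: G0 nn)
  have "((\<lambda>s. H s - v s) has_integral (v y - v 0)) {0..y}"
    unfolding H_def v_def using tmom_deriv_backward[OF p] y
    by (intro fundamental_theorem_of_calculus) (auto simp flip: has_real_derivative_iff_has_vector_derivative)
  moreover have "((\<lambda>s. H s - v s) has_integral (integral {0..y} H - G y)) {0..y}"
    unfolding G_def by (intro has_integral_diff integrable_integral Hint vint)
  ultimately have "integral {0..y} H - G y = v y - v 0" by (rule has_integral_unique[THEN sym])
  then have "integral {0..y} H - G y = v y - 1" using p by (simp add: v_def tmom_at_0)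
  then have IH: "integral {0..y} H = v y - 1 + G y" by simp
  have eq: "z powr p * forward p (z powr \<alpha> * y) = z powr p - psi0 p * (z powr p * G (z powr \<alpha> * y))" for z
    by (simp add: forward_def G_def v_def algebra_simps)
  show ?int unfolding eq by (intro Bochner_Integration.integrable_diff integrable_mult_right int intG)
  have "step p (forward p) y = (1 - psi0 p) - psi0 p * (v y - 1 + G y)"
    unfolding step_def eq using int intG by (simp add: valG IH psi0_def)
  then show ?eq by (simp add: forward_def G_def v_def algebra_simps)
qed

lemma forward_continuous: "0 \<le> p + \<alpha> \<Longrightarrow> continuous_on {0..T} (forward p)"
  using forward_deriv by (rule DERIV_continuous_on)

text \<open>By \<open>forward_step\<close> the integrand is the derivative of e^y times
  \<open>forward p y\<close>; so the forward expression satisfies the same integral equation as the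
  moment of order p.\<close>

lemma forward_solves:
  assumes p: "0 \<le> p + \<alpha>" and int: "integrable K (\<lambda>z. z powr p)" and t: "0 \<le> t"
  shows "((\<lambda>y. exp y * step p (forward p) y) has_integral (exp t * forward p t - 1)) {0..t}"
proof -
  have "((\<lambda>y. exp y * (forward p y - psi0 p * tmom (p + \<alpha>) y)) has_integral (exp t * forward p t - exp 0 * forward p 0)) {0..t}"
    using t by (intro fundamental_theorem_of_calculus)
      (auto intro!: derivative_eq_intros forward_deriv[OF p] simp: algebra_simps simp flip: has_real_derivative_iff_has_vector_derivative)
  moreover have "forward p 0 = 1" by (simp add: forward_def)
  ultimately show ?thesis
    using forward_step(2)[OF p int] by (subst has_integral_cong) auto
qed

text \<open>Both sides solve the backward equation. At a time s where their difference d is largest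
  in absolute value, that equation gives e^s |d(s)| \<le> (e^s - 1) |d(s)|, because z^\<alpha> y
  never exceeds y and z^p never exceeds 1; hence d vanishes.\<close>

theorem tmom_forward:
  assumes p: "0 \<le> p" and t: "0 \<le> t"
  shows "tmom p t = forward p t"
proof -
  have p\<alpha>: "0 \<le> p + \<alpha>" using p \<alpha> by simp
  note int = powr_integrable[OF p]
  define d where "d x = tmom p x - forward p x" for x
  have dc: "continuous_on {0..t} d"
    unfolding d_def using tmom_continuous[OF p] forward_continuous[OF p\<alpha>]
    by (intro continuous_intros) (auto intro: continuous_on_subset)
  have "\<exists>x\<in>{0..t}. \<forall>y\<in>{0..t}. \<bar>d y\<bar> \<le> \<bar>d x\<bar>"
    by (rule continuous_attains_sup) (use t dc in \<open>auto intro!: continuous_intros\<close>)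
  then obtain s where s: "0 \<le> s" "s \<le> t" and smax: "\<And>y. 0 \<le> y \<Longrightarrow> y \<le> t \<Longrightarrow> \<bar>d y\<bar> \<le> \<bar>d s\<bar>" by auto
  define B where "B = \<bar>d s\<bar>"
  have i1: "((\<lambda>y. exp y * step p (tmom p) y) has_integral (exp s * tmom p s - 1)) {0..s}"
  proof -
    have "continuous_on {0..s} (\<lambda>y. exp y * step p (tmom p) y)"
      using step_continuous[OF p tmom_continuous[OF p] tmom_abs_le_1[OF p]]
      by (intro continuous_intros) (auto intro: continuous_on_subset)
    from integrable_integral[OF integrable_continuous_interval[OF this]]
    show ?thesis using tmom_eq[OF p s(1)] by (simp add: exp_minus field_simps)
  qed
  have i2: "((\<lambda>y. exp y * (step p (tmom p) y - step p (forward p) y)) has_integral exp s * d s) {0..s}"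
    using has_integral_diff[OF i1 forward_solves[OF p\<alpha> int s(1)]] by (simp add: d_def algebra_simps)
  have i3: "((\<lambda>y. exp y * B) has_integral (exp s * B - exp 0 * B)) {0..s}"
    using s by (intro fundamental_theorem_of_calculus)
      (auto intro!: derivative_eq_intros simp flip: has_real_derivative_iff_has_vector_derivative)
  have bnd: "norm (exp y * (step p (tmom p) y - step p (forward p) y)) \<le> exp y * B" if y: "y \<in> {0..s}" for y
  proof -
    have i: "integrable K (\<lambda>z. z powr p * tmom p (z powr \<alpha> * y))" "integrable K (\<lambda>z. z powr p * forward p (z powr \<alpha> * y))"
      using y by (auto intro: step_integrable[OF p tmom_measurable tmom_abs_le_1[OF p]] forward_step(1)[OF p\<alpha> int])
    then have "step p (tmom p) y - step p (forward p) y = (\<integral>z. z powr p * d (z powr \<alpha> * y) \<partial>K)"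
      unfolding step_def d_def by (simp add: right_diff_distrib)
    also have "\<bar>\<dots>\<bar> \<le> (\<integral>z. \<bar>z powr p * d (z powr \<alpha> * y)\<bar> \<partial>K)" by (rule integral_abs_bound)
    also have "\<dots> \<le> (\<integral>z. B \<partial>K)"
    proof (rule integral_mono_AE)
      show "integrable K (\<lambda>z. \<bar>z powr p * d (z powr \<alpha> * y)\<bar>)"
        using Bochner_Integration.integrable_diff[OF i] unfolding d_def by (intro integrable_abs) (simp add: right_diff_distrib)
      show "AE z in K. \<bar>z powr p * d (z powr \<alpha> * y)\<bar> \<le> B"
        using K_unit
      proof eventually_elim
        case (elim z)
        have "z powr \<alpha> * y \<le> 1 * t"
          using elim y s \<alpha> by (intro mult_mono) (auto simp: powr_le1)
        then have "\<bar>d (z powr \<alpha> * y)\<bar> \<le> B" unfolding B_def using y by (intro smax) auto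
        then have "\<bar>z powr p\<bar> * \<bar>d (z powr \<alpha> * y)\<bar> \<le> 1 * B" using elim p by (intro mult_mono) (auto simp: powr_le1)
        then show ?case by (simp add: abs_mult)
      qed
    qed simp
    finally show ?thesis by (simp add: prob_space abs_mult)
  qed
  have "norm (exp s * d s) \<le> exp s * B - exp 0 * B"
    using integral_norm_bound_integral[OF has_integral_integrable[OF i2] has_integral_integrable[OF i3] bnd]
    unfolding integral_unique[OF i2] integral_unique[OF i3] .
  moreover have "norm (exp s * d s) = exp s * B" unfolding B_def by (simp add: abs_mult)
  ultimately have "B \<le> 0" unfolding exp_zero by linarith
  then have "d t = 0" using smax[OF t order_refl] B_def by simp
  then show ?thesis by (simp add: d_def)
qed

lemma tmom_deriv:
  assumes p: "0 \<le> p" and t: "0 < t"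
  shows "(tmom p has_real_derivative - psi0 p * tmom (p + \<alpha>) t) (at t)"
proof -
  have "(forward p has_real_derivative - psi0 p * tmom (p + \<alpha>) t) (at t within {0..t + 1})"
    using p \<alpha> t by (intro forward_deriv) auto
  moreover have "at t within {0..t + 1} = at t" using t by (intro at_within_interior) auto
  ultimately have "(forward p has_real_derivative - psi0 p * tmom (p + \<alpha>) t) (at t)" by simp
  moreover have "\<forall>\<^sub>F x in nhds t. x \<in> {0<..}" using t by (intro eventually_nhds_in_open) auto
  then have "\<forall>\<^sub>F x in nhds t. tmom p x = forward p x"
    by eventually_elim (use tmom_forward[OF p] in auto)
  ultimately show ?thesis by (subst DERIV_cong_ev[OF refl _ refl])
qed

lemma psi0_0 [simp]: "psi0 0 = 0"
proof -
  have "(\<integral>z. z powr 0 \<partial>K) = (\<integral>z. 1 \<partial>K)"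
    using K_unit by (intro integral_cong_AE) (auto elim!: eventually_mono)
  then show ?thesis by (simp add: psi0_def prob_space)
qed

lemma tmom_p0: "0 \<le> t \<Longrightarrow> tmom 0 t = 1"
  using tmom_forward[of 0 t] by (simp add: forward_def)

lemma psi0_mono:
  assumes "0 \<le> p" "p \<le> q" shows "psi0 p \<le> psi0 q"
proof -
  have "(\<integral>z. z powr q \<partial>K) \<le> (\<integral>z. z powr p \<partial>K)"
  proof (intro integral_mono_AE powr_integrable)
    show "AE z in K. z powr q \<le> z powr p"
      using K_unit by eventually_elim (use assms in \<open>auto intro: powr_mono'\<close>)
  qed (use assms in auto)
  then show ?thesis by (simp add: psi0_def)
qed

text \<open>Otherwise Z = 1 almost surely, and the constant 1 is the power k = 0 of any ratio r, so
  the law would be arithmetic.\<close>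

lemma psi0_pos:
  assumes p: "0 < p" shows "0 < psi0 p"
proof (rule ccontr)
  assume "\<not> 0 < psi0 p"
  then have "(\<integral>z. 1 - z powr p \<partial>K) \<le> 0"
    using powr_integrable[of p] p by (simp add: psi0_def prob_space)
  moreover have nn: "AE z in K. 0 \<le> 1 - z powr p" using AE_powr_le_1[of p] p by auto
  ultimately have "(\<integral>z. 1 - z powr p \<partial>K) = 0" using integral_nonneg_AE[OF nn] by linarith
  then have "AE z in K. 1 - z powr p = 0"
    using powr_integrable[of p] p nn by (subst (asm) integral_nonneg_eq_0_iff_AE) auto
  with K_unit have "AE z in K. \<exists>k::nat. z = (1 / 2) ^ k"
  proof eventually_elim
    case (elim z)
    then have "z powr p = 1" by simp
    then have "z = 1" using elim p by (metis less_numeral_extra(3) powr_eq_one_iff_gen)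
    then show ?case by (intro exI[of _ 0]) simp
  qed
  then show False using nonarith by (auto dest: spec[of _ "1 / 2"])
qed

lemma psi0_nonneg: "0 \<le> p \<Longrightarrow> 0 \<le> psi0 p"
  using psi0_mono[of 0 p] by simp

lemma tmom_diff:
  assumes p: "0 \<le> p" and st: "0 \<le> s" "s \<le> t"
  shows "tmom p s - tmom p t = psi0 p * integral {s..t} (tmom (p + \<alpha>))"
proof -
  have "integral {0..s} (tmom (p + \<alpha>)) + integral {s..t} (tmom (p + \<alpha>)) = integral {0..t} (tmom (p + \<alpha>))"
    using st p \<alpha> by (intro Henstock_Kurzweil_Integration.integral_combine tmom_integrable_on) auto
  then have "psi0 p * integral {0..t} (tmom (p + \<alpha>)) =
      psi0 p * integral {0..s} (tmom (p + \<alpha>)) + psi0 p * integral {s..t} (tmom (p + \<alpha>))"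
    by (metis distrib_left)
  then show ?thesis
    using tmom_forward[OF p, of s] tmom_forward[OF p, of t] st by (simp add: forward_def)
qed

lemma tmom_antimono:
  assumes p: "0 \<le> p" and st: "0 \<le> s" "s \<le> t"
  shows "tmom p t \<le> tmom p s"
proof -
  have "0 \<le> integral {s..t} (tmom (p + \<alpha>))"
    using p \<alpha> by (intro integral_nonneg tmom_integrable_on tmom_nonneg) auto
  then have "0 \<le> psi0 p * integral {s..t} (tmom (p + \<alpha>))" using psi0_nonneg[OF p] by simp
  then show ?thesis using tmom_diff[OF assms] by linarith
qed

text \<open>The moment of order p + \<alpha> decreases in time, so its values at the two ends bound
  its integral. This is the device by which size estimates and limits pass from order p to order p +
  \<alpha>.\<close>

lemma tmom_diff_bounds:
  assumes p: "0 \<le> p" and st: "0 \<le> s" "s \<le> t"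
  shows "psi0 p * ((t - s) * tmom (p + \<alpha>) t) \<le> tmom p s - tmom p t"
    and "tmom p s - tmom p t \<le> psi0 p * ((t - s) * tmom (p + \<alpha>) s)"
proof -
  have p\<alpha>: "0 \<le> p + \<alpha>" using p \<alpha> by simp
  have c: "((\<lambda>_. c) has_integral (t - s) * c) {s..t}" for c :: real
    using has_integral_const_real[of c s t] st by simp
  note i = integrable_integral[OF tmom_integrable_on[OF p\<alpha>, of s t]]
  have "(t - s) * tmom (p + \<alpha>) t \<le> integral {s..t} (tmom (p + \<alpha>))"
    by (rule has_integral_le[OF c i]) (use tmom_antimono[OF p\<alpha>] st in auto)
  then show "psi0 p * ((t - s) * tmom (p + \<alpha>) t) \<le> tmom p s - tmom p t"
    unfolding tmom_diff[OF assms] using psi0_nonneg[OF p] by (rule mult_left_mono)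
  have "integral {s..t} (tmom (p + \<alpha>)) \<le> (t - s) * tmom (p + \<alpha>) s"
    by (rule has_integral_le[OF i c]) (use tmom_antimono[OF p\<alpha>] st in auto)
  then show "tmom p s - tmom p t \<le> psi0 p * ((t - s) * tmom (p + \<alpha>) s)"
    unfolding tmom_diff[OF assms] using psi0_nonneg[OF p] by (rule mult_left_mono)
qed

lemma law_powr_integrable:
  assumes "0 \<le> p" "0 \<le> t"
  shows "integrable (law t) (\<lambda>y. y powr p)" and "(\<integral>y. y powr p \<partial>law t) = tmom p t"
proof -
  have nn: "(\<integral>\<^sup>+y. ennreal (y powr p) \<partial>law t) = ennreal (tmom p t)"
    using law_moments[OF assms(2)] ennreal_tmom[OF assms] by simp
  show "integrable (law t) (\<lambda>y. y powr p)"
    by (rule integrableI_nn_integral_finite[OF _ _ nn]) (auto simp: tmom_nonneg)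
  show "(\<integral>y. y powr p \<partial>law t) = tmom p t"
    by (subst integral_eq_nn_integral) (auto simp: nn tmom_nonneg)
qed

lemma prob_space_law:
  assumes t: "0 \<le> t" shows "prob_space (law t)"
proof (rule prob_spaceI)
  have "emeasure (law t) (space (law t)) = (\<integral>\<^sup>+y. 1 \<partial>law t)" by simp
  also have "\<dots> = (\<integral>\<^sup>+y. ennreal (y powr 0) \<partial>law t)"
    using law_pos[of t] by (intro nn_integral_cong_AE) (auto elim!: eventually_mono)
  also have "\<dots> = ennreal (tmom 0 t)"
    unfolding law_moments[OF t] by (rule ennreal_tmom[OF order_refl t, symmetric])
  finally show "emeasure (law t) (space (law t)) = 1" using tmom_p0[OF t] by simp
qed

lemma tmom_square_le:
  assumes p: "0 \<le> p" and t: "0 \<le> t"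
  shows "(tmom p t)\<^sup>2 \<le> tmom (2 * p) t"
proof -
  interpret L: prob_space "law t" by (rule prob_space_law[OF t])
  define c where "c = tmom p t"
  note i1 = law_powr_integrable[OF p t]
  have "0 \<le> 2 * p" using p by simp
  note i2 = law_powr_integrable[OF this t]
  have "0 \<le> (\<integral>y. (y powr p - c)\<^sup>2 \<partial>law t)" by simp
  also have "\<dots> = (\<integral>y. y powr (2 * p) - 2 * c * y powr p + c\<^sup>2 \<partial>law t)"
    by (intro Bochner_Integration.integral_cong refl)
       (simp add: power2_eq_square algebra_simps flip: powr_add)
  also have "\<dots> = tmom (2 * p) t - 2 * c * c + c\<^sup>2"
    using i1 i2 by (simp add: c_def L.prob_space)
  finally show ?thesis by (simp add: c_def power2_eq_square)
qed

text \<open>The reciprocal 1 / m(\<alpha>) has derivative psi0(\<alpha>) m(2\<alpha>) /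
  m(\<alpha>)^2, which \<open>tmom_square_le\<close> bounds below by psi0(\<alpha>); so the
  reciprocal grows at least linearly.\<close>

lemma tmom_alpha_bound:
  assumes t: "0 \<le> t" shows "t * tmom \<alpha> t \<le> 1 / psi0 \<alpha>"
proof (cases "tmom \<alpha> t = 0 \<or> t = 0")
  case True
  then show ?thesis using psi0_pos[OF \<alpha>] by auto
next
  case False
  then have t: "0 < t" and pos: "0 < tmom \<alpha> t" using t tmom_nonneg[of \<alpha> t] by auto
  have posx: "0 < tmom \<alpha> x" if "0 \<le> x" "x \<le> t" for x
    using tmom_antimono[of \<alpha> x t] pos that \<alpha> by simp
  have d: "((\<lambda>x. 1 / tmom \<alpha> x) has_real_derivative psi0 \<alpha> * tmom (2 * \<alpha>) x / (tmom \<alpha> x)\<^sup>2) (at x)"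
    if "0 < x" "x < t" for x
    using tmom_deriv[of \<alpha> x] posx[of x] that \<alpha>
    by (auto intro!: derivative_eq_intros simp: power2_eq_square)
  have "\<exists>l z. 0 < z \<and> z < t \<and> ((\<lambda>x. 1 / tmom \<alpha> x) has_real_derivative l) (at z) \<and> 1 / tmom \<alpha> t - 1 / tmom \<alpha> 0 = (t - 0) * l"
  proof (rule MVT[OF t])
    have "continuous_on {0..t} (tmom \<alpha>)" using tmom_continuous[of \<alpha>] \<alpha> by (auto intro: continuous_on_subset)
    then show "continuous_on {0..t} (\<lambda>x. 1 / tmom \<alpha> x)"
      using posx by (intro continuous_intros) force+
  qed (use d real_differentiable_def in blast)
  then obtain l z where z: "0 < z" "z < t" "((\<lambda>x. 1 / tmom \<alpha> x) has_real_derivative l) (at z)"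
    and l: "1 / tmom \<alpha> t - 1 / tmom \<alpha> 0 = (t - 0) * l" by blast
  have "l = psi0 \<alpha> * tmom (2 * \<alpha>) z / (tmom \<alpha> z)\<^sup>2" using DERIV_unique[OF z(3) d[OF z(1,2)]] .
  moreover have "1 \<le> tmom (2 * \<alpha>) z / (tmom \<alpha> z)\<^sup>2"
    using tmom_square_le[of \<alpha> z] posx[of z] z \<alpha> by simp
  ultimately have "psi0 \<alpha> * 1 \<le> l"
    using mult_left_mono[of 1 "tmom (2 * \<alpha>) z / (tmom \<alpha> z)\<^sup>2" "psi0 \<alpha>"] psi0_pos[OF \<alpha>] by simp
  then have "t * psi0 \<alpha> \<le> t * l" using t by simp
  also have "\<dots> \<le> 1 / tmom \<alpha> t" using l \<alpha> by (simp add: tmom_at_0)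
  finally show ?thesis using pos psi0_pos[OF \<alpha>] by (simp add: field_simps)
qed

text \<open>Each induction step uses \<open>tmom_diff_bounds\<close> between s = t k / (k + 1) and
  t: the interval has length t / (k + 1), and replacing t^k by s^k costs only (1 + 1/k)^k \<le> e.
  So one step contributes the factor e (k + 1) / psi0(\<alpha>).\<close>

lemma tmom_bound_le:
  assumes k: "1 \<le> k" and t: "0 \<le> t"
  shows "t ^ k * tmom (real k * \<alpha>) t \<le> fact k * (exp 1 / psi0 \<alpha>) ^ k"
  using k t
proof (induction k arbitrary: t rule: dec_induct)
  case base
  have "1 / psi0 \<alpha> \<le> exp 1 / psi0 \<alpha>" using psi0_pos[OF \<alpha>] by (intro divide_right_mono) auto
  then show ?case using tmom_alpha_bound[OF base] by simp
next
  case (step k)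
  define c where "c = psi0 \<alpha>"
  have c: "0 < c" unfolding c_def by (rule psi0_pos[OF \<alpha>])
  show ?case
  proof (cases "t = 0")
    case True
    then show ?thesis using c by (simp add: c_def)
  next
    case False
    then have t: "0 < t" using step.prems by simp
    define K' where "K' = real k"
    have K': "1 \<le> K'" using step.hyps by (simp add: K'_def)
    define s where "s = t * (K' / (K' + 1))"
    have s: "0 \<le> s" "s \<le> t" "t - s = t / (K' + 1)" using t K' by (auto simp: s_def field_simps)
    have pk: "0 \<le> K' * \<alpha>" using \<alpha> K' by simp
    have eq: "K' * \<alpha> + \<alpha> = real (Suc k) * \<alpha>" by (simp add: K'_def algebra_simps)
    have "c * (t / (K' + 1) * tmom (real (Suc k) * \<alpha>) t) \<le> psi0 (K' * \<alpha>) * (t / (K' + 1) * tmom (real (Suc k) * \<alpha>) t)"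
      unfolding c_def using \<alpha> K' t by (intro mult_right_mono psi0_mono mult_nonneg_nonneg tmom_nonneg) auto
    also have "\<dots> \<le> tmom (K' * \<alpha>) s - tmom (K' * \<alpha>) t"
      using tmom_diff_bounds(1)[OF pk s(1,2)] unfolding s(3) eq .
    also have "\<dots> \<le> tmom (K' * \<alpha>) s" using tmom_nonneg by simp
    finally have "t * tmom (real (Suc k) * \<alpha>) t \<le> (K' + 1) / c * tmom (K' * \<alpha>) s"
      using c K' by (simp add: field_simps)
    then have "t ^ k * (t * tmom (real (Suc k) * \<alpha>) t) \<le> t ^ k * ((K' + 1) / c * tmom (K' * \<alpha>) s)"
      using t by (intro mult_left_mono) auto
    also have "t ^ k * ((K' + 1) / c * tmom (K' * \<alpha>) s)
        = (((K' + 1) / K') ^ k * (K' + 1) / c) * (s ^ k * tmom (K' * \<alpha>) s)"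
    proof -
      have "((K' + 1) / K') ^ k * s ^ k = t ^ k"
        using K' t by (simp add: s_def power_mult_distrib[symmetric])
      then have "(((K' + 1) / K') ^ k * (K' + 1) / c) * (s ^ k * tmom (K' * \<alpha>) s)
          = t ^ k * ((K' + 1) / c * tmom (K' * \<alpha>) s)" by (metis (no_types, lifting) mult.assoc mult.commute times_divide_eq_left)
      then show ?thesis by (rule sym)
    qed
    also have "\<dots> \<le> (exp 1 * (K' + 1) / c) * (fact k * (exp 1 / c) ^ k)"
    proof (rule mult_mono[OF divide_right_mono[OF mult_right_mono]])
      have "((K' + 1) / K') ^ k = (1 + 1 / real k) ^ k" using K' by (simp add: K'_def add_divide_distrib)
      also have "\<dots> \<le> exp 1" using exp_ge_one_plus_x_over_n_power_n[of k 1] step.hyps by simp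
      finally show "((K' + 1) / K') ^ k \<le> exp 1" .
      show "s ^ k * tmom (K' * \<alpha>) s \<le> fact k * (exp 1 / c) ^ k"
        using step.IH[OF s(1)] by (simp add: K'_def c_def)
    qed (use c K' s in \<open>auto intro!: mult_nonneg_nonneg tmom_nonneg\<close>)
    also have "\<dots> = fact (Suc k) * (exp 1 / c) ^ Suc k" by (simp add: K'_def algebra_simps)
    finally show ?thesis by (simp add: c_def mult_ac)
  qed
qed

end

text \<open>A monotone-density argument: c G n is caught between the difference quotients of F n on
  the two sides of x. For fixed h these converge with n, and h is taken so small that both limits
  lie within \<delta> of D.\<close>

lemma difference_quotient_squeeze:
  fixes F G :: "nat \<Rightarrow> real \<Rightarrow> real" and Fl :: "real \<Rightarrow> real"
  assumes x: "0 < x" and c: "0 < c"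
    and lim: "\<And>y. 0 < y \<Longrightarrow> (\<lambda>n. F n y) \<longlonglongrightarrow> Fl y"
    and deriv: "(Fl has_real_derivative - D) (at x)"
    and up: "\<And>n h. 0 < h \<Longrightarrow> h < x \<Longrightarrow> c * (h * G n x) \<le> F n (x - h) - F n x"
    and lo: "\<And>n h. 0 < h \<Longrightarrow> F n x - F n (x + h) \<le> c * (h * G n x)"
  shows "(\<lambda>n. G n x) \<longlonglongrightarrow> D / c"
proof (rule LIMSEQ_I)
  fix \<epsilon> :: real assume \<epsilon>: "0 < \<epsilon>"
  define \<delta> where "\<delta> = c * \<epsilon> / 2"
  have \<delta>: "0 < \<delta>" using c \<epsilon> by (simp add: \<delta>_def)
  have "((\<lambda>h. (Fl (x + h) - Fl x) / h) \<longlongrightarrow> - D) (at 0)"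
    using deriv by (simp add: DERIV_def)
  from LIM_D[OF this \<delta>] obtain s where s: "0 < s"
    and sd: "\<And>h. h \<noteq> 0 \<Longrightarrow> \<bar>h\<bar> < s \<Longrightarrow> \<bar>(Fl (x + h) - Fl x) / h + D\<bar> < \<delta>" by auto
  define h where "h = min s x / 2"
  have h: "0 < h" "h < x" "\<bar>h\<bar> < s" using s x by (auto simp: h_def)
  have "(\<lambda>n. (F n (x - h) - F n x) / h) \<longlonglongrightarrow> (Fl (x - h) - Fl x) / h"
    using h x by (intro tendsto_intros lim) auto
  moreover have "(Fl (x - h) - Fl x) / h < D + \<delta>"
    using sd[of "- h"] h by (auto simp: abs_less_iff minus_divide_right[symmetric] simp del: minus_divide_right)
  ultimately have "\<forall>\<^sub>F n in sequentially. (F n (x - h) - F n x) / h < D + \<delta>" by (rule order_tendstoD)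
  moreover have "(\<lambda>n. (F n x - F n (x + h)) / h) \<longlonglongrightarrow> (Fl x - Fl (x + h)) / h"
    using h x by (intro tendsto_intros lim) auto
  then have "\<forall>\<^sub>F n in sequentially. D - \<delta> < (F n x - F n (x + h)) / h"
  proof (rule order_tendstoD)
    have "(Fl x - Fl (x + h)) / h = - ((Fl (x + h) - Fl x) / h)" using h by (simp add: field_simps)
    then show "D - \<delta> < (Fl x - Fl (x + h)) / h" using sd[of h] h unfolding abs_less_iff by linarith
  qed
  ultimately have "\<forall>\<^sub>F n in sequentially. \<bar>G n x - D / c\<bar> < \<epsilon>"
  proof eventually_elim
    case (elim n)
    have "c * G n x \<le> (F n (x - h) - F n x) / h" using up[OF h(1,2), of n] h by (simp add: field_simps)
    moreover have "(F n x - F n (x + h)) / h \<le> c * G n x" using lo[OF h(1), of n] h by (simp add: field_simps)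
    ultimately have "\<bar>c * G n x - D\<bar> < c * \<epsilon>" using elim \<delta> unfolding \<delta>_def by linarith
    moreover have "\<bar>c * G n x - D\<bar> = c * \<bar>G n x - D / c\<bar>"
    proof -
      have "c * G n x - D = c * (G n x - D / c)" using c by (simp add: field_simps)
      then show ?thesis using c by (simp add: abs_mult)
    qed
    ultimately show ?case using c by simp
  qed
  then show "\<exists>no. \<forall>n\<ge>no. norm (G n x - D / c) < \<epsilon>" by (simp add: eventually_sequentially)
qed

lemma LIMSEQ_if_subseq:
  fixes X :: "nat \<Rightarrow> 'a::metric_space"
  assumes "\<And>\<phi> :: nat \<Rightarrow> nat. strict_mono \<phi> \<Longrightarrow> \<exists>\<psi>. strict_mono \<psi> \<and> (\<lambda>n. X (\<phi> (\<psi> n))) \<longlonglongrightarrow> L"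
  shows "X \<longlonglongrightarrow> L"
proof (rule tendstoI, rule ccontr)
  fix \<epsilon> :: real assume \<epsilon>: "0 < \<epsilon>" and "\<not> (\<forall>\<^sub>F n in sequentially. dist (X n) L < \<epsilon>)"
  from not_eventually_sequentiallyD[OF this(2)] obtain \<phi> :: "nat \<Rightarrow> nat"
    where \<phi>: "strict_mono \<phi>" "\<And>n. \<not> dist (X (\<phi> n)) L < \<epsilon>" by blast
  obtain \<psi> where "(\<lambda>n. X (\<phi> (\<psi> n))) \<longlonglongrightarrow> L" using assms[OF \<phi>(1)] by blast
  from tendstoD[OF this \<epsilon>] have "\<forall>\<^sub>F n in sequentially. False" by eventually_elim (use \<phi> in auto)
  then show False by simp
qed

section \<open>Negative moments, slow variation and convergence of the means\<close>

context tagged_fragment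
begin

text \<open>For a negative order finiteness of the full sum is not known beforehand, so
  \<open>forward (- p)\<close>, which solves the recursion with equality, is shown to dominate the
  moments of every finite number of generations. It grows at most like t^(p/\<alpha>), because
  interpolation between the orders 0 and \<alpha> bounds the moment of order \<alpha> - p by a
  multiple of s^(-\<theta>) with \<theta> = 1 - p/\<alpha>.\<close>

lemma negative_moment_bound:
  assumes p: "0 < p" "p < \<alpha>" and int: "integrable K (\<lambda>z. z powr (- p))"
  obtains C where "0 \<le> C" "\<And>t. 1 \<le> t \<Longrightarrow> (SUP n. mom n (- p) t) \<le> ennreal (C * t powr (p / \<alpha>))"
proof -
  have q: "0 \<le> - p + \<alpha>" using p by simp
  have "(\<integral>z. 1 \<partial>K) \<le> (\<integral>z. z powr (- p) \<partial>K)"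
  proof (rule integral_mono_AE)
    show "AE z in K. 1 \<le> z powr (- p)"
      using K_unit
    proof eventually_elim
      case (elim z)
      then have "z powr 0 \<le> z powr (- p)" using p by (intro powr_mono') auto
      then show ?case using elim by simp
    qed
  qed (use int in auto)
  \<comment> \<open>For negative orders the sign of \<open>psi0\<close> is reversed, which makes
    \<open>forward (- p)\<close> at least 1.\<close>
  then have psi: "psi0 (- p) \<le> 0" by (simp add: psi0_def prob_space)
  have ig0: "0 \<le> integral {0..t} (tmom (- p + \<alpha>))" for t
    using q by (intro integral_nonneg tmom_integrable_on tmom_nonneg)
  have fwd1: "1 \<le> forward (- p) t" for t
    using mult_nonpos_nonneg[OF psi ig0] by (simp add: forward_def)
  have mom_le: "mom n (- p) t \<le> ennreal (forward (- p) t)" if "0 \<le> t" for n t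
    using that
  proof (induction n arbitrary: t)
    case 0
    then show ?case by (simp add: mom_0)
  next
    case (Suc n)
    have step0: "0 \<le> step (- p) (forward (- p)) y" for y
      unfolding step_def by (intro integral_nonneg_AE AE_I2 mult_nonneg_nonneg order_trans[OF zero_le_one fwd1]) auto
    have "mom (Suc n) (- p) t \<le> ennreal (exp (- t)) * (1 + (\<integral>\<^sup>+y. ennreal (exp y * step (- p) (forward (- p)) y) * indicator {0..t} y \<partial>lborel))"
      unfolding mom_Suc[OF Suc.prems]
    proof (intro mult_left_mono add_left_mono nn_integral_mono)
      fix y
      show "ennreal (exp y) * (\<integral>\<^sup>+z. ennreal (z powr (- p)) * mom n (- p) (z powr \<alpha> * y) \<partial>K) * indicator {0..t} y
          \<le> ennreal (exp y * step (- p) (forward (- p)) y) * indicator {0..t} y"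
      proof (cases "y \<in> {0..t}")
        case True
        have "(\<integral>\<^sup>+z. ennreal (z powr (- p)) * mom n (- p) (z powr \<alpha> * y) \<partial>K)
            \<le> (\<integral>\<^sup>+z. ennreal (z powr (- p) * forward (- p) (z powr \<alpha> * y)) \<partial>K)"
          using True fwd1
          by (intro nn_integral_mono) (auto simp: ennreal_mult order_trans[OF zero_le_one] intro!: mult_left_mono Suc.IH)
        also have "\<dots> = ennreal (step (- p) (forward (- p)) y)"
          unfolding step_def using True fwd1
          by (intro nn_integral_eq_integral forward_step(1) q int) (auto simp: order_trans[OF zero_le_one])
        finally show ?thesis using True step0 by (auto simp: ennreal_mult intro!: mult_left_mono)
      qed auto
    qed auto
    also have "(\<integral>\<^sup>+y. ennreal (exp y * step (- p) (forward (- p)) y) * indicator {0..t} y \<partial>lborel) = ennreal (exp t * forward (- p) t - 1)"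
      using step0 by (intro nn_integral_has_integral_lebesgue' forward_solves[OF q int Suc.prems]) auto
    also have "ennreal (exp (- t)) * (1 + ennreal (exp t * forward (- p) t - 1)) = ennreal (forward (- p) t)"
    proof -
      have "1 * 1 \<le> exp t * forward (- p) t" using Suc.prems fwd1 by (intro mult_mono) auto
      then have "1 + ennreal (exp t * forward (- p) t - 1) = ennreal (exp t * forward (- p) t)"
        by (subst ennreal_1[symmetric], subst ennreal_plus[symmetric]) auto
      then show ?thesis using fwd1[of t] by (simp add: exp_minus flip: ennreal_mult)
    qed
    finally show ?case .
  qed
  define \<theta> where "\<theta> = 1 - p / \<alpha>"
  have \<theta>: "0 < \<theta>" "\<theta> < 1" using p by (auto simp: \<theta>_def)
  define D where "D = 1 + 1 / psi0 \<alpha>"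
  have D: "0 \<le> D" using psi0_pos[OF \<alpha>] by (simp add: D_def)
  have tb: "tmom (- p + \<alpha>) s \<le> D * s powr (- \<theta>)" if s: "0 < s" for s
  proof -
    interpret L: prob_space "law s" using s by (intro prob_space_law) auto
    have i: "integrable (law s) (\<lambda>y. y powr \<alpha>)" "(\<integral>y. y powr \<alpha> \<partial>law s) = tmom \<alpha> s"
      using law_powr_integrable[of \<alpha> s] s \<alpha> by auto
    have "tmom (- p + \<alpha>) s = (\<integral>y. y powr (- p + \<alpha>) \<partial>law s)"
      using law_powr_integrable(2)[of "- p + \<alpha>" s] s q by simp
    also have "\<dots> \<le> (\<integral>y. s powr (- \<theta>) + y powr \<alpha> * s powr (1 - \<theta>) \<partial>law s)"
    proof (rule integral_mono_AE)
      show "AE y in law s. y powr (- p + \<alpha>) \<le> s powr (- \<theta>) + y powr \<alpha> * s powr (1 - \<theta>)"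
        using law_pos[of s]
      proof eventually_elim
        case (elim y)
        have eq: "y powr (- p + \<alpha>) = (y powr \<alpha>) powr \<theta>"
          using \<alpha> by (simp add: powr_powr \<theta>_def algebra_simps)
        define x where "x = y powr \<alpha>"
        have x: "0 < x" using elim by (simp add: x_def)
        \<comment> \<open>The split is at x = 1/s, the scale of y^\<alpha> under
          \<open>law s\<close>: below it x^\<theta> is monotone, above it x^(\<theta> - 1) is
          decreasing.\<close>
        show ?case unfolding eq x_def[symmetric]
        proof (cases "x \<le> 1 / s")
          case True
          have "x powr \<theta> \<le> (1 / s) powr \<theta>" using True x \<theta> by (intro powr_mono2) auto
          also have "\<dots> = s powr (- \<theta>)" using s by (simp add: powr_divide powr_minus field_simps)
          finally show "x powr \<theta> \<le> s powr (- \<theta>) + x * s powr (1 - \<theta>)" using x by (simp add: add_increasing2)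
        next
          case False
          have "x powr \<theta> = x * x powr (\<theta> - 1)" using x by (simp add: powr_diff)
          also have "x powr (\<theta> - 1) \<le> (1 / s) powr (\<theta> - 1)" using False x \<theta> s by (intro powr_mono2') auto
          also have "(1 / s) powr (\<theta> - 1) = s powr (1 - \<theta>)" using s by (simp add: powr_divide powr_diff)
          finally show "x powr \<theta> \<le> s powr (- \<theta>) + x * s powr (1 - \<theta>)" using x by (simp add: add_increasing)
        qed
      qed
    qed (use i law_powr_integrable(1)[of "- p + \<alpha>" s] s q in auto)
    also have "\<dots> = s powr (- \<theta>) + tmom \<alpha> s * s powr (1 - \<theta>)" using i by (simp add: L.prob_space)
    also have "tmom \<alpha> s * s powr (1 - \<theta>) = (s * tmom \<alpha> s) * s powr (- \<theta>)"
      using s by (simp add: powr_diff powr_minus field_simps)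
    also have "\<dots> \<le> 1 / psi0 \<alpha> * s powr (- \<theta>)" using tmom_alpha_bound[of s] s by (intro mult_right_mono) auto
    finally show ?thesis by (simp add: D_def distrib_right)
  qed
  have ib: "integral {0..t} (tmom (- p + \<alpha>)) \<le> D * (t powr (1 - \<theta>) / (1 - \<theta>))" if t: "0 \<le> t" for t
  proof -
    have "((\<lambda>s. D * s powr (- \<theta>)) has_integral D * (t powr (- \<theta> + 1) / (- \<theta> + 1))) {0..t}"
      using \<theta> t by (intro has_integral_mult_right has_integral_powr_from_0) auto
    from has_integral_spike_finite[OF _ _ this, of "{0}" "\<lambda>s. if s = 0 then tmom (- p + \<alpha>) 0 else D * s powr (- \<theta>)"]
    have "((\<lambda>s. if s = 0 then tmom (- p + \<alpha>) 0 else D * s powr (- \<theta>)) has_integral D * (t powr (- \<theta> + 1) / (- \<theta> + 1))) {0..t}"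
      by auto
    from has_integral_le[OF integrable_integral[OF tmom_integrable_on[OF q]] this] tb show ?thesis
      by (auto simp: add.commute)
  qed
  define C where "C = 1 + - psi0 (- p) * (D / (1 - \<theta>))"
  have "(SUP n. mom n (- p) t) \<le> ennreal (C * t powr (p / \<alpha>))" if t: "1 \<le> t" for t
  proof -
    have "(SUP n. mom n (- p) t) \<le> ennreal (forward (- p) t)" using mom_le t by (intro SUP_least) auto
    also have "forward (- p) t \<le> C * t powr (p / \<alpha>)"
    proof -
      have "- psi0 (- p) * integral {0..t} (tmom (- p + \<alpha>)) \<le> - psi0 (- p) * (D * (t powr (1 - \<theta>) / (1 - \<theta>)))"
        using psi t by (intro mult_left_mono ib) auto
      moreover have "1 \<le> t powr (1 - \<theta>)" using t \<theta> by (intro ge_one_powr_ge_zero) auto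
      moreover have "C * t powr (1 - \<theta>) = t powr (1 - \<theta>) + - psi0 (- p) * (D * (t powr (1 - \<theta>) / (1 - \<theta>)))"
        unfolding C_def by (simp add: distrib_right left_diff_distrib)
      ultimately have "forward (- p) t \<le> C * t powr (1 - \<theta>)" unfolding forward_def by linarith
      then show ?thesis by (simp add: \<theta>_def)
    qed
    finally show ?thesis by (simp add: ennreal_leI)
  qed
  moreover have "0 \<le> C" unfolding C_def using psi D \<theta> by (intro add_nonneg_nonneg mult_nonneg_nonneg divide_nonneg_nonneg) auto
  ultimately show ?thesis using that by blast
qed

text \<open>Equating the backward and the forward derivative of the moment of order \<alpha> shows
  that averaging changes Q(t) = t m(\<alpha>)(t) by - psi0(\<alpha>) t m(2\<alpha>)(t), which is
  O(1/t). The bounds on the moments of order \<alpha> and 2\<alpha> give |Q'(x)| \<le> C / x. So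
  \<open>slowly_varying\<close> applies with the law of Z^\<alpha>.\<close>

lemma tmom_slowly_varying:
  "((\<lambda>t. exp h * t * tmom \<alpha> (exp h * t) - t * tmom \<alpha> t) \<longlongrightarrow> 0) at_top"
proof -
  \<comment> \<open>The cut at 0 makes Q bounded on the whole line.\<close>
  define Q where "Q t = max 0 t * tmom \<alpha> t" for t
  define c where "c = psi0 \<alpha>"
  have c: "0 < c" unfolding c_def by (rule psi0_pos[OF \<alpha>])
  define C2 where "C2 = fact 2 * (exp 1 / c) ^ 2"
  have b2: "t\<^sup>2 * tmom (2 * \<alpha>) t \<le> C2" if "0 \<le> t" for t
    using tmom_bound_le[of 2 t] that by (simp add: C2_def c_def)
  have [measurable]: "(\<lambda>z. z powr \<alpha>) \<in> measurable K borel" by measurable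
  interpret MK: multiplicative_kernel "distr K borel (\<lambda>z. z powr \<alpha>)"
  proof (intro multiplicative_kernel.intro multiplicative_kernel_axioms.intro prob_space_distr)
    show "AE w in distr K borel (\<lambda>z. z powr \<alpha>). 0 < w"
      using K_unit by (subst AE_distr_iff) (auto elim!: eventually_mono)
  qed auto
  have Qm[measurable]: "Q \<in> borel_measurable borel" unfolding Q_def by measurable
  have QB: "\<bar>Q t\<bar> \<le> 1 / c" for t
  proof (cases "0 \<le> t")
    case True
    then show ?thesis using tmom_alpha_bound[of t] tmom_nonneg[of \<alpha> t] by (simp add: Q_def c_def)
  next
    case False
    then show ?thesis using c by (simp add: Q_def)
  qed
  have avg: "MK.avg Q t = (\<integral>z. Q (z powr \<alpha> * t) \<partial>K)" for t
    unfolding MK.avg_def by (subst integral_distr) auto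
  have harm_eq: "MK.avg Q t - Q t = - c * (t * tmom (2 * \<alpha>) t)" if t: "0 < t" for t
  proof -
    have "(tmom \<alpha> has_real_derivative (step \<alpha> (tmom \<alpha>) t - tmom \<alpha> t)) (at t within {0..t + 1})"
      using \<alpha> t by (intro tmom_deriv_backward) auto
    moreover have "at t within {0..t + 1} = at t" using t by (intro at_within_interior) auto
    ultimately have "step \<alpha> (tmom \<alpha>) t - tmom \<alpha> t = - c * tmom (2 * \<alpha>) t"
      using DERIV_unique[OF _ tmom_deriv[of \<alpha> t]] \<alpha> t by (simp add: c_def)
    moreover have "MK.avg Q t = t * step \<alpha> (tmom \<alpha>) t"
      unfolding avg step_def using t
      by (subst integral_mult_right_zero[symmetric], intro Bochner_Integration.integral_cong refl) (simp add: Q_def max_def mult_le_0_iff)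
    moreover have "Q t = t * tmom \<alpha> t" using t by (simp add: Q_def)
    ultimately have "MK.avg Q t - Q t = t * (- c * tmom (2 * \<alpha>) t)" by (metis right_diff_distrib)
    then show ?thesis by simp
  qed
  have harm: "((\<lambda>t. MK.avg Q t - Q t) \<longlongrightarrow> 0) at_top"
  proof (rule Lim_null_comparison)
    show "\<forall>\<^sub>F t in at_top. norm (MK.avg Q t - Q t) \<le> c * C2 * inverse t"
      using eventually_gt_at_top[of 0]
    proof eventually_elim
      case (elim t)
      have "t * tmom (2 * \<alpha>) t \<le> C2 * inverse t"
        using b2[of t] elim by (simp add: field_simps power2_eq_square)
      then show ?case unfolding harm_eq[OF elim] using elim c tmom_nonneg[of "2 * \<alpha>" t] by (simp add: abs_mult mult.assoc)
    qed
    show "((\<lambda>t. c * C2 * inverse t) \<longlongrightarrow> 0) at_top"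
      by (intro tendsto_mult_right_zero tendsto_inverse_0_at_top filterlim_ident)
  qed
  define C where "C = 1 / c + c * C2"
  have dQ: "\<exists>y. ((\<lambda>x. x * tmom \<alpha> x) has_real_derivative y) (at x) \<and> \<bar>y\<bar> \<le> C / x" if x: "0 < x" for x
  proof (intro exI conjI)
    show "((\<lambda>x. x * tmom \<alpha> x) has_real_derivative (tmom \<alpha> x + - c * tmom (2 * \<alpha>) x * x)) (at x)"
      using tmom_deriv[of \<alpha> x] x \<alpha> by (auto intro!: derivative_eq_intros simp: c_def)
    have "x * tmom \<alpha> x \<le> 1 / c" using tmom_alpha_bound[of x] x by (simp add: c_def)
    then have "tmom \<alpha> x \<le> 1 / c / x" using x by (simp only: pos_le_divide_eq mult.commute)
    moreover have "c * (tmom (2 * \<alpha>) x * x) \<le> c * (C2 / x)"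
      using b2[of x] x c by (intro mult_left_mono) (auto simp: field_simps power2_eq_square)
    moreover have "0 \<le> c * (tmom (2 * \<alpha>) x * x)" using c x by (simp add: tmom_nonneg)
    moreover have "C / x = 1 / c / x + c * (C2 / x)" by (simp add: C_def add_divide_distrib)
    ultimately show "\<bar>tmom \<alpha> x + - c * tmom (2 * \<alpha>) x * x\<bar> \<le> C / x"
      using tmom_nonneg[of \<alpha> x] by (simp add: abs_le_iff mult.assoc)
  qed
  have lip: "\<bar>Q t - Q s\<bar> \<le> C * ln (t / s)" if st: "1 \<le> s" "s \<le> t" for s t
  proof -
    have "t * tmom \<alpha> t - C * ln t \<le> s * tmom \<alpha> s - C * ln s"
    proof (rule DERIV_nonpos_imp_nonincreasing[OF st(2)])
      fix x assume x: "s \<le> x" "x \<le> t"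
      obtain y where y: "((\<lambda>x. x * tmom \<alpha> x) has_real_derivative y) (at x)" "\<bar>y\<bar> \<le> C / x" using dQ[of x] x st by auto
      have "((\<lambda>x. C * ln x) has_real_derivative C * (1 / x)) (at x)"
        using x st by (auto intro!: derivative_eq_intros)
      from DERIV_diff[OF y(1) this]
      have "((\<lambda>x. x * tmom \<alpha> x - C * ln x) has_real_derivative y - C * (1 / x)) (at x)" .
      then show "\<exists>y. ((\<lambda>x. x * tmom \<alpha> x - C * ln x) has_real_derivative y) (at x) \<and> y \<le> 0"
        using y(2) by (intro exI[of _ "y - C * (1 / x)"]) auto
    qed
    moreover have "s * tmom \<alpha> s + C * ln s \<le> t * tmom \<alpha> t + C * ln t"
    proof (rule DERIV_nonneg_imp_nondecreasing[OF st(2)])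
      fix x assume x: "s \<le> x" "x \<le> t"
      obtain y where y: "((\<lambda>x. x * tmom \<alpha> x) has_real_derivative y) (at x)" "\<bar>y\<bar> \<le> C / x" using dQ[of x] x st by auto
      have "((\<lambda>x. C * ln x) has_real_derivative C * (1 / x)) (at x)"
        using x st by (auto intro!: derivative_eq_intros)
      from DERIV_add[OF y(1) this]
      have "((\<lambda>x. x * tmom \<alpha> x + C * ln x) has_real_derivative y + C * (1 / x)) (at x)" .
      then show "\<exists>y. ((\<lambda>x. x * tmom \<alpha> x + C * ln x) has_real_derivative y) (at x) \<and> 0 \<le> y"
        using y(2) by (intro exI[of _ "y + C * (1 / x)"]) auto
    qed
    moreover have "C * ln (t / s) = C * ln t - C * ln s" using st by (simp add: ln_div right_diff_distrib)
    ultimately show ?thesis using st by (simp add: Q_def)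
  qed
  have na: "\<not> (AE w in distr K borel (\<lambda>z. z powr \<alpha>). \<exists>k::int. ln w = d * k)" if d: "0 < d" for d :: real
  proof
    assume "AE w in distr K borel (\<lambda>z. z powr \<alpha>). \<exists>k::int. ln w = d * k"
    then have "AE z in K. \<exists>k::int. ln (z powr \<alpha>) = d * k"
      by (subst (asm) AE_distr_iff) measurable
    with K_unit have "AE z in K. \<exists>k::nat. z = exp (- (d / \<alpha>)) ^ k"
    proof eventually_elim
      case (elim z)
      then obtain k :: int where k: "\<alpha> * ln z = d * k" by (auto simp: ln_powr)
      \<comment> \<open>Since z \<le> 1, the integer k is nonpositive, and the lattice becomes the
        geometric sequence of exp(-d/\<alpha>) with natural exponents.\<close>
      have "\<alpha> * ln z \<le> 0" using elim \<alpha> by (intro mult_nonneg_nonpos) auto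
      then have k0: "k \<le> 0" using k d by (simp add: mult_le_0_iff)
      have "z = exp (ln z)" using elim by simp
      also have "ln z = real (nat (- k)) * (- (d / \<alpha>))" using k k0 \<alpha> by (simp add: field_simps)
      also have "exp \<dots> = exp (- (d / \<alpha>)) ^ nat (- k)" by (rule exp_of_nat_mult)
      finally show ?case by blast
    qed
    then show False using nonarith d \<alpha> by (auto dest!: spec[of _ "exp (- (d / \<alpha>))"])
  qed
  have "((\<lambda>t. Q (exp h * t) - Q t) \<longlongrightarrow> 0) at_top"
    by (rule MK.slowly_varying[OF Qm QB harm lip _ na]) auto
  then show ?thesis
  proof (rule Lim_transform_eventually)
    show "\<forall>\<^sub>F t in at_top. Q (exp h * t) - Q t = exp h * t * tmom \<alpha> (exp h * t) - t * tmom \<alpha> t"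
      using eventually_gt_at_top[of 0] by eventually_elim (simp add: Q_def)
  qed
qed

text \<open>The moments of \<rho> up to their common factor, normalised to 1 at k = 1. The recursion
  \<open>rho_moment_Suc\<close> is the one that the forward equation imposes on limits of rescaled
  moments.\<close>

definition rho_moment :: "nat \<Rightarrow> real" where
  "rho_moment k = fact (k - 1) * (\<Prod>j=1..k - 1. 1 / psi0 (\<alpha> * real j))"

lemma rho_moment_Suc:
  assumes "1 \<le> k"
  shows "rho_moment (Suc k) = real k * rho_moment k / psi0 (real k * \<alpha>)"
proof -
  obtain m where m: "k = Suc m" using assms by (cases k) auto
  show ?thesis unfolding rho_moment_def m by (simp add: mult_ac del: of_nat_Suc)
qed

lemma rho_moment_bounds:
  assumes "1 \<le> k"
  shows "0 \<le> rho_moment k" and "rho_moment k \<le> fact k * (1 / psi0 \<alpha>) ^ (k - 1)"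
proof -
  have "0 \<le> rho_moment k \<and> rho_moment k \<le> fact k * (1 / psi0 \<alpha>) ^ (k - 1)"
    using assms
  proof (induction k rule: dec_induct)
    case base
    then show ?case by (simp add: rho_moment_def)
  next
    case (step k)
    have pk: "psi0 \<alpha> \<le> psi0 (real k * \<alpha>)" using step.hyps \<alpha> by (intro psi0_mono) auto
    have pos: "0 < psi0 \<alpha>" by (rule psi0_pos[OF \<alpha>])
    have "real k * rho_moment k / psi0 (real k * \<alpha>) \<le> real (Suc k) * (fact k * (1 / psi0 \<alpha>) ^ (k - 1)) / psi0 \<alpha>"
      using step pk pos by (intro frac_le mult_mono) auto
    also have "\<dots> = fact (Suc k) * (1 / psi0 \<alpha>) ^ (Suc k - 1)"
      using step.hyps by (cases k) auto
    finally show ?case using step pk pos by (simp add: rho_moment_Suc)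
  qed
  then show "0 \<le> rho_moment k" "rho_moment k \<le> fact k * (1 / psi0 \<alpha>) ^ (k - 1)" by auto
qed

text \<open>For k = 1, slow variation carries the convergence from x = 1 to every x > 0. The
  variable x drives the induction: differentiating the limit q rho_k / x^k in x gives k q rho_k /
  x^(k+1) up to sign, and the forward equation divides this by psi0(k \<alpha>).\<close>

lemma tmom_scaled_limits:
  fixes T :: "nat \<Rightarrow> real"
  assumes T: "filterlim T at_top sequentially" and Tpos: "\<And>n. 0 < T n"
    and q: "(\<lambda>n. T n * tmom \<alpha> (T n)) \<longlonglongrightarrow> q" and k: "1 \<le> k" and x: "0 < x"
  shows "(\<lambda>n. T n ^ k * tmom (real k * \<alpha>) (x * T n)) \<longlonglongrightarrow> q * rho_moment k / x ^ k"
  using k x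
proof (induction k arbitrary: x rule: dec_induct)
  case base
  have "(\<lambda>n. exp (ln x) * T n * tmom \<alpha> (exp (ln x) * T n) - T n * tmom \<alpha> (T n)) \<longlonglongrightarrow> 0"
    by (rule filterlim_compose[OF tmom_slowly_varying T])
  from tendsto_divide[OF tendsto_add[OF this q] tendsto_const, of x]
  show ?case using base by (simp add: rho_moment_def mult.assoc)
next
  case (step k)
  define Fl where "Fl y = q * rho_moment k / y ^ k" for y
  define c where "c = psi0 (real k * \<alpha>)"
  have c: "0 < c" unfolding c_def using step.hyps \<alpha> by (intro psi0_pos) auto
  have k\<alpha>: "0 \<le> real k * \<alpha>" using \<alpha> by simp
  have eq: "real k * \<alpha> + \<alpha> = real (Suc k) * \<alpha>" by (simp add: algebra_simps)
  have "(\<lambda>n. T n ^ Suc k * tmom (real (Suc k) * \<alpha>) (x * T n)) \<longlonglongrightarrow> real k * q * rho_moment k / x ^ Suc k / c"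
  proof (rule difference_quotient_squeeze[where F = "\<lambda>n y. T n ^ k * tmom (real k * \<alpha>) (y * T n)" and Fl = Fl
        and G = "\<lambda>n x. T n ^ Suc k * tmom (real (Suc k) * \<alpha>) (x * T n)"])
    show "(\<lambda>n. T n ^ k * tmom (real k * \<alpha>) (y * T n)) \<longlonglongrightarrow> Fl y" if "0 < y" for y
      unfolding Fl_def by (rule step.IH[OF that])
    show "(Fl has_real_derivative - (real k * q * rho_moment k / x ^ Suc k)) (at x)"
    proof -
      obtain m where m: "k = Suc m" using step.hyps by (cases k) auto
      have "(Fl has_real_derivative - (q * rho_moment k * (real k * x ^ (k - Suc 0)) / (x ^ k * x ^ k))) (at x)"
        unfolding Fl_def using step.prems by (auto intro!: derivative_eq_intros)
      moreover have "q * rho_moment k * (real k * x ^ (k - Suc 0)) / (x ^ k * x ^ k) = real k * q * rho_moment k / x ^ Suc k"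
        using step.prems by (simp add: m field_simps)
      ultimately show ?thesis by simp
    qed
    fix n :: nat and h :: real assume h: "0 < h"
    have T0: "0 \<le> T n ^ k" using Tpos[of n] by simp
    have "tmom (real k * \<alpha>) (x * T n) - tmom (real k * \<alpha>) ((x + h) * T n) \<le>
        c * (((x + h) * T n - x * T n) * tmom (real (Suc k) * \<alpha>) (x * T n))"
      unfolding c_def eq[symmetric] using Tpos[of n] h step.prems by (intro tmom_diff_bounds(2) k\<alpha>) auto
    from mult_left_mono[OF this T0]
    show "T n ^ k * tmom (real k * \<alpha>) (x * T n) - T n ^ k * tmom (real k * \<alpha>) ((x + h) * T n)
        \<le> c * (h * (T n ^ Suc k * tmom (real (Suc k) * \<alpha>) (x * T n)))"
      by (simp add: algebra_simps)
    assume hx: "h < x"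
    have "c * ((x * T n - (x - h) * T n) * tmom (real (Suc k) * \<alpha>) (x * T n)) \<le>
      tmom (real k * \<alpha>) ((x - h) * T n) - tmom (real k * \<alpha>) (x * T n)"
      unfolding c_def eq[symmetric] using Tpos[of n] h hx step.prems by (intro tmom_diff_bounds(1) k\<alpha>) auto
    from mult_left_mono[OF this T0]
    show "c * (h * (T n ^ Suc k * tmom (real (Suc k) * \<alpha>) (x * T n)))
      \<le> T n ^ k * tmom (real k * \<alpha>) ((x - h) * T n) - T n ^ k * tmom (real k * \<alpha>) (x * T n)"
      by (simp add: algebra_simps)
  qed (use c step.prems in auto)
  then show ?case using step.hyps by (simp add: rho_moment_Suc c_def field_simps)
qed

text \<open>The variables V = (r Y)^\<alpha>, with Y of law \<open>law (T n)\<close>, have integer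
  moments tending to q / c0 times those of the image of \<rho> under x -> x^\<alpha>. The moment
  theorem therefore applies with c = q / c0, and f(r Y) is a function of V.\<close>

lemma weak_limit_of_means:
  fixes T r :: "nat \<Rightarrow> real" and \<rho> :: "real measure" and f :: "real \<Rightarrow> real"
  assumes \<rho>: "prob_space \<rho>" and sets_\<rho>: "sets \<rho> = sets (restrict_space borel {0<..})"
    and mom\<rho>: "\<And>k. 1 \<le> k \<Longrightarrow> has_bochner_integral \<rho> (\<lambda>x. x powr (real k * \<alpha>)) (c0 * rho_moment k)"
    and p: "0 < p" "p < \<alpha>" and int: "integrable K (\<lambda>z. z powr (- p))"
    and fm[measurable]: "f \<in> borel_measurable borel" and fc: "continuous_on {0<..} f" and fB: "\<And>x. \<bar>f x\<bar> \<le> B"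
    and T: "filterlim T at_top sequentially" and T1: "\<And>n. 1 \<le> T n" and r0: "\<And>n. 0 < r n"
    and r: "(\<lambda>n. r n / T n powr (1 / \<alpha>)) \<longlonglongrightarrow> 1"
    and q: "(\<lambda>n. T n * tmom \<alpha> (T n)) \<longlonglongrightarrow> q"
  shows "(\<lambda>n. \<integral>y. f (r n * y) \<partial>law (T n)) \<longlonglongrightarrow> (\<integral>x. f x \<partial>\<rho>)"
proof -
  interpret \<rho>: prob_space \<rho> by fact
  have Tpos: "0 < T n" for n using T1[of n] by linarith
  have L: "prob_space (law (T n))" for n using Tpos[of n] by (intro prob_space_law) auto
  have sp\<rho>: "space \<rho> = {0<..}" using sets_eq_imp_space_eq[OF sets_\<rho>] by (simp add: space_restrict_space)
  have \<rho>m: "g \<in> borel_measurable \<rho>" if "g \<in> borel_measurable borel" for g :: "real \<Rightarrow> real"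
    using measurable_restrict_space1[OF that, of "{0<..}"] measurable_cong_sets[OF sets_\<rho> refl] by blast
  \<comment> \<open>This is the error made by replacing r^\<alpha> by T; it tends to 1 and is
    therefore bounded.\<close>
  define s where "s n = (r n / T n powr (1 / \<alpha>)) powr \<alpha>" for n
  have s_lim: "s \<longlonglongrightarrow> 1" using tendsto_powr[OF r tendsto_const, of \<alpha>] by (simp add: s_def[abs_def])
  have s0: "0 < s n" for n using r0[of n] Tpos[of n] by (simp add: s_def)
  have rs: "r n powr \<alpha> = s n * T n" for n
    using r0[of n] Tpos[of n] \<alpha> by (simp add: s_def powr_divide powr_powr)
  obtain S where S: "\<And>n. s n \<le> S"
    using Bseq_def convergent_imp_Bseq[OF convergentI[OF s_lim]] by (metis abs_le_D1 real_norm_def)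
  define c where "c = psi0 \<alpha>"
  have c: "0 < c" unfolding c_def by (rule psi0_pos[OF \<alpha>])
  \<comment> \<open>One pair (C, Kc) has to serve both the approximating laws and the limit: S'
    absorbs the factors s, and C absorbs the constant c0 c that the exponent k - 1 in the bound on
    \<open>rho_moment\<close> leaves over.\<close>
  define S' where "S' = max 1 S"
  define Kc where "Kc = S' * (exp 1 / c)"
  have S': "1 \<le> S'" "s n \<le> S'" for n using S[of n] by (auto simp: S'_def)
  have ec: "0 < 1 / c" "1 / c \<le> exp 1 / c" using c by (auto intro!: divide_right_mono)
  have Kc: "1 / c \<le> Kc" "0 < Kc"
  proof -
    have "1 * (1 / c) \<le> S' * (exp 1 / c)" using S'(1) ec by (intro mult_mono) auto
    then show "1 / c \<le> Kc" by (simp add: Kc_def)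
    then show "0 < Kc" using ec(1) by linarith
  qed
  \<comment> \<open>This constant is the moment of order \<alpha> of a law on the open half-line;
    positivity is what allows division by it.\<close>
  have c0: "0 < c0"
  proof -
    have hb: "has_bochner_integral \<rho> (\<lambda>x. x powr \<alpha>) c0" using mom\<rho>[of 1] by (simp add: rho_moment_def)
    then have i: "integrable \<rho> (\<lambda>x. x powr \<alpha>)" "(\<integral>x. x powr \<alpha> \<partial>\<rho>) = c0"
      by (auto simp: has_bochner_integral_iff)
    have "0 \<le> c0" unfolding i(2)[symmetric] by simp
    moreover have "c0 \<noteq> 0"
    proof
      assume "c0 = 0"
      then have "AE x in \<rho>. x powr \<alpha> = 0" using integral_nonneg_eq_0_iff_AE[OF i(1)] i(2) by auto
      moreover have "AE x in \<rho>. 0 < x" using sp\<rho> by (intro AE_I2) auto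
      ultimately have "AE x in \<rho>. False" by eventually_elim auto
      then show False by simp
    qed
    ultimately show ?thesis by simp
  qed
  define C where "C = max 1 (c0 * c)"
  have C: "1 \<le> C" "c0 * c \<le> C" by (auto simp: C_def)
  define \<mu> where "\<mu> n = distr (law (T n)) borel (\<lambda>y. (r n * y) powr \<alpha>)" for n
  define \<rho>' where "\<rho>' = distr \<rho> borel (\<lambda>x. x powr \<alpha>)"
  have \<rho>'m: "(\<lambda>x. x powr \<alpha>) \<in> measurable \<rho> borel" by (rule \<rho>m) measurable
  have mpow: "((r n * y) powr \<alpha>) ^ k = (s n * T n) ^ k * y powr (real k * \<alpha>)" if "0 < y" for n k y
    using that r0[of n] rs[of n] by (simp add: powr_mult power_mult_distrib powr_power mult.commute)
  have \<mu>int: "integrable (\<mu> n) (\<lambda>v. v ^ k)"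
    and \<mu>mom: "(\<integral>v. v ^ k \<partial>\<mu> n) = s n ^ k * (T n ^ k * tmom (real k * \<alpha>) (T n))" for n k
  proof -
    have k\<alpha>: "0 \<le> real k * \<alpha>" using \<alpha> by simp
    have Tn: "0 \<le> T n" using Tpos[of n] by simp
    have eq: "AE y in law (T n). (s n * T n) ^ k * y powr (real k * \<alpha>) = ((r n * y) powr \<alpha>) ^ k"
      using law_pos by eventually_elim (rule mpow[symmetric])
    have "integrable (law (T n)) (\<lambda>y. (s n * T n) ^ k * y powr (real k * \<alpha>))"
      by (intro integrable_mult_right law_powr_integrable k\<alpha> Tn)
    then have "integrable (law (T n)) (\<lambda>y. ((r n * y) powr \<alpha>) ^ k)"
      by (rule integrable_cong_AE_imp[OF _ _ eq]) measurable
    then show "integrable (\<mu> n) (\<lambda>v. v ^ k)"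
      unfolding \<mu>_def by (subst integrable_distr_eq) auto
    have "(\<integral>v. v ^ k \<partial>\<mu> n) = (\<integral>y. ((r n * y) powr \<alpha>) ^ k \<partial>law (T n))"
      unfolding \<mu>_def by (subst integral_distr) auto
    also have "\<dots> = (\<integral>y. (s n * T n) ^ k * y powr (real k * \<alpha>) \<partial>law (T n))"
      by (rule integral_cong_AE[OF _ _ eq, symmetric]) measurable
    also have "\<dots> = (s n * T n) ^ k * tmom (real k * \<alpha>) (T n)"
      using law_powr_integrable(2)[OF k\<alpha> Tn] by simp
    finally show "(\<integral>v. v ^ k \<partial>\<mu> n) = s n ^ k * (T n ^ k * tmom (real k * \<alpha>) (T n))"
      by (simp add: power_mult_distrib)
  qed
  have \<mu>em: "exponential_moments (\<mu> n) C Kc" for n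
  proof (intro exponential_moments.intro exponential_moments_axioms.intro)
    interpret L: prob_space "law (T n)" by (rule L)
    show P: "prob_space (\<mu> n)" unfolding \<mu>_def by (intro L.prob_space_distr) measurable
    show "AE v in \<mu> n. 0 \<le> v" unfolding \<mu>_def by (subst AE_distr_iff) auto
    show "(\<integral>v. v ^ k \<partial>\<mu> n) \<le> C * fact k * Kc ^ k" for k
    proof (cases "k = 0")
      case True
      then show ?thesis using C by (simp add: prob_space.prob_space[OF P])
    next
      case False
      have "s n ^ k * (T n ^ k * tmom (real k * \<alpha>) (T n)) \<le> S' ^ k * (fact k * (exp 1 / c) ^ k)"
      proof (rule mult_mono)
        show "s n ^ k \<le> S' ^ k" using S'(2) s0[of n] by (intro power_mono) auto
        show "T n ^ k * tmom (real k * \<alpha>) (T n) \<le> fact k * (exp 1 / c) ^ k"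
          unfolding c_def using False Tpos[of n] by (intro tmom_bound_le) auto
      qed (use S' Tpos[of n] in \<open>auto simp: tmom_nonneg\<close>)
      also have "\<dots> = fact k * Kc ^ k" unfolding Kc_def power_mult_distrib by (simp only: mult.left_commute)
      also have "\<dots> \<le> C * (fact k * Kc ^ k)" using mult_right_mono[OF C(1), of "fact k * Kc ^ k"] Kc(2) by simp
      finally show ?thesis unfolding \<mu>mom by (simp add: mult.assoc)
    qed
    show "sets (\<mu> n) = sets borel" by (simp add: \<mu>_def)
  qed (rule \<mu>int)
  have \<rho>pos: "AE v in \<rho>'. 0 < v"
    unfolding \<rho>'_def using \<rho>'m sp\<rho> by (subst AE_distr_iff) auto
  have \<rho>int: "integrable \<rho>' (\<lambda>v. v ^ k)"
    and \<rho>mom: "1 \<le> k \<Longrightarrow> (\<integral>v. v ^ k \<partial>\<rho>') = c0 * rho_moment k" for k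
  proof -
    have e: "(x powr \<alpha>) ^ k = x powr (real k * \<alpha>)" if "x \<in> space \<rho>" for x
      using that sp\<rho> by (simp add: powr_power mult.commute)
    have "integrable \<rho> (\<lambda>x. x powr (real k * \<alpha>))"
    proof (cases "k = 0")
      case False
      then show ?thesis using mom\<rho>[of k] by (auto simp: has_bochner_integral_iff)
    next
      case True
      have "integrable \<rho> (\<lambda>x. 1 :: real)" by simp
      then show ?thesis by (rule Bochner_Integration.integrable_cong[THEN iffD1, rotated 2]) (use True sp\<rho> in auto)
    qed
    then have i: "integrable \<rho> (\<lambda>x. (x powr \<alpha>) ^ k)"
      using e by (subst Bochner_Integration.integrable_cong[OF refl e]) auto
    then show "integrable \<rho>' (\<lambda>v. v ^ k)"
      unfolding \<rho>'_def using \<rho>'m by (subst integrable_distr_eq) auto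
    assume k: "1 \<le> k"
    have "(\<integral>v. v ^ k \<partial>\<rho>') = (\<integral>x. (x powr \<alpha>) ^ k \<partial>\<rho>)"
      unfolding \<rho>'_def using \<rho>'m by (subst integral_distr) auto
    also have "\<dots> = (\<integral>x. x powr (real k * \<alpha>) \<partial>\<rho>)" by (intro Bochner_Integration.integral_cong refl e)
    also have "\<dots> = c0 * rho_moment k" using mom\<rho>[OF k] by (simp add: has_bochner_integral_iff)
    finally show "(\<integral>v. v ^ k \<partial>\<rho>') = c0 * rho_moment k" .
  qed
  have \<rho>em: "exponential_moments \<rho>' C Kc"
  proof (intro exponential_moments.intro exponential_moments_axioms.intro)
    show P: "prob_space \<rho>'" unfolding \<rho>'_def by (intro \<rho>.prob_space_distr \<rho>'m)
    show "(\<integral>v. v ^ k \<partial>\<rho>') \<le> C * fact k * Kc ^ k" for k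
    proof (cases "k = 0")
      case True
      then show ?thesis using C by (simp add: prob_space.prob_space[OF P])
    next
      case False
      have "c0 * rho_moment k \<le> c0 * (fact k * (1 / c) ^ (k - 1))"
        using rho_moment_bounds(2)[of k] False c0 by (simp add: c_def)
      also have "\<dots> = c0 * c * (fact k * (1 / c) ^ k)" using False c by (cases k) auto
      also have "\<dots> \<le> C * (fact k * Kc ^ k)"
      proof (rule mult_mono[OF C(2)])
        show "fact k * (1 / c) ^ k \<le> fact k * Kc ^ k" using Kc ec by (intro mult_left_mono power_mono) auto
      qed (use C c in auto)
      finally show ?thesis using \<rho>mom[of k] False by (simp add: mult.assoc)
    qed
    show "sets \<rho>' = sets borel" by (simp add: \<rho>'_def)
    show "AE v in \<rho>'. 0 \<le> v" using \<rho>pos by eventually_elim simp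
  qed (rule \<rho>int)
  \<comment> \<open>The growth T^(p/\<alpha>) of the negative moment is cancelled by the factor
    r^(-p). In terms of V the exponent is p/\<alpha>, which is below 1 as the moment theorem
    demands.\<close>
  obtain D where D: "0 \<le> D" "\<And>t. 1 \<le> t \<Longrightarrow> (SUP n. mom n (- p) t) \<le> ennreal (D * t powr (p / \<alpha>))"
    using negative_moment_bound[OF p int] by blast
  define s' where "s' n = (r n / T n powr (1 / \<alpha>)) powr (- p)" for n
  have "s' \<longlonglongrightarrow> 1" using tendsto_powr[OF r tendsto_const, of "- p"] by (simp add: s'_def[abs_def])
  then obtain S2 where S2: "\<And>n. s' n \<le> S2"
    using Bseq_def convergent_imp_Bseq[OF convergentI] by (metis abs_le_D1 real_norm_def)
  have neg: "(\<integral>\<^sup>+v. ennreal (v powr (- (p / \<alpha>))) \<partial>\<mu> n) \<le> ennreal (D * S2)" for n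
  proof -
    have "(\<integral>\<^sup>+v. ennreal (v powr (- (p / \<alpha>))) \<partial>\<mu> n) = (\<integral>\<^sup>+y. ennreal (((r n * y) powr \<alpha>) powr (- (p / \<alpha>))) \<partial>law (T n))"
      unfolding \<mu>_def by (subst nn_integral_distr) measurable
    also have "\<dots> = (\<integral>\<^sup>+y. ennreal (r n powr (- p)) * ennreal (y powr (- p)) \<partial>law (T n))"
    proof (rule nn_integral_cong_AE)
      show "AE y in law (T n). ennreal (((r n * y) powr \<alpha>) powr (- (p / \<alpha>))) = ennreal (r n powr (- p)) * ennreal (y powr (- p))"
        using law_pos
      proof eventually_elim
        case (elim y)
        have "((r n * y) powr \<alpha>) powr (- (p / \<alpha>)) = r n powr (- p) * y powr (- p)"
          using elim r0[of n] \<alpha> by (simp add: powr_powr powr_mult)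
        then show ?case by (simp add: ennreal_mult)
      qed
    qed
    also have "\<dots> = ennreal (r n powr (- p)) * (SUP m. mom m (- p) (T n))"
      using law_moments[of "T n" "- p"] Tpos[of n] by (subst nn_integral_cmult) auto
    also have "\<dots> \<le> ennreal (r n powr (- p)) * ennreal (D * T n powr (p / \<alpha>))"
      by (intro mult_left_mono D T1) auto
    also have "\<dots> = ennreal (D * s' n)"
    proof -
      have eq: "r n powr (- p) * (D * T n powr (p / \<alpha>)) = D * s' n"
        using r0[of n] Tpos[of n] by (simp add: s'_def powr_divide powr_powr powr_minus field_simps)
      show ?thesis unfolding eq[symmetric] using D(1) by (simp add: ennreal_mult)
    qed
    also have "\<dots> \<le> ennreal (D * S2)" using S2 D by (intro ennreal_leI mult_left_mono) auto
    finally show ?thesis .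
  qed
  have conv: "(\<lambda>n. \<integral>v. v ^ k \<partial>\<mu> n) \<longlonglongrightarrow> q / c0 * (\<integral>v. v ^ k \<partial>\<rho>')" if k: "1 \<le> k" for k
  proof -
    have "(\<lambda>n. s n ^ k * (T n ^ k * tmom (real k * \<alpha>) (1 * T n))) \<longlonglongrightarrow> 1 ^ k * (q * rho_moment k / 1 ^ k)"
      by (intro tendsto_mult tendsto_power s_lim tmom_scaled_limits T Tpos q k) auto
    then show ?thesis using c0 \<rho>mom[OF k] by (simp add: \<mu>mom)
  qed
  have \<mu>pos: "AE v in \<mu> n. 0 < v" for n
    unfolding \<mu>_def using law_pos[of "T n"] r0[of n] by (subst AE_distr_iff) (auto elim!: eventually_mono)
  have weak: "weak_conv_m \<mu> \<rho>'"
    by (rule moments_imp_weak_conv(2)[OF \<mu>em \<rho>em Kc(2) conv \<mu>pos \<rho>pos _ _ neg]) (use p \<alpha> in auto)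
  interpret \<rho>': exponential_moments \<rho>' C Kc by (rule \<rho>em)
  have rd\<rho>: "real_distribution \<rho>'"
    by unfold_locales (auto simp: \<rho>'_def)
  have rd\<mu>: "real_distribution (\<mu> n)" for n
  proof -
    interpret m: exponential_moments "\<mu> n" C Kc by (rule \<mu>em)
    show ?thesis by unfold_locales (auto simp: \<mu>_def)
  qed
  \<comment> \<open>The zero extension of v -> f(v^(1/\<alpha>)) can be discontinuous at 0 only, and
    0 is a null point of the limit law.\<close>
  define g where "g v = (if 0 < v then f (v powr (1 / \<alpha>)) else 0)" for v
  have gm[measurable]: "g \<in> borel_measurable borel" unfolding g_def by measurable
  have "(\<lambda>n. \<integral>v. g v \<partial>\<mu> n) \<longlonglongrightarrow> (\<integral>v. g v \<partial>\<rho>')"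
  proof (rule weak_conv_imp_bdd_ae_continuous_conv[OF rd\<mu> rd\<rho> weak])
    have cont: "isCont g v" if "v \<noteq> 0" for v
    proof (cases "0 < v")
      case True
      have "isCont f (v powr (1 / \<alpha>))" using fc True by (simp add: continuous_on_eq_continuous_at)
      then have "isCont (\<lambda>v. f (v powr (1 / \<alpha>))) v"
      proof (rule isCont_o2[rotated])
        show "isCont (\<lambda>v. v powr (1 / \<alpha>)) v"
          using True by (intro continuous_at_within_powr continuous_ident continuous_const) auto
      qed
      moreover have "\<forall>\<^sub>F x in nhds v. x \<in> {0<..}" using True by (intro eventually_nhds_in_open) auto
      then have "\<forall>\<^sub>F x in nhds v. g x = f (x powr (1 / \<alpha>))" by eventually_elim (simp add: g_def)
      ultimately show ?thesis by (simp add: isCont_cong)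
    next
      case False
      then have "\<forall>\<^sub>F x in nhds v. x \<in> {..<0}" using that by (intro eventually_nhds_in_open) auto
      then have "\<forall>\<^sub>F x in nhds v. g x = 0" by eventually_elim (simp add: g_def)
      from isCont_cong[OF this] show ?thesis by simp
    qed
    have "emeasure \<rho>' {x. \<not> isCont g x} \<le> emeasure \<rho>' {0}"
      using cont by (intro emeasure_mono) (auto simp: \<rho>'_def)
    also have "emeasure \<rho>' {0} = 0"
      using \<rho>pos by (subst AE_iff_measurable[symmetric, where P = "\<lambda>v. v \<noteq> 0"]) (auto simp: \<rho>'_def elim!: eventually_mono)
    finally show "emeasure \<rho>' {x. \<not> isCont g x} = 0" by simp
    show "norm (g v) \<le> B" for v using fB[of 0] fB[of "v powr (1 / \<alpha>)"] by (auto simp: g_def)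
  qed (rule gm)
  moreover have "(\<integral>v. g v \<partial>\<mu> n) = (\<integral>y. f (r n * y) \<partial>law (T n))" for n
  proof -
    have "(\<integral>v. g v \<partial>\<mu> n) = (\<integral>y. g ((r n * y) powr \<alpha>) \<partial>law (T n))"
      unfolding \<mu>_def by (subst integral_distr) auto
    also have "\<dots> = (\<integral>y. f (r n * y) \<partial>law (T n))"
    proof (rule integral_cong_AE)
      show "AE y in law (T n). g ((r n * y) powr \<alpha>) = f (r n * y)"
        using law_pos by eventually_elim (use r0[of n] \<alpha> in \<open>simp add: g_def powr_powr\<close>)
    qed measurable
    finally show ?thesis .
  qed
  moreover have "(\<integral>v. g v \<partial>\<rho>') = (\<integral>x. f x \<partial>\<rho>)"
  proof -
    have "(\<integral>v. g v \<partial>\<rho>') = (\<integral>x. g (x powr \<alpha>) \<partial>\<rho>)"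
      unfolding \<rho>'_def using \<rho>'m by (subst integral_distr) auto
    also have "\<dots> = (\<integral>x. f x \<partial>\<rho>)"
      using sp\<rho> \<alpha> by (intro Bochner_Integration.integral_cong) (auto simp: g_def powr_powr)
    finally show ?thesis .
  qed
  ultimately show ?thesis by simp
qed

text \<open>The values T m(\<alpha>)(T) lie in a compact interval, so every subsequence has a
  further one along which they converge, and \<open>weak_limit_of_means\<close> gives the same limit
  of the means on each of these.\<close>

theorem means_converge:
  fixes T r :: "nat \<Rightarrow> real" and \<rho> :: "real measure" and f :: "real \<Rightarrow> real"
  assumes \<rho>: "prob_space \<rho>" "sets \<rho> = sets (restrict_space borel {0<..})"
      "\<And>k. 1 \<le> k \<Longrightarrow> has_bochner_integral \<rho> (\<lambda>x. x powr (real k * \<alpha>)) (c0 * rho_moment k)"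
    and p: "0 < p" "p < \<alpha>" "integrable K (\<lambda>z. z powr (- p))"
    and f: "f \<in> borel_measurable borel" "continuous_on {0<..} f" "\<And>x. \<bar>f x\<bar> \<le> B"
    and T: "filterlim T at_top sequentially"
    and r: "(\<lambda>n. r n / T n powr (1 / \<alpha>)) \<longlonglongrightarrow> 1"
  shows "(\<lambda>n. \<integral>y. f (r n * y) \<partial>law (T n)) \<longlonglongrightarrow> (\<integral>x. f x \<partial>\<rho>)"
proof -
  have "\<forall>\<^sub>F n in sequentially. 1 \<le> T n" using T by (simp add: filterlim_at_top)
  moreover have "\<forall>\<^sub>F n in sequentially. 0 < r n / T n powr (1 / \<alpha>)"
    by (rule order_tendstoD(1)[OF r]) simp
  ultimately have "\<forall>\<^sub>F n in sequentially. 1 \<le> T n \<and> 0 < r n"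
    by eventually_elim (auto simp: zero_less_divide_iff)
  then obtain N where N: "\<And>n. N \<le> n \<Longrightarrow> 1 \<le> T n \<and> 0 < r n" by (auto simp: eventually_sequentially)
  have "(\<lambda>n. \<integral>y. f (r (n + N) * y) \<partial>law (T (n + N))) \<longlonglongrightarrow> (\<integral>x. f x \<partial>\<rho>)"
  proof (rule LIMSEQ_if_subseq)
    fix \<phi> :: "nat \<Rightarrow> nat" assume \<phi>: "strict_mono \<phi>"
    define Q where "Q n = T (\<phi> n + N) * tmom \<alpha> (T (\<phi> n + N))" for n
    have "Q n \<in> {0..1 / psi0 \<alpha>}" for n
      using N[of "\<phi> n + N"] tmom_alpha_bound[of "T (\<phi> n + N)"] by (auto simp: Q_def tmom_nonneg)
    moreover have "seq_compact {0..1 / psi0 \<alpha>}" by (simp add: compact_imp_seq_compact)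
    ultimately obtain q \<psi> where \<psi>: "strict_mono \<psi>" "(Q \<circ> \<psi>) \<longlonglongrightarrow> q" unfolding seq_compact_def by blast
    have sub: "filterlim (\<lambda>n. \<phi> (\<psi> n) + N) at_top sequentially"
      using strict_mono_compose[OF \<phi> \<psi>(1)]
      by (intro filterlim_subseq[of "\<lambda>n. \<phi> (\<psi> n) + N"]) (auto simp: strict_mono_def)
    have "(\<lambda>n. \<integral>y. f (r (\<phi> (\<psi> n) + N) * y) \<partial>law (T (\<phi> (\<psi> n) + N))) \<longlonglongrightarrow> (\<integral>x. f x \<partial>\<rho>)"
    proof (rule weak_limit_of_means[OF \<rho> p f])
      show "filterlim (\<lambda>n. T (\<phi> (\<psi> n) + N)) at_top sequentially" by (rule filterlim_compose[OF T sub])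
      show "(\<lambda>n. r (\<phi> (\<psi> n) + N) / T (\<phi> (\<psi> n) + N) powr (1 / \<alpha>)) \<longlonglongrightarrow> 1" by (rule filterlim_compose[OF r sub])
      show "(\<lambda>n. T (\<phi> (\<psi> n) + N) * tmom \<alpha> (T (\<phi> (\<psi> n) + N))) \<longlonglongrightarrow> q" using \<psi>(2) by (simp add: Q_def comp_def)
    qed (use N in auto)
    then show "\<exists>\<psi>. strict_mono \<psi> \<and> (\<lambda>n. \<integral>y. f (r (\<phi> (\<psi> n) + N) * y) \<partial>law (T (\<phi> (\<psi> n) + N))) \<longlonglongrightarrow> (\<integral>x. f x \<partial>\<rho>)"
      using \<psi>(1) by blast
  qed
  then show ?thesis by (rule LIMSEQ_offset)
qed

end

subsection \<open>The law of the marked tree\<close>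

type_synonym mark = "(nat \<Rightarrow> real) \<times> real"

abbreviation mark_space :: "mark measure" where
  "mark_space \<equiv> seq_space \<Otimes>\<^sub>M borel"

definition mark_law :: "(nat \<Rightarrow> real) measure \<Rightarrow> mark measure" where
  "mark_law \<nu> = \<nu> \<Otimes>\<^sub>M density lborel (exponential_density 1)"

definition tree_law :: "(nat \<Rightarrow> real) measure \<Rightarrow> (node \<Rightarrow> mark) measure" where
  "tree_law \<nu> = Pi\<^sub>M UNIV (\<lambda>_. mark_law \<nu>)"

text \<open>Nodes are stored with the first step from the root at the end of the list; the
  descendants of child i of the root, that child included, are the nodes
  \<open>w @ [i]\<close>.\<close>

definition subtree :: "nat \<Rightarrow> (node \<Rightarrow> 'm) \<Rightarrow> node \<Rightarrow> 'm" where
  "subtree i \<theta> w = \<theta> (w @ [i])"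

lemma PiM_coordinates_indep:
  fixes N :: "'m measure"
  assumes N: "prob_space N"
  shows "prob_space.indep_vars (Pi\<^sub>M (UNIV :: 'i set) (\<lambda>_. N)) (\<lambda>_. N) (\<lambda>v \<theta>. \<theta> v) UNIV"
proof -
  interpret prob_space "Pi\<^sub>M (UNIV :: 'i set) (\<lambda>_. N)" by (intro prob_space_PiM N)
  have comp: "distr (Pi\<^sub>M UNIV (\<lambda>_. N)) N (\<lambda>\<theta>. \<theta> (v :: 'i)) = N" for v
    by (rule distr_PiM_component) (use N in auto)
  have "(\<lambda>x. \<lambda>i\<in>UNIV. x i) = (\<lambda>x :: 'i \<Rightarrow> 'm. x)" by (simp add: restrict_UNIV)
  then show ?thesis
    by (subst indep_vars_iff_distr_eq_PiM') (auto simp: comp distr_id2)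
qed

text \<open>The node \<open>[]\<close> and the sets of nodes \<open>w @ [i]\<close>, one for each i,
  partition the index set. Disjoint blocks of coordinates are independent, and w ->
  \<open>w @ [i]\<close> identifies each block with the whole tree.\<close>

lemma subtree_distribution:
  fixes N :: "'m measure"
  assumes N: "prob_space N"
  defines "P \<equiv> Pi\<^sub>M (UNIV :: node set) (\<lambda>_. N)"
  shows "distr P (N \<Otimes>\<^sub>M Pi\<^sub>M UNIV (\<lambda>_::nat. P)) (\<lambda>\<theta>. (\<theta> [], \<lambda>i. subtree i \<theta>)) = N \<Otimes>\<^sub>M Pi\<^sub>M UNIV (\<lambda>_::nat. P)"
proof -
  interpret Pr: prob_space P unfolding P_def by (intro prob_space_PiM N)
  have comp: "distr P N (\<lambda>\<theta>. \<theta> v) = N" for v unfolding P_def by (rule distr_PiM_component) (use N in auto)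
  have coord[measurable]: "(\<lambda>\<theta>. \<theta> v) \<in> measurable P N" for v unfolding P_def by measurable
  have ind: "Pr.indep_vars (\<lambda>_. N) (\<lambda>v \<theta>. \<theta> v) UNIV" unfolding P_def by (rule PiM_coordinates_indep[OF N])
  have sub: "(\<lambda>f. \<lambda>w. f (w @ [i])) \<in> measurable (Pi\<^sub>M A (\<lambda>_. N)) P" if "\<And>w. w @ [i] \<in> A" for i and A :: "node set"
    unfolding P_def using that by (intro measurable_PiM_single') (auto simp: space_PiM PiE_iff)
  have subm[measurable]: "subtree i \<in> measurable P P" for i
    using sub[of i UNIV] by (simp add: P_def subtree_def[abs_def])
  have subtree_law: "distr P P (subtree i) = P" for i
  proof -
    have "distr (Pi\<^sub>M UNIV (\<lambda>_. N)) (Pi\<^sub>M UNIV (\<lambda>_. N)) (\<lambda>\<theta>. \<lambda>w\<in>UNIV. \<theta> (w @ [i])) = Pi\<^sub>M (UNIV :: node set) (\<lambda>_. N)"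
      by (rule distr_PiM_reindex) (use N in \<open>auto simp: inj_on_def\<close>)
    then show ?thesis unfolding P_def subtree_def[abs_def] restrict_UNIV .
  qed
  have indsub: "Pr.indep_vars (\<lambda>_. P) subtree UNIV"
  proof -
    have "Pr.indep_vars (\<lambda>i. Pi\<^sub>M (range (\<lambda>w. w @ [i])) (\<lambda>_. N)) (\<lambda>i \<theta>. restrict (\<lambda>v. \<theta> v) (range (\<lambda>w. w @ [i]))) UNIV"
      by (rule Pr.indep_vars_restrict[OF ind]) (auto simp: disjoint_family_on_def)
    from Pr.indep_vars_compose2[OF this, of "\<lambda>i f w. f (w @ [i])" "\<lambda>_. P"] sub
    show ?thesis by (simp add: subtree_def[abs_def])
  qed
  have sublaw: "distr P (Pi\<^sub>M UNIV (\<lambda>_::nat. P)) (\<lambda>\<theta> i. subtree i \<theta>) = Pi\<^sub>M UNIV (\<lambda>_. P)"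
    using Pr.indep_vars_iff_distr_eq_PiM'[of UNIV subtree "\<lambda>_. P"] indsub subm by (simp add: subtree_law restrict_UNIV)
  let ?S = "Pi\<^sub>M {[]} (\<lambda>_. N)" and ?T = "Pi\<^sub>M (UNIV - {[]}) (\<lambda>_::node. N)"
  let ?X = "\<lambda>\<theta>. restrict (\<lambda>v. \<theta> v) {[]}" and ?Y = "\<lambda>\<theta>. restrict (\<lambda>v. \<theta> v) (UNIV - {[]})"
  let ?f = "\<lambda>f. f []" and ?g = "\<lambda>f i w. f (w @ [i])"
  have X: "?X \<in> measurable P ?S" and Y: "?Y \<in> measurable P ?T" by measurable
  have f: "?f \<in> measurable ?S N" by (rule measurable_component_singleton) simp
  have g: "?g \<in> measurable ?T (Pi\<^sub>M UNIV (\<lambda>_::nat. P))"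
    by (intro measurable_PiM_single' sub) (auto simp: P_def space_PiM PiE_iff)
  have gY: "?g (?Y \<theta>) = (\<lambda>i. subtree i \<theta>)" for \<theta> :: "node \<Rightarrow> 'm" by (simp add: subtree_def[abs_def])
  have "Pr.indep_var ?S ?X ?T ?Y"
    by (rule Pr.indep_var_restrict[OF ind]) auto
  then have "distr P (?S \<Otimes>\<^sub>M ?T) (\<lambda>\<theta>. (?X \<theta>, ?Y \<theta>)) = distr P ?S ?X \<Otimes>\<^sub>M distr P ?T ?Y"
    by (simp add: Pr.indep_var_distribution_eq)
  then have "distr (distr P (?S \<Otimes>\<^sub>M ?T) (\<lambda>\<theta>. (?X \<theta>, ?Y \<theta>))) (N \<Otimes>\<^sub>M Pi\<^sub>M UNIV (\<lambda>_::nat. P)) (\<lambda>(x, y). (?f x, ?g y))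
      = distr (distr P ?S ?X) N ?f \<Otimes>\<^sub>M distr (distr P ?T ?Y) (Pi\<^sub>M UNIV (\<lambda>_::nat. P)) ?g"
  proof (subst pair_measure_distr)
    show "sigma_finite_measure (distr (distr P ?T ?Y) (Pi\<^sub>M UNIV (\<lambda>_::nat. P)) ?g)"
      using g Y by (intro prob_space_imp_sigma_finite prob_space.prob_space_distr Pr.prob_space_distr) auto
  qed (use f g in auto)
  also have "distr (distr P ?S ?X) N ?f = N"
    using f X comp by (subst distr_distr) (auto simp: comp_def)
  also have "distr (distr P ?T ?Y) (Pi\<^sub>M UNIV (\<lambda>_::nat. P)) ?g = Pi\<^sub>M UNIV (\<lambda>_. P)"
    using g Y sublaw by (subst distr_distr) (auto simp: comp_def subtree_def[abs_def])
  also have "distr (distr P (?S \<Otimes>\<^sub>M ?T) (\<lambda>\<theta>. (?X \<theta>, ?Y \<theta>))) (N \<Otimes>\<^sub>M Pi\<^sub>M UNIV (\<lambda>_::nat. P)) (\<lambda>(x, y). (?f x, ?g y))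
      = distr P (N \<Otimes>\<^sub>M Pi\<^sub>M UNIV (\<lambda>_::nat. P)) (\<lambda>\<theta>. (\<theta> [], \<lambda>i. subtree i \<theta>))"
  proof (subst distr_distr)
    show "(\<lambda>(x, y). (?f x, ?g y)) \<in> measurable (?S \<Otimes>\<^sub>M ?T) (N \<Otimes>\<^sub>M Pi\<^sub>M UNIV (\<lambda>_::nat. P))"
      unfolding split_beta'
      by (rule measurable_Pair[OF measurable_compose[OF measurable_fst f] measurable_compose[OF measurable_snd g]])
  qed (use X Y in \<open>auto simp: comp_def subtree_def[abs_def]\<close>)
  finally show ?thesis .
qed

context offspring_and_lifetimes
begin

lemma sets_mark_law [measurable_cong]: "sets (mark_law \<nu>) = sets mark_space"
  unfolding mark_law_def by (intro sets_pair_measure_cong) (auto simp: reproduction.sets_law)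

lemma lifetime_measurable [measurable]: "e v \<in> borel_measurable M"
  using lifetime_law[of v] by (simp add: distributed_def)

lemma offspring_measurable' [measurable]: "\<eta> v \<in> measurable M seq_space"
  by (rule offspring_measurable)

text \<open>The event factorises in two stages: independence of the generated sigma-algebras
  separates ratios from lifetimes, and then each family splits over the nodes.\<close>

lemma prob_offspring_lifetime:
  assumes J: "finite J" and A: "\<And>v. v \<in> J \<Longrightarrow> A v \<in> sets seq_space" and B: "\<And>v. v \<in> J \<Longrightarrow> B v \<in> sets borel"
  shows "prob {\<omega> \<in> space M. \<forall>v\<in>J. \<eta> v \<omega> \<in> A v \<and> e v \<omega> \<in> B v} = (\<Prod>v\<in>J. prob (\<eta> v -` A v \<inter> space M) * prob (e v -` B v \<inter> space M))"
proof (cases "J = {}")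
  case True
  then show ?thesis by (simp add: prob_space)
next
  case False
  let ?a = "{\<omega> \<in> space M. \<forall>v\<in>J. \<eta> v \<omega> \<in> A v}" and ?b = "{\<omega> \<in> space M. \<forall>v\<in>J. e v \<omega> \<in> B v}"
  have "?a \<in> sets (vimage_algebra (space M) (\<lambda>\<omega> v. \<eta> v \<omega>) (Pi\<^sub>M UNIV (\<lambda>_. seq_space)))"
  proof -
    have "{f \<in> space (Pi\<^sub>M UNIV (\<lambda>_. seq_space)). \<forall>v\<in>J. f v \<in> A v} \<in> sets (Pi\<^sub>M UNIV (\<lambda>_. seq_space))"
      using J A by measurable
    from in_vimage_algebra[OF this, of "\<lambda>\<omega> v. \<eta> v \<omega>" "space M"] show ?thesis
      by (rule back_subst[of "\<lambda>x. x \<in> _"]) (auto simp: space_PiM)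
  qed
  moreover have "?b \<in> sets (vimage_algebra (space M) (\<lambda>\<omega> v. e v \<omega>) (Pi\<^sub>M UNIV (\<lambda>_. borel)))"
  proof -
    have "{f \<in> space (Pi\<^sub>M UNIV (\<lambda>_. borel)). \<forall>v\<in>J. f v \<in> B v} \<in> sets (Pi\<^sub>M UNIV (\<lambda>_. borel))"
      using J B by measurable
    from in_vimage_algebra[OF this, of "\<lambda>\<omega> v. e v \<omega>" "space M"] show ?thesis
      by (rule back_subst[of "\<lambda>x. x \<in> _"]) (auto simp: space_PiM)
  qed
  ultimately have "prob (?a \<inter> ?b) = prob ?a * prob ?b"
    by (rule indep_setD[OF offspring_lifetime_indep])
  moreover have "?a \<inter> ?b = {\<omega> \<in> space M. \<forall>v\<in>J. \<eta> v \<omega> \<in> A v \<and> e v \<omega> \<in> B v}" by auto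
  moreover have "prob ?a = (\<Prod>v\<in>J. prob (\<eta> v -` A v \<inter> space M))"
  proof -
    have "?a = (\<Inter>v\<in>J. \<eta> v -` A v \<inter> space M)" using False by auto
    then show ?thesis using indep_varsD[OF offspring_indep False J, of A] A by simp
  qed
  moreover have "prob ?b = (\<Prod>v\<in>J. prob (e v -` B v \<inter> space M))"
  proof -
    have "?b = (\<Inter>v\<in>J. e v -` B v \<inter> space M)" using False by auto
    then show ?thesis using indep_varsD[OF lifetime_indep False J, of B] B by simp
  qed
  ultimately show ?thesis by (simp add: prod.distrib)
qed

text \<open>Rectangles are an intersection-stable generator of the mark space, so the factorisation
  of \<open>prob_offspring_lifetime\<close> suffices.\<close>

lemma indep_marks: "indep_vars (\<lambda>_. mark_space) (\<lambda>v \<omega>. (\<eta> v \<omega>, e v \<omega>)) UNIV"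
proof -
  define X where "X v \<omega> = (\<eta> v \<omega>, e v \<omega>)" for v \<omega>
  have X[measurable]: "X v \<in> measurable M mark_space" for v unfolding X_def by measurable
  define R where "R = {A \<times> B | A B. A \<in> sets seq_space \<and> B \<in> sets (borel :: real measure)}"
  have R: "sets mark_space = sigma_sets (space mark_space) R"
    unfolding R_def sets_pair_measure space_pair_measure by simp
  define G where "G v = {X v -` C \<inter> space M | C. C \<in> R}" for v
  have stable: "Int_stable (G v)" for v
  proof (rule Int_stableI)
    fix a b assume "a \<in> G v" "b \<in> G v"
    then obtain A B A' B' where ab: "a = X v -` (A \<times> B) \<inter> space M" "b = X v -` (A' \<times> B') \<inter> space M"
      "A \<in> sets seq_space" "B \<in> sets borel" "A' \<in> sets seq_space" "B' \<in> sets borel"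
      by (auto simp: G_def R_def)
    have "a \<inter> b = X v -` ((A \<inter> A') \<times> (B \<inter> B')) \<inter> space M" using ab(1,2) by auto
    moreover have "(A \<inter> A') \<times> (B \<inter> B') \<in> R" using ab(3-6) unfolding R_def by blast
    ultimately show "a \<inter> b \<in> G v" unfolding G_def by blast
  qed
  have "indep_sets G UNIV"
  proof (rule indep_setsI)
    show "G v \<subseteq> events" for v by (auto simp: G_def R_def intro!: measurable_sets[OF X])
    fix C J assume J: "J \<noteq> {}" "J \<subseteq> (UNIV :: node set)" "finite J" "\<forall>v\<in>J. C v \<in> G v"
    then have "\<forall>v\<in>J. \<exists>A B. C v = X v -` (A \<times> B) \<inter> space M \<and> A \<in> sets seq_space \<and> B \<in> sets borel"
      by (auto simp: G_def R_def)
    then obtain A B where AB: "\<And>v. v \<in> J \<Longrightarrow> C v = X v -` (A v \<times> B v) \<inter> space M"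
      "\<And>v. v \<in> J \<Longrightarrow> A v \<in> sets seq_space" "\<And>v. v \<in> J \<Longrightarrow> B v \<in> sets borel" by metis
    have "(\<Inter>v\<in>J. C v) = {\<omega> \<in> space M. \<forall>v\<in>J. \<eta> v \<omega> \<in> A v \<and> e v \<omega> \<in> B v}"
      using J(1) AB(1) by (auto simp: X_def)
    then have "prob (\<Inter>v\<in>J. C v) = (\<Prod>v\<in>J. prob (\<eta> v -` A v \<inter> space M) * prob (e v -` B v \<inter> space M))"
      using prob_offspring_lifetime[OF J(3) AB(2,3)] by simp
    also have "\<dots> = (\<Prod>v\<in>J. prob (C v))"
    proof (rule prod.cong[OF refl])
      fix v assume v: "v \<in> J"
      have "C v = {\<omega> \<in> space M. \<forall>v\<in>{v}. \<eta> v \<omega> \<in> A v \<and> e v \<omega> \<in> B v}" using AB(1)[OF v] by (auto simp: X_def)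
      then show "prob (\<eta> v -` A v \<inter> space M) * prob (e v -` B v \<inter> space M) = prob (C v)"
        using prob_offspring_lifetime[of "{v}" A B] AB(2,3)[OF v] by simp
    qed
    finally show "prob (\<Inter>v\<in>J. C v) = (\<Prod>v\<in>J. prob (C v))" .
  qed
  then have "indep_sets (\<lambda>v. sigma_sets (space M) (G v)) UNIV" by (rule indep_sets_sigma) (rule stable)
  moreover have "{X v -` C \<inter> space M | C. C \<in> sets mark_space} = sigma_sets (space M) (G v)" for v
    unfolding R G_def by (rule sigma_sets_vimage_commute) (use measurable_space[OF X] in auto)
  ultimately have "indep_vars (\<lambda>_. mark_space) X UNIV"
    unfolding indep_vars_def2 by (auto simp: sigma_sets_sigma_sets_eq[unfolded sigma_sets_sigma_sets_eq] intro: X)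
  then show ?thesis unfolding X_def .
qed

lemma mark_distribution: "distr M mark_space (\<lambda>\<omega>. (\<eta> v \<omega>, e v \<omega>)) = mark_law \<nu>"
proof -
  have E: "distr M borel (e v) = density lborel (exponential_density 1)"
    using distributed_distr_eq_density[OF lifetime_law[of v]] distr_cong[of M M borel lborel "e v" "e v"] by simp
  interpret V: prob_space "distr M seq_space (\<eta> v)" by (rule prob_space_distr) measurable
  interpret E: prob_space "distr M borel (e v)" by (rule prob_space_distr) measurable
  have "distr M seq_space (\<eta> v) \<Otimes>\<^sub>M distr M borel (e v) = distr M mark_space (\<lambda>\<omega>. (\<eta> v \<omega>, e v \<omega>))"
  proof (rule pair_measure_eqI)
    fix A B assume "A \<in> sets (distr M seq_space (\<eta> v))" "B \<in> sets (distr M borel (e v))"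
    then have AB: "A \<in> sets seq_space" "B \<in> sets borel" by auto
    have "emeasure (distr M mark_space (\<lambda>\<omega>. (\<eta> v \<omega>, e v \<omega>))) (A \<times> B) = emeasure M {\<omega> \<in> space M. \<forall>v\<in>{v}. \<eta> v \<omega> \<in> A \<and> e v \<omega> \<in> B}"
      using AB by (subst emeasure_distr) (auto intro!: arg_cong[where f = "emeasure M"])
    also have "\<dots> = ennreal (prob (\<eta> v -` A \<inter> space M) * prob (e v -` B \<inter> space M))"
      using prob_offspring_lifetime[of "{v}" "\<lambda>_. A" "\<lambda>_. B"] AB by (simp add: emeasure_eq_measure)
    also have "\<dots> = emeasure (distr M seq_space (\<eta> v)) A * emeasure (distr M borel (e v)) B"
      using AB by (simp add: emeasure_distr emeasure_eq_measure ennreal_mult)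
    finally show "emeasure (distr M seq_space (\<eta> v)) A * emeasure (distr M borel (e v)) B
      = emeasure (distr M mark_space (\<lambda>\<omega>. (\<eta> v \<omega>, e v \<omega>))) (A \<times> B)" by simp
  qed (auto intro!: V.sigma_finite_measure_axioms E.sigma_finite_measure_axioms cong: sets_pair_measure_cong)
  then show ?thesis unfolding E by (simp add: offspring_law mark_law_def)
qed

text \<open>Identifies the law of the marks with the canonical product measure, so that expectations
  can be computed on a space where the subtrees are themselves points of the space.\<close>

theorem tree_distribution:
  "distr M (tree_law \<nu>) (\<lambda>\<omega> v. (\<eta> v \<omega>, e v \<omega>)) = tree_law \<nu>"
proof -
  have "distr M (Pi\<^sub>M UNIV (\<lambda>_. mark_space)) (\<lambda>\<omega>. \<lambda>v\<in>UNIV. (\<eta> v \<omega>, e v \<omega>))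
      = Pi\<^sub>M UNIV (\<lambda>v. distr M mark_space (\<lambda>\<omega>. (\<eta> v \<omega>, e v \<omega>)))"
    using indep_vars_iff_distr_eq_PiM'[of UNIV "\<lambda>v \<omega>. (\<eta> v \<omega>, e v \<omega>)" "\<lambda>_. mark_space"] indep_marks by simp
  moreover have "sets (tree_law \<nu>) = sets (Pi\<^sub>M UNIV (\<lambda>_. mark_space))"
    unfolding tree_law_def by (intro sets_PiM_cong refl sets_mark_law)
  ultimately show ?thesis
    using distr_cong[of M M "tree_law \<nu>" "Pi\<^sub>M UNIV (\<lambda>_. mark_space)" "\<lambda>\<omega> v. (\<eta> v \<omega>, e v \<omega>)" "\<lambda>\<omega> v. (\<eta> v \<omega>, e v \<omega>)"]
    by (simp add: mark_distribution tree_law_def restrict_UNIV)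
qed

end

subsection \<open>Sums over the particles of a marked tree\<close>

text \<open>Together with \<open>life\<close> this gives the coordinates of a marked tree in the
  shape expected by \<open>node_size\<close> and \<open>birth_time\<close>, with the tree itself as
  the sample point.\<close>

definition ratio :: "node \<Rightarrow> (node \<Rightarrow> mark) \<Rightarrow> nat \<Rightarrow> real" where
  "ratio v \<theta> = fst (\<theta> v)"

definition life :: "node \<Rightarrow> (node \<Rightarrow> mark) \<Rightarrow> real" where
  "life v \<theta> = snd (\<theta> v)"

text \<open>Collects the almost sure properties of the marks for all nodes at once, in a form
  inherited by subtrees, so that identities between sums can be proved pathwise.\<close>

definition good :: "(node \<Rightarrow> mark) \<Rightarrow> bool" where
  "good \<theta> \<longleftrightarrow> (\<forall>v. (\<forall>i. 0 \<le> fst (\<theta> v) i \<and> fst (\<theta> v) i \<le> 1) \<and> 0 < snd (\<theta> v))"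

lemma good_subtree: "good \<theta> \<Longrightarrow> good (subtree i \<theta>)"
  by (simp add: good_def subtree_def)

lemma node_size_snoc:
  "node_size ratio (w @ [i]) \<theta> = fst (\<theta> []) i * node_size ratio w (subtree i \<theta>)"
  by (induction w) (simp_all add: ratio_def subtree_def mult.assoc)

lemma node_size_nonneg: "good \<theta> \<Longrightarrow> 0 \<le> node_size ratio w \<theta>"
  by (induction w) (auto simp: good_def ratio_def)

lemma birth_time_nonneg: "good \<theta> \<Longrightarrow> 0 \<le> birth_time \<alpha> ratio life w \<theta>"
proof (induction w)
  case (Cons i w)
  assume "good \<theta>"
  then have "0 \<le> life w \<theta>" by (simp add: good_def life_def less_imp_le)
  then show ?case using Cons by simp
qed simp

lemma birth_time_snoc:
  assumes "good \<theta>"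
  shows "birth_time \<alpha> ratio life (w @ [i]) \<theta> = snd (\<theta> []) + fst (\<theta> []) i powr (- \<alpha>) * birth_time \<alpha> ratio life w (subtree i \<theta>)"
proof (induction w)
  case Nil
  then show ?case by (simp add: life_def)
next
  case (Cons j w)
  have "0 \<le> fst (\<theta> []) i" using assms by (simp add: good_def)
  moreover have "life (w @ [i]) \<theta> = life w (subtree i \<theta>)" by (simp add: life_def subtree_def)
  ultimately show ?case
    using Cons node_size_nonneg[OF good_subtree[OF assms], of w i]
    by (simp add: node_size_snoc powr_mult algebra_simps)
qed

text \<open>Self-similarity: after the death of the root at time e, all durations in the subtree of
  a child of ratio x carry the factor x^(-\<alpha>), so time t is time x^\<alpha> (t - e) on the
  local clock. The guard excludes children of size 0, whose times carry no meaning.\<close>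

lemma alive_snoc:
  assumes g: "good \<theta>"
  shows "w @ [i] \<in> alive \<alpha> ratio life t \<theta> \<longleftrightarrow>
    0 < fst (\<theta> []) i \<and> w \<in> alive \<alpha> ratio life (fst (\<theta> []) i powr \<alpha> * (t - snd (\<theta> []))) (subtree i \<theta>)"
proof (cases "0 < fst (\<theta> []) i")
  case True
  define x where "x = fst (\<theta> []) i"
  have x: "0 < x" "x powr (- \<alpha>) = 1 / x powr \<alpha>" using True by (auto simp: x_def powr_minus divide_inverse)
  have death: "death_time \<alpha> ratio life (w @ [i]) \<theta> = snd (\<theta> []) + x powr (- \<alpha>) * death_time \<alpha> ratio life w (subtree i \<theta>)"
    using birth_time_snoc[OF g, of \<alpha> "0 # w" i] birth_time_snoc[OF g, of \<alpha> w i]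
    unfolding death_time_def x_def by simp
  have aff: "c + 1 / a * b \<le> t \<longleftrightarrow> b \<le> a * (t - c)" "t < c + 1 / a * b \<longleftrightarrow> a * (t - c) < b" if "0 < a" for a b c :: real
    using that by (auto simp: field_simps)
  have "snd (\<theta> []) + x powr (- \<alpha>) * b \<le> t \<longleftrightarrow> b \<le> x powr \<alpha> * (t - snd (\<theta> []))" for b
    unfolding x(2) by (rule aff(1)) (use x in simp)
  moreover have "t < snd (\<theta> []) + x powr (- \<alpha>) * b \<longleftrightarrow> x powr \<alpha> * (t - snd (\<theta> [])) < b" for b
    unfolding x(2) by (rule aff(2)) (use x in simp)
  moreover have "0 < x * s \<longleftrightarrow> 0 < s" for s using x by (simp add: zero_less_mult_iff)
  ultimately show ?thesis
    using True unfolding alive_def mem_Collect_eq death birth_time_snoc[OF g] node_size_snoc x_def[symmetric] by simp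
next
  case False
  then show ?thesis
    using node_size_nonneg[OF good_subtree[OF g], of w i]
    by (auto simp: alive_def node_size_snoc zero_less_mult_iff)
qed

lemma Nil_alive: "[] \<in> alive \<alpha> ratio life t \<theta> \<longleftrightarrow> 0 \<le> t \<and> t < snd (\<theta> [])"
  by (simp add: alive_def death_time_def life_def)

lemma nn_integral_nodes:
  fixes F :: "node \<Rightarrow> ennreal"
  shows "(\<integral>\<^sup>+u. F u \<partial>count_space UNIV) = F [] + (\<Sum>i. \<integral>\<^sup>+w. F (w @ [i]) \<partial>count_space UNIV)"
proof -
  have bij: "bij_betw (\<lambda>(i, w). w @ [i]) UNIV (- {[]} :: node set)"
  proof (rule bij_betwI')
    fix u :: node assume "u \<in> - {[]}"
    then have "u = butlast u @ [last u]" by simp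
    then show "\<exists>x\<in>UNIV. u = (case x of (i, w) \<Rightarrow> w @ [i])" by (intro bexI[of _ "(last u, butlast u)"]) auto
  qed auto
  have "(\<integral>\<^sup>+u. F u \<partial>count_space UNIV) = (\<integral>\<^sup>+u. F u * indicator {[]} u + F u * indicator (- {[]}) u \<partial>count_space UNIV)"
    by (intro nn_integral_cong) (auto simp: indicator_def)
  also have "\<dots> = F [] + (\<integral>\<^sup>+u. F u \<partial>count_space (- {[]}))"
    by (subst nn_integral_add) (auto simp: nn_integral_count_space_indicator)
  also have "(\<integral>\<^sup>+u. F u \<partial>count_space (- {[]})) = (\<integral>\<^sup>+x. F (snd x @ [fst x]) \<partial>count_space UNIV)"
    using nn_integral_bij_count_space[OF bij, of F] by (simp add: split_beta')
  also have "\<dots> = (\<Sum>i. \<integral>\<^sup>+w. F (w @ [i]) \<partial>count_space UNIV)"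
    using nn_integral_fst_count_space[of "\<lambda>x. F (snd x @ [fst x])"] by (simp add: nn_integral_count_space_nat)
  finally show ?thesis .
qed

text \<open>With the number of generations in \<open>enat\<close>, the truncated sums and the full
  sum are instances of one definition; values in ennreal postpone all questions of
  summability.\<close>

definition alive_sum :: "real \<Rightarrow> enat \<Rightarrow> (real \<Rightarrow> ennreal) \<Rightarrow> real \<Rightarrow> (node \<Rightarrow> mark) \<Rightarrow> ennreal" where
  "alive_sum \<alpha> n G t \<theta> = (\<integral>\<^sup>+u. (if enat (length u) < n \<and> u \<in> alive \<alpha> ratio life t \<theta> then G (node_size ratio u \<theta>) else 0) \<partial>count_space UNIV)"

lemma alive_sum_0: "alive_sum \<alpha> 0 G t \<theta> = 0"
  by (simp add: alive_sum_def)

text \<open>Phrased with \<open>eSuc\<close>, the decomposition at the root covers the truncated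
  sums and also the full one, as \<open>eSuc \<infinity> = \<infinity>\<close>.\<close>

lemma alive_sum_eSuc:
  assumes g: "good \<theta>"
  shows "alive_sum \<alpha> (eSuc n) G t \<theta> = (if 0 \<le> t \<and> t < snd (\<theta> []) then G 1 else 0) +
    (\<Sum>i. if 0 < fst (\<theta> []) i
         then alive_sum \<alpha> n (\<lambda>x. G (fst (\<theta> []) i * x)) (fst (\<theta> []) i powr \<alpha> * (t - snd (\<theta> []))) (subtree i \<theta>) else 0)"
proof -
  have "0 < eSuc n" by simp
  then show ?thesis
    unfolding alive_sum_def
    by (subst nn_integral_nodes)
       (auto simp: Suc_ile_eq alive_snoc[OF g] Nil_alive node_size_snoc zero_enat_def[symmetric]
         intro!: arg_cong2[where f = "(+)"] suminf_cong nn_integral_cong)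
qed

lemma alive_sum_mono_gen: "m \<le> n \<Longrightarrow> alive_sum \<alpha> m G t \<theta> \<le> alive_sum \<alpha> n G t \<theta>"
  unfolding alive_sum_def by (intro nn_integral_mono) auto

lemma alive_sum_mono: "(\<And>x. 0 < x \<Longrightarrow> G x \<le> H x) \<Longrightarrow> alive_sum \<alpha> n G t \<theta> \<le> alive_sum \<alpha> n H t \<theta>"
  unfolding alive_sum_def by (intro nn_integral_mono) (auto simp: alive_def)

lemma alive_sum_cong: "(\<And>x. 0 < x \<Longrightarrow> G x = H x) \<Longrightarrow> alive_sum \<alpha> n G t \<theta> = alive_sum \<alpha> n H t \<theta>"
  by (intro antisym alive_sum_mono) auto

lemma alive_sum_cmult: "alive_sum \<alpha> n (\<lambda>x. c * G x) t \<theta> = c * alive_sum \<alpha> n G t \<theta>"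
  unfolding alive_sum_def by (subst nn_integral_cmult[symmetric]) (auto intro!: nn_integral_cong)

lemma alive_sum_neg:
  assumes "good \<theta>" "t < 0" shows "alive_sum \<alpha> n G t \<theta> = 0"
proof -
  have "alive \<alpha> ratio life t \<theta> = {}"
  proof -
    have "\<not> birth_time \<alpha> ratio life u \<theta> \<le> t" for u
      using birth_time_nonneg[OF assms(1), of \<alpha> u] assms(2) by linarith
    then show ?thesis by (simp add: alive_def)
  qed
  then show ?thesis by (simp add: alive_sum_def)
qed

lemma alive_sum_SUP: "alive_sum \<alpha> \<infinity> G t \<theta> = (SUP n. alive_sum \<alpha> (enat n) G t \<theta>)"
proof -
  let ?F = "\<lambda>n u. if enat (length u) < enat n \<and> u \<in> alive \<alpha> ratio life t \<theta> then G (node_size ratio u \<theta>) else 0"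
  have "(SUP n. ?F n u) = (if u \<in> alive \<alpha> ratio life t \<theta> then G (node_size ratio u \<theta>) else 0)" for u
  proof (rule antisym)
    show "(if u \<in> alive \<alpha> ratio life t \<theta> then G (node_size ratio u \<theta>) else 0) \<le> (SUP n. ?F n u)"
      by (rule SUP_upper2[of "Suc (length u)"]) auto
    show "(SUP n. ?F n u) \<le> (if u \<in> alive \<alpha> ratio life t \<theta> then G (node_size ratio u \<theta>) else 0)"
      by (rule SUP_least) auto
  qed
  moreover have "(\<integral>\<^sup>+u. (SUP n. ?F n u) \<partial>count_space UNIV) = (SUP n. \<integral>\<^sup>+u. ?F n u \<partial>count_space UNIV)"
    by (intro nn_integral_monotone_convergence_SUP) (auto simp: incseq_def le_fun_def)
  ultimately show ?thesis by (simp add: alive_sum_def)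
qed

definition gen_sum :: "real \<Rightarrow> nat \<Rightarrow> (node \<Rightarrow> mark) \<Rightarrow> ennreal" where
  "gen_sum \<beta> n \<theta> = (\<integral>\<^sup>+u. (if length u = n then ennreal (node_size ratio u \<theta> powr \<beta>) else 0) \<partial>count_space UNIV)"

lemma gen_sum_0: "gen_sum \<beta> 0 \<theta> = 1"
proof -
  have "gen_sum \<beta> 0 \<theta> = (\<integral>\<^sup>+u. indicator {[]} (u :: node) \<partial>count_space UNIV)"
    unfolding gen_sum_def by (intro nn_integral_cong) (auto simp: indicator_def)
  then show ?thesis by simp
qed

lemma gen_sum_Suc:
  assumes g: "good \<theta>"
  shows "gen_sum \<beta> (Suc n) \<theta> = (\<Sum>i. ennreal (fst (\<theta> []) i powr \<beta>) * gen_sum \<beta> n (subtree i \<theta>))"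
proof -
  have "(\<integral>\<^sup>+w. (if length (w @ [i]) = Suc n then ennreal (node_size ratio (w @ [i]) \<theta> powr \<beta>) else 0) \<partial>count_space UNIV)
     = ennreal (fst (\<theta> []) i powr \<beta>) * gen_sum \<beta> n (subtree i \<theta>)" for i
    unfolding gen_sum_def
    using g node_size_nonneg[OF good_subtree[OF g]]
    by (subst nn_integral_cmult[symmetric])
      (auto intro!: nn_integral_cong simp: node_size_snoc powr_mult ennreal_mult good_def)
  then show ?thesis unfolding gen_sum_def by (subst nn_integral_nodes) simp
qed

section \<open>Branching property, size-biased law and first moments on the canonical tree\<close>

locale fragmentation_law = reproduction_law \<nu> for \<nu> :: "(nat \<Rightarrow> real) measure" +
  fixes \<alpha> \<beta> :: real
  assumes \<alpha>: "0 < \<alpha>" and \<beta>: "0 < \<beta>"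
    and ratios_unit: "AE \<xi> in \<nu>. \<forall>j. \<xi> j \<in> {0..1}"
    and malthus: "(\<integral>\<^sup>+\<xi>. (\<Sum>j. ennreal (\<xi> j powr \<beta>)) \<partial>\<nu>) = 1"
begin

abbreviation "E \<equiv> density lborel (exponential_density 1)"
abbreviation "N \<equiv> mark_law \<nu>"
abbreviation "P \<equiv> tree_law \<nu>"
abbreviation "PP \<equiv> Pi\<^sub>M UNIV (\<lambda>_::nat. P)"

declare sets_law [measurable_cong]

lemma component_measurable [measurable]: "(\<lambda>\<xi>. \<xi> i) \<in> borel_measurable \<nu>"
  by (subst measurable_cong_sets[OF sets_law refl]) measurable

lemma prob_space_E: "prob_space E"
  by (rule prob_space_exponential_density) simp

lemma sets_N [measurable_cong]: "sets N = sets mark_space"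
  unfolding mark_law_def by (intro sets_pair_measure_cong) (auto simp: sets_law)

sublocale mk: prob_space N
proof -
  interpret E: prob_space E by (rule prob_space_E)
  interpret pair_prob_space \<nu> E ..
  show "prob_space N" unfolding mark_law_def by unfold_locales
qed

sublocale tree: prob_space P
  unfolding tree_law_def by (intro prob_space_PiM mk.prob_space_axioms)

sublocale trees: prob_space PP
  by (intro prob_space_PiM tree.prob_space_axioms)

lemma coordinate_measurable [measurable]: "(\<lambda>\<theta>. \<theta> v) \<in> measurable P N"
  unfolding tree_law_def by measurable

lemma coordinate_measurable' [measurable]: "(\<lambda>\<theta>. \<theta> v) \<in> measurable P mark_space"
  using coordinate_measurable[of v] by (simp add: measurable_cong_sets[OF refl sets_N])

lemma subtree_measurable [measurable]: "subtree i \<in> measurable P P"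
  unfolding subtree_def[abs_def]
  by (subst (2) tree_law_def, intro measurable_PiM_single') (auto simp: space_PiM tree_law_def PiE_iff)

lemma ratio_component_measurable: "(\<lambda>x. fst x i) \<in> borel_measurable mark_space"
  by measurable

lemma AE_good: "AE \<theta> in P. good \<theta>"
proof -
  have E0: "AE e in E. 0 < e"
  proof (subst AE_density)
    have "AE e in lborel. e \<noteq> (0 :: real)" by (rule AE_lborel_singleton)
    then show "AE e in lborel. 0 < ennreal (exponential_density 1 e) \<longrightarrow> 0 < e"
      by eventually_elim (auto simp: exponential_density_def split: if_splits)
  qed simp
  have "AE x in N. (\<forall>i. 0 \<le> fst x i \<and> fst x i \<le> 1) \<and> 0 < snd x"
  proof -
    have [measurable]: "(\<lambda>x. fst x i) \<in> borel_measurable (\<nu> \<Otimes>\<^sub>M E)" for i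
      by (rule measurable_compose[OF measurable_fst component_measurable])
    interpret E: prob_space E by (rule prob_space_E)
    interpret pair_prob_space \<nu> E ..
    show ?thesis
      unfolding mark_law_def
    proof (rule AE_pair_measure)
      show "AE \<xi> in \<nu>. AE e in E. (\<forall>i. 0 \<le> fst (\<xi>, e) i \<and> fst (\<xi>, e) i \<le> 1) \<and> 0 < snd (\<xi>, e)"
        using ratios_unit
      proof eventually_elim
        case (elim \<xi>)
        show ?case using E0 by eventually_elim (use elim in auto)
      qed
    qed measurable
  qed
  then have "AE \<theta> in P. (\<forall>i. 0 \<le> fst (\<theta> v) i \<and> fst (\<theta> v) i \<le> 1) \<and> 0 < snd (\<theta> v)" for v
    unfolding tree_law_def by (intro AE_PiM_component mk.prob_space_axioms) auto
  then show ?thesis unfolding good_def AE_all_countable by blast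
qed

lemma ratio_measurable [measurable]: "(\<lambda>\<theta>. ratio v \<theta> i) \<in> borel_measurable P"
  unfolding ratio_def by (rule measurable_compose[OF coordinate_measurable' ratio_component_measurable])

lemma life_measurable [measurable]: "life v \<in> borel_measurable P"
  unfolding life_def[abs_def] by (rule measurable_compose[OF coordinate_measurable' measurable_snd])

lemma node_size_measurable [measurable]: "node_size ratio u \<in> borel_measurable P"
proof (induction u)
  case (Cons i v)
  note [measurable] = this
  show ?case by simp measurable
qed simp

lemma birth_time_measurable [measurable]: "birth_time \<alpha> ratio life u \<in> borel_measurable P"
proof (induction u)
  case (Cons i v)
  note [measurable] = this
  show ?case by simp measurable
qed simp

lemma death_time_measurable [measurable]: "death_time \<alpha> ratio life u \<in> borel_measurable P"
  unfolding death_time_def[abs_def] by measurable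

lemma nn_integral_nodes_measurable:
  assumes "\<And>u. (\<lambda>x. F x u) \<in> borel_measurable L"
  shows "(\<lambda>x. \<integral>\<^sup>+u. F x u \<partial>count_space (UNIV :: node set)) \<in> borel_measurable L"
proof -
  interpret sigma_finite_measure "count_space (UNIV :: node set)"
    by (rule sigma_finite_measure_count_space_countable) simp
  have "case_prod (\<lambda>u x. F x u) \<in> borel_measurable (count_space UNIV \<Otimes>\<^sub>M L)"
    using assms by (intro measurable_pair_measure_countable1) auto
  then have "case_prod F \<in> borel_measurable (L \<Otimes>\<^sub>M count_space UNIV)"
    by (subst measurable_pair_swap_iff) (simp add: split_beta')
  then show ?thesis by (rule borel_measurable_nn_integral)
qed

lemma alive_sum_measurable:
  assumes G: "case_prod G \<in> borel_measurable (L \<Otimes>\<^sub>M borel)" and t[measurable]: "t \<in> borel_measurable L"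
    and \<theta>[measurable]: "\<theta> \<in> measurable L P"
  shows "(\<lambda>x. alive_sum \<alpha> n (G x) (t x) (\<theta> x)) \<in> borel_measurable L"
  unfolding alive_sum_def
proof (rule nn_integral_nodes_measurable)
  fix u
  have [measurable]: "(\<lambda>x. G x (node_size ratio u (\<theta> x))) \<in> borel_measurable L"
    using measurable_compose[OF measurable_Pair[OF measurable_ident measurable_compose[OF \<theta> node_size_measurable[of u]]] G] by simp
  have [measurable]: "(\<lambda>x. node_size ratio u (\<theta> x)) \<in> borel_measurable L" "(\<lambda>x. birth_time \<alpha> ratio life u (\<theta> x)) \<in> borel_measurable L"
    "(\<lambda>x. death_time \<alpha> ratio life u (\<theta> x)) \<in> borel_measurable L"
    by measurable
  show "(\<lambda>x. if enat (length u) < n \<and> u \<in> alive \<alpha> ratio life (t x) (\<theta> x) then G x (node_size ratio u (\<theta> x)) else 0) \<in> borel_measurable L"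
    unfolding alive_def mem_Collect_eq by measurable
qed

lemma gen_sum_measurable [measurable]: "gen_sum \<beta> n \<in> borel_measurable P"
  unfolding gen_sum_def[abs_def] by (rule nn_integral_nodes_measurable) measurable

lemma subtrees_distribution: "distr P (N \<Otimes>\<^sub>M PP) (\<lambda>\<theta>. (\<theta> [], \<lambda>i. subtree i \<theta>)) = N \<Otimes>\<^sub>M PP"
  unfolding tree_law_def by (rule subtree_distribution[OF mk.prob_space_axioms])

lemma subtrees_measurable [measurable]: "(\<lambda>\<theta>. (\<theta> [], \<lambda>i. subtree i \<theta>)) \<in> measurable P (N \<Otimes>\<^sub>M PP)"
proof (rule measurable_Pair)
  show "(\<lambda>\<theta> i. subtree i \<theta>) \<in> measurable P PP"
    using measurable_space[OF subtree_measurable] by (intro measurable_PiM_single') (auto simp: PiE_iff)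
qed measurable

lemma nn_integral_subtrees:
  assumes [measurable]: "case_prod F \<in> borel_measurable (N \<Otimes>\<^sub>M PP)"
  shows "(\<integral>\<^sup>+\<theta>. F (\<theta> []) (\<lambda>i. subtree i \<theta>) \<partial>P) = (\<integral>\<^sup>+x. \<integral>\<^sup>+\<phi>. F x \<phi> \<partial>PP \<partial>N)"
proof -
  have "(\<integral>\<^sup>+\<theta>. F (\<theta> []) (\<lambda>i. subtree i \<theta>) \<partial>P) = (\<integral>\<^sup>+y. case_prod F y \<partial>distr P (N \<Otimes>\<^sub>M PP) (\<lambda>\<theta>. (\<theta> [], \<lambda>i. subtree i \<theta>)))"
    by (subst nn_integral_distr) auto
  also have "\<dots> = (\<integral>\<^sup>+x. \<integral>\<^sup>+\<phi>. F x \<phi> \<partial>PP \<partial>N)"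
    unfolding subtrees_distribution by (subst trees.nn_integral_fst[symmetric]) auto
  finally show ?thesis .
qed

lemma nn_integral_subtree:
  assumes [measurable]: "case_prod F \<in> borel_measurable (N \<Otimes>\<^sub>M P)"
  shows "(\<integral>\<^sup>+\<theta>. F (\<theta> []) (subtree i \<theta>) \<partial>P) = (\<integral>\<^sup>+x. \<integral>\<^sup>+\<theta>. F x \<theta> \<partial>P \<partial>N)"
proof -
  have m: "(\<lambda>\<phi>. \<phi> i) \<in> measurable PP P" by (rule measurable_component_singleton) simp
  have "(\<integral>\<^sup>+\<theta>. F (\<theta> []) (subtree i \<theta>) \<partial>P) = (\<integral>\<^sup>+x. \<integral>\<^sup>+\<phi>. F x (\<phi> i) \<partial>PP \<partial>N)"
    using m by (intro nn_integral_subtrees[of "\<lambda>x \<phi>. F x (\<phi> i)"]) measurable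
  also have "(\<integral>\<^sup>+x. \<integral>\<^sup>+\<phi>. F x (\<phi> i) \<partial>PP \<partial>N) = (\<integral>\<^sup>+x. \<integral>\<^sup>+\<theta>. F x \<theta> \<partial>P \<partial>N)"
  proof (rule nn_integral_cong)
    fix x assume that: "x \<in> space N"
    have "(\<integral>\<^sup>+\<theta>. F x \<theta> \<partial>P) = (\<integral>\<^sup>+\<theta>. F x \<theta> \<partial>distr PP P (\<lambda>\<phi>. \<phi> i))"
      by (subst distr_PiM_component) (auto intro: tree.prob_space_axioms)
    also have "\<dots> = (\<integral>\<^sup>+\<phi>. F x (\<phi> i) \<partial>PP)"
      using m that by (subst nn_integral_distr) measurable
    finally show "(\<integral>\<^sup>+\<phi>. F x (\<phi> i) \<partial>PP) = (\<integral>\<^sup>+\<theta>. F x \<theta> \<partial>P)" by simp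
  qed
  finally show ?thesis .
qed

text \<open>The size-biased law x^\<beta> \<sigma>(dx), built on \<nu> times counting measure so
  that sums over children become integrals. The Malthusian condition says that its mass is
  1.\<close>

definition tag :: "real measure" where
  "tag = distr (density (\<nu> \<Otimes>\<^sub>M count_space UNIV) (\<lambda>x. ennreal (fst x (snd x) powr \<beta>))) borel (\<lambda>x. fst x (snd x))"

lemma pair_component_measurable [measurable]:
  "(\<lambda>x. fst x (snd x)) \<in> borel_measurable (\<nu> \<Otimes>\<^sub>M count_space (UNIV :: nat set))"
  by (rule measurable_compose_countable[where f = "\<lambda>j x. fst x j" and g = snd])
     (auto intro: measurable_compose[OF measurable_fst component_measurable])

lemma nn_integral_tag:
  assumes [measurable]: "h \<in> borel_measurable borel"
  shows "(\<integral>\<^sup>+z. h z \<partial>tag) = (\<integral>\<^sup>+\<xi>. (\<Sum>j. ennreal (\<xi> j powr \<beta>) * h (\<xi> j)) \<partial>\<nu>)"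
proof -
  interpret C: sigma_finite_measure "count_space (UNIV :: nat set)"
    by (rule sigma_finite_measure_count_space_countable) simp
  have "(\<integral>\<^sup>+z. h z \<partial>tag) = (\<integral>\<^sup>+x. ennreal (fst x (snd x) powr \<beta>) * h (fst x (snd x)) \<partial>(\<nu> \<Otimes>\<^sub>M count_space UNIV))"
    unfolding tag_def by (subst nn_integral_distr) (auto simp: nn_integral_density)
  also have "\<dots> = (\<integral>\<^sup>+\<xi>. \<integral>\<^sup>+j. ennreal (\<xi> j powr \<beta>) * h (\<xi> j) \<partial>count_space UNIV \<partial>\<nu>)"
    by (subst C.nn_integral_fst[symmetric]) auto
  finally show ?thesis by (simp add: nn_integral_count_space_nat)
qed

lemma sets_tag [measurable_cong]: "sets tag = sets borel"
  by (simp add: tag_def)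

sublocale tag: prob_space tag
proof (rule prob_spaceI)
  have "emeasure tag (space tag) = (\<integral>\<^sup>+z. 1 \<partial>tag)" by simp
  also have "\<dots> = 1" using malthus by (subst nn_integral_tag) auto
  finally show "emeasure tag (space tag) = 1" .
qed

text \<open>The weight x^\<beta> vanishes exactly at x = 0, so a null set of \<open>tag\<close> is
  one that the nonzero ratios of all children avoid almost surely.\<close>

lemma AE_tag_iff:
  assumes [measurable]: "Measurable.pred borel Q"
  shows "(AE z in tag. Q z) \<longleftrightarrow> (AE \<xi> in \<nu>. \<forall>j. \<xi> j \<noteq> 0 \<longrightarrow> Q (\<xi> j))"
proof -
  have m[measurable]: "(\<lambda>z. if Q z then 0 else 1 :: ennreal) \<in> borel_measurable borel" by measurable
  then have "(\<lambda>z. if Q z then 0 else 1 :: ennreal) \<in> borel_measurable tag"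
    by (simp add: measurable_cong_sets[OF sets_tag refl])
  then have "(AE z in tag. Q z) \<longleftrightarrow> (\<integral>\<^sup>+z. (if Q z then 0 else 1) \<partial>tag) = 0"
    by (subst nn_integral_0_iff_AE) (auto elim!: eventually_mono split: if_splits)
  also have "\<dots> \<longleftrightarrow> (AE \<xi> in \<nu>. (\<Sum>j. ennreal (\<xi> j powr \<beta>) * (if Q (\<xi> j) then 0 else 1)) = 0)"
    by (subst nn_integral_tag) (auto simp: nn_integral_0_iff_AE)
  also have "\<dots> \<longleftrightarrow> (AE \<xi> in \<nu>. \<forall>j. \<xi> j \<noteq> 0 \<longrightarrow> Q (\<xi> j))"
  proof (rule AE_cong)
    fix \<xi> :: "nat \<Rightarrow> real"
    have "(\<Sum>j. ennreal (\<xi> j powr \<beta>) * (if Q (\<xi> j) then 0 else 1)) = 0 \<longleftrightarrow>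
        (\<forall>j. ennreal (\<xi> j powr \<beta>) * (if Q (\<xi> j) then 0 else 1) = 0)"
      by (rule suminf_eq_zero_iff) auto
    then show "(\<Sum>j. ennreal (\<xi> j powr \<beta>) * (if Q (\<xi> j) then 0 else 1)) = 0 \<longleftrightarrow> (\<forall>j. \<xi> j \<noteq> 0 \<longrightarrow> Q (\<xi> j))"
      by (auto split: if_splits)
  qed
  finally show ?thesis .
qed

lemma AE_tag_unit: "AE z in tag. 0 < z \<and> z \<le> 1"
  using ratios_unit by (subst AE_tag_iff) (auto elim!: eventually_mono simp: less_le)

lemma nn_integral_marks:
  assumes [measurable]: "case_prod g \<in> borel_measurable (borel \<Otimes>\<^sub>M borel)"
  shows "(\<integral>\<^sup>+x. (\<Sum>i. ennreal (fst x i powr \<beta>) * g (fst x i) (snd x)) \<partial>N) = (\<integral>\<^sup>+e. \<integral>\<^sup>+z. g z e \<partial>tag \<partial>E)"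
proof -
  interpret E: prob_space E by (rule prob_space_E)
  interpret pair_sigma_finite \<nu> E ..
  have [measurable]: "(\<lambda>x. fst x i) \<in> borel_measurable (\<nu> \<Otimes>\<^sub>M E)" for i
    by (rule measurable_compose[OF measurable_fst component_measurable])
  have [measurable]: "(\<lambda>x. g (fst x i) (snd x)) \<in> borel_measurable (\<nu> \<Otimes>\<^sub>M E)" for i
  proof -
    have "snd \<in> borel_measurable (\<nu> \<Otimes>\<^sub>M E)"
    proof -
      have id: "(\<lambda>x. x) \<in> borel_measurable E" by simp
      from measurable_compose[OF measurable_snd[of \<nu> E] id] show ?thesis .
    qed
    then have "(\<lambda>x. (fst x i, snd x)) \<in> measurable (\<nu> \<Otimes>\<^sub>M E) (borel \<Otimes>\<^sub>M borel)" by measurable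
    from measurable_compose[OF this assms] show ?thesis by simp
  qed
  have "(\<integral>\<^sup>+x. (\<Sum>i. ennreal (fst x i powr \<beta>) * g (fst x i) (snd x)) \<partial>N)
     = (\<integral>\<^sup>+e. \<integral>\<^sup>+\<xi>. (\<Sum>i. ennreal (\<xi> i powr \<beta>) * g (\<xi> i) e) \<partial>\<nu> \<partial>E)"
    unfolding mark_law_def by (subst nn_integral_snd[symmetric]) auto
  also have "\<dots> = (\<integral>\<^sup>+e. \<integral>\<^sup>+z. g z e \<partial>tag \<partial>E)"
    by (intro nn_integral_cong nn_integral_tag[symmetric]) measurable
  finally show ?thesis .
qed

definition mom :: "nat \<Rightarrow> real \<Rightarrow> real \<Rightarrow> ennreal" where
  "mom n p t = (\<integral>\<^sup>+\<theta>. alive_sum \<alpha> (enat n) (\<lambda>x. ennreal (x powr (\<beta> + p))) t \<theta> \<partial>P)"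

text \<open>The many-to-one measure: expectations of sums over living particles with weight
  x^\<beta> are integrals against it. That its mass is 1 for t \<ge> 0 is the conservation of the
  moment of order 0.\<close>

definition law :: "real \<Rightarrow> real measure" where
  "law t = distr (density (P \<Otimes>\<^sub>M count_space UNIV)
     (\<lambda>x. if snd x \<in> alive \<alpha> ratio life t (fst x) then ennreal (node_size ratio (snd x) (fst x) powr \<beta>) else 0))
     borel (\<lambda>x. node_size ratio (snd x) (fst x))"

lemma alive_measurable [measurable]: "Measurable.pred P (\<lambda>\<theta>. u \<in> alive \<alpha> ratio life t \<theta>)"
  unfolding alive_def mem_Collect_eq by measurable

lemma nn_integral_law:
  assumes [measurable]: "h \<in> borel_measurable borel"
  shows "(\<integral>\<^sup>+y. h y \<partial>law t) = (\<integral>\<^sup>+\<theta>. alive_sum \<alpha> \<infinity> (\<lambda>x. ennreal (x powr \<beta>) * h x) t \<theta> \<partial>P)"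
proof -
  interpret C: sigma_finite_measure "count_space (UNIV :: node set)"
    by (rule sigma_finite_measure_count_space_countable) simp
  have [measurable]: "(\<lambda>x. node_size ratio (snd x) (fst x)) \<in> borel_measurable (P \<Otimes>\<^sub>M count_space UNIV)"
    by (rule measurable_compose_countable[where f = "\<lambda>u x. node_size ratio u (fst x)" and g = snd]) measurable
  have [measurable]: "Measurable.pred (P \<Otimes>\<^sub>M count_space UNIV) (\<lambda>x. snd x \<in> alive \<alpha> ratio life t (fst x))"
    by (rule measurable_compose_countable[where f = "\<lambda>u x. u \<in> alive \<alpha> ratio life t (fst x)" and g = snd]) measurable
  have "(\<integral>\<^sup>+y. h y \<partial>law t) = (\<integral>\<^sup>+x. (if snd x \<in> alive \<alpha> ratio life t (fst x) then ennreal (node_size ratio (snd x) (fst x) powr \<beta>) else 0)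
      * h (node_size ratio (snd x) (fst x)) \<partial>(P \<Otimes>\<^sub>M count_space UNIV))"
    unfolding law_def by (subst nn_integral_distr) (auto simp: nn_integral_density)
  also have "\<dots> = (\<integral>\<^sup>+\<theta>. \<integral>\<^sup>+u. (if u \<in> alive \<alpha> ratio life t \<theta> then ennreal (node_size ratio u \<theta> powr \<beta>) else 0)
      * h (node_size ratio u \<theta>) \<partial>count_space UNIV \<partial>P)"
    by (subst C.nn_integral_fst[symmetric]) (measurable, simp only: fst_conv snd_conv)
  also have "\<dots> = (\<integral>\<^sup>+\<theta>. alive_sum \<alpha> \<infinity> (\<lambda>x. ennreal (x powr \<beta>) * h x) t \<theta> \<partial>P)"
    unfolding alive_sum_def by (intro nn_integral_cong) auto
  finally show ?thesis .
qed

lemma sets_law' [measurable_cong]: "sets (law t) = sets borel"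
  by (simp add: law_def)

lemma AE_law_pos: "AE y in law t. 0 < y"
proof -
  have "(\<integral>\<^sup>+y. (if 0 < y then 0 else 1) \<partial>law t) = (\<integral>\<^sup>+\<theta>. alive_sum \<alpha> \<infinity> (\<lambda>x. 0) t \<theta> \<partial>P)"
    by (subst nn_integral_law) (auto intro!: nn_integral_cong alive_sum_cong)
  also have "\<dots> = 0" by (simp add: alive_sum_def)
  finally have "AE y in law t. (if 0 < y then 0 else 1) = (0 :: ennreal)"
    by (subst (asm) nn_integral_0_iff_AE) auto
  then show ?thesis by eventually_elim (auto split: if_splits)
qed

lemma alive_sum_powr_measurable:
  "(\<lambda>x. alive_sum \<alpha> n (\<lambda>y. ennreal (y powr q)) (fst x) (snd x)) \<in> borel_measurable (borel \<Otimes>\<^sub>M P)"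
  by (rule alive_sum_measurable) measurable

lemma alive_sum_powr_measurable' [measurable]:
  "(\<lambda>\<theta>. alive_sum \<alpha> n (\<lambda>y. ennreal (y powr q)) t \<theta>) \<in> borel_measurable P"
  by (rule alive_sum_measurable) measurable

lemma mom_measurable: "mom n p \<in> borel_measurable borel"
  using tree.borel_measurable_nn_integral[of "\<lambda>t \<theta>. alive_sum \<alpha> (enat n) (\<lambda>x. ennreal (x powr (\<beta> + p))) t \<theta>" borel]
    alive_sum_powr_measurable by (simp add: mom_def[abs_def] split_beta')

lemma mom_neg: "t < 0 \<Longrightarrow> mom n p t = 0"
  unfolding mom_def using AE_good
  by (subst nn_integral_0_iff_AE) (auto elim!: eventually_mono simp: alive_sum_neg)

lemma alive_sum_powr_scale:
  assumes "0 < x"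
  shows "alive_sum \<alpha> n (\<lambda>y. ennreal ((x * y) powr q)) t \<theta> = ennreal (x powr q) * alive_sum \<alpha> n (\<lambda>y. ennreal (y powr q)) t \<theta>"
  unfolding alive_sum_cmult[symmetric] using assms by (intro alive_sum_cong) (simp add: powr_mult ennreal_mult)

lemma mom_Suc_marks:
  "mom (Suc n) p t = (\<integral>\<^sup>+x. (if 0 \<le> t \<and> t < snd x then 1 else 0) \<partial>N) +
     (\<integral>\<^sup>+x. (\<Sum>i. ennreal (fst x i powr \<beta>) * (ennreal (fst x i powr p) * mom n p (fst x i powr \<alpha> * (t - snd x)))) \<partial>N)"
proof -
  define H where "H x \<theta> = alive_sum \<alpha> (enat n) (\<lambda>y. ennreal (y powr (\<beta> + p))) (x powr \<alpha> * (t - snd \<theta>)) (subtree 0 (\<lambda>_. \<theta>))" for x :: real and \<theta> :: mark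
  have [measurable]: "(\<lambda>x. fst x i) \<in> borel_measurable N" for i
    by (subst measurable_cong_sets[OF sets_N refl]) (rule ratio_component_measurable)
  have [measurable]: "snd \<in> borel_measurable N"
    by (subst measurable_cong_sets[OF sets_N refl]) measurable
  have m: "(\<lambda>x. alive_sum \<alpha> (enat n) (\<lambda>y. ennreal (y powr (\<beta> + p))) (fst (fst x) i powr \<alpha> * (t - snd (fst x))) (snd x))
      \<in> borel_measurable (N \<Otimes>\<^sub>M P)" for i
    by (rule alive_sum_measurable) measurable
  have "mom (Suc n) p t = (\<integral>\<^sup>+\<theta>. (if 0 \<le> t \<and> t < snd (\<theta> []) then 1 else 0) +
     (\<Sum>i. ennreal (fst (\<theta> []) i powr (\<beta> + p)) * alive_sum \<alpha> (enat n) (\<lambda>y. ennreal (y powr (\<beta> + p)))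
        (fst (\<theta> []) i powr \<alpha> * (t - snd (\<theta> []))) (subtree i \<theta>)) \<partial>P)"
    unfolding mom_def
  proof (rule nn_integral_cong_AE)
    show "AE \<theta> in P. alive_sum \<alpha> (enat (Suc n)) (\<lambda>x. ennreal (x powr (\<beta> + p))) t \<theta> = (if 0 \<le> t \<and> t < snd (\<theta> []) then 1 else 0) +
     (\<Sum>i. ennreal (fst (\<theta> []) i powr (\<beta> + p)) * alive_sum \<alpha> (enat n) (\<lambda>y. ennreal (y powr (\<beta> + p)))
        (fst (\<theta> []) i powr \<alpha> * (t - snd (\<theta> []))) (subtree i \<theta>))"
      using AE_good
    proof eventually_elim
      case (elim \<theta>)
      have z: "0 < fst (\<theta> []) i \<or> fst (\<theta> []) i = 0" for i using elim by (auto simp: good_def less_le)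
      have e: "(if 0 < fst (\<theta> []) i then alive_sum \<alpha> (enat n) (\<lambda>x. ennreal ((fst (\<theta> []) i * x) powr (\<beta> + p))) s (subtree i \<theta>) else 0)
         = ennreal (fst (\<theta> []) i powr (\<beta> + p)) * alive_sum \<alpha> (enat n) (\<lambda>y. ennreal (y powr (\<beta> + p))) s (subtree i \<theta>)" for i s
      proof (cases "0 < fst (\<theta> []) i")
        case True
        then show ?thesis using alive_sum_powr_scale[OF True] by simp
      next
        case False
        then have "fst (\<theta> []) i = 0" using z[of i] by simp
        then show ?thesis by simp
      qed
      show ?case unfolding eSuc_enat[symmetric] alive_sum_eSuc[OF elim] e by simp
    qed
  qed
  also have "\<dots> = (\<integral>\<^sup>+\<theta>. (if 0 \<le> t \<and> t < snd (\<theta> []) then 1 else 0) \<partial>P) +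
     (\<Sum>i. \<integral>\<^sup>+\<theta>. ennreal (fst (\<theta> []) i powr (\<beta> + p)) * alive_sum \<alpha> (enat n) (\<lambda>y. ennreal (y powr (\<beta> + p)))
        (fst (\<theta> []) i powr \<alpha> * (t - snd (\<theta> []))) (subtree i \<theta>) \<partial>P)"
  proof -
    have [measurable]: "(\<lambda>\<theta>. alive_sum \<alpha> (enat n) (\<lambda>y. ennreal (y powr (\<beta> + p))) (fst (\<theta> []) i powr \<alpha> * (t - snd (\<theta> []))) (subtree i \<theta>))
      \<in> borel_measurable P" for i
      using ratio_measurable[of "[]" i] life_measurable[of "[]"]
      by (intro alive_sum_measurable) (auto simp: ratio_def life_def[abs_def])
    have [measurable]: "(\<lambda>\<theta>. fst (\<theta> []) i) \<in> borel_measurable P" "(\<lambda>\<theta>. snd (\<theta> [])) \<in> borel_measurable P" for i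
      using ratio_measurable[of "[]" i] life_measurable[of "[]"] by (simp_all add: ratio_def life_def[abs_def])
    show ?thesis by (subst nn_integral_add, measurable, subst nn_integral_suminf) auto
  qed
  also have "(\<integral>\<^sup>+\<theta>. (if 0 \<le> t \<and> t < snd (\<theta> []) then 1 else 0) \<partial>P) = (\<integral>\<^sup>+x. (if 0 \<le> t \<and> t < snd x then 1 else (0::ennreal)) \<partial>N)"
    by (subst nn_integral_subtree[where F = "\<lambda>x \<theta>. if 0 \<le> t \<and> t < snd x then 1 else 0"]) (auto simp: tree.emeasure_space_1)
  also have "(\<lambda>i. \<integral>\<^sup>+\<theta>. ennreal (fst (\<theta> []) i powr (\<beta> + p)) * alive_sum \<alpha> (enat n) (\<lambda>y. ennreal (y powr (\<beta> + p)))
        (fst (\<theta> []) i powr \<alpha> * (t - snd (\<theta> []))) (subtree i \<theta>) \<partial>P) =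
     (\<lambda>i. \<integral>\<^sup>+x. ennreal (fst x i powr (\<beta> + p)) * mom n p (fst x i powr \<alpha> * (t - snd x)) \<partial>N)"
  proof
    fix i
    show "(\<integral>\<^sup>+\<theta>. ennreal (fst (\<theta> []) i powr (\<beta> + p)) * alive_sum \<alpha> (enat n) (\<lambda>y. ennreal (y powr (\<beta> + p)))
        (fst (\<theta> []) i powr \<alpha> * (t - snd (\<theta> []))) (subtree i \<theta>) \<partial>P) =
      (\<integral>\<^sup>+x. ennreal (fst x i powr (\<beta> + p)) * mom n p (fst x i powr \<alpha> * (t - snd x)) \<partial>N)"
      unfolding mom_def using m[of i]
      by (subst nn_integral_subtree[where F = "\<lambda>x \<theta>. ennreal (fst x i powr (\<beta> + p)) * alive_sum \<alpha> (enat n) (\<lambda>y. ennreal (y powr (\<beta> + p)))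
        (fst x i powr \<alpha> * (t - snd x)) \<theta>"])
        (auto simp: split_beta' intro!: nn_integral_cong nn_integral_cmult)
  qed
  also have "(\<Sum>i. \<integral>\<^sup>+x. ennreal (fst x i powr (\<beta> + p)) * mom n p (fst x i powr \<alpha> * (t - snd x)) \<partial>N)
     = (\<integral>\<^sup>+x. (\<Sum>i. ennreal (fst x i powr \<beta>) * (ennreal (fst x i powr p) * mom n p (fst x i powr \<alpha> * (t - snd x)))) \<partial>N)"
  proof -
    note [measurable] = mom_measurable
    show ?thesis
      by (subst nn_integral_suminf[symmetric]) (auto intro!: nn_integral_cong suminf_cong simp: powr_add ennreal_mult mult.assoc)
  qed
  finally show ?thesis .
qed

lemma nn_integral_E:
  assumes [measurable]: "g \<in> borel_measurable borel"
  shows "(\<integral>\<^sup>+e. g e \<partial>E) = (\<integral>\<^sup>+e. ennreal (exp (- e)) * g e * indicator {0..} e \<partial>lborel)"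
  by (subst nn_integral_density) (auto intro!: nn_integral_cong simp: exponential_density_def indicator_def)

text \<open>The root is alive at t with probability e^(-t). Otherwise its lifetime is exponential,
  and passing to the remaining time y = t - e pulls e^(-t) out of the integral; negative y drop out
  because nothing is alive before time 0.\<close>

lemma mom_Suc:
  assumes t: "0 \<le> t"
  shows "mom (Suc n) p t = ennreal (exp (- t)) *
      (1 + (\<integral>\<^sup>+y. ennreal (exp y) * (\<integral>\<^sup>+z. ennreal (z powr p) * mom n p (z powr \<alpha> * y) \<partial>tag) * indicator {0..t} y \<partial>lborel))"
proof -
  note [measurable] = mom_measurable
  define J where "J y = (\<integral>\<^sup>+z. ennreal (z powr p) * mom n p (z powr \<alpha> * y) \<partial>tag)" for y
  have J[measurable]: "J \<in> borel_measurable borel" unfolding J_def by measurable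
  interpret E: prob_space E by (rule prob_space_E)
  interpret pair_sigma_finite \<nu> E ..
  have "(\<integral>\<^sup>+x. (if 0 \<le> t \<and> t < snd x then 1 else 0) \<partial>N) = (\<integral>\<^sup>+e. \<integral>\<^sup>+\<xi>. (if t < e then 1 else 0) \<partial>\<nu> \<partial>E)"
    unfolding mark_law_def using t by (subst nn_integral_snd[symmetric]) auto
  also have "\<dots> = (\<integral>\<^sup>+e. (if t < e then 1 else 0) \<partial>E)"
    by (simp add: emeasure_space_1)
  also have "\<dots> = (\<integral>\<^sup>+e. ennreal (exp (- e)) * indicator {t..} e \<partial>lborel)"
  proof (subst nn_integral_E)
    have "AE e in lborel. e \<noteq> t" by (rule AE_lborel_singleton)
    then have "AE e in lborel. ennreal (exp (- e)) * (if t < e then 1 else 0) * indicator {0..} e = ennreal (exp (- e)) * indicator {t..} e"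
      by eventually_elim (use t in \<open>auto simp: indicator_def\<close>)
    then show "(\<integral>\<^sup>+e. ennreal (exp (- e)) * (if t < e then 1 else 0) * indicator {0..} e \<partial>lborel) =
        (\<integral>\<^sup>+e. ennreal (exp (- e)) * indicator {t..} e \<partial>lborel)"
      by (rule nn_integral_cong_AE)
  qed simp
  also have "\<dots> = ennreal (0 - (- exp (- t)))"
  proof (rule nn_integral_FTC_atLeast)
    have "((\<lambda>e :: real. exp (- e)) \<longlongrightarrow> 0) at_top"
      by (rule filterlim_compose[OF exp_at_bot filterlim_uminus_at_bot_at_top])
    from tendsto_minus[OF this] show "((\<lambda>e. - exp (- e)) \<longlongrightarrow> (0 :: real)) at_top" by simp
  qed (auto intro!: derivative_eq_intros)
  finally have first: "(\<integral>\<^sup>+x. (if 0 \<le> t \<and> t < snd x then 1 else (0::ennreal)) \<partial>N) = ennreal (exp (- t))" by simp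
  have "(\<integral>\<^sup>+x. (\<Sum>i. ennreal (fst x i powr \<beta>) * (ennreal (fst x i powr p) * mom n p (fst x i powr \<alpha> * (t - snd x)))) \<partial>N)
     = (\<integral>\<^sup>+e. J (t - e) \<partial>E)"
    unfolding J_def
    by (rule nn_integral_marks[where g = "\<lambda>z e. ennreal (z powr p) * mom n p (z powr \<alpha> * (t - e))"]) measurable
  also have "\<dots> = (\<integral>\<^sup>+e. ennreal (exp (- e)) * J (t - e) * indicator {0..} e \<partial>lborel)"
    by (rule nn_integral_E) measurable
  also have "\<dots> = ennreal \<bar>- 1\<bar> * (\<integral>\<^sup>+y. ennreal (exp (- (t + - 1 * y))) * J (t - (t + - 1 * y)) * indicator {0..} (t + - 1 * y) \<partial>lborel)"
    by (rule nn_integral_real_affine) auto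
  also have "\<dots> = (\<integral>\<^sup>+y. ennreal (exp (- t)) * (ennreal (exp y) * J y * indicator {0..t} y) \<partial>lborel)"
  proof -
    have "J y = 0" if "y < 0" for y
    proof -
      have "AE z in tag. ennreal (z powr p) * mom n p (z powr \<alpha> * y) = 0"
        using AE_tag_unit by eventually_elim (use that in \<open>simp add: mom_neg mult_pos_neg\<close>)
      from nn_integral_cong_AE[OF this] show ?thesis unfolding J_def by simp
    qed
    then have "ennreal (exp (- (t + - 1 * y))) * J (t - (t + - 1 * y)) * indicator {0..} (t + - 1 * y)
      = ennreal (exp (- t)) * (ennreal (exp y) * J y * indicator {0..t} y)" for y
      by (cases "0 \<le> y") (auto simp: indicator_def ennreal_mult[symmetric] mult.assoc[symmetric] exp_add[symmetric])
    then show ?thesis by simp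
  qed
  also have "\<dots> = ennreal (exp (- t)) * (\<integral>\<^sup>+y. ennreal (exp y) * J y * indicator {0..t} y \<partial>lborel)"
  proof (rule nn_integral_cmult)
    have "J \<in> borel_measurable lborel" using J by simp
    moreover have "(indicator {0..t} :: real \<Rightarrow> ennreal) \<in> borel_measurable lborel" by simp
    ultimately show "(\<lambda>y. ennreal (exp y) * J y * indicator {0..t} y) \<in> borel_measurable lborel"
      by (intro borel_measurable_times_ennreal) auto
  qed
  finally show ?thesis unfolding mom_Suc_marks first J_def by (simp add: distrib_left)
qed

lemma tagged_fragment:
  assumes "\<not> (\<exists>r. 0 < r \<and> r < 1 \<and> (AE z in tag. \<exists>k::nat. z = r ^ k))"
  shows "tagged_fragment tag \<alpha> mom law"
proof (intro tagged_fragment.intro tagged_fragment_axioms.intro tag.prob_space_axioms \<alpha> sets_tag AE_tag_unit assms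
    mom_measurable mom_Suc sets_law' AE_law_pos)
  show "mom 0 p t = 0" for p t by (simp add: mom_def zero_enat_def[symmetric] alive_sum_0)
  show "mom n p t \<le> mom (Suc n) p t" for n p t
    unfolding mom_def by (intro nn_integral_mono alive_sum_mono_gen) simp
  show "(\<integral>\<^sup>+y. ennreal (y powr p) \<partial>law t) = (SUP n. mom n p t)" for p t
  proof -
    have "(\<integral>\<^sup>+y. ennreal (y powr p) \<partial>law t) = (\<integral>\<^sup>+\<theta>. alive_sum \<alpha> \<infinity> (\<lambda>x. ennreal (x powr (\<beta> + p))) t \<theta> \<partial>P)"
      by (subst nn_integral_law) (auto intro!: nn_integral_cong alive_sum_cong simp: powr_add ennreal_mult)
    also have "\<dots> = (\<integral>\<^sup>+\<theta>. (SUP n. alive_sum \<alpha> (enat n) (\<lambda>x. ennreal (x powr (\<beta> + p))) t \<theta>) \<partial>P)"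
      unfolding alive_sum_SUP ..
    also have "\<dots> = (SUP n. mom n p t)"
      unfolding mom_def
      by (rule nn_integral_monotone_convergence_SUP) (auto simp: incseq_def le_fun_def intro!: alive_sum_mono_gen)
    finally show ?thesis .
  qed
qed

end

subsection \<open>Second moments of branching sums\<close>

context prob_space
begin

lemma indep_centered_square:
  fixes Y :: "nat \<Rightarrow> 'a \<Rightarrow> real"
  assumes ind: "indep_vars (\<lambda>_. borel) Y UNIV" and sq: "\<And>i. i < n \<Longrightarrow> integrable M (\<lambda>\<omega>. (Y i \<omega>)\<^sup>2)"
    and mean: "\<And>i. i < n \<Longrightarrow> expectation (Y i) = 0"
  shows "integrable M (\<lambda>\<omega>. (c + (\<Sum>i<n. Y i \<omega>))\<^sup>2)" (is ?int)
    and "(\<integral>\<omega>. (c + (\<Sum>i<n. Y i \<omega>))\<^sup>2 \<partial>M) = c\<^sup>2 + (\<Sum>i<n. \<integral>\<omega>. (Y i \<omega>)\<^sup>2 \<partial>M)" (is ?eq)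
proof -
  have rv[measurable]: "Y i \<in> borel_measurable M" for i using ind by (auto simp: indep_vars_def)
  have Yi: "integrable M (Y i)" if "i < n" for i by (rule square_integrable_imp_integrable[OF rv sq[OF that]])
  have cross: "integrable M (\<lambda>\<omega>. Y i \<omega> * Y j \<omega>) \<and> (\<integral>\<omega>. Y i \<omega> * Y j \<omega> \<partial>M) = 0" if "i < n" "j < n" "i \<noteq> j" for i j
  proof -
    have I: "indep_vars (\<lambda>_. borel) Y {i, j}" by (rule indep_vars_subset[OF ind]) auto
    have Yij: "k \<in> {i, j} \<Longrightarrow> integrable M (Y k)" for k using Yi that by auto
    show ?thesis
      using indep_vars_integrable[of "{i, j}" Y] indep_vars_lebesgue_integral[of "{i, j}" Y] I Yij that mean
      by simp
  qed
  have "m \<le> n \<Longrightarrow> integrable M (\<lambda>\<omega>. (c + (\<Sum>i<m. Y i \<omega>))\<^sup>2) \<and>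
      (\<integral>\<omega>. (c + (\<Sum>i<m. Y i \<omega>))\<^sup>2 \<partial>M) = c\<^sup>2 + (\<Sum>i<m. \<integral>\<omega>. (Y i \<omega>)\<^sup>2 \<partial>M)" for m
  proof (induction m)
    case 0
    then show ?case by (simp add: prob_space)
  next
    case (Suc m)
    then have m: "m < n" by simp
    have eq: "(c + (\<Sum>i<Suc m. Y i \<omega>))\<^sup>2 =
      (c + (\<Sum>i<m. Y i \<omega>))\<^sup>2 + (2 * c * Y m \<omega> + (\<Sum>i<m. 2 * (Y i \<omega> * Y m \<omega>))) + (Y m \<omega>)\<^sup>2" for \<omega>
    proof -
      have "(\<Sum>i<m. 2 * (Y i \<omega> * Y m \<omega>)) = 2 * (\<Sum>i<m. Y i \<omega>) * Y m \<omega>"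
        by (simp add: sum_distrib_left sum_distrib_right mult_ac)
      then show ?thesis by (simp add: power2_eq_square algebra_simps)
    qed
    have ic: "integrable M (\<lambda>\<omega>. \<Sum>i<m. 2 * (Y i \<omega> * Y m \<omega>))"
      using cross m by (intro Bochner_Integration.integrable_sum integrable_mult_right) auto
    have "(\<integral>\<omega>. (\<Sum>i<m. 2 * (Y i \<omega> * Y m \<omega>)) \<partial>M) = (\<Sum>i<m. \<integral>\<omega>. 2 * (Y i \<omega> * Y m \<omega>) \<partial>M)"
      using cross m by (intro Bochner_Integration.integral_sum integrable_mult_right) auto
    also have "\<dots> = 0" using cross m by (intro sum.neutral) auto
    finally have c0: "(\<integral>\<omega>. (\<Sum>i<m. 2 * (Y i \<omega> * Y m \<omega>)) \<partial>M) = 0" .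
    note I = Suc.IH[OF less_imp_le[OF m]]
    have "integrable M (\<lambda>\<omega>. 2 * c * Y m \<omega> + (\<Sum>i<m. 2 * (Y i \<omega> * Y m \<omega>)))"
      using Yi[OF m] ic by (intro Bochner_Integration.integrable_add integrable_mult_right)
    moreover have "(\<integral>\<omega>. 2 * c * Y m \<omega> + (\<Sum>i<m. 2 * (Y i \<omega> * Y m \<omega>)) \<partial>M) = 0"
      using Yi[OF m] ic c0 mean[OF m] by simp
    ultimately show ?case unfolding eq using I sq[OF m] by simp
  qed
  then show ?int ?eq by blast+
qed

text \<open>A variance is at most a second moment, and the square of the mean is at most the square
  of the sum of absolute means. The first sum will supply the contraction and the second term
  involves means only; if some second moment is infinite, the right-hand side is infinite.\<close>

lemma indep_sum_square_le:
  fixes Y :: "nat \<Rightarrow> 'a \<Rightarrow> real"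
  assumes ind: "indep_vars (\<lambda>_. borel) Y UNIV"
  shows "(\<integral>\<^sup>+\<omega>. ennreal ((a + (\<Sum>i<n. Y i \<omega>))\<^sup>2) \<partial>M) \<le>
    (\<Sum>i<n. \<integral>\<^sup>+\<omega>. ennreal ((Y i \<omega>)\<^sup>2) \<partial>M) + (ennreal \<bar>a\<bar> + (\<Sum>i<n. ennreal \<bar>expectation (Y i)\<bar>))\<^sup>2"
proof (cases "\<exists>i<n. (\<integral>\<^sup>+\<omega>. ennreal ((Y i \<omega>)\<^sup>2) \<partial>M) = \<infinity>")
  case True
  then have eq: "(\<Sum>i<n. \<integral>\<^sup>+\<omega>. ennreal ((Y i \<omega>)\<^sup>2) \<partial>M) = \<infinity>" by auto
  show ?thesis unfolding eq by simp
next
  case False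
  have rv[measurable]: "Y i \<in> borel_measurable M" for i using ind by (auto simp: indep_vars_def)
  have sq: "integrable M (\<lambda>\<omega>. (Y i \<omega>)\<^sup>2)" if "i < n" for i
    using False that by (intro integrableI_bounded) (auto simp: less_top)
  have Yi: "integrable M (Y i)" if "i < n" for i by (rule square_integrable_imp_integrable[OF rv sq[OF that]])
  define Z where "Z i \<omega> = Y i \<omega> - expectation (Y i)" for i \<omega>
  define c where "c = a + (\<Sum>i<n. expectation (Y i))"
  have indZ: "indep_vars (\<lambda>_. borel) Z UNIV"
    unfolding Z_def by (rule indep_vars_compose2[OF ind]) measurable
  have Z2: "(Z i \<omega>)\<^sup>2 = (Y i \<omega>)\<^sup>2 - 2 * expectation (Y i) * Y i \<omega> + (expectation (Y i))\<^sup>2" for i \<omega>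
    by (simp add: Z_def power2_eq_square algebra_simps)
  have sqZ: "integrable M (\<lambda>\<omega>. (Z i \<omega>)\<^sup>2)" if "i < n" for i
    unfolding Z2 using sq[OF that] Yi[OF that] by simp
  have sqZ_le: "(\<integral>\<omega>. (Z i \<omega>)\<^sup>2 \<partial>M) \<le> (\<integral>\<omega>. (Y i \<omega>)\<^sup>2 \<partial>M)" if "i < n" for i
    unfolding Z2 using sq[OF that] Yi[OF that] by (simp add: prob_space power2_eq_square)
  have meanZ: "expectation (Z i) = 0" if "i < n" for i
    unfolding Z_def using Yi[OF that] by (simp add: prob_space)
  have eq: "a + (\<Sum>i<n. Y i \<omega>) = c + (\<Sum>i<n. Z i \<omega>)" for \<omega>
    by (simp add: c_def Z_def sum_subtractf)
  have abs_c: "\<bar>c\<bar> \<le> \<bar>a\<bar> + (\<Sum>i<n. \<bar>expectation (Y i)\<bar>)"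
    unfolding c_def using sum_abs[of "\<lambda>i. expectation (Y i)" "{..<n}"] by linarith
  have "(\<integral>\<^sup>+\<omega>. ennreal ((a + (\<Sum>i<n. Y i \<omega>))\<^sup>2) \<partial>M) = ennreal (\<integral>\<omega>. (c + (\<Sum>i<n. Z i \<omega>))\<^sup>2 \<partial>M)"
    unfolding eq by (intro nn_integral_eq_integral indep_centered_square(1) indZ sqZ meanZ) auto
  also have "(\<integral>\<omega>. (c + (\<Sum>i<n. Z i \<omega>))\<^sup>2 \<partial>M) = c\<^sup>2 + (\<Sum>i<n. \<integral>\<omega>. (Z i \<omega>)\<^sup>2 \<partial>M)"
    by (intro indep_centered_square(2) indZ sqZ meanZ)
  also have "\<dots> \<le> (\<bar>a\<bar> + (\<Sum>i<n. \<bar>expectation (Y i)\<bar>))\<^sup>2 + (\<Sum>i<n. \<integral>\<omega>. (Y i \<omega>)\<^sup>2 \<partial>M)"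
    using power_mono[OF abs_c, of 2] sqZ_le by (intro add_mono sum_mono) auto
  also have "ennreal \<dots> = (ennreal \<bar>a\<bar> + (\<Sum>i<n. ennreal \<bar>expectation (Y i)\<bar>))\<^sup>2 + (\<Sum>i<n. ennreal (\<integral>\<omega>. (Y i \<omega>)\<^sup>2 \<partial>M))"
    by (simp add: ennreal_plus sum_nonneg sum_ennreal flip: ennreal_power)
  also have "(\<Sum>i<n. ennreal (\<integral>\<omega>. (Y i \<omega>)\<^sup>2 \<partial>M)) = (\<Sum>i<n. \<integral>\<^sup>+\<omega>. ennreal ((Y i \<omega>)\<^sup>2) \<partial>M)"
    using sq by (intro sum.cong refl nn_integral_eq_integral[symmetric]) auto
  finally show ?thesis by (simp add: ennreal_leI add.commute)
qed

end

context fragmentation_law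
begin

text \<open>Given the mark of the root the subtrees are independent, so
  \<open>indep_sum_square_le\<close> applies to the first n children for each fixed mark, with a
  bound that is free of n; Fatou then passes to infinitely many children.\<close>

theorem second_moment_step:
  fixes h :: "mark \<Rightarrow> nat \<Rightarrow> (node \<Rightarrow> mark) \<Rightarrow> real"
  assumes [measurable]: "a \<in> borel_measurable N"
    and h[measurable]: "\<And>i. (\<lambda>x. h (fst x) i (snd x)) \<in> borel_measurable (N \<Otimes>\<^sub>M P)"
    and X: "AE \<theta> in P. (\<lambda>i. h (\<theta> []) i (subtree i \<theta>)) sums (X \<theta> - a (\<theta> []))"
  shows "(\<integral>\<^sup>+\<theta>. ennreal ((X \<theta>)\<^sup>2) \<partial>P) \<le>
    (\<integral>\<^sup>+x. (\<Sum>i. \<integral>\<^sup>+\<theta>. ennreal ((h x i \<theta>)\<^sup>2) \<partial>P) + (ennreal \<bar>a x\<bar> + (\<Sum>i. ennreal \<bar>\<integral>\<theta>. h x i \<theta> \<partial>P\<bar>))\<^sup>2 \<partial>N)"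
proof -
  have comp[measurable]: "(\<lambda>\<phi>. \<phi> i) \<in> measurable PP P" for i by (rule measurable_component_singleton) simp
  have hm: "h x i \<in> borel_measurable P" if "x \<in> space N" for x i
    using measurable_compose[OF measurable_Pair1'[OF that] h[of i]] by simp
  have hphi[measurable]: "(\<lambda>x. h (fst x) i (snd x i)) \<in> borel_measurable (N \<Otimes>\<^sub>M PP)" for i
    using measurable_compose[of "\<lambda>x. (fst x, snd x i)" "N \<Otimes>\<^sub>M PP" "N \<Otimes>\<^sub>M P" _ borel, OF _ h[of i]] by simp
  define Y where "Y n x \<phi> = a x + (\<Sum>i<n. h x i (\<phi> i))" for n x and \<phi> :: "nat \<Rightarrow> node \<Rightarrow> mark"
  have Ym[measurable]: "(\<lambda>x. Y n (fst x) (snd x)) \<in> borel_measurable (N \<Otimes>\<^sub>M PP)" for n unfolding Y_def by measurable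
  let ?B = "\<lambda>x. (\<Sum>i. \<integral>\<^sup>+\<theta>. ennreal ((h x i \<theta>)\<^sup>2) \<partial>P) + (ennreal \<bar>a x\<bar> + (\<Sum>i. ennreal \<bar>\<integral>\<theta>. h x i \<theta> \<partial>P\<bar>))\<^sup>2"
  have bound: "(\<integral>\<^sup>+\<phi>. ennreal ((Y n x \<phi>)\<^sup>2) \<partial>PP) \<le> ?B x" if x: "x \<in> space N" for n x
  proof -
    have "trees.indep_vars (\<lambda>_. borel) (\<lambda>i \<phi>. h x i (\<phi> i)) UNIV"
      by (rule trees.indep_vars_compose2[OF PiM_coordinates_indep[OF tree.prob_space_axioms]]) (rule hm[OF x])
    from trees.indep_sum_square_le[OF this, of "a x" n]
    have "(\<integral>\<^sup>+\<phi>. ennreal ((Y n x \<phi>)\<^sup>2) \<partial>PP) \<le> (\<Sum>i<n. \<integral>\<^sup>+\<phi>. ennreal ((h x i (\<phi> i))\<^sup>2) \<partial>PP)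
      + (ennreal \<bar>a x\<bar> + (\<Sum>i<n. ennreal \<bar>\<integral>\<phi>. h x i (\<phi> i) \<partial>PP\<bar>))\<^sup>2"
      by (simp add: Y_def)
    also have "(\<lambda>i. \<integral>\<^sup>+\<phi>. ennreal ((h x i (\<phi> i))\<^sup>2) \<partial>PP) = (\<lambda>i. \<integral>\<^sup>+\<theta>. ennreal ((h x i \<theta>)\<^sup>2) \<partial>P)"
    proof
      fix i
      have "(\<integral>\<^sup>+\<theta>. ennreal ((h x i \<theta>)\<^sup>2) \<partial>distr PP P (\<lambda>\<phi>. \<phi> i)) = (\<integral>\<^sup>+\<phi>. ennreal ((h x i (\<phi> i))\<^sup>2) \<partial>PP)"
        using hm[OF x] by (subst nn_integral_distr) auto
      then show "(\<integral>\<^sup>+\<phi>. ennreal ((h x i (\<phi> i))\<^sup>2) \<partial>PP) = (\<integral>\<^sup>+\<theta>. ennreal ((h x i \<theta>)\<^sup>2) \<partial>P)"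
        by (subst (asm) distr_PiM_component) (auto intro: tree.prob_space_axioms)
    qed
    also have "(\<lambda>i. ennreal \<bar>\<integral>\<phi>. h x i (\<phi> i) \<partial>PP\<bar>) = (\<lambda>i. ennreal \<bar>\<integral>\<theta>. h x i \<theta> \<partial>P\<bar>)"
    proof
      fix i
      have "(\<integral>\<theta>. h x i \<theta> \<partial>distr PP P (\<lambda>\<phi>. \<phi> i)) = (\<integral>\<phi>. h x i (\<phi> i) \<partial>PP)"
        using hm[OF x] by (subst integral_distr) auto
      then show "ennreal \<bar>\<integral>\<phi>. h x i (\<phi> i) \<partial>PP\<bar> = ennreal \<bar>\<integral>\<theta>. h x i \<theta> \<partial>P\<bar>"
        by (subst (asm) distr_PiM_component) (auto intro: tree.prob_space_axioms)
    qed
    also have "(\<Sum>i<n. \<integral>\<^sup>+\<theta>. ennreal ((h x i \<theta>)\<^sup>2) \<partial>P) + (ennreal \<bar>a x\<bar> + (\<Sum>i<n. ennreal \<bar>\<integral>\<theta>. h x i \<theta> \<partial>P\<bar>))\<^sup>2 \<le> ?B x"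
      by (intro add_mono power_mono sum_le_suminf add_left_mono) auto
    finally show ?thesis .
  qed
  have "(\<integral>\<^sup>+\<theta>. ennreal ((X \<theta>)\<^sup>2) \<partial>P) = (\<integral>\<^sup>+\<theta>. liminf (\<lambda>n. ennreal ((Y n (\<theta> []) (\<lambda>i. subtree i \<theta>))\<^sup>2)) \<partial>P)"
  proof (rule nn_integral_cong_AE)
    show "AE \<theta> in P. ennreal ((X \<theta>)\<^sup>2) = liminf (\<lambda>n. ennreal ((Y n (\<theta> []) (\<lambda>i. subtree i \<theta>))\<^sup>2))"
      using X
    proof eventually_elim
      case (elim \<theta>)
      then have "(\<lambda>n. Y n (\<theta> []) (\<lambda>i. subtree i \<theta>)) \<longlonglongrightarrow> a (\<theta> []) + (X \<theta> - a (\<theta> []))"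
        unfolding Y_def sums_def by (intro tendsto_add tendsto_const)
      then have "(\<lambda>n. ennreal ((Y n (\<theta> []) (\<lambda>i. subtree i \<theta>))\<^sup>2)) \<longlonglongrightarrow> ennreal ((X \<theta>)\<^sup>2)"
        by (intro tendsto_ennrealI tendsto_power) simp
      then show ?case using lim_imp_Liminf[of sequentially] by force
    qed
  qed
  also have "\<dots> \<le> liminf (\<lambda>n. \<integral>\<^sup>+\<theta>. ennreal ((Y n (\<theta> []) (\<lambda>i. subtree i \<theta>))\<^sup>2) \<partial>P)"
  proof (rule nn_integral_liminf)
    fix n
    have "(\<lambda>\<theta>. (\<lambda>x. Y n (fst x) (snd x)) (\<theta> [], \<lambda>i. subtree i \<theta>)) \<in> borel_measurable P"
      by (rule measurable_compose[OF subtrees_measurable Ym])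
    then show "(\<lambda>\<theta>. ennreal ((Y n (\<theta> []) (\<lambda>i. subtree i \<theta>))\<^sup>2)) \<in> borel_measurable P" by simp
  qed
  also have "(\<lambda>n. \<integral>\<^sup>+\<theta>. ennreal ((Y n (\<theta> []) (\<lambda>i. subtree i \<theta>))\<^sup>2) \<partial>P) = (\<lambda>n. \<integral>\<^sup>+x. \<integral>\<^sup>+\<phi>. ennreal ((Y n x \<phi>)\<^sup>2) \<partial>PP \<partial>N)"
    by (intro ext nn_integral_subtrees) (simp add: split_beta')
  also have "liminf \<dots> \<le> (\<integral>\<^sup>+x. ?B x \<partial>N)"
    by (intro Liminf_le always_eventually allI nn_integral_mono bound) auto
  finally show ?thesis .
qed

end

lemma ennreal_enn2real_le': "ennreal (enn2real x) \<le> x"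
  by (cases x) auto

lemma sums_enn2real:
  fixes f :: "nat \<Rightarrow> ennreal"
  assumes "(\<Sum>i. f i) < \<infinity>"
  shows "(\<lambda>i. enn2real (f i)) sums enn2real (\<Sum>i. f i)"
proof -
  have fin: "f i < \<infinity>" for i
    using ennreal_suminf_lessD[OF assms] by simp
  have "(\<lambda>n. \<Sum>i<n. f i) \<longlonglongrightarrow> (\<Sum>i. f i)" by (rule summable_LIMSEQ[OF summableI])
  then have "(\<lambda>n. enn2real (\<Sum>i<n. f i)) \<longlonglongrightarrow> enn2real (\<Sum>i. f i)"
    using assms by (intro tendsto_enn2real) (auto simp: less_top)
  moreover have "enn2real (\<Sum>i<n. f i) = (\<Sum>i<n. enn2real (f i))" for n
  proof (induction n)
    case (Suc n)
    have "(\<Sum>i<n. f i) < \<infinity>" using fin by (simp add: less_top)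
    then show ?case using Suc fin[of n] by (simp add: enn2real_plus less_top)
  qed simp
  ultimately show ?thesis by (simp add: sums_def)
qed

section \<open>Signed weighted sums and their decomposition at the root\<close>

context fragmentation_law
begin

text \<open>The scale r is independent of the time s, because passing to a child of ratio x
  multiplies r by x and sends s to x^\<alpha> (s - e). As \<open>ennreal\<close> maps negative reals
  to 0, the two terms are the sums of the positive and of the negative parts.\<close>

definition weighted_sum :: "enat \<Rightarrow> (real \<Rightarrow> real) \<Rightarrow> real \<Rightarrow> real \<Rightarrow> (node \<Rightarrow> mark) \<Rightarrow> real" where
  "weighted_sum n f s r \<theta> =
     enn2real (alive_sum \<alpha> n (\<lambda>y. ennreal (y powr \<beta> * f (r * y))) s \<theta>) -
     enn2real (alive_sum \<alpha> n (\<lambda>y. ennreal (- (y powr \<beta> * f (r * y)))) s \<theta>)"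

abbreviation mass_sum :: "enat \<Rightarrow> real \<Rightarrow> (node \<Rightarrow> mark) \<Rightarrow> ennreal" where
  "mass_sum n s \<theta> \<equiv> alive_sum \<alpha> n (\<lambda>y. ennreal (y powr \<beta>)) s \<theta>"

lemma alive_sum_le_mass:
  assumes "\<And>x. \<bar>f x\<bar> \<le> B" "0 \<le> B"
  shows "alive_sum \<alpha> n (\<lambda>y. ennreal (y powr \<beta> * f (r * y))) s \<theta> \<le> ennreal B * mass_sum n s \<theta>"
  unfolding alive_sum_cmult[symmetric]
proof (rule alive_sum_mono)
  fix x :: real
  have "x powr \<beta> * f (r * x) \<le> B * x powr \<beta>"
    using assms(1)[of "r * x"] by (subst mult.commute) (intro mult_right_mono, auto)
  then show "ennreal (x powr \<beta> * f (r * x)) \<le> ennreal B * ennreal (x powr \<beta>)"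
    using assms(2) by (simp add: ennreal_leI flip: ennreal_mult)
qed

lemma weighted_sum_abs_le:
  assumes f: "\<And>x. \<bar>f x\<bar> \<le> B" and fin: "mass_sum n s \<theta> < \<infinity>"
  shows "\<bar>weighted_sum n f s r \<theta>\<bar> \<le> B * enn2real (mass_sum n s \<theta>)"
proof -
  have B: "0 \<le> B" using f[of 0] by linarith
  have *: "enn2real (alive_sum \<alpha> n (\<lambda>y. ennreal (y powr \<beta> * g (r * y))) s \<theta>) \<le> B * enn2real (mass_sum n s \<theta>)"
    if "\<And>x. \<bar>g x\<bar> \<le> B" for g
  proof -
    have "enn2real (alive_sum \<alpha> n (\<lambda>y. ennreal (y powr \<beta> * g (r * y))) s \<theta>) \<le> enn2real (ennreal B * mass_sum n s \<theta>)"
      using fin by (intro enn2real_mono alive_sum_le_mass that B) (simp add: ennreal_mult_less_top)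
    then show ?thesis using B by (simp add: enn2real_mult)
  qed
  have "enn2real (alive_sum \<alpha> n (\<lambda>y. ennreal (- (y powr \<beta> * f (r * y)))) s \<theta>) \<le> B * enn2real (mass_sum n s \<theta>)"
    using *[of "\<lambda>x. - f x"] f by simp
  then show ?thesis
    using *[of f, OF f] enn2real_nonneg[of "alive_sum \<alpha> n (\<lambda>y. ennreal (y powr \<beta> * f (r * y))) s \<theta>"]
      enn2real_nonneg[of "alive_sum \<alpha> n (\<lambda>y. ennreal (- (y powr \<beta> * f (r * y)))) s \<theta>"]
    unfolding weighted_sum_def by linarith
qed

lemma alive_sum_weighted_eSuc:
  assumes g: "good \<theta>"
  shows "alive_sum \<alpha> (eSuc n) (\<lambda>y. ennreal (y powr \<beta> * f (r * y))) s \<theta> =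
    (if 0 \<le> s \<and> s < snd (\<theta> []) then ennreal (f r) else 0) +
    (\<Sum>i. ennreal (fst (\<theta> []) i powr \<beta>) * alive_sum \<alpha> n (\<lambda>y. ennreal (y powr \<beta> * f (r * fst (\<theta> []) i * y)))
       (fst (\<theta> []) i powr \<alpha> * (s - snd (\<theta> []))) (subtree i \<theta>))"
proof -
  have "(if 0 < x then alive_sum \<alpha> n (\<lambda>y. ennreal ((x * y) powr \<beta> * f (r * (x * y)))) t \<theta>' else 0) =
      ennreal (x powr \<beta>) * alive_sum \<alpha> n (\<lambda>y. ennreal (y powr \<beta> * f (r * x * y))) t \<theta>'" if "0 \<le> x" for x t \<theta>'
  proof (cases "0 < x")
    case True
    then show ?thesis
      unfolding alive_sum_cmult[symmetric]
      by (auto intro!: alive_sum_cong simp: powr_mult ennreal_mult' mult.assoc)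
  next
    case False
    then have "x = 0" using that by simp
    then show ?thesis by simp
  qed
  moreover have "0 \<le> fst (\<theta> []) i" for i using g by (simp add: good_def)
  ultimately show ?thesis unfolding alive_sum_eSuc[OF g] by simp
qed

text \<open>The decomposition holds for nonnegative terms in ennreal; applied to f and to -f, with
  the finite mass excluding a difference of infinities, it gives the signed series by
  subtraction.\<close>

lemma weighted_sum_sums:
  assumes g: "good \<theta>" and fin: "mass_sum (eSuc n) s \<theta> < \<infinity>" and f: "\<And>x. \<bar>f x\<bar> \<le> B"
  shows "(\<lambda>i. fst (\<theta> []) i powr \<beta> * weighted_sum n f (fst (\<theta> []) i powr \<alpha> * (s - snd (\<theta> []))) (r * fst (\<theta> []) i) (subtree i \<theta>))
    sums (weighted_sum (eSuc n) f s r \<theta> - (if 0 \<le> s \<and> s < snd (\<theta> []) then f r else 0))"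
proof -
  have B: "0 \<le> B" using f[of 0] by linarith
  define T where "T h i = ennreal (fst (\<theta> []) i powr \<beta>) * alive_sum \<alpha> n (\<lambda>y. ennreal (y powr \<beta> * h (r * fst (\<theta> []) i * y)))
       (fst (\<theta> []) i powr \<alpha> * (s - snd (\<theta> []))) (subtree i \<theta>)" for h i
  \<comment> \<open>The maximum with 0 mirrors the truncation by \<open>ennreal\<close> in the root
    term; the truncated terms of f and -f recombine to f r.\<close>
  define c where "c h = (if 0 \<le> s \<and> s < snd (\<theta> []) then max 0 (h r) else 0)" for h :: "real \<Rightarrow> real"
  have *: "(\<lambda>i. enn2real (T h i)) sums (enn2real (alive_sum \<alpha> (eSuc n) (\<lambda>y. ennreal (y powr \<beta> * h (r * y))) s \<theta>) - c h)"
    if h: "\<And>x. \<bar>h x\<bar> \<le> B" for h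
  proof -
    have "alive_sum \<alpha> (eSuc n) (\<lambda>y. ennreal (y powr \<beta> * h (r * y))) s \<theta> \<le> ennreal B * mass_sum (eSuc n) s \<theta>"
      by (rule alive_sum_le_mass[OF h B])
    also have "\<dots> < \<infinity>" using fin by (simp add: ennreal_mult_less_top)
    finally have fin': "alive_sum \<alpha> (eSuc n) (\<lambda>y. ennreal (y powr \<beta> * h (r * y))) s \<theta> < \<infinity>" .
    have eq: "alive_sum \<alpha> (eSuc n) (\<lambda>y. ennreal (y powr \<beta> * h (r * y))) s \<theta> = ennreal (c h) + (\<Sum>i. T h i)"
      unfolding alive_sum_weighted_eSuc[OF g] T_def c_def by (auto simp: max_def ennreal_neg)
    then have finT: "(\<Sum>i. T h i) < \<infinity>" using fin' by simp
    have "enn2real (alive_sum \<alpha> (eSuc n) (\<lambda>y. ennreal (y powr \<beta> * h (r * y))) s \<theta>) = c h + enn2real (\<Sum>i. T h i)"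
      unfolding eq using finT by (subst enn2real_plus) (auto simp: c_def)
    then show ?thesis using sums_enn2real[OF finT] by simp
  qed
  have D: "(\<lambda>i. enn2real (T f i) - enn2real (T (\<lambda>x. - f x) i)) sums
    ((enn2real (alive_sum \<alpha> (eSuc n) (\<lambda>y. ennreal (y powr \<beta> * f (r * y))) s \<theta>) - c f) -
     (enn2real (alive_sum \<alpha> (eSuc n) (\<lambda>y. ennreal (y powr \<beta> * - f (r * y))) s \<theta>) - c (\<lambda>x. - f x)))"
    using f by (intro sums_diff *) auto
  have cc: "c f - c (\<lambda>x. - f x) = (if 0 \<le> s \<and> s < snd (\<theta> []) then f r else 0)" by (auto simp: c_def)
  have TT: "enn2real (T f i) - enn2real (T (\<lambda>x. - f x) i) = fst (\<theta> []) i powr \<beta> *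
      weighted_sum n f (fst (\<theta> []) i powr \<alpha> * (s - snd (\<theta> []))) (r * fst (\<theta> []) i) (subtree i \<theta>)" for i
    unfolding T_def weighted_sum_def by (simp add: enn2real_mult right_diff_distrib)
  have "weighted_sum (eSuc n) f s r \<theta> - (if 0 \<le> s \<and> s < snd (\<theta> []) then f r else 0) =
    (enn2real (alive_sum \<alpha> (eSuc n) (\<lambda>y. ennreal (y powr \<beta> * f (r * y))) s \<theta>) - c f) -
     (enn2real (alive_sum \<alpha> (eSuc n) (\<lambda>y. ennreal (y powr \<beta> * - f (r * y))) s \<theta>) - c (\<lambda>x. - f x))"
    unfolding weighted_sum_def mult_minus_right cc[symmetric] by linarith
  then show ?thesis using D unfolding TT by (simp only:)
qed

lemma weighted_sum_measurable:
  assumes [measurable]: "f \<in> borel_measurable borel" "s \<in> borel_measurable L" "r \<in> borel_measurable L" "\<theta> \<in> measurable L P"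
  shows "(\<lambda>x. weighted_sum n f (s x) (r x) (\<theta> x)) \<in> borel_measurable L"
proof -
  have [measurable]: "(\<lambda>x. alive_sum \<alpha> n (\<lambda>y. ennreal (y powr \<beta> * f (r x * y))) (s x) (\<theta> x)) \<in> borel_measurable L"
    by (rule alive_sum_measurable) measurable
  have [measurable]: "(\<lambda>x. alive_sum \<alpha> n (\<lambda>y. ennreal (- (y powr \<beta> * f (r x * y)))) (s x) (\<theta> x)) \<in> borel_measurable L"
    by (rule alive_sum_measurable) measurable
  show ?thesis unfolding weighted_sum_def by measurable
qed

lemma fst_N_measurable [measurable]: "(\<lambda>x. fst x i) \<in> borel_measurable N"
  by (subst measurable_cong_sets[OF sets_N refl]) (rule ratio_component_measurable)

lemma snd_N_measurable [measurable]: "snd \<in> borel_measurable N"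
  by (subst measurable_cong_sets[OF sets_N refl]) measurable

end

section \<open>Second moment of the total mass\<close>

locale L2_fragmentation_law = fragmentation_law +
  assumes second_moment: "(\<integral>\<^sup>+\<xi>. (\<Sum>j. ennreal (\<xi> j powr \<beta>))\<^sup>2 \<partial>\<nu>) < \<infinity>"
    and tag_nonarithmetic: "\<not> (\<exists>r. 0 < r \<and> r < 1 \<and> (AE z in tag. \<exists>k::nat. z = r ^ k))"
begin

sublocale frag: tagged_fragment tag \<alpha> mom law
  by (rule tagged_fragment[OF tag_nonarithmetic])

text \<open>The characteristic function at 2\<beta>: size-biasing has already used one power
  \<beta>. Being below 1, it is the contraction factor of all second-moment recursions.\<close>

definition q2 :: real where "q2 = 1 - frag.psi0 \<beta>"

definition C2 :: real where "C2 = enn2real (\<integral>\<^sup>+\<xi>. (\<Sum>j. ennreal (\<xi> j powr \<beta>))\<^sup>2 \<partial>\<nu>)"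

lemma q2: "0 \<le> q2" "q2 < 1"
proof -
  show "q2 < 1" using frag.psi0_pos[OF \<beta>] by (simp add: q2_def)
  have "0 \<le> (\<integral>z. z powr \<beta> \<partial>tag)" by simp
  then show "0 \<le> q2" by (simp add: q2_def frag.psi0_def)
qed

lemma nn_integral_tag_powr: "(\<integral>\<^sup>+z. ennreal (z powr \<beta>) \<partial>tag) = ennreal q2"
  unfolding q2_def frag.psi0_def using frag.powr_integrable[of \<beta>] \<beta>
  by (subst nn_integral_eq_integral) auto

lemma nn_integral_N_squares: "(\<integral>\<^sup>+x. (\<Sum>i. (ennreal (fst x i powr \<beta>))\<^sup>2) \<partial>N) = ennreal q2"
proof -
  interpret E: prob_space E by (rule prob_space_E)
  show ?thesis
    using nn_integral_marks[of "\<lambda>z e. ennreal (z powr \<beta>)"] E.emeasure_space_1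
    by (simp add: nn_integral_tag_powr power2_eq_square)
qed

lemma nn_integral_N_sum: "(\<integral>\<^sup>+x. (\<Sum>i. ennreal (fst x i powr \<beta>)) \<partial>N) = 1"
proof -
  interpret E: prob_space E by (rule prob_space_E)
  have "(\<integral>\<^sup>+x. (\<Sum>i. ennreal (fst x i powr \<beta>) * 1) \<partial>N) = (\<integral>\<^sup>+e. \<integral>\<^sup>+z. 1 \<partial>tag \<partial>E)"
    by (rule nn_integral_marks) simp
  also have "\<dots> = 1"
    unfolding nn_integral_const tag.emeasure_space_1 E.emeasure_space_1 by simp
  finally show ?thesis by simp
qed

lemma C2_nonneg: "0 \<le> C2" by (simp add: C2_def)

lemma nn_integral_N_square_sum: "(\<integral>\<^sup>+x. (\<Sum>i. ennreal (fst x i powr \<beta>))\<^sup>2 \<partial>N) = ennreal C2"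
proof -
  interpret E: prob_space E by (rule prob_space_E)
  interpret pair_sigma_finite \<nu> E ..
  have [measurable]: "(\<lambda>x. fst x i) \<in> borel_measurable (\<nu> \<Otimes>\<^sub>M E)" for i
    by (rule measurable_compose[OF measurable_fst component_measurable])
  have "(\<integral>\<^sup>+x. (\<Sum>i. ennreal (fst x i powr \<beta>))\<^sup>2 \<partial>N) = (\<integral>\<^sup>+e. \<integral>\<^sup>+\<xi>. (\<Sum>j. ennreal (\<xi> j powr \<beta>))\<^sup>2 \<partial>\<nu> \<partial>E)"
    unfolding mark_law_def by (subst nn_integral_snd[symmetric]) auto
  also have "\<dots> = (\<integral>\<^sup>+\<xi>. (\<Sum>j. ennreal (\<xi> j powr \<beta>))\<^sup>2 \<partial>\<nu>)" using E.emeasure_space_1 by simp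
  finally show ?thesis using second_moment by (simp add: C2_def)
qed

lemma ennreal_square_le: "(1 + x)\<^sup>2 \<le> 2 + 2 * x\<^sup>2" for x :: ennreal
proof (cases x)
  case (real y)
  have "(1 + y)\<^sup>2 \<le> 2 + 2 * y\<^sup>2" using zero_le_power2[of "1 - y"] by (simp add: power2_eq_square algebra_simps)
  then have "ennreal ((1 + y)\<^sup>2) \<le> ennreal (2 + 2 * y\<^sup>2)" by (rule ennreal_leI)
  then show ?thesis using real by (simp add: ennreal_plus ennreal_mult flip: ennreal_power ennreal_1 ennreal_numeral)
next
  case top
  then show ?thesis by (simp add: ennreal_mult_top)
qed

text \<open>The fixed point of K -> 2 + 2 C2 + q2 K, the map that the second-moment recursion
  produces; it bounds all iterates started from 0.\<close>

definition Kmax :: real where "Kmax = (2 + 2 * C2) / (1 - q2)"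

lemma Kmax: "0 \<le> Kmax" "2 + 2 * C2 + q2 * Kmax = Kmax"
proof -
  show "0 \<le> Kmax" unfolding Kmax_def using q2 C2_nonneg by (intro divide_nonneg_pos) auto
  have "Kmax * (1 - q2) = 2 + 2 * C2" unfolding Kmax_def using q2 by simp
  then show "2 + 2 * C2 + q2 * Kmax = Kmax" by (simp add: right_diff_distrib mult.commute)
qed

lemma nn_integral_mass: "(\<integral>\<^sup>+\<theta>. mass_sum \<infinity> s \<theta> \<partial>P) \<le> 1"
proof (cases "0 \<le> s")
  case True
  interpret L: prob_space "law s" by (rule frag.prob_space_law[OF True])
  have "(\<integral>\<^sup>+\<theta>. mass_sum \<infinity> s \<theta> \<partial>P) = (\<integral>\<^sup>+y. 1 \<partial>law s)"
    by (subst nn_integral_law) auto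
  then show ?thesis by (simp add: L.emeasure_space_1)
next
  case False
  have "(\<integral>\<^sup>+\<theta>. mass_sum \<infinity> s \<theta> \<partial>P) = (\<integral>\<^sup>+\<theta>. 0 \<partial>P)"
    by (rule nn_integral_cong_AE) (use AE_good in \<open>eventually_elim, use False in \<open>simp add: alive_sum_neg\<close>\<close>)
  then show ?thesis by simp
qed

lemma mass_sum_le: "mass_sum n s \<theta> \<le> mass_sum \<infinity> s \<theta>"
  by (rule alive_sum_mono_gen) simp

lemma AE_mass_finite: "AE \<theta> in P. mass_sum n s \<theta> < \<infinity>"
proof -
  have "AE \<theta> in P. mass_sum \<infinity> s \<theta> \<noteq> \<infinity>"
    using nn_integral_mass[of s] by (intro nn_integral_PInf_AE) (auto simp: top_unique)
  then show ?thesis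
    by eventually_elim (use mass_sum_le[of n s] in \<open>auto simp: less_top intro: le_less_trans\<close>)
qed

lemma mean_mass_le: "\<bar>\<integral>\<theta>. enn2real (mass_sum n s \<theta>) \<partial>P\<bar> \<le> 1"
proof -
  have "(\<integral>\<theta>. enn2real (mass_sum n s \<theta>) \<partial>P) = enn2real (\<integral>\<^sup>+\<theta>. ennreal (enn2real (mass_sum n s \<theta>)) \<partial>P)"
    by (intro integral_eq_nn_integral) auto
  also have "(\<integral>\<^sup>+\<theta>. ennreal (enn2real (mass_sum n s \<theta>)) \<partial>P) \<le> (\<integral>\<^sup>+\<theta>. mass_sum \<infinity> s \<theta> \<partial>P)"
    by (intro nn_integral_mono order_trans[OF ennreal_enn2real_le' mass_sum_le])
  then have "enn2real (\<integral>\<^sup>+\<theta>. ennreal (enn2real (mass_sum n s \<theta>)) \<partial>P) \<le> 1"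
    using nn_integral_mass[of s] by (intro enn2real_leI) auto
  finally show ?thesis by simp
qed

text \<open>The recursion cannot by itself exclude an infinite second moment, so it is run from
  generation 0 upwards, where the bound is trivial. The means are at most 1, which turns the second
  part of \<open>second_moment_step\<close> into (1 + sum of weights)^2.\<close>

lemma mass_second_moment_finite_gen:
  "(\<integral>\<^sup>+\<theta>. ennreal ((enn2real (mass_sum (enat n) s \<theta>))\<^sup>2) \<partial>P) \<le> ennreal Kmax"
proof (induction n arbitrary: s)
  case 0
  then show ?case by (simp add: zero_enat_def[symmetric] alive_sum_0)
next
  case (Suc n)
  define a where "a x = (if 0 \<le> s \<and> s < snd x then 1 else 0 :: real)" for x :: mark
  define h where "h x i \<theta> = fst x i powr \<beta> * enn2real (mass_sum (enat n) (fst x i powr \<alpha> * (s - snd x)) \<theta>)" for x :: mark and i \<theta>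
  have w: "weighted_sum m (\<lambda>_. 1) t 1 \<theta> = enn2real (mass_sum m t \<theta>)" for m t \<theta>
    by (simp add: weighted_sum_def alive_sum_def ennreal_neg cong: if_cong)
  have wr: "weighted_sum m (\<lambda>_. 1) t r \<theta> = enn2real (mass_sum m t \<theta>)" for m t r \<theta>
    using w[of m t \<theta>] by (simp add: weighted_sum_def)
  have "(\<integral>\<^sup>+\<theta>. ennreal ((enn2real (mass_sum (enat (Suc n)) s \<theta>))\<^sup>2) \<partial>P) \<le>
    (\<integral>\<^sup>+x. (\<Sum>i. \<integral>\<^sup>+\<theta>. ennreal ((h x i \<theta>)\<^sup>2) \<partial>P) + (ennreal \<bar>a x\<bar> + (\<Sum>i. ennreal \<bar>\<integral>\<theta>. h x i \<theta> \<partial>P\<bar>))\<^sup>2 \<partial>N)"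
  proof (rule second_moment_step)
    show "a \<in> borel_measurable N" unfolding a_def by measurable
    have "(\<lambda>x. mass_sum (enat n) (fst (fst x) i powr \<alpha> * (s - snd (fst x))) (snd x)) \<in> borel_measurable (N \<Otimes>\<^sub>M P)" for i
      by (rule alive_sum_measurable) measurable
    then show "(\<lambda>x. h (fst x) i (snd x)) \<in> borel_measurable (N \<Otimes>\<^sub>M P)" for i
      unfolding h_def by measurable
    show "AE \<theta> in P. (\<lambda>i. h (\<theta> []) i (subtree i \<theta>)) sums (enn2real (mass_sum (enat (Suc n)) s \<theta>) - a (\<theta> []))"
      using AE_good AE_mass_finite[of "enat (Suc n)" s]
    proof eventually_elim
      case (elim \<theta>)
      show ?case
        using weighted_sum_sums[OF elim(1), of "enat n" s "\<lambda>_. 1" 1 1] elim(2)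
        by (simp add: eSuc_enat wr h_def a_def)
    qed
  qed
  also have "\<dots> \<le> (\<integral>\<^sup>+x. (\<Sum>i. (ennreal (fst x i powr \<beta>))\<^sup>2) * ennreal Kmax + (2 + 2 * (\<Sum>i. ennreal (fst x i powr \<beta>))\<^sup>2) \<partial>N)"
  proof (intro nn_integral_mono add_mono)
    fix x
    have "(\<integral>\<^sup>+\<theta>. ennreal ((h x i \<theta>)\<^sup>2) \<partial>P) \<le> (ennreal (fst x i powr \<beta>))\<^sup>2 * ennreal Kmax" for i
    proof -
      have "(\<integral>\<^sup>+\<theta>. ennreal ((h x i \<theta>)\<^sup>2) \<partial>P) = (\<integral>\<^sup>+\<theta>. (ennreal (fst x i powr \<beta>))\<^sup>2 * ennreal ((enn2real (mass_sum (enat n) (fst x i powr \<alpha> * (s - snd x)) \<theta>))\<^sup>2) \<partial>P)"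
        by (simp add: h_def power_mult_distrib ennreal_mult ennreal_power)
      also have "\<dots> = (ennreal (fst x i powr \<beta>))\<^sup>2 * (\<integral>\<^sup>+\<theta>. ennreal ((enn2real (mass_sum (enat n) (fst x i powr \<alpha> * (s - snd x)) \<theta>))\<^sup>2) \<partial>P)"
        by (rule nn_integral_cmult) measurable
      also have "\<dots> \<le> (ennreal (fst x i powr \<beta>))\<^sup>2 * ennreal Kmax" by (intro mult_left_mono Suc.IH) auto
      finally show ?thesis .
    qed
    then show "(\<Sum>i. \<integral>\<^sup>+\<theta>. ennreal ((h x i \<theta>)\<^sup>2) \<partial>P) \<le> (\<Sum>i. (ennreal (fst x i powr \<beta>))\<^sup>2) * ennreal Kmax"
      unfolding ennreal_suminf_multc[symmetric] by (intro suminf_le) auto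
    have "ennreal \<bar>\<integral>\<theta>. h x i \<theta> \<partial>P\<bar> \<le> ennreal (fst x i powr \<beta>)" for i
      using mult_left_mono[OF mean_mass_le[of "enat n" "fst x i powr \<alpha> * (s - snd x)"], of "fst x i powr \<beta>"]
      unfolding h_def by (intro ennreal_leI) (simp add: abs_mult)
    then have "(\<Sum>i. ennreal \<bar>\<integral>\<theta>. h x i \<theta> \<partial>P\<bar>) \<le> (\<Sum>i. ennreal (fst x i powr \<beta>))" by (intro suminf_le) auto
    then have "(ennreal \<bar>a x\<bar> + (\<Sum>i. ennreal \<bar>\<integral>\<theta>. h x i \<theta> \<partial>P\<bar>))\<^sup>2 \<le> (1 + (\<Sum>i. ennreal (fst x i powr \<beta>)))\<^sup>2"
      by (intro power_mono add_mono) (auto simp: a_def)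
    also have "\<dots> \<le> 2 + 2 * (\<Sum>i. ennreal (fst x i powr \<beta>))\<^sup>2" by (rule ennreal_square_le)
    finally show "(ennreal \<bar>a x\<bar> + (\<Sum>i. ennreal \<bar>\<integral>\<theta>. h x i \<theta> \<partial>P\<bar>))\<^sup>2 \<le> 2 + 2 * (\<Sum>i. ennreal (fst x i powr \<beta>))\<^sup>2" .
  qed
  also have "\<dots> = ennreal q2 * ennreal Kmax + (2 + 2 * ennreal C2)"
    by (subst nn_integral_add, measurable, subst nn_integral_multc, measurable, subst nn_integral_add, measurable, subst nn_integral_cmult, measurable)
       (simp add: nn_integral_N_squares nn_integral_N_square_sum mk.emeasure_space_1)
  also have "\<dots> = ennreal (2 + 2 * C2 + q2 * Kmax)"
    using q2(1) Kmax(1) C2_nonneg by (simp add: ennreal_plus ennreal_mult add.commute flip: ennreal_numeral)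
  finally show ?case unfolding Kmax(2) .
qed

theorem mass_second_moment:
  "(\<integral>\<^sup>+\<theta>. (mass_sum \<infinity> s \<theta>)\<^sup>2 \<partial>P) \<le> ennreal Kmax"
proof -
  have inc: "incseq (\<lambda>n. mass_sum (enat n) s \<theta>)" for \<theta>
    by (auto simp: incseq_def intro!: alive_sum_mono_gen)
  have "(\<integral>\<^sup>+\<theta>. (mass_sum \<infinity> s \<theta>)\<^sup>2 \<partial>P) = (\<integral>\<^sup>+\<theta>. liminf (\<lambda>n. (mass_sum (enat n) s \<theta>)\<^sup>2) \<partial>P)"
  proof (rule nn_integral_cong_AE)
    show "AE \<theta> in P. (mass_sum \<infinity> s \<theta>)\<^sup>2 = liminf (\<lambda>n. (mass_sum (enat n) s \<theta>)\<^sup>2)"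
      using AE_mass_finite[of \<infinity> s]
    proof eventually_elim
      case (elim \<theta>)
      have "(\<lambda>n. mass_sum (enat n) s \<theta>) \<longlonglongrightarrow> mass_sum \<infinity> s \<theta>"
        unfolding alive_sum_SUP[of _ "\<lambda>y. ennreal (y powr \<beta>)"] by (rule LIMSEQ_SUP[OF inc])
      then have "(\<lambda>n. mass_sum (enat n) s \<theta> * mass_sum (enat n) s \<theta>) \<longlonglongrightarrow> mass_sum \<infinity> s \<theta> * mass_sum \<infinity> s \<theta>"
        using elim by (intro tendsto_mult_ennreal) auto
      then have "(\<lambda>n. (mass_sum (enat n) s \<theta>)\<^sup>2) \<longlonglongrightarrow> (mass_sum \<infinity> s \<theta>)\<^sup>2" by (simp add: power2_eq_square)
      then show ?case using lim_imp_Liminf[of sequentially] by force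
    qed
  qed
  also have "\<dots> \<le> liminf (\<lambda>n. \<integral>\<^sup>+\<theta>. (mass_sum (enat n) s \<theta>)\<^sup>2 \<partial>P)"
    by (rule nn_integral_liminf) measurable
  also have "\<dots> \<le> ennreal Kmax"
  proof (rule Liminf_le)
    have "(\<integral>\<^sup>+\<theta>. (mass_sum (enat n) s \<theta>)\<^sup>2 \<partial>P) \<le> ennreal Kmax" for n
    proof -
      have "(\<integral>\<^sup>+\<theta>. (mass_sum (enat n) s \<theta>)\<^sup>2 \<partial>P) = (\<integral>\<^sup>+\<theta>. ennreal ((enn2real (mass_sum (enat n) s \<theta>))\<^sup>2) \<partial>P)"
        by (rule nn_integral_cong_AE)
           (use AE_mass_finite[of "enat n" s] in \<open>eventually_elim, simp flip: ennreal_power add: less_top\<close>)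
      then show ?thesis using mass_second_moment_finite_gen[of n s] by (rule ord_eq_le_trans)
    qed
    then show "\<forall>\<^sub>F n in sequentially. (\<integral>\<^sup>+\<theta>. (mass_sum (enat n) s \<theta>)\<^sup>2 \<partial>P) \<le> ennreal Kmax"
      by (intro always_eventually allI)
  qed (rule sequentially_bot)
  finally show ?thesis .
qed

end

subsection \<open>The intrinsic martingale\<close>

text \<open>Cauchy-Schwarz with weights q^i bounds the square of a tail sum of increments by the
  geometric tail times the weighted sum of squares. The rate is pathwise, so almost sure convergence
  and, after integration, convergence in L^2 come together.\<close>

lemma geometric_increments:
  fixes m :: "nat \<Rightarrow> real"
  assumes q: "0 < q" "q < 1" and y: "summable (\<lambda>i. (m (Suc i) - m i)\<^sup>2 / q ^ i)"
    and W: "(\<Sum>i. (m (Suc i) - m i)\<^sup>2 / q ^ i) \<le> W"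
  shows "convergent m" and "(lim m - m k)\<^sup>2 \<le> q ^ k / (1 - q) * W"
proof -
  define d where "d i = m (Suc i) - m i" for i
  have W0: "0 \<le> W" using suminf_nonneg[OF y] W q by simp
  have incr: "(m j - m k)\<^sup>2 \<le> q ^ k / (1 - q) * W" if "k \<le> j" for j k
  proof -
    have "m j - m k = (\<Sum>i = k..<j. sqrt (q ^ i) * (d i / sqrt (q ^ i)))"
      using that q by (simp add: d_def sum_Suc_diff')
    then have "(m j - m k)\<^sup>2 \<le> (\<Sum>i = k..<j. (sqrt (q ^ i))\<^sup>2) * (\<Sum>i = k..<j. (d i / sqrt (q ^ i))\<^sup>2)"
      by (simp only: Cauchy_Schwarz_ineq_sum)
    also have "\<dots> = (\<Sum>i = k..<j. q ^ i) * (\<Sum>i = k..<j. (d i)\<^sup>2 / q ^ i)"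
      using q by (simp add: power_divide)
    also have "\<dots> \<le> q ^ k / (1 - q) * W"
    proof (rule mult_mono)
      have "(\<Sum>i = k..<j. q ^ i) = (\<Sum>i<j - k. q ^ (i + k))"
        using that sum.shift_bounds_nat_ivl[of "\<lambda>i. q ^ i" 0 k "j - k"] by (simp add: lessThan_atLeast0)
      also have "\<dots> = q ^ k * (\<Sum>i<j - k. q ^ i)" by (simp add: sum_distrib_left power_add mult.commute)
      also have "\<dots> \<le> q ^ k * (1 / (1 - q))"
      proof (rule mult_left_mono)
        have "(\<Sum>i<j - k. q ^ i) \<le> (\<Sum>i. q ^ i)" using q by (intro sum_le_suminf summable_geometric) auto
        then show "(\<Sum>i<j - k. q ^ i) \<le> 1 / (1 - q)" using q by (simp add: suminf_geometric)
      qed (use q in auto)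
      finally show "(\<Sum>i = k..<j. q ^ i) \<le> q ^ k / (1 - q)" by simp
      have "(\<Sum>i = k..<j. (d i)\<^sup>2 / q ^ i) \<le> (\<Sum>i. (d i)\<^sup>2 / q ^ i)"
        using y q by (intro sum_le_suminf) (auto simp: d_def)
      then show "(\<Sum>i = k..<j. (d i)\<^sup>2 / q ^ i) \<le> W" using W by (simp add: d_def)
    qed (use q in \<open>auto intro!: sum_nonneg\<close>)
    finally show ?thesis .
  qed
  have "Cauchy m"
  proof (rule CauchyI)
    fix \<epsilon> :: real assume \<epsilon>: "0 < \<epsilon>"
    have "(\<lambda>k. q ^ k / (1 - q) * W) \<longlonglongrightarrow> 0 / (1 - q) * W"
      using q by (intro tendsto_intros LIMSEQ_power_zero) auto
    then have "\<forall>\<^sub>F k in sequentially. q ^ k / (1 - q) * W < (\<epsilon> / 2)\<^sup>2"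
      using \<epsilon> by (intro order_tendstoD(2)) auto
    then obtain K where K: "q ^ K / (1 - q) * W < (\<epsilon> / 2)\<^sup>2" by (auto simp: eventually_sequentially)
    have "\<bar>m j - m K\<bar> < \<epsilon> / 2" if "K \<le> j" for j
      using incr[OF that] K \<epsilon> by (intro power2_less_imp_less[of _ "\<epsilon> / 2"]) auto
    then have "norm (m i - m j) < \<epsilon>" if "K \<le> i" "K \<le> j" for i j
      using that by (smt (verit) real_norm_def field_sum_of_halves)
    then show "\<exists>K. \<forall>i\<ge>K. \<forall>j\<ge>K. norm (m i - m j) < \<epsilon>" by blast
  qed
  then show conv: "convergent m" by (simp add: Cauchy_convergent_iff)
  then have "m \<longlonglongrightarrow> lim m" by (simp add: convergent_LIMSEQ_iff)
  then have "(\<lambda>j. (m j - m k)\<^sup>2) \<longlonglongrightarrow> (lim m - m k)\<^sup>2" by (intro tendsto_intros)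
  then show "(lim m - m k)\<^sup>2 \<le> q ^ k / (1 - q) * W"
    by (rule LIMSEQ_le_const2) (use incr in blast)
qed

context L2_fragmentation_law
begin

definition mart :: "nat \<Rightarrow> (node \<Rightarrow> mark) \<Rightarrow> real" where
  "mart n \<theta> = enn2real (gen_sum \<beta> n \<theta>)"

lemma nn_integral_gen_sum: "(\<integral>\<^sup>+\<theta>. gen_sum \<beta> n \<theta> \<partial>P) = 1"
proof (induction n)
  case 0
  then show ?case by (simp add: gen_sum_0 tree.emeasure_space_1)
next
  case (Suc n)
  have [measurable]: "(\<lambda>\<theta>. fst (\<theta> []) i) \<in> borel_measurable P" for i
    using ratio_measurable[of "[]" i] by (simp add: ratio_def)
  have [measurable]: "(\<lambda>\<theta>. gen_sum \<beta> n (subtree i \<theta>)) \<in> borel_measurable P" for i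
    by (rule measurable_compose[OF subtree_measurable gen_sum_measurable])
  have "(\<integral>\<^sup>+\<theta>. gen_sum \<beta> (Suc n) \<theta> \<partial>P) = (\<integral>\<^sup>+\<theta>. (\<Sum>i. ennreal (fst (\<theta> []) i powr \<beta>) * gen_sum \<beta> n (subtree i \<theta>)) \<partial>P)"
    by (rule nn_integral_cong_AE) (use AE_good in \<open>eventually_elim, simp add: gen_sum_Suc\<close>)
  also have "\<dots> = (\<Sum>i. \<integral>\<^sup>+\<theta>. ennreal (fst (\<theta> []) i powr \<beta>) * gen_sum \<beta> n (subtree i \<theta>) \<partial>P)"
    by (rule nn_integral_suminf) measurable
  also have "\<dots> = (\<Sum>i. \<integral>\<^sup>+x. ennreal (fst x i powr \<beta>) \<partial>N)"
  proof (rule suminf_cong)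
    fix i
    show "(\<integral>\<^sup>+\<theta>. ennreal (fst (\<theta> []) i powr \<beta>) * gen_sum \<beta> n (subtree i \<theta>) \<partial>P) = (\<integral>\<^sup>+x. ennreal (fst x i powr \<beta>) \<partial>N)"
      by (subst nn_integral_subtree[where F = "\<lambda>x \<theta>. ennreal (fst x i powr \<beta>) * gen_sum \<beta> n \<theta>"])
         (auto intro!: nn_integral_cong simp: nn_integral_cmult Suc.IH)
  qed
  also have "\<dots> = (\<integral>\<^sup>+x. (\<Sum>i. ennreal (fst x i powr \<beta>)) \<partial>N)"
    by (rule nn_integral_suminf[symmetric]) measurable
  finally show ?case by (simp add: nn_integral_N_sum)
qed

lemma AE_gen_sum_finite: "AE \<theta> in P. \<forall>n. gen_sum \<beta> n \<theta> < \<infinity>"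
  unfolding AE_all_countable
proof
  fix n
  have "AE \<theta> in P. gen_sum \<beta> n \<theta> \<noteq> \<infinity>"
    by (rule nn_integral_PInf_AE) (auto simp: nn_integral_gen_sum)
  then show "AE \<theta> in P. gen_sum \<beta> n \<theta> < \<infinity>" by eventually_elim (simp add: less_top)
qed

lemma mart_measurable [measurable]: "mart n \<in> borel_measurable P"
  unfolding mart_def[abs_def] by measurable

lemma mart_nonneg: "0 \<le> mart n \<theta>"
  by (simp add: mart_def)

lemma mart_mean: "integrable P (mart n)" "(\<integral>\<theta>. mart n \<theta> \<partial>P) = 1"
proof -
  have "(\<integral>\<^sup>+\<theta>. ennreal (mart n \<theta>) \<partial>P) = (\<integral>\<^sup>+\<theta>. gen_sum \<beta> n \<theta> \<partial>P)"
    by (rule nn_integral_cong_AE) (use AE_gen_sum_finite in \<open>eventually_elim, simp add: mart_def less_top\<close>)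
  then have nn: "(\<integral>\<^sup>+\<theta>. ennreal (mart n \<theta>) \<partial>P) = ennreal 1" by (simp add: nn_integral_gen_sum)
  show "integrable P (mart n)"
    by (rule integrableI_nn_integral_finite[OF _ _ nn]) (auto simp: mart_def)
  show "(\<integral>\<theta>. mart n \<theta> \<partial>P) = 1"
    by (subst integral_eq_nn_integral) (auto simp: nn mart_nonneg)
qed

lemma mart_sums: "AE \<theta> in P. \<forall>n. (\<lambda>i. fst (\<theta> []) i powr \<beta> * mart n (subtree i \<theta>)) sums mart (Suc n) \<theta>"
  using AE_good AE_gen_sum_finite
proof eventually_elim
  case (elim \<theta>)
  show ?case
  proof
    fix n
    have eq: "gen_sum \<beta> (Suc n) \<theta> = (\<Sum>i. ennreal (fst (\<theta> []) i powr \<beta>) * gen_sum \<beta> n (subtree i \<theta>))"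
      by (rule gen_sum_Suc[OF elim(1)])
    have "(\<Sum>i. ennreal (fst (\<theta> []) i powr \<beta>) * gen_sum \<beta> n (subtree i \<theta>)) < \<infinity>"
      using elim(2) unfolding eq[symmetric] by blast
    from sums_enn2real[OF this]
    show "(\<lambda>i. fst (\<theta> []) i powr \<beta> * mart n (subtree i \<theta>)) sums mart (Suc n) \<theta>"
      by (simp add: mart_def eq enn2real_mult)
  qed
qed

text \<open>The second-moment step with no root term: q2 contracts the second moment, and means
  enter only through m. With m = 1 it bounds the martingale; with m = 0 it makes the increments
  decay geometrically.\<close>

lemma generation_step:
  assumes [measurable]: "v \<in> borel_measurable P"
    and u: "AE \<theta> in P. (\<lambda>i. fst (\<theta> []) i powr \<beta> * v (subtree i \<theta>)) sums u \<theta>"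
    and sq: "(\<integral>\<^sup>+\<theta>. ennreal ((v \<theta>)\<^sup>2) \<partial>P) \<le> ennreal B" "0 \<le> B" and mean: "\<bar>\<integral>\<theta>. v \<theta> \<partial>P\<bar> \<le> m"
  shows "(\<integral>\<^sup>+\<theta>. ennreal ((u \<theta>)\<^sup>2) \<partial>P) \<le> ennreal (q2 * B + m\<^sup>2 * C2)"
proof -
  have m: "0 \<le> m" using mean by linarith
  let ?S = "\<lambda>x :: mark. (\<Sum>i. ennreal (fst x i powr \<beta>))" and ?Q = "\<lambda>x :: mark. (\<Sum>i. (ennreal (fst x i powr \<beta>))\<^sup>2)"
  have "(\<integral>\<^sup>+\<theta>. ennreal ((u \<theta>)\<^sup>2) \<partial>P) \<le>
    (\<integral>\<^sup>+x. (\<Sum>i. \<integral>\<^sup>+\<theta>. ennreal ((fst x i powr \<beta> * v \<theta>)\<^sup>2) \<partial>P) + (ennreal \<bar>0\<bar> + (\<Sum>i. ennreal \<bar>\<integral>\<theta>. fst x i powr \<beta> * v \<theta> \<partial>P\<bar>))\<^sup>2 \<partial>N)"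
    by (rule second_moment_step[where h = "\<lambda>x i \<theta>. fst x i powr \<beta> * v \<theta>" and a = "\<lambda>_. 0"]) (measurable, use u in simp)
  also have "\<dots> \<le> (\<integral>\<^sup>+x. ?Q x * ennreal B + ennreal (m\<^sup>2) * (?S x)\<^sup>2 \<partial>N)"
  proof (intro nn_integral_mono add_mono)
    fix x :: mark
    have "(\<integral>\<^sup>+\<theta>. ennreal ((fst x i powr \<beta> * v \<theta>)\<^sup>2) \<partial>P) \<le> (ennreal (fst x i powr \<beta>))\<^sup>2 * ennreal B" for i
    proof -
      have "(\<integral>\<^sup>+\<theta>. ennreal ((fst x i powr \<beta> * v \<theta>)\<^sup>2) \<partial>P) = (ennreal (fst x i powr \<beta>))\<^sup>2 * (\<integral>\<^sup>+\<theta>. ennreal ((v \<theta>)\<^sup>2) \<partial>P)"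
        by (subst nn_integral_cmult[symmetric]) (auto simp: power_mult_distrib ennreal_mult ennreal_power)
      then show ?thesis using sq by (simp add: mult_left_mono)
    qed
    then show "(\<Sum>i. \<integral>\<^sup>+\<theta>. ennreal ((fst x i powr \<beta> * v \<theta>)\<^sup>2) \<partial>P) \<le> ?Q x * ennreal B"
      unfolding ennreal_suminf_multc[symmetric] by (intro suminf_le) auto
    have "(\<Sum>i. ennreal \<bar>\<integral>\<theta>. fst x i powr \<beta> * v \<theta> \<partial>P\<bar>) \<le> (\<Sum>i. ennreal m * ennreal (fst x i powr \<beta>))"
    proof (intro suminf_le)
      fix i
      have "\<bar>\<integral>\<theta>. fst x i powr \<beta> * v \<theta> \<partial>P\<bar> \<le> m * fst x i powr \<beta>"
        using mult_right_mono[OF mean, of "fst x i powr \<beta>"] by (simp add: abs_mult mult.commute)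
      then show "ennreal \<bar>\<integral>\<theta>. fst x i powr \<beta> * v \<theta> \<partial>P\<bar> \<le> ennreal m * ennreal (fst x i powr \<beta>)"
        using m by (simp add: ennreal_leI flip: ennreal_mult)
    qed auto
    then have "(ennreal \<bar>0\<bar> + (\<Sum>i. ennreal \<bar>\<integral>\<theta>. fst x i powr \<beta> * v \<theta> \<partial>P\<bar>))\<^sup>2 \<le> (ennreal m * ?S x)\<^sup>2"
      by (intro power_mono) auto
    also have "\<dots> = ennreal (m\<^sup>2) * (?S x)\<^sup>2" using m by (simp add: power_mult_distrib ennreal_power)
    finally show "(ennreal \<bar>0\<bar> + (\<Sum>i. ennreal \<bar>\<integral>\<theta>. fst x i powr \<beta> * v \<theta> \<partial>P\<bar>))\<^sup>2 \<le> ennreal (m\<^sup>2) * (?S x)\<^sup>2" .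
  qed
  also have "\<dots> = ennreal q2 * ennreal B + ennreal (m\<^sup>2) * ennreal C2"
    by (subst nn_integral_add, measurable, subst nn_integral_multc, measurable, subst nn_integral_cmult, measurable)
       (simp add: nn_integral_N_squares nn_integral_N_square_sum)
  also have "\<dots> = ennreal (q2 * B + m\<^sup>2 * C2)"
    using q2(1) sq(2) C2_nonneg by (simp add: ennreal_plus ennreal_mult)
  finally show ?thesis .
qed

lemma mart_second_moment: "(\<integral>\<^sup>+\<theta>. ennreal ((mart n \<theta>)\<^sup>2) \<partial>P) \<le> ennreal Kmax"
proof (induction n)
  case 0
  have "1 \<le> Kmax" using Kmax(2) mult_nonneg_nonneg[OF q2(1) Kmax(1)] C2_nonneg by linarith
  then show ?case by (simp add: mart_def gen_sum_0 tree.emeasure_space_1)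
next
  case (Suc n)
  have "AE \<theta> in P. (\<lambda>i. fst (\<theta> []) i powr \<beta> * mart n (subtree i \<theta>)) sums mart (Suc n) \<theta>"
    using mart_sums by eventually_elim blast
  from generation_step[OF mart_measurable this Suc Kmax(1), of 1] mart_mean(2)[of n]
  have "(\<integral>\<^sup>+\<theta>. ennreal ((mart (Suc n) \<theta>)\<^sup>2) \<partial>P) \<le> ennreal (q2 * Kmax + C2)" by simp
  also have "\<dots> \<le> ennreal Kmax" using Kmax(2) C2_nonneg by (intro ennreal_leI) linarith
  finally show ?case .
qed

lemma nn_integral_square_diff_le:
  assumes [measurable]: "u \<in> borel_measurable P" "v \<in> borel_measurable P"
    and u: "(\<integral>\<^sup>+\<theta>. ennreal ((u \<theta>)\<^sup>2) \<partial>P) \<le> ennreal a" and v: "(\<integral>\<^sup>+\<theta>. ennreal ((v \<theta>)\<^sup>2) \<partial>P) \<le> ennreal b"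
    and ab: "0 \<le> a" "0 \<le> b"
  shows "(\<integral>\<^sup>+\<theta>. ennreal ((u \<theta> - v \<theta>)\<^sup>2) \<partial>P) \<le> ennreal (2 * a + 2 * b)"
proof -
  have le: "(x - y)\<^sup>2 \<le> 2 * x\<^sup>2 + 2 * y\<^sup>2" for x y :: real
    using zero_le_power2[of "x + y"] by (simp add: power2_eq_square algebra_simps)
  have "(\<integral>\<^sup>+\<theta>. ennreal ((u \<theta> - v \<theta>)\<^sup>2) \<partial>P) \<le> (\<integral>\<^sup>+\<theta>. ennreal 2 * ennreal ((u \<theta>)\<^sup>2) + ennreal 2 * ennreal ((v \<theta>)\<^sup>2) \<partial>P)"
  proof (intro nn_integral_mono)
    fix \<theta>
    have "ennreal 2 * ennreal ((u \<theta>)\<^sup>2) + ennreal 2 * ennreal ((v \<theta>)\<^sup>2) = ennreal (2 * (u \<theta>)\<^sup>2 + 2 * (v \<theta>)\<^sup>2)"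
      by (subst ennreal_plus) (simp_all add: ennreal_mult)
    then show "ennreal ((u \<theta> - v \<theta>)\<^sup>2) \<le> ennreal 2 * ennreal ((u \<theta>)\<^sup>2) + ennreal 2 * ennreal ((v \<theta>)\<^sup>2)"
      using le[of "u \<theta>" "v \<theta>"] by (simp only: ennreal_leI)
  qed
  also have "\<dots> = ennreal 2 * (\<integral>\<^sup>+\<theta>. ennreal ((u \<theta>)\<^sup>2) \<partial>P) + ennreal 2 * (\<integral>\<^sup>+\<theta>. ennreal ((v \<theta>)\<^sup>2) \<partial>P)"
    by (subst nn_integral_add, measurable, subst nn_integral_cmult, measurable, subst nn_integral_cmult, measurable)
  also have "\<dots> \<le> ennreal 2 * ennreal a + ennreal 2 * ennreal b"
    by (intro add_mono mult_left_mono u v) auto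
  also have "\<dots> = ennreal (2 * a + 2 * b)" using ab by (simp add: ennreal_plus ennreal_mult)
  finally show ?thesis .
qed

text \<open>An increment of the martingale is the weighted sum of the previous increments in the
  subtrees, which have mean 0, so each generation contributes a factor q2. The constant 4 Kmax for
  the first increment comes from (x - y)^2 \<le> 2 x^2 + 2 y^2.\<close>

lemma mart_increment:
  "(\<integral>\<^sup>+\<theta>. ennreal ((mart (Suc n) \<theta> - mart n \<theta>)\<^sup>2) \<partial>P) \<le> ennreal (q2 ^ n * (4 * Kmax))"
proof (induction n)
  case 0
  show ?case
    using nn_integral_square_diff_le[OF mart_measurable mart_measurable mart_second_moment mart_second_moment Kmax(1) Kmax(1), of 1 0]
    by simp
next
  case (Suc n)
  have "AE \<theta> in P. (\<lambda>i. fst (\<theta> []) i powr \<beta> * (mart (Suc n) (subtree i \<theta>) - mart n (subtree i \<theta>))) sums (mart (Suc (Suc n)) \<theta> - mart (Suc n) \<theta>)"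
    using mart_sums by eventually_elim (auto intro!: sums_diff simp: right_diff_distrib)
  from generation_step[OF _ this Suc, of 0] show ?case
    using q2(1) Kmax(1) mart_mean[of n] mart_mean[of "Suc n"] by (simp add: mult.assoc)
qed

definition mart_lim :: "(node \<Rightarrow> mark) \<Rightarrow> real" where
  "mart_lim \<theta> = lim (\<lambda>n. mart n \<theta>)"

lemma mart_lim_measurable [measurable]: "mart_lim \<in> borel_measurable P"
  unfolding mart_lim_def[abs_def] by measurable

theorem mart_lim_L2: "(\<lambda>k. \<integral>\<^sup>+\<theta>. ennreal ((mart_lim \<theta> - mart k \<theta>)\<^sup>2) \<partial>P) \<longlonglongrightarrow> 0"
proof -
  \<comment> \<open>Strictly between q2 and 1: finiteness of the expectation of W uses q2 / q < 1,
    and the decay of the tail uses q < 1.\<close>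
  define q where "q = (1 + q2) / 2"
  have q: "0 < q" "q < 1" "q2 < q" using q2 by (auto simp: q_def)
  define y where "y i \<theta> = (mart (Suc i) \<theta> - mart i \<theta>)\<^sup>2 / q ^ i" for i \<theta>
  define W where "W \<theta> = (\<Sum>i. ennreal (y i \<theta>))" for \<theta>
  have y0: "0 \<le> y i \<theta>" for i \<theta> using q by (simp add: y_def)
  have ym[measurable]: "y i \<in> borel_measurable P" for i unfolding y_def by measurable
  have Wm[measurable]: "W \<in> borel_measurable P" unfolding W_def by measurable
  have "(\<integral>\<^sup>+\<theta>. W \<theta> \<partial>P) = (\<Sum>i. \<integral>\<^sup>+\<theta>. ennreal (y i \<theta>) \<partial>P)"
    unfolding W_def by (rule nn_integral_suminf) measurable
  also have "\<dots> \<le> (\<Sum>i. ennreal (4 * Kmax * (q2 / q) ^ i))"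
  proof (intro suminf_le)
    fix i
    have "(\<integral>\<^sup>+\<theta>. ennreal (y i \<theta>) \<partial>P) = (\<integral>\<^sup>+\<theta>. ennreal (1 / q ^ i) * ennreal ((mart (Suc i) \<theta> - mart i \<theta>)\<^sup>2) \<partial>P)"
    proof (rule nn_integral_cong)
      fix \<theta>
      show "ennreal (y i \<theta>) = ennreal (1 / q ^ i) * ennreal ((mart (Suc i) \<theta> - mart i \<theta>)\<^sup>2)"
        unfolding y_def by (subst ennreal_mult[symmetric]) (use q in auto)
    qed
    also have "\<dots> = ennreal (1 / q ^ i) * (\<integral>\<^sup>+\<theta>. ennreal ((mart (Suc i) \<theta> - mart i \<theta>)\<^sup>2) \<partial>P)"
      by (rule nn_integral_cmult) measurable
    also have "\<dots> \<le> ennreal (1 / q ^ i) * ennreal (q2 ^ i * (4 * Kmax))"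
      by (intro mult_left_mono mart_increment) auto
    also have "\<dots> = ennreal (4 * Kmax * (q2 / q) ^ i)"
      by (subst ennreal_mult[symmetric]) (use q q2 Kmax(1) in \<open>auto simp: power_divide mult_ac\<close>)
    finally show "(\<integral>\<^sup>+\<theta>. ennreal (y i \<theta>) \<partial>P) \<le> ennreal (4 * Kmax * (q2 / q) ^ i)" .
  qed auto
  also have "\<dots> < \<infinity>"
  proof -
    have "summable (\<lambda>i. 4 * Kmax * (q2 / q) ^ i)"
      using q q2 by (intro summable_mult summable_geometric) auto
    moreover have "0 \<le> 4 * Kmax * (q2 / q) ^ i" for i using q q2 Kmax(1) by auto
    ultimately have "(\<Sum>i. ennreal (4 * Kmax * (q2 / q) ^ i)) = ennreal (\<Sum>i. 4 * Kmax * (q2 / q) ^ i)"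
      by (intro suminf_ennreal2)
    then show ?thesis by (simp only: infinity_ennreal_def ennreal_less_top)
  qed
  finally have Wfin: "(\<integral>\<^sup>+\<theta>. W \<theta> \<partial>P) < \<infinity>" .
  then have AEW: "AE \<theta> in P. W \<theta> \<noteq> \<infinity>" by (intro nn_integral_PInf_AE) auto
  have bound: "(\<integral>\<^sup>+\<theta>. ennreal ((mart_lim \<theta> - mart k \<theta>)\<^sup>2) \<partial>P) \<le> ennreal (q ^ k) * (ennreal (1 / (1 - q)) * (\<integral>\<^sup>+\<theta>. W \<theta> \<partial>P))" for k
  proof -
    have "(\<integral>\<^sup>+\<theta>. ennreal ((mart_lim \<theta> - mart k \<theta>)\<^sup>2) \<partial>P) \<le> (\<integral>\<^sup>+\<theta>. ennreal (q ^ k / (1 - q)) * W \<theta> \<partial>P)"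
    proof (rule nn_integral_mono_AE)
      show "AE \<theta> in P. ennreal ((mart_lim \<theta> - mart k \<theta>)\<^sup>2) \<le> ennreal (q ^ k / (1 - q)) * W \<theta>"
        using AEW
      proof eventually_elim
        case (elim \<theta>)
        have s: "summable (\<lambda>i. y i \<theta>)"
          using elim y0 unfolding W_def by (intro summable_suminf_not_top) auto
        then have W: "W \<theta> = ennreal (\<Sum>i. y i \<theta>)" unfolding W_def by (intro suminf_ennreal2 y0)
        have "(mart_lim \<theta> - mart k \<theta>)\<^sup>2 \<le> q ^ k / (1 - q) * (\<Sum>i. y i \<theta>)"
          unfolding mart_lim_def by (rule geometric_increments(2)[OF q(1,2)]) (use s in \<open>auto simp: y_def\<close>)
        then show ?case unfolding W
          by (subst ennreal_mult[symmetric]) (use q suminf_nonneg[OF s y0] in \<open>auto intro: ennreal_leI\<close>)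
      qed
    qed
    also have "\<dots> = ennreal (q ^ k / (1 - q)) * (\<integral>\<^sup>+\<theta>. W \<theta> \<partial>P)" by (rule nn_integral_cmult) measurable
    also have "\<dots> = ennreal (q ^ k) * (ennreal (1 / (1 - q)) * (\<integral>\<^sup>+\<theta>. W \<theta> \<partial>P))"
    proof -
      have "ennreal (q ^ k / (1 - q)) = ennreal (q ^ k) * ennreal (1 / (1 - q))"
        by (subst ennreal_mult[symmetric]) (use q in auto)
      then show ?thesis by (simp only: mult.assoc)
    qed
    finally show ?thesis .
  qed
  have "(\<lambda>k. ennreal (q ^ k) * (ennreal (1 / (1 - q)) * (\<integral>\<^sup>+\<theta>. W \<theta> \<partial>P))) \<longlonglongrightarrow> ennreal 0 * (ennreal (1 / (1 - q)) * (\<integral>\<^sup>+\<theta>. W \<theta> \<partial>P))"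
    using q Wfin by (intro tendsto_mult_ennreal tendsto_ennrealI LIMSEQ_power_zero tendsto_const) (auto simp: ennreal_mult_eq_top_iff)
  then have lim: "(\<lambda>k. ennreal (q ^ k) * (ennreal (1 / (1 - q)) * (\<integral>\<^sup>+\<theta>. W \<theta> \<partial>P))) \<longlonglongrightarrow> 0"
    by (simp only: ennreal_0 mult_zero_left)
  show ?thesis
  proof (rule tendsto_sandwich[OF _ _ tendsto_const lim])
    show "\<forall>\<^sub>F k in sequentially. (\<integral>\<^sup>+\<theta>. ennreal ((mart_lim \<theta> - mart k \<theta>)\<^sup>2) \<partial>P)
        \<le> ennreal (q ^ k) * (ennreal (1 / (1 - q)) * (\<integral>\<^sup>+\<theta>. W \<theta> \<partial>P))"
      by (intro always_eventually allI bound)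
  qed (intro always_eventually allI zero_le)
qed

lemma mart_lim_second_moment: "(\<integral>\<^sup>+\<theta>. ennreal ((mart_lim \<theta>)\<^sup>2) \<partial>P) < \<infinity>"
proof -
  have "\<forall>\<^sub>F k in sequentially. (\<integral>\<^sup>+\<theta>. ennreal ((mart_lim \<theta> - mart k \<theta>)\<^sup>2) \<partial>P) < 1"
    using mart_lim_L2 by (rule order_tendstoD) simp
  then obtain k where k: "(\<integral>\<^sup>+\<theta>. ennreal ((mart_lim \<theta> - mart k \<theta>)\<^sup>2) \<partial>P) < 1" by (auto simp: eventually_sequentially)
  have "(\<integral>\<^sup>+\<theta>. ennreal (((mart_lim \<theta> - mart k \<theta>) - (- mart k \<theta>))\<^sup>2) \<partial>P) \<le> ennreal (2 * 1 + 2 * Kmax)"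
    using k mart_second_moment[of k] Kmax(1) by (intro nn_integral_square_diff_le) (auto simp: less_imp_le)
  then show ?thesis by (simp add: le_less_trans[OF _ ennreal_less_top])
qed

end

subsection \<open>Asymptotics of the weighted sums\<close>

text \<open>For a child of ratio x the quotient of scale r x and the power 1/\<alpha> of time
  x^\<alpha> (T - e) differs from r / T^(1/\<alpha>) by the factor (T / (T - e))^(1/\<alpha>), which
  tends to 1. So the admissible pairs are stable under passing to a child.\<close>

lemma rescaled_sequences:
  fixes T r :: "nat \<Rightarrow> real"
  assumes \<alpha>: "0 < \<alpha>" and T: "filterlim T at_top sequentially" and r: "(\<lambda>n. r n / T n powr (1 / \<alpha>)) \<longlonglongrightarrow> 1"
    and x: "0 < x"
  shows "filterlim (\<lambda>n. x powr \<alpha> * (T n - e)) at_top sequentially"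
    and "(\<lambda>n. r n * x / (x powr \<alpha> * (T n - e)) powr (1 / \<alpha>)) \<longlonglongrightarrow> 1"
proof -
  have Te: "filterlim (\<lambda>n. T n - e) at_top sequentially"
    using filterlim_tendsto_add_at_top[OF tendsto_const[of "- e"] T] by simp
  then show "filterlim (\<lambda>n. x powr \<alpha> * (T n - e)) at_top sequentially"
    using x by (intro filterlim_tendsto_pos_mult_at_top[OF tendsto_const]) auto
  have "(\<lambda>n. e / (T n - e)) \<longlonglongrightarrow> 0" by (rule real_tendsto_divide_at_top[OF tendsto_const Te])
  then have "(\<lambda>n. (1 + e / (T n - e)) powr (1 / \<alpha>)) \<longlonglongrightarrow> (1 + 0) powr (1 / \<alpha>)"
    by (intro tendsto_powr tendsto_add tendsto_const) auto
  from tendsto_mult[OF r this]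
  have "(\<lambda>n. r n / T n powr (1 / \<alpha>) * (1 + e / (T n - e)) powr (1 / \<alpha>)) \<longlonglongrightarrow> 1" by simp
  moreover have "\<forall>\<^sub>F n in sequentially. r n / T n powr (1 / \<alpha>) * (1 + e / (T n - e)) powr (1 / \<alpha>)
     = r n * x / (x powr \<alpha> * (T n - e)) powr (1 / \<alpha>)"
  proof -
    have "\<forall>\<^sub>F n in sequentially. max 0 e < T n" using T unfolding filterlim_at_top_dense by blast
    then show ?thesis
    proof eventually_elim
      case (elim n)
      have eq: "1 + e / (T n - e) = T n / (T n - e)" using elim by (simp add: field_simps)
      have "(x powr \<alpha> * (T n - e)) powr (1 / \<alpha>) = x * (T n - e) powr (1 / \<alpha>)"
        using elim x \<alpha> by (simp add: powr_mult powr_powr)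
      then show ?case unfolding eq using elim x by (simp add: powr_divide)
    qed
  qed
  ultimately show "(\<lambda>n. r n * x / (x powr \<alpha> * (T n - e)) powr (1 / \<alpha>)) \<longlonglongrightarrow> 1"
    by (rule Lim_transform_eventually)
qed

context L2_fragmentation_law
begin

context
  fixes f :: "real \<Rightarrow> real" and B :: real
  assumes fm [measurable]: "f \<in> borel_measurable borel" and fB: "\<And>x. \<bar>f x\<bar> \<le> B"
begin

lemma B_nonneg: "0 \<le> B" using fB[of 0] by linarith

lemma weighted_measurable [measurable]: "weighted_sum n f s r \<in> borel_measurable P"
  by (rule weighted_sum_measurable) measurable

lemma weighted_second_moment:
  "(\<integral>\<^sup>+\<theta>. ennreal ((weighted_sum \<infinity> f s r \<theta>)\<^sup>2) \<partial>P) \<le> ennreal (B\<^sup>2 * Kmax)"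
proof -
  have "(\<integral>\<^sup>+\<theta>. ennreal ((weighted_sum \<infinity> f s r \<theta>)\<^sup>2) \<partial>P) \<le> (\<integral>\<^sup>+\<theta>. ennreal (B\<^sup>2) * (mass_sum \<infinity> s \<theta>)\<^sup>2 \<partial>P)"
  proof (rule nn_integral_mono_AE)
    show "AE \<theta> in P. ennreal ((weighted_sum \<infinity> f s r \<theta>)\<^sup>2) \<le> ennreal (B\<^sup>2) * (mass_sum \<infinity> s \<theta>)\<^sup>2"
      using AE_mass_finite[of \<infinity> s]
    proof eventually_elim
      case (elim \<theta>)
      obtain y where y: "mass_sum \<infinity> s \<theta> = ennreal y" "0 \<le> y" using elim by (cases "mass_sum \<infinity> s \<theta>") auto
      have "\<bar>weighted_sum \<infinity> f s r \<theta>\<bar> \<le> B * y"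
        using weighted_sum_abs_le[OF fB elim] y by simp
      then have "\<bar>weighted_sum \<infinity> f s r \<theta>\<bar>\<^sup>2 \<le> (B * y)\<^sup>2" by (intro power_mono) auto
      then have "ennreal ((weighted_sum \<infinity> f s r \<theta>)\<^sup>2) \<le> ennreal (B\<^sup>2 * y\<^sup>2)"
        by (intro ennreal_leI) (simp add: power_mult_distrib)
      then show ?case unfolding y(1) using y(2) by (simp add: ennreal_mult ennreal_power)
    qed
  qed
  also have "\<dots> = ennreal (B\<^sup>2) * (\<integral>\<^sup>+\<theta>. (mass_sum \<infinity> s \<theta>)\<^sup>2 \<partial>P)" by (rule nn_integral_cmult) measurable
  also have "\<dots> \<le> ennreal (B\<^sup>2) * ennreal Kmax" by (intro mult_left_mono mass_second_moment) auto
  finally show ?thesis using Kmax(1) by (simp add: ennreal_mult)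
qed

lemma weighted_integrable: "integrable P (weighted_sum \<infinity> f s r)"
proof (rule tree.square_integrable_imp_integrable)
  have "(\<integral>\<^sup>+\<theta>. ennreal ((weighted_sum \<infinity> f s r \<theta>)\<^sup>2) \<partial>P) < \<infinity>"
    using weighted_second_moment by (rule le_less_trans) simp
  then show "integrable P (\<lambda>\<theta>. (weighted_sum \<infinity> f s r \<theta>)\<^sup>2)" by (intro integrableI_bounded) auto
qed measurable

lemma scaled_law_measurable [measurable]: "(\<lambda>y. f (r * y)) \<in> borel_measurable (law s)"
  by (subst measurable_cong_sets[OF sets_law' refl]) measurable

lemma weighted_mean:
  assumes s: "0 \<le> s"
  shows "(\<integral>\<theta>. weighted_sum \<infinity> f s r \<theta> \<partial>P) = (\<integral>y. f (r * y) \<partial>law s)"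
proof -
  interpret L: prob_space "law s" by (rule frag.prob_space_law[OF s])
  define pa where "pa g \<theta> = alive_sum \<alpha> \<infinity> (\<lambda>y. ennreal (y powr \<beta> * g (r * y))) s \<theta>" for g \<theta>
  have pam[measurable]: "pa g \<in> borel_measurable P" if [measurable]: "g \<in> borel_measurable borel" for g
    unfolding pa_def by (rule alive_sum_measurable) measurable
  have part: "integrable P (\<lambda>\<theta>. enn2real (pa g \<theta>)) \<and> (\<integral>\<theta>. enn2real (pa g \<theta>) \<partial>P) = enn2real (\<integral>\<^sup>+y. ennreal (g (r * y)) \<partial>law s)"
    if [measurable]: "g \<in> borel_measurable borel" and g: "\<And>x. \<bar>g x\<bar> \<le> B" for g
  proof -
    have le: "pa g \<theta> \<le> ennreal B * mass_sum \<infinity> s \<theta>" for \<theta>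
      unfolding pa_def by (rule alive_sum_le_mass[OF g B_nonneg])
    have fin: "AE \<theta> in P. ennreal (enn2real (pa g \<theta>)) = pa g \<theta>"
      using AE_mass_finite[of \<infinity> s]
    proof eventually_elim
      case (elim \<theta>)
      have "pa g \<theta> < \<infinity>" using le[of \<theta>] elim by (simp add: le_less_trans ennreal_mult_less_top)
      then show ?case by (simp add: less_top)
    qed
    have eq: "(\<integral>\<^sup>+y. ennreal (g (r * y)) \<partial>law s) = (\<integral>\<^sup>+\<theta>. pa g \<theta> \<partial>P)"
      unfolding pa_def
      by (subst nn_integral_law) (auto intro!: nn_integral_cong alive_sum_cong simp: ennreal_mult')
    have "(\<integral>\<^sup>+y. ennreal (g (r * y)) \<partial>law s) \<le> (\<integral>\<^sup>+y. ennreal B \<partial>law s)"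
      using g by (intro nn_integral_mono ennreal_leI) (simp add: abs_le_iff)
    also have "\<dots> < \<infinity>" by (simp add: L.emeasure_space_1)
    finally have fin2: "(\<integral>\<^sup>+\<theta>. pa g \<theta> \<partial>P) < \<infinity>" unfolding eq .
    have eq2: "(\<integral>\<^sup>+\<theta>. ennreal (enn2real (pa g \<theta>)) \<partial>P) = (\<integral>\<^sup>+\<theta>. pa g \<theta> \<partial>P)" by (rule nn_integral_cong_AE[OF fin])
    have "integrable P (\<lambda>\<theta>. enn2real (pa g \<theta>))" using fin2 eq2 by (intro integrableI_nonneg) auto
    moreover have "(\<integral>\<theta>. enn2real (pa g \<theta>) \<partial>P) = enn2real (\<integral>\<^sup>+\<theta>. ennreal (enn2real (pa g \<theta>)) \<partial>P)"
      by (rule integral_eq_nn_integral) auto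
    ultimately show ?thesis unfolding eq eq2 by simp
  qed
  have neg: "(\<lambda>x. - f x) \<in> borel_measurable borel" "\<And>x. \<bar>- f x\<bar> \<le> B" using fB by auto
  have int: "integrable (law s) (\<lambda>y. f (r * y))"
    by (rule L.integrable_const_bound[where B = B]) (use fB in auto)
  have "(\<integral>\<theta>. weighted_sum \<infinity> f s r \<theta> \<partial>P) = (\<integral>\<theta>. enn2real (pa f \<theta>) - enn2real (pa (\<lambda>x. - f x) \<theta>) \<partial>P)"
    by (simp add: weighted_sum_def pa_def)
  also have "\<dots> = enn2real (\<integral>\<^sup>+y. ennreal (f (r * y)) \<partial>law s) - enn2real (\<integral>\<^sup>+y. ennreal (- f (r * y)) \<partial>law s)"
    using part[OF fm fB] part[OF neg] by simp
  also have "\<dots> = (\<integral>y. f (r * y) \<partial>law s)"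
    by (rule real_lebesgue_integral_def[OF int, symmetric])
  finally show ?thesis .
qed

lemma weighted_mean_bound: "\<bar>\<integral>\<theta>. weighted_sum \<infinity> f s r \<theta> \<partial>P\<bar> \<le> B"
proof (cases "0 \<le> s")
  case True
  interpret L: prob_space "law s" by (rule frag.prob_space_law[OF True])
  have "\<bar>\<integral>y. f (r * y) \<partial>law s\<bar> \<le> (\<integral>y. \<bar>f (r * y)\<bar> \<partial>law s)" by (rule integral_abs_bound)
  also have "\<dots> \<le> (\<integral>y. B \<partial>law s)"
    by (intro integral_mono integrable_abs L.integrable_const_bound[where B = B]) (use fB B_nonneg in auto)
  finally show ?thesis by (simp add: weighted_mean[OF True] L.prob_space)
next
  case False
  have "(\<integral>\<theta>. weighted_sum \<infinity> f s r \<theta> \<partial>P) = (\<integral>\<theta>. 0 \<partial>P)"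
  proof (rule integral_cong_AE)
    show "AE \<theta> in P. weighted_sum \<infinity> f s r \<theta> = 0"
      using AE_good by eventually_elim (use False in \<open>simp add: weighted_sum_def alive_sum_neg\<close>)
  qed measurable
  then show ?thesis using B_nonneg by simp
qed

context
  fixes c :: real
begin

text \<open>The mean-square distance to c times the k-th martingale value. Time and scale are
  independent arguments, since only then does the family satisfy a recursion over the
  children.\<close>

definition gap :: "nat \<Rightarrow> real \<Rightarrow> real \<Rightarrow> ennreal" where
  "gap k s r = (\<integral>\<^sup>+\<theta>. ennreal ((weighted_sum \<infinity> f s r \<theta> - c * mart k \<theta>)\<^sup>2) \<partial>P)"

definition gap_bound :: real where "gap_bound = 2 * (B\<^sup>2 * Kmax) + 2 * (c\<^sup>2 * Kmax)"

lemma gap_bound: "0 \<le> gap_bound" "gap k s r \<le> ennreal gap_bound"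
proof -
  show "0 \<le> gap_bound" using Kmax(1) by (simp add: gap_bound_def)
  have "(\<integral>\<^sup>+\<theta>. ennreal ((c * mart k \<theta>)\<^sup>2) \<partial>P) = ennreal (c\<^sup>2) * (\<integral>\<^sup>+\<theta>. ennreal ((mart k \<theta>)\<^sup>2) \<partial>P)"
    by (subst nn_integral_cmult[symmetric]) (auto simp: power_mult_distrib ennreal_mult)
  also have "\<dots> \<le> ennreal (c\<^sup>2) * ennreal Kmax" by (intro mult_left_mono mart_second_moment) auto
  finally have "(\<integral>\<^sup>+\<theta>. ennreal ((c * mart k \<theta>)\<^sup>2) \<partial>P) \<le> ennreal (c\<^sup>2 * Kmax)" using Kmax(1) by (simp add: ennreal_mult)
  then show "gap k s r \<le> ennreal gap_bound"
    unfolding gap_def gap_bound_def using Kmax(1)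
    by (intro nn_integral_square_diff_le weighted_second_moment) auto
qed

lemma gap_measurable: "(\<lambda>x. gap k (fst x) (snd x)) \<in> borel_measurable (borel \<Otimes>\<^sub>M borel)"
proof -
  have [measurable]: "(\<lambda>x. weighted_sum \<infinity> f (fst (fst x)) (snd (fst x)) (snd x)) \<in> borel_measurable ((borel \<Otimes>\<^sub>M borel) \<Otimes>\<^sub>M P)"
    by (rule weighted_sum_measurable) measurable
  show ?thesis
    unfolding gap_def by (rule tree.borel_measurable_nn_integral) (simp add: split_beta')
qed

text \<open>The martingale has mean 1 for every index, so the mean of the difference in
  \<open>gap\<close> is this number for all k.\<close>

definition mean_gap :: "real \<Rightarrow> real \<Rightarrow> real" where
  "mean_gap s r = (\<integral>\<theta>. weighted_sum \<infinity> f s r \<theta> \<partial>P) - c"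

lemma mean_gap_eq: "(\<integral>\<theta>. weighted_sum \<infinity> f s r \<theta> - c * mart k \<theta> \<partial>P) = mean_gap s r"
  using mart_mean[of k] weighted_integrable by (simp add: mean_gap_def)

lemma mean_gap_bound: "\<bar>mean_gap s r\<bar> \<le> B + \<bar>c\<bar>"
  using weighted_mean_bound[of s r] by (simp add: mean_gap_def abs_le_iff) linarith

lemma mean_gap_measurable: "(\<lambda>x. mean_gap (fst x) (snd x)) \<in> borel_measurable (borel \<Otimes>\<^sub>M borel)"
proof -
  have [measurable]: "(\<lambda>x. weighted_sum \<infinity> f (fst (fst x)) (snd (fst x)) (snd x)) \<in> borel_measurable ((borel \<Otimes>\<^sub>M borel) \<Otimes>\<^sub>M P)"
    by (rule weighted_sum_measurable) measurable
  have "(\<lambda>x. \<integral>\<theta>. weighted_sum \<infinity> f (fst x) (snd x) \<theta> \<partial>P) \<in> borel_measurable (borel \<Otimes>\<^sub>M borel)"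
    by (rule tree.borel_measurable_lebesgue_integral) (simp add: split_beta')
  then show ?thesis unfolding mean_gap_def by measurable
qed

definition initial_part :: "real \<Rightarrow> real \<Rightarrow> mark \<Rightarrow> real" where
  "initial_part s r x = (if 0 \<le> s \<and> s < snd x then f r else 0)"

text \<open>The weighted sum and the martingale split over the children with the same weights
  x^\<beta>, hence so does their difference, the martingale index dropping by one. The root
  contributes to the weighted sum only, through \<open>initial_part\<close>.\<close>

lemma gap_Suc_le:
  "gap (Suc k) s r \<le>
    (\<integral>\<^sup>+x. (\<Sum>i. (ennreal (fst x i powr \<beta>))\<^sup>2 * gap k (fst x i powr \<alpha> * (s - snd x)) (r * fst x i)) \<partial>N) +
    (\<integral>\<^sup>+x. (ennreal \<bar>initial_part s r x\<bar> + (\<Sum>i. ennreal (fst x i powr \<beta>) * ennreal \<bar>mean_gap (fst x i powr \<alpha> * (s - snd x)) (r * fst x i)\<bar>))\<^sup>2 \<partial>N)"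
proof -
  define h where "h x i \<theta> = fst x i powr \<beta> * (weighted_sum \<infinity> f (fst x i powr \<alpha> * (s - snd x)) (r * fst x i) \<theta> - c * mart k \<theta>)"
    for x :: mark and i \<theta>
  have am[measurable]: "initial_part s r \<in> borel_measurable N" unfolding initial_part_def by measurable
  have [measurable]: "(\<lambda>x. gap k (fst x i powr \<alpha> * (s - snd x)) (r * fst x i)) \<in> borel_measurable N" for i
    using measurable_compose[OF _ gap_measurable, of "\<lambda>x. (fst x i powr \<alpha> * (s - snd x), r * fst x i)" N] by simp
  have [measurable]: "(\<lambda>x. mean_gap (fst x i powr \<alpha> * (s - snd x)) (r * fst x i)) \<in> borel_measurable N" for i
    using measurable_compose[OF _ mean_gap_measurable, of "\<lambda>x. (fst x i powr \<alpha> * (s - snd x), r * fst x i)" N] by simp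
  have "gap (Suc k) s r \<le>
    (\<integral>\<^sup>+x. (\<Sum>i. \<integral>\<^sup>+\<theta>. ennreal ((h x i \<theta>)\<^sup>2) \<partial>P) + (ennreal \<bar>initial_part s r x\<bar> + (\<Sum>i. ennreal \<bar>\<integral>\<theta>. h x i \<theta> \<partial>P\<bar>))\<^sup>2 \<partial>N)"
    unfolding gap_def
  proof (rule second_moment_step[OF am])
    have [measurable]: "(\<lambda>x. weighted_sum \<infinity> f (fst (fst x) i powr \<alpha> * (s - snd (fst x))) (r * fst (fst x) i) (snd x)) \<in> borel_measurable (N \<Otimes>\<^sub>M P)" for i
      by (rule weighted_sum_measurable) measurable
    show "(\<lambda>x. h (fst x) i (snd x)) \<in> borel_measurable (N \<Otimes>\<^sub>M P)" for i
      unfolding h_def by measurable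
    show "AE \<theta> in P. (\<lambda>i. h (\<theta> []) i (subtree i \<theta>)) sums (weighted_sum \<infinity> f s r \<theta> - c * mart (Suc k) \<theta> - initial_part s r (\<theta> []))"
      using AE_good AE_mass_finite[of \<infinity> s] mart_sums
    proof eventually_elim
      case (elim \<theta>)
      have "(\<lambda>i. fst (\<theta> []) i powr \<beta> * weighted_sum \<infinity> f (fst (\<theta> []) i powr \<alpha> * (s - snd (\<theta> []))) (r * fst (\<theta> []) i) (subtree i \<theta>))
        sums (weighted_sum \<infinity> f s r \<theta> - initial_part s r (\<theta> []))"
        using weighted_sum_sums[OF elim(1), of \<infinity> s f B r] elim(2) fB by (simp add: initial_part_def)
      moreover have "(\<lambda>i. c * (fst (\<theta> []) i powr \<beta> * mart k (subtree i \<theta>))) sums (c * mart (Suc k) \<theta>)"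
        using elim(3) by (intro sums_mult) blast
      ultimately have "(\<lambda>i. fst (\<theta> []) i powr \<beta> * weighted_sum \<infinity> f (fst (\<theta> []) i powr \<alpha> * (s - snd (\<theta> []))) (r * fst (\<theta> []) i) (subtree i \<theta>)
          - c * (fst (\<theta> []) i powr \<beta> * mart k (subtree i \<theta>))) sums
          (weighted_sum \<infinity> f s r \<theta> - initial_part s r (\<theta> []) - c * mart (Suc k) \<theta>)"
        by (rule sums_diff)
      moreover have "weighted_sum \<infinity> f s r \<theta> - initial_part s r (\<theta> []) - c * mart (Suc k) \<theta> =
          weighted_sum \<infinity> f s r \<theta> - c * mart (Suc k) \<theta> - initial_part s r (\<theta> [])" by simp
      moreover have "fst (\<theta> []) i powr \<beta> * weighted_sum \<infinity> f (fst (\<theta> []) i powr \<alpha> * (s - snd (\<theta> []))) (r * fst (\<theta> []) i) (subtree i \<theta>)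
          - c * (fst (\<theta> []) i powr \<beta> * mart k (subtree i \<theta>)) = h (\<theta> []) i (subtree i \<theta>)" for i
        by (simp add: h_def right_diff_distrib mult.left_commute)
      ultimately show ?case by (simp only:)
    qed
  qed
  also have "\<dots> = (\<integral>\<^sup>+x. (\<Sum>i. (ennreal (fst x i powr \<beta>))\<^sup>2 * gap k (fst x i powr \<alpha> * (s - snd x)) (r * fst x i)) +
     (ennreal \<bar>initial_part s r x\<bar> + (\<Sum>i. ennreal (fst x i powr \<beta>) * ennreal \<bar>mean_gap (fst x i powr \<alpha> * (s - snd x)) (r * fst x i)\<bar>))\<^sup>2 \<partial>N)"
  proof -
    have "(\<integral>\<^sup>+\<theta>. ennreal ((h x i \<theta>)\<^sup>2) \<partial>P) = (ennreal (fst x i powr \<beta>))\<^sup>2 * gap k (fst x i powr \<alpha> * (s - snd x)) (r * fst x i)" for x i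
      unfolding h_def gap_def
      by (subst nn_integral_cmult[symmetric]) (auto simp: power_mult_distrib ennreal_mult ennreal_power)
    moreover have "ennreal \<bar>\<integral>\<theta>. h x i \<theta> \<partial>P\<bar> = ennreal (fst x i powr \<beta>) * ennreal \<bar>mean_gap (fst x i powr \<alpha> * (s - snd x)) (r * fst x i)\<bar>" for x i
      unfolding h_def by (simp add: mean_gap_eq abs_mult ennreal_mult)
    ultimately show ?thesis by simp
  qed
  also have "\<dots> = (\<integral>\<^sup>+x. (\<Sum>i. (ennreal (fst x i powr \<beta>))\<^sup>2 * gap k (fst x i powr \<alpha> * (s - snd x)) (r * fst x i)) \<partial>N) +
    (\<integral>\<^sup>+x. (ennreal \<bar>initial_part s r x\<bar> + (\<Sum>i. ennreal (fst x i powr \<beta>) * ennreal \<bar>mean_gap (fst x i powr \<alpha> * (s - snd x)) (r * fst x i)\<bar>))\<^sup>2 \<partial>N)"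
    by (rule nn_integral_add) measurable
  finally show ?thesis .
qed

end

end

lemma mean_gap_tendsto:
  assumes fm: "f \<in> borel_measurable borel" and fB: "\<And>x. \<bar>f x\<bar> \<le> B"
    and means: "(\<lambda>n. \<integral>y. f (r n * y) \<partial>law (T n)) \<longlonglongrightarrow> c" and T: "filterlim T at_top sequentially"
  shows "(\<lambda>n. mean_gap f c (T n) (r n)) \<longlonglongrightarrow> 0"
proof -
  have "(\<lambda>n. (\<integral>y. f (r n * y) \<partial>law (T n)) - c) \<longlonglongrightarrow> c - c" by (intro tendsto_diff means tendsto_const)
  then have "(\<lambda>n. (\<integral>y. f (r n * y) \<partial>law (T n)) - c) \<longlonglongrightarrow> 0" by simp
  moreover have "\<forall>\<^sub>F n in sequentially. (\<integral>y. f (r n * y) \<partial>law (T n)) - c = mean_gap f c (T n) (r n)"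
  proof -
    have "\<forall>\<^sub>F n in sequentially. 0 \<le> T n" using T unfolding filterlim_at_top by blast
    then show ?thesis by eventually_elim (simp add: mean_gap_def[OF fm fB] weighted_mean[OF fm fB])
  qed
  ultimately show ?thesis by (rule Lim_transform_eventually)
qed

text \<open>The induction on k treats all admissible pairs (T, r) at once, because the children see
  rescaled pairs. Of the two integrals in \<open>gap_Suc_le\<close> the first yields the factor q2
  in the limit, and the second vanishes because the mean gap of every child does.\<close>

lemma gap_limit:
  assumes fm: "f \<in> borel_measurable borel" and fB: "\<And>x. \<bar>f x\<bar> \<le> B"
    and means: "\<And>T r. filterlim T at_top sequentially \<Longrightarrow> (\<lambda>n. r n / T n powr (1 / \<alpha>)) \<longlonglongrightarrow> 1 \<Longrightarrow>
      (\<lambda>n. \<integral>y. f (r n * y) \<partial>law (T n)) \<longlonglongrightarrow> c"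
    and T: "filterlim T at_top sequentially" and r: "(\<lambda>n. r n / T n powr (1 / \<alpha>)) \<longlonglongrightarrow> 1"
    and \<epsilon>: "0 < (\<epsilon> :: real)"
  shows "\<forall>\<^sub>F n in sequentially. gap f c k (T n) (r n) \<le> ennreal (q2 ^ k * gap_bound B c + \<epsilon>)"
  using T r \<epsilon>
proof (induction k arbitrary: T r \<epsilon>)
  case 0
  have b: "gap f c 0 (T n) (r n) \<le> ennreal (gap_bound B c)" for n by (rule gap_bound(2)[OF fm fB])
  have "gap f c 0 (T n) (r n) \<le> ennreal (q2 ^ 0 * gap_bound B c + \<epsilon>)" for n
    by (rule order_trans[OF b ennreal_leI]) (use "0.prems"(3) in simp)
  then show ?case by simp
next
  case (Suc k)
  note T = Suc.prems(1) and r = Suc.prems(2) and \<epsilon> = Suc.prems(3)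
  note [measurable] = fm
  define L where "L = q2 ^ k * gap_bound B c"
  have L: "0 \<le> L" unfolding L_def using q2(1) gap_bound(1)[OF fm fB] by auto
  define w where "w x i = ennreal (fst x i powr \<beta>)" for x :: mark and i :: nat
  define S where "S n x i = fst x i powr \<alpha> * (T n - snd x)" for n and x :: mark and i :: nat
  have wm[measurable]: "(\<lambda>x. w x i) \<in> borel_measurable N" for i unfolding w_def by measurable
  have gm[measurable]: "(\<lambda>x. gap f c k (S n x i) (r n * fst x i)) \<in> borel_measurable N" for n i
    unfolding S_def
    using measurable_compose[OF _ gap_measurable[OF fm fB], of "\<lambda>x. (fst x i powr \<alpha> * (T n - snd x), r n * fst x i)" N c k] by simp
  have mm[measurable]: "(\<lambda>x. mean_gap f c (S n x i) (r n * fst x i)) \<in> borel_measurable N" for n i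
    unfolding S_def
    using measurable_compose[OF _ mean_gap_measurable[OF fm fB], of "\<lambda>x. (fst x i powr \<alpha> * (T n - snd x), r n * fst x i)" N c] by simp
  have im[measurable]: "initial_part f s \<rho> \<in> borel_measurable N" for s \<rho>
    unfolding initial_part_def[OF fm fB] by measurable
  define I1 where "I1 n = (\<integral>\<^sup>+x. (\<Sum>i. (w x i)\<^sup>2 * gap f c k (S n x i) (r n * fst x i)) \<partial>N)" for n
  define I2 where "I2 n = (\<integral>\<^sup>+x. (ennreal \<bar>initial_part f (T n) (r n) x\<bar> + (\<Sum>i. w x i * ennreal \<bar>mean_gap f c (S n x i) (r n * fst x i)\<bar>))\<^sup>2 \<partial>N)" for n
  have le: "gap f c (Suc k) (T n) (r n) \<le> I1 n + I2 n" for n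
    unfolding I1_def I2_def w_def S_def by (rule gap_Suc_le[OF fm fB])
  have nonneg: "AE x in N. \<forall>i. 0 \<le> fst x i"
  proof -
    interpret E: prob_space E by (rule prob_space_E)
    interpret pair_prob_space \<nu> E ..
    have [measurable]: "(\<lambda>x. fst x i) \<in> borel_measurable (\<nu> \<Otimes>\<^sub>M E)" for i
      by (rule measurable_compose[OF measurable_fst component_measurable])
    show ?thesis
      unfolding mark_law_def
      by (rule AE_pair_measure) (measurable, use ratios_unit in \<open>auto elim!: eventually_mono\<close>)
  qed
  have sq_sum: "(\<integral>\<^sup>+x. (\<Sum>i. (w x i)\<^sup>2) \<partial>N) = ennreal q2" unfolding w_def by (rule nn_integral_N_squares)
  have sum1: "(\<integral>\<^sup>+x. (\<Sum>i. w x i) \<partial>N) = 1" unfolding w_def by (rule nn_integral_N_sum)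
  have sum2: "(\<integral>\<^sup>+x. (\<Sum>i. w x i)\<^sup>2 \<partial>N) = ennreal C2" unfolding w_def by (rule nn_integral_N_square_sum)
  \<comment> \<open>The sum over children is written as an integral over the product with counting
    measure, so that one reverse Fatou argument covers expectation and sum; the dominating function
    is the squared weight times \<open>gap_bound\<close>.\<close>
  have lim1: "limsup I1 \<le> ennreal q2 * ennreal L"
  proof -
    interpret C: sigma_finite_measure "count_space (UNIV :: nat set)"
      by (rule sigma_finite_measure_count_space_countable) simp
    interpret NC: pair_sigma_finite N "count_space (UNIV :: nat set)" ..
    let ?NC = "N \<Otimes>\<^sub>M count_space (UNIV :: nat set)"
    have [measurable]: "(\<lambda>z. w (fst z) (snd z)) \<in> borel_measurable ?NC"
      by (rule measurable_compose_countable[where f = "\<lambda>i z. w (fst z) i" and g = snd]) measurable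
    have [measurable]: "(\<lambda>z. gap f c k (S n (fst z) (snd z)) (r n * fst (fst z) (snd z))) \<in> borel_measurable ?NC" for n
      by (rule measurable_compose_countable[where f = "\<lambda>i z. gap f c k (S n (fst z) i) (r n * fst (fst z) i)" and g = snd])
         (auto intro: measurable_compose[OF measurable_fst gm])
    have I1_eq: "I1 n = (\<integral>\<^sup>+z. (w (fst z) (snd z))\<^sup>2 * gap f c k (S n (fst z) (snd z)) (r n * fst (fst z) (snd z)) \<partial>?NC)" for n
      unfolding I1_def by (subst C.nn_integral_fst[symmetric]) (auto simp: nn_integral_count_space_nat)
    have sq_sum': "(\<integral>\<^sup>+z. (w (fst z) (snd z))\<^sup>2 \<partial>?NC) = ennreal q2"
      unfolding sq_sum[symmetric] by (subst C.nn_integral_fst[symmetric]) (auto simp: nn_integral_count_space_nat)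
    have "limsup I1 \<le> (\<integral>\<^sup>+z. limsup (\<lambda>n. (w (fst z) (snd z))\<^sup>2 * gap f c k (S n (fst z) (snd z)) (r n * fst (fst z) (snd z))) \<partial>?NC)"
      unfolding I1_eq
    proof (rule nn_integral_limsup[where w = "\<lambda>z. (w (fst z) (snd z))\<^sup>2 * ennreal (gap_bound B c)"])
      show "AE z in ?NC. (w (fst z) (snd z))\<^sup>2 * gap f c k (S n (fst z) (snd z)) (r n * fst (fst z) (snd z)) \<le> (w (fst z) (snd z))\<^sup>2 * ennreal (gap_bound B c)" for n
        by (intro AE_I2 mult_left_mono gap_bound[OF fm fB]) auto
      show "(\<integral>\<^sup>+z. (w (fst z) (snd z))\<^sup>2 * ennreal (gap_bound B c) \<partial>?NC) < \<infinity>"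
        by (subst nn_integral_multc) (auto simp: sq_sum' ennreal_mult_less_top)
    qed measurable
    also have "\<dots> \<le> (\<integral>\<^sup>+z. (w (fst z) (snd z))\<^sup>2 * ennreal L \<partial>?NC)"
    proof (rule nn_integral_mono_AE)
      have "AE x in N. AE i in count_space UNIV. 0 \<le> fst (fst (x, i)) (snd (x, i))" using nonneg by (simp add: AE_count_space)
      then have "AE z in ?NC. 0 \<le> fst (fst z) (snd z)"
      proof (rule NC.AE_pair_measure[rotated])
        show "{z \<in> space ?NC. 0 \<le> fst (fst z) (snd z)} \<in> sets ?NC"
        proof -
          have [measurable]: "(\<lambda>z. fst (fst z) (snd z)) \<in> borel_measurable ?NC"
            by (rule measurable_compose_countable[where f = "\<lambda>i z. fst (fst z) i" and g = snd])
               (auto intro: measurable_compose[OF measurable_fst fst_N_measurable])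
          show ?thesis by measurable
        qed
      qed
      then show "AE z in ?NC. limsup (\<lambda>n. (w (fst z) (snd z))\<^sup>2 * gap f c k (S n (fst z) (snd z)) (r n * fst (fst z) (snd z)))
          \<le> (w (fst z) (snd z))\<^sup>2 * ennreal L"
      proof eventually_elim
        case (elim z)
        define x i where "x = fst z" and "i = snd z"
        show ?case unfolding x_def[symmetric] i_def[symmetric]
        proof (cases "fst x i = 0")
          case True
          then have "w x i = 0" by (simp add: w_def)
          then show "limsup (\<lambda>n. (w x i)\<^sup>2 * gap f c k (S n x i) (r n * fst x i)) \<le> (w x i)\<^sup>2 * ennreal L"
            by (simp add: Limsup_const)
        next
          case False
          then have xi: "0 < fst x i" using elim by (simp add: x_def i_def)
          define u where "u = (fst x i powr \<beta>)\<^sup>2"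
          have u: "0 < u" "(w x i)\<^sup>2 = ennreal u" using xi by (auto simp: u_def w_def ennreal_power)
          show "limsup (\<lambda>n. (w x i)\<^sup>2 * gap f c k (S n x i) (r n * fst x i)) \<le> (w x i)\<^sup>2 * ennreal L"
          proof (rule ennreal_le_epsilon)
            \<comment> \<open>The tolerance handed to the induction hypothesis is e / u, so that the
              weight u of the child turns it back into e.\<close>
            fix e :: real assume e: "0 < e"
            have "\<forall>\<^sub>F n in sequentially. gap f c k (S n x i) (r n * fst x i) \<le> ennreal (L + e / u)"
              unfolding S_def L_def
              by (rule Suc.IH[OF rescaled_sequences[OF \<alpha> T r xi]]) (use e u in auto)
            then have "\<forall>\<^sub>F n in sequentially. (w x i)\<^sup>2 * gap f c k (S n x i) (r n * fst x i) \<le> ennreal (u * L + e)"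
            proof eventually_elim
              case (elim n)
              have "(w x i)\<^sup>2 * gap f c k (S n x i) (r n * fst x i) \<le> ennreal u * ennreal (L + e / u)"
                unfolding u(2) by (intro mult_left_mono elim) auto
              also have "\<dots> = ennreal (u * L + e)"
                by (subst ennreal_mult[symmetric]) (use u L e in \<open>auto simp: distrib_left\<close>)
              finally show ?case .
            qed
            then have "limsup (\<lambda>n. (w x i)\<^sup>2 * gap f c k (S n x i) (r n * fst x i)) \<le> ennreal (u * L + e)"
              by (rule Limsup_bounded)
            also have "\<dots> = (w x i)\<^sup>2 * ennreal L + ennreal e"
              unfolding u(2) using u L e by (simp add: ennreal_plus ennreal_mult)
            finally show "limsup (\<lambda>n. (w x i)\<^sup>2 * gap f c k (S n x i) (r n * fst x i)) \<le> (w x i)\<^sup>2 * ennreal L + ennreal e" .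
          qed
        qed
      qed
    qed
    also have "\<dots> = ennreal q2 * ennreal L" by (subst nn_integral_multc) (auto simp: sq_sum')
    finally show ?thesis .
  qed
  define G where "G = B + \<bar>c\<bar>"
  have B0: "0 \<le> B" by (rule B_nonneg[OF fm fB])
  have G0: "0 \<le> G" using B0 by (simp add: G_def)
  \<comment> \<open>Dominated convergence is used twice: over the marks, dominated by a constant
    plus a multiple of the squared sum of weights, and, for a fixed mark, over the children, whose
    weights have a finite sum. The root term is 0 once T exceeds the lifetime of the root.\<close>
  have lim2: "I2 \<longlonglongrightarrow> (\<integral>\<^sup>+x. 0 \<partial>N)"
    unfolding I2_def
  proof (rule nn_integral_dominated_convergence[where w = "\<lambda>x. ennreal (2 * B\<^sup>2) + ennreal (2 * G\<^sup>2) * (\<Sum>i. w x i)\<^sup>2"])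
    show "(\<integral>\<^sup>+x. ennreal (2 * B\<^sup>2) + ennreal (2 * G\<^sup>2) * (\<Sum>i. w x i)\<^sup>2 \<partial>N) < \<infinity>"
      by (subst nn_integral_add, measurable, subst nn_integral_cmult, measurable)
         (simp add: sum2 mk.emeasure_space_1 ennreal_mult_less_top)
    fix n
    have sq: "(a + b)\<^sup>2 \<le> 2 * a\<^sup>2 + 2 * b\<^sup>2" for a b :: ennreal
    proof (cases "a = top \<or> b = top")
      case True
      then show ?thesis by (auto simp: power2_eq_square ennreal_mult_top)
    next
      case False
      then obtain a' b' where ab: "a = ennreal a'" "b = ennreal b'" "0 \<le> a'" "0 \<le> b'" by (metis ennreal_cases)
      have "(a' + b')\<^sup>2 \<le> 2 * a'\<^sup>2 + 2 * b'\<^sup>2"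
        using zero_le_power2[of "a' - b'"] by (simp add: power2_eq_square algebra_simps)
      then have "ennreal ((a' + b')\<^sup>2) \<le> ennreal (2 * a'\<^sup>2 + 2 * b'\<^sup>2)" by (rule ennreal_leI)
      moreover have "ennreal (2 * a'\<^sup>2 + 2 * b'\<^sup>2) = 2 * (ennreal a')\<^sup>2 + 2 * (ennreal b')\<^sup>2"
        using ab by (simp add: ennreal_plus ennreal_mult ennreal_power)
      moreover have "ennreal ((a' + b')\<^sup>2) = (ennreal a' + ennreal b')\<^sup>2"
        using ab by (simp add: ennreal_plus ennreal_power[symmetric])
      ultimately show ?thesis unfolding ab(1,2) by simp
    qed
    show "AE x in N. (ennreal \<bar>initial_part f (T n) (r n) x\<bar> + (\<Sum>i. w x i * ennreal \<bar>mean_gap f c (S n x i) (r n * fst x i)\<bar>))\<^sup>2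
        \<le> ennreal (2 * B\<^sup>2) + ennreal (2 * G\<^sup>2) * (\<Sum>i. w x i)\<^sup>2"
    proof (rule AE_I2)
      fix x
      have "(\<Sum>i. w x i * ennreal \<bar>mean_gap f c (S n x i) (r n * fst x i)\<bar>) \<le> (\<Sum>i. w x i * ennreal G)"
        unfolding G_def by (intro suminf_le mult_left_mono ennreal_leI mean_gap_bound[OF fm fB]) auto
      then have s: "(\<Sum>i. w x i * ennreal \<bar>mean_gap f c (S n x i) (r n * fst x i)\<bar>) \<le> ennreal G * (\<Sum>i. w x i)"
        by (simp add: mult.commute)
      have a: "ennreal \<bar>initial_part f (T n) (r n) x\<bar> \<le> ennreal B"
        using fB B0 by (intro ennreal_leI) (simp add: initial_part_def[OF fm fB])
      have "(ennreal \<bar>initial_part f (T n) (r n) x\<bar> + (\<Sum>i. w x i * ennreal \<bar>mean_gap f c (S n x i) (r n * fst x i)\<bar>))\<^sup>2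
        \<le> (ennreal B + ennreal G * (\<Sum>i. w x i))\<^sup>2" by (intro power_mono add_mono a s) auto
      also have "\<dots> \<le> 2 * (ennreal B)\<^sup>2 + 2 * (ennreal G * (\<Sum>i. w x i))\<^sup>2" by (rule sq)
      also have "\<dots> = ennreal (2 * B\<^sup>2) + ennreal (2 * G\<^sup>2) * (\<Sum>i. w x i)\<^sup>2"
        using B0 G0 by (simp add: ennreal_mult power_mult_distrib mult.assoc flip: ennreal_power)
      finally show "(ennreal \<bar>initial_part f (T n) (r n) x\<bar> + (\<Sum>i. w x i * ennreal \<bar>mean_gap f c (S n x i) (r n * fst x i)\<bar>))\<^sup>2
        \<le> ennreal (2 * B\<^sup>2) + ennreal (2 * G\<^sup>2) * (\<Sum>i. w x i)\<^sup>2" .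
    qed
  next
    have fin: "AE x in N. (\<Sum>i. w x i) \<noteq> \<infinity>" by (rule nn_integral_PInf_AE) (auto simp: sum1)
    show "AE x in N. (\<lambda>n. (ennreal \<bar>initial_part f (T n) (r n) x\<bar> + (\<Sum>i. w x i * ennreal \<bar>mean_gap f c (S n x i) (r n * fst x i)\<bar>))\<^sup>2) \<longlonglongrightarrow> 0"
      using nonneg fin
    proof eventually_elim
      case (elim x)
      have "(\<lambda>n. \<integral>\<^sup>+i. w x i * ennreal \<bar>mean_gap f c (S n x i) (r n * fst x i)\<bar> \<partial>count_space UNIV) \<longlonglongrightarrow> (\<integral>\<^sup>+i. 0 \<partial>count_space (UNIV :: nat set))"
      proof (rule nn_integral_dominated_convergence[where w = "\<lambda>i. w x i * ennreal G"])
        show "AE i in count_space UNIV. w x i * ennreal \<bar>mean_gap f c (S n x i) (r n * fst x i)\<bar> \<le> w x i * ennreal G" for n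
          unfolding G_def by (intro AE_I2 mult_left_mono ennreal_leI mean_gap_bound[OF fm fB]) auto
        show "(\<integral>\<^sup>+i. w x i * ennreal G \<partial>count_space UNIV) < \<infinity>"
          using elim(2) by (simp add: nn_integral_count_space_nat ennreal_mult_less_top less_top)
        show "AE i in count_space UNIV. (\<lambda>n. w x i * ennreal \<bar>mean_gap f c (S n x i) (r n * fst x i)\<bar>) \<longlonglongrightarrow> 0"
        proof (rule AE_I2)
          fix i
          show "(\<lambda>n. w x i * ennreal \<bar>mean_gap f c (S n x i) (r n * fst x i)\<bar>) \<longlonglongrightarrow> 0"
          proof (cases "fst x i = 0")
            case True
            then show ?thesis by (simp add: w_def)
          next
            case False
            then have xi: "0 < fst x i" using elim(1) by (simp add: less_le)
            note rs = rescaled_sequences[OF \<alpha> T r xi, of "snd x"]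
            have "(\<lambda>n. mean_gap f c (S n x i) (r n * fst x i)) \<longlonglongrightarrow> 0"
              unfolding S_def by (rule mean_gap_tendsto[OF fm fB means[OF rs] rs(1)])
            then have "(\<lambda>n. w x i * ennreal \<bar>mean_gap f c (S n x i) (r n * fst x i)\<bar>) \<longlonglongrightarrow> w x i * ennreal 0"
              by (intro tendsto_mult_ennreal tendsto_const tendsto_ennrealI tendsto_rabs_zero) (auto simp: w_def)
            then show ?thesis by simp
          qed
        qed
      qed auto
      then have s0: "(\<lambda>n. \<Sum>i. w x i * ennreal \<bar>mean_gap f c (S n x i) (r n * fst x i)\<bar>) \<longlonglongrightarrow> 0"
        by (simp add: nn_integral_count_space_nat)
      have "\<forall>\<^sub>F n in sequentially. snd x \<le> T n" using T unfolding filterlim_at_top by blast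
      then have "\<forall>\<^sub>F n in sequentially. 0 = ennreal \<bar>initial_part f (T n) (r n) x\<bar>"
        by eventually_elim (simp add: initial_part_def[OF fm fB])
      then have a0: "(\<lambda>n. ennreal \<bar>initial_part f (T n) (r n) x\<bar>) \<longlonglongrightarrow> 0"
        by (rule Lim_transform_eventually[OF tendsto_const])
      have "(\<lambda>n. ennreal \<bar>initial_part f (T n) (r n) x\<bar> + (\<Sum>i. w x i * ennreal \<bar>mean_gap f c (S n x i) (r n * fst x i)\<bar>)) \<longlonglongrightarrow> 0 + 0"
        by (intro tendsto_add a0 s0)
      then have "(\<lambda>n. (ennreal \<bar>initial_part f (T n) (r n) x\<bar> + (\<Sum>i. w x i * ennreal \<bar>mean_gap f c (S n x i) (r n * fst x i)\<bar>)) *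
          (ennreal \<bar>initial_part f (T n) (r n) x\<bar> + (\<Sum>i. w x i * ennreal \<bar>mean_gap f c (S n x i) (r n * fst x i)\<bar>))) \<longlonglongrightarrow> 0 * 0"
        by (intro tendsto_mult_ennreal) auto
      then show ?case by (simp add: power2_eq_square)
    qed
  qed measurable
  have q2L: "ennreal q2 * ennreal L = ennreal (q2 ^ Suc k * gap_bound B c)"
    using q2(1) L by (simp add: L_def mult.assoc flip: ennreal_mult)
  have nn: "0 \<le> q2 ^ Suc k * gap_bound B c" using q2(1) gap_bound(1)[OF fm fB] by auto
  have "limsup I1 < ennreal (q2 ^ Suc k * gap_bound B c + \<epsilon> / 2)"
    using lim1 unfolding q2L by (rule le_less_trans) (use nn \<epsilon> in \<open>auto intro!: ennreal_lessI\<close>)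
  then have "\<forall>\<^sub>F n in sequentially. I1 n < ennreal (q2 ^ Suc k * gap_bound B c + \<epsilon> / 2)" by (rule Limsup_lessD)
  moreover have "\<forall>\<^sub>F n in sequentially. I2 n < ennreal (\<epsilon> / 2)"
    using lim2 by (rule order_tendstoD) (use \<epsilon> in simp)
  ultimately show ?case
  proof eventually_elim
    case (elim n)
    have "gap f c (Suc k) (T n) (r n) \<le> ennreal (q2 ^ Suc k * gap_bound B c + \<epsilon> / 2) + ennreal (\<epsilon> / 2)"
      using le[of n] add_mono[OF less_imp_le[OF elim(1)] less_imp_le[OF elim(2)]] by (rule order_trans)
    also have "\<dots> = ennreal (q2 ^ Suc k * gap_bound B c + \<epsilon>)"
      by (subst ennreal_plus[symmetric]) (use nn \<epsilon> in auto)
    finally show ?case .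
  qed
qed

text \<open>The index k is fixed first, so large that the martingale is close to its limit and q2^k
  \<open>gap_bound\<close> is small; only then does n grow. Each of the two distances is made at
  most \<epsilon>/4, because (x - y)^2 \<le> 2 x^2 + 2 y^2 doubles both.\<close>

theorem weighted_sum_L2_limit:
  assumes fm: "f \<in> borel_measurable borel" and fB: "\<And>x. \<bar>f x\<bar> \<le> B"
    and means: "\<And>T r. filterlim T at_top sequentially \<Longrightarrow> (\<lambda>n. r n / T n powr (1 / \<alpha>)) \<longlonglongrightarrow> 1 \<Longrightarrow>
      (\<lambda>n. \<integral>y. f (r n * y) \<partial>law (T n)) \<longlonglongrightarrow> c"
    and T: "filterlim T at_top sequentially" and r: "(\<lambda>n. r n / T n powr (1 / \<alpha>)) \<longlonglongrightarrow> 1"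
  shows "(\<lambda>n. \<integral>\<^sup>+\<theta>. ennreal ((weighted_sum \<infinity> f (T n) (r n) \<theta> - c * mart_lim \<theta>)\<^sup>2) \<partial>P) \<longlonglongrightarrow> 0"
proof (rule order_tendstoI)
  fix e :: ennreal assume e: "0 < e"
  note [measurable] = weighted_measurable[OF fm fB]
  obtain \<epsilon> where \<epsilon>: "0 < \<epsilon>" "ennreal \<epsilon> < e"
    using e by (metis ennreal_0 ennreal_less_zero_iff dense ennreal_cases less_top top.not_eq_extremum order_less_imp_not_eq2 ennreal_neg leI less_trans)
  have "(\<lambda>k. ennreal (c\<^sup>2) * (\<integral>\<^sup>+\<theta>. ennreal ((mart_lim \<theta> - mart k \<theta>)\<^sup>2) \<partial>P)) \<longlonglongrightarrow> ennreal (c\<^sup>2) * 0"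
    by (intro tendsto_mult_ennreal mart_lim_L2 tendsto_const) auto
  then have m0: "(\<lambda>k. ennreal (c\<^sup>2) * (\<integral>\<^sup>+\<theta>. ennreal ((mart_lim \<theta> - mart k \<theta>)\<^sup>2) \<partial>P)) \<longlonglongrightarrow> 0" by simp
  have "\<forall>\<^sub>F k in sequentially. ennreal (c\<^sup>2) * (\<integral>\<^sup>+\<theta>. ennreal ((mart_lim \<theta> - mart k \<theta>)\<^sup>2) \<partial>P) < ennreal (\<epsilon> / 4)"
    using m0 by (rule order_tendstoD) (use \<epsilon> in simp)
  moreover have "(\<lambda>k. q2 ^ k * gap_bound B c) \<longlonglongrightarrow> 0 * gap_bound B c"
    using q2 by (intro tendsto_mult_right LIMSEQ_power_zero) auto
  then have "\<forall>\<^sub>F k in sequentially. q2 ^ k * gap_bound B c < \<epsilon> / 8"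
    by (rule order_tendstoD) (use \<epsilon> in simp)
  ultimately have "\<forall>\<^sub>F k in sequentially. ennreal (c\<^sup>2) * (\<integral>\<^sup>+\<theta>. ennreal ((mart_lim \<theta> - mart k \<theta>)\<^sup>2) \<partial>P) < ennreal (\<epsilon> / 4)
      \<and> q2 ^ k * gap_bound B c < \<epsilon> / 8" by eventually_elim auto
  then obtain k where k1: "ennreal (c\<^sup>2) * (\<integral>\<^sup>+\<theta>. ennreal ((mart_lim \<theta> - mart k \<theta>)\<^sup>2) \<partial>P) < ennreal (\<epsilon> / 4)"
    and k2: "q2 ^ k * gap_bound B c < \<epsilon> / 8" by (auto simp: eventually_sequentially)
  have second: "(\<integral>\<^sup>+\<theta>. ennreal ((c * mart_lim \<theta> - c * mart k \<theta>)\<^sup>2) \<partial>P) \<le> ennreal (\<epsilon> / 4)"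
  proof -
    have "(\<integral>\<^sup>+\<theta>. ennreal ((c * mart_lim \<theta> - c * mart k \<theta>)\<^sup>2) \<partial>P) = (\<integral>\<^sup>+\<theta>. ennreal (c\<^sup>2) * ennreal ((mart_lim \<theta> - mart k \<theta>)\<^sup>2) \<partial>P)"
    proof (rule nn_integral_cong)
      fix \<theta>
      have "(c * mart_lim \<theta> - c * mart k \<theta>)\<^sup>2 = c\<^sup>2 * (mart_lim \<theta> - mart k \<theta>)\<^sup>2"
        by (metis power_mult_distrib right_diff_distrib)
      then show "ennreal ((c * mart_lim \<theta> - c * mart k \<theta>)\<^sup>2) = ennreal (c\<^sup>2) * ennreal ((mart_lim \<theta> - mart k \<theta>)\<^sup>2)"
        by (simp add: ennreal_mult)
    qed
    also have "\<dots> = ennreal (c\<^sup>2) * (\<integral>\<^sup>+\<theta>. ennreal ((mart_lim \<theta> - mart k \<theta>)\<^sup>2) \<partial>P)"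
      by (rule nn_integral_cmult) measurable
    finally show ?thesis using k1 by simp
  qed
  have "\<forall>\<^sub>F n in sequentially. gap f c k (T n) (r n) \<le> ennreal (q2 ^ k * gap_bound B c + \<epsilon> / 8)"
    by (rule gap_limit[OF fm fB means T r]) (use \<epsilon> in auto)
  then show "\<forall>\<^sub>F n in sequentially. (\<integral>\<^sup>+\<theta>. ennreal ((weighted_sum \<infinity> f (T n) (r n) \<theta> - c * mart_lim \<theta>)\<^sup>2) \<partial>P) < e"
  proof eventually_elim
    case (elim n)
    have "gap f c k (T n) (r n) \<le> ennreal (\<epsilon> / 4)"
      using elim by (rule order_trans) (use k2 in \<open>auto intro!: ennreal_leI\<close>)
    then have first: "(\<integral>\<^sup>+\<theta>. ennreal ((weighted_sum \<infinity> f (T n) (r n) \<theta> - c * mart k \<theta>)\<^sup>2) \<partial>P) \<le> ennreal (\<epsilon> / 4)"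
      unfolding gap_def[OF fm fB] .
    have "(\<integral>\<^sup>+\<theta>. ennreal (((weighted_sum \<infinity> f (T n) (r n) \<theta> - c * mart k \<theta>) - (c * mart_lim \<theta> - c * mart k \<theta>))\<^sup>2) \<partial>P)
        \<le> ennreal (2 * (\<epsilon> / 4) + 2 * (\<epsilon> / 4))"
      by (rule nn_integral_square_diff_le[OF _ _ first second]) (use \<epsilon> in auto)
    then have "(\<integral>\<^sup>+\<theta>. ennreal ((weighted_sum \<infinity> f (T n) (r n) \<theta> - c * mart_lim \<theta>)\<^sup>2) \<partial>P) \<le> ennreal \<epsilon>" by simp
    then show ?case using \<epsilon>(2) by (rule le_less_trans)
  qed
qed simp

end

subsection \<open>Transfer to the genealogical construction\<close>

lemma node_size_marks: "node_size ratio u (\<lambda>v. (\<eta> v \<omega>, e v \<omega>)) = node_size \<eta> u \<omega>"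
  by (induction u) (simp_all add: ratio_def)

lemma birth_time_marks: "birth_time \<alpha> ratio life u (\<lambda>v. (\<eta> v \<omega>, e v \<omega>)) = birth_time \<alpha> \<eta> e u \<omega>"
  by (induction u) (simp_all add: node_size_marks life_def)

lemma alive_marks: "alive \<alpha> ratio life t (\<lambda>v. (\<eta> v \<omega>, e v \<omega>)) = alive \<alpha> \<eta> e t \<omega>"
  by (simp add: alive_def death_time_def node_size_marks birth_time_marks life_def)

text \<open>Summability of reals is absolute and \<open>infsum\<close> defaults to 0 without it,
  hence the case distinction. The right-hand side consists of integrals over counting measure, the
  form in which sums over the tree are handled.\<close>

lemma infsum_real_eq_nn_integral:
  fixes h :: "'b \<Rightarrow> real"
  shows "infsum h A = (if (\<integral>\<^sup>+x. (if x \<in> A then ennreal \<bar>h x\<bar> else 0) \<partial>count_space UNIV) < \<infinity>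
    then enn2real (\<integral>\<^sup>+x. (if x \<in> A then ennreal (h x) else 0) \<partial>count_space UNIV) -
      enn2real (\<integral>\<^sup>+x. (if x \<in> A then ennreal (- h x) else 0) \<partial>count_space UNIV) else 0)"
proof -
  define h' where "h' x = (if x \<in> A then h x else 0)" for x
  have h': "infsum h A = infsum h' UNIV"
    by (rule infsum_cong_neutral) (auto simp: h'_def)
  have eq: "(if x \<in> A then ennreal \<bar>h x\<bar> else 0) = ennreal (norm (h' x))"
    "(if x \<in> A then ennreal (h x) else 0) = ennreal (h' x)"
    "(if x \<in> A then ennreal (- h x) else 0) = ennreal (- h' x)" for x
    by (auto simp: h'_def)
  have int: "integrable (count_space UNIV) h' \<longleftrightarrow> (\<integral>\<^sup>+x. ennreal (norm (h' x)) \<partial>count_space UNIV) < \<infinity>"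
    by (simp add: integrable_iff_bounded)
  show ?thesis
  proof (cases "integrable (count_space UNIV) h'")
    case True
    then have "Infinite_Set_Sum.abs_summable_on h' UNIV" by (simp add: Infinite_Set_Sum.abs_summable_on_def)
    then have "infsum h' UNIV = (\<integral>x. h' x \<partial>count_space UNIV)"
      by (simp add: infsetsum_infsum[symmetric] infsetsum_def)
    then show ?thesis
      unfolding h' eq using True int by (simp add: real_lebesgue_integral_def)
  next
    case False
    then have "\<not> Infinite_Set_Sum.abs_summable_on h' UNIV" by (simp add: Infinite_Set_Sum.abs_summable_on_def)
    then have "\<not> h' summable_on UNIV"
      using abs_summable_equivalent[of h' UNIV] summable_on_iff_abs_summable_on_real[of h' UNIV] by blast
    then have "infsum h' UNIV = 0" by (rule infsum_not_exists)
    then show ?thesis unfolding h' eq using False int by simp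
  qed
qed

text \<open>A divergent sum needs no separate case: \<open>enn2real\<close> of infinity is 0, like
  the default value of \<open>infsum\<close>.\<close>

lemma intrinsic_martingale_marks:
  "intrinsic_martingale \<eta> \<beta> n \<omega> = enn2real (gen_sum \<beta> n (\<lambda>v. (\<eta> v \<omega>, e v \<omega>)))"
proof -
  have neg: "ennreal (- (x powr \<beta>)) = 0" for x :: real by (rule ennreal_neg) simp
  have "(\<integral>\<^sup>+u. (if u \<in> {u. length u = n} then ennreal (- (node_size \<eta> u \<omega> powr \<beta>)) else 0) \<partial>count_space UNIV) = 0"
    unfolding neg by simp
  moreover have abs: "\<bar>x powr \<beta>\<bar> = x powr \<beta>" for x :: real by (rule abs_of_nonneg) simp
  ultimately show ?thesis
    unfolding intrinsic_martingale_def infsum_real_eq_nn_integral gen_sum_def node_size_marks abs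
    by (cases "(\<integral>\<^sup>+u. (if length u = n then ennreal (node_size \<eta> u \<omega> powr \<beta>) else 0) \<partial>count_space UNIV) = top")
       (simp_all add: less_top)
qed

context fragmentation_law
begin

lemma config_sum_marks:
  "config_sum \<alpha> \<eta> e t (\<lambda>x. x powr \<beta> * f (r * x)) \<omega> =
    (if alive_sum \<alpha> \<infinity> (\<lambda>x. ennreal \<bar>x powr \<beta> * f (r * x)\<bar>) t (\<lambda>v. (\<eta> v \<omega>, e v \<omega>)) < \<infinity>
     then weighted_sum \<infinity> f t r (\<lambda>v. (\<eta> v \<omega>, e v \<omega>)) else 0)"
  unfolding config_sum_def infsum_real_eq_nn_integral weighted_sum_def alive_sum_def node_size_marks alive_marks
  by simp

end

section \<open>From the structural measure to the size-biased law\<close>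

lemma sets_structural_measure: "sets (structural_measure \<nu>) = sets (restrict_space borel {0<..1})"
  unfolding structural_measure_def
  using sets.space_closed[of "restrict_space borel {0<..1::real}"] sets.sigma_sets_eq[of "restrict_space borel {0<..1::real}"]
  by (simp add: space_restrict_space)

text \<open>The structural measure is the restriction to the half-open unit interval of the image of
  \<nu> times counting measure under (\<xi>, j) -> \<xi> j; checking this on sets is enough to
  obtain all integrals.\<close>

lemma (in reproduction_law) nn_integral_structural_measure:
  assumes g[measurable]: "g \<in> borel_measurable borel"
  shows "(\<integral>\<^sup>+z. g z \<partial>structural_measure \<nu>) = (\<integral>\<^sup>+\<xi>. (\<Sum>j. if \<xi> j \<in> {0<..1} then g (\<xi> j) else 0) \<partial>\<nu>)"
proof -
  interpret C: sigma_finite_measure "count_space (UNIV :: nat set)"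
    by (rule sigma_finite_measure_count_space_countable) simp
  have comp: "(\<lambda>\<xi>. \<xi> j) \<in> borel_measurable \<nu>" for j
    by (subst measurable_cong_sets[OF sets_law refl]) measurable
  have [measurable]: "(\<lambda>x. fst x (snd x)) \<in> borel_measurable (\<nu> \<Otimes>\<^sub>M count_space (UNIV :: nat set))"
    by (rule measurable_compose_countable[where f = "\<lambda>j x. fst x j" and g = snd])
       (auto intro: measurable_compose[OF measurable_fst comp])
  define D where "D = distr (\<nu> \<Otimes>\<^sub>M count_space (UNIV :: nat set)) borel (\<lambda>x. fst x (snd x))"
  have D: "(\<integral>\<^sup>+z. h z \<partial>D) = (\<integral>\<^sup>+\<xi>. (\<Sum>j. h (\<xi> j)) \<partial>\<nu>)" if [measurable]: "h \<in> borel_measurable borel" for h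
    unfolding D_def
    by (subst nn_integral_distr, measurable, subst C.nn_integral_fst[symmetric]) (auto simp: nn_integral_count_space_nat)
  have "structural_measure \<nu> = restrict_space D {0<..1}"
  proof (rule measure_eqI)
    have "sets (structural_measure \<nu>) = sets (restrict_space borel {0<..1})"
      by (rule sets_structural_measure)
    also have "\<dots> = sets (restrict_space D {0<..1})" by (intro sets_restrict_space_cong) (simp add: D_def)
    finally show "sets (structural_measure \<nu>) = sets (restrict_space D {0<..1})" .
    fix B assume "B \<in> sets (structural_measure \<nu>)"
    then have B: "B \<in> sets (restrict_space borel {0<..1})" by (simp add: sets_structural_measure)
    then have B'[measurable]: "B \<in> sets borel" and sub: "B \<subseteq> {0<..1}" by (auto simp: sets_restrict_space_iff)
    have count: "emeasure (count_space UNIV) {j. \<xi> j \<in> B} = (\<Sum>j. indicator B (\<xi> j) :: ennreal)" for \<xi> :: "nat \<Rightarrow> real"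
      by (subst nn_integral_count_space_nat[symmetric])
         (simp add: nn_integral_indicator[symmetric] indicator_def del: nn_integral_indicator)
    have "emeasure (restrict_space D {0<..1}) B = emeasure D B"
      by (rule emeasure_restrict_space) (use sub in \<open>auto simp: D_def\<close>)
    also have "\<dots> = (\<integral>\<^sup>+z. indicator B z \<partial>D)" by (rule nn_integral_indicator[symmetric]) (simp add: D_def)
    also have "\<dots> = (\<integral>\<^sup>+\<xi>. (\<Sum>j. indicator B (\<xi> j)) \<partial>\<nu>)" by (rule D) measurable
    finally show "emeasure (structural_measure \<nu>) B = emeasure (restrict_space D {0<..1}) B"
      unfolding emeasure_structural_measure[OF sets_law B] count by simp
  qed
  then have "(\<integral>\<^sup>+z. g z \<partial>structural_measure \<nu>) = (\<integral>\<^sup>+z. g z * indicator {0<..1} z \<partial>D)"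
    by (simp add: nn_integral_restrict_space D_def)
  also have "\<dots> = (\<integral>\<^sup>+\<xi>. (\<Sum>j. g (\<xi> j) * indicator {0<..1} (\<xi> j)) \<partial>\<nu>)" by (rule D) measurable
  also have "\<dots> = (\<integral>\<^sup>+\<xi>. (\<Sum>j. if \<xi> j \<in> {0<..1} then g (\<xi> j) else 0) \<partial>\<nu>)"
    by (intro nn_integral_cong suminf_cong) auto
  finally show ?thesis .
qed

lemma (in reproduction_law) char_fun_eq:
  assumes "AE \<xi> in \<nu>. \<forall>j. \<xi> j \<in> {0..1}"
  shows "char_fun \<nu> b = (\<integral>\<^sup>+\<xi>. (\<Sum>j. ennreal (\<xi> j powr b)) \<partial>\<nu>)"
  unfolding char_fun_def
proof (subst nn_integral_structural_measure)
  show "(\<integral>\<^sup>+\<xi>. (\<Sum>j. if \<xi> j \<in> {0<..1} then ennreal (\<xi> j powr b) else 0) \<partial>\<nu>) = (\<integral>\<^sup>+\<xi>. (\<Sum>j. ennreal (\<xi> j powr b)) \<partial>\<nu>)"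
  proof (rule nn_integral_cong_AE)
    show "AE \<xi> in \<nu>. (\<Sum>j. if \<xi> j \<in> {0<..1} then ennreal (\<xi> j powr b) else 0) = (\<Sum>j. ennreal (\<xi> j powr b))"
      using assms
    proof eventually_elim
      case (elim \<xi>)
      have "(if \<xi> j \<in> {0<..1} then ennreal (\<xi> j powr b) else 0) = ennreal (\<xi> j powr b)" for j
      proof (cases "\<xi> j = 0")
        case False
        then have "\<xi> j \<in> {0<..1}" using elim[rule_format, of j] by auto
        then show ?thesis by simp
      qed simp
      then show ?case by simp
    qed
  qed
qed simp

context fragmentation_law
begin

lemma char_fun_tag: "char_fun \<nu> (\<beta> + p) = (\<integral>\<^sup>+z. ennreal (z powr p) \<partial>tag)"
proof -
  have "ennreal (x powr (\<beta> + p)) = ennreal (x powr \<beta>) * ennreal (x powr p)" for x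
    by (subst powr_add, subst ennreal_mult) auto
  then show ?thesis unfolding char_fun_eq[OF ratios_unit] by (subst nn_integral_tag) auto
qed

lemma powr_tag_measurable [measurable]: "(\<lambda>z. z powr p) \<in> borel_measurable tag"
proof -
  have "(\<lambda>z. z powr p) \<in> borel_measurable borel" by (intro powr_real_measurable) auto
  then show ?thesis by (simp only: measurable_cong_sets[OF sets_tag refl])
qed

lemma psi_tag: "psi \<nu> (\<beta> + p) = 1 - (\<integral>z. z powr p \<partial>tag)"
proof -
  have "(\<integral>z. z powr p \<partial>tag) = enn2real (\<integral>\<^sup>+z. ennreal (z powr p) \<partial>tag)"
    by (rule integral_eq_nn_integral) simp_all
  then show ?thesis by (simp only: psi_def char_fun_tag)
qed

text \<open>The density x^\<beta> is positive on the half-open unit interval, so the size-biased law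
  and the structural measure have the same null sets there.\<close>

lemma tag_nonarithmeticI:
  assumes "\<not> arithmetic (structural_measure \<nu>)"
  shows "\<not> (\<exists>r. 0 < r \<and> r < 1 \<and> (AE z in tag. \<exists>k::nat. z = r ^ k))"
proof
  assume "\<exists>r. 0 < r \<and> r < 1 \<and> (AE z in tag. \<exists>k::nat. z = r ^ k)"
  then obtain r :: real where r: "0 < r" "r < 1" and AE: "AE z in tag. \<exists>k::nat. z = r ^ k" by blast
  define Q where "Q z \<longleftrightarrow> (\<exists>k::nat. z = r ^ k)" for z
  have Q[measurable]: "Measurable.pred borel Q" unfolding Q_def[abs_def] by measurable
  have "AE \<xi> in \<nu>. \<forall>j. \<xi> j \<noteq> 0 \<longrightarrow> Q (\<xi> j)"
    using AE unfolding AE_tag_iff[OF Q, symmetric] by (simp add: Q_def)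
  then have "(\<integral>\<^sup>+\<xi>. (\<Sum>j. if \<xi> j \<in> {0<..1} then (if Q (\<xi> j) then 0 else 1) else 0) \<partial>\<nu>) = (\<integral>\<^sup>+\<xi>. 0 \<partial>\<nu>)"
  proof (intro nn_integral_cong_AE, eventually_elim)
    case (elim \<xi>)
    then have "(if \<xi> j \<in> {0<..1} then (if Q (\<xi> j) then 0 else 1) else 0) = (0 :: ennreal)" for j by auto
    then show ?case by simp
  qed
  then have z: "(\<integral>\<^sup>+z. (if Q z then 0 else 1) \<partial>structural_measure \<nu>) = 0"
    by (subst nn_integral_structural_measure) auto
  have "(\<lambda>z. if Q z then 0 else 1 :: ennreal) \<in> borel_measurable (restrict_space borel {0<..1})"
    by (rule measurable_restrict_space1) measurable
  then have m: "(\<lambda>z. if Q z then 0 else 1 :: ennreal) \<in> borel_measurable (structural_measure \<nu>)"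
    by (simp add: measurable_cong_sets[OF sets_structural_measure refl])
  have "AE z in structural_measure \<nu>. (if Q z then 0 else 1) = (0 :: ennreal)"
    using z m by (subst (asm) nn_integral_0_iff_AE) auto
  then have "AE z in structural_measure \<nu>. \<exists>k::nat. z = r ^ k"
    by eventually_elim (auto simp: Q_def split: if_splits)
  then show False using assms r unfolding arithmetic_def by blast
qed

lemma abscissa_tag:
  assumes "abscissa \<nu> < ereal \<beta>"
  obtains p where "0 < p" "p < \<alpha>" "integrable tag (\<lambda>z. z powr (- p))"
proof -
  obtain b where b: "b < \<beta>" "char_fun \<nu> b < \<infinity>"
    using assms by (auto simp: abscissa_def Inf_less_iff)
  \<comment> \<open>The cap \<alpha>/2 keeps p below \<alpha>, as
    \<open>negative_moment_bound\<close> demands; a p smaller than \<beta> - b stays integrable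
    because ratios are at most 1.\<close>
  define p where "p = min (\<alpha> / 2) (\<beta> - b)"
  have p: "0 < p" "p < \<alpha>" "p \<le> \<beta> - b" using b \<alpha> by (auto simp: p_def)
  have "(\<integral>\<^sup>+z. ennreal (norm (z powr (- p))) \<partial>tag) \<le> (\<integral>\<^sup>+z. ennreal (z powr (b - \<beta>)) \<partial>tag)"
  proof (rule nn_integral_mono_AE)
    show "AE z in tag. ennreal (norm (z powr (- p))) \<le> ennreal (z powr (b - \<beta>))"
      using AE_tag_unit
    proof eventually_elim
      case (elim z)
      then have "z powr (- p) \<le> z powr (b - \<beta>)" using p by (intro powr_mono') auto
      then show ?case by (simp add: ennreal_leI)
    qed
  qed
  also have "\<dots> < \<infinity>" using b char_fun_tag[of "b - \<beta>"] by simp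
  finally have "integrable tag (\<lambda>z. z powr (- p))" by (intro integrableI_bounded) auto
  then show thesis using p by (intro that)
qed

end

theorem theorem6:
  fixes M :: "'a measure" and \<nu> :: "(nat \<Rightarrow> real) measure"
    and \<eta> :: "node \<Rightarrow> 'a \<Rightarrow> nat \<Rightarrow> real" and e :: "node \<Rightarrow> 'a \<Rightarrow> real"
    and \<alpha> \<beta> :: real and \<rho> :: "real measure" and f :: "real \<Rightarrow> real"
  assumes "\<alpha> > 0"
    and "offspring_and_lifetimes M \<nu> \<eta> e"
    and "AE \<xi> in \<nu>. \<forall>j. \<xi> j \<in> {0..1}"
    and "(\<integral>\<^sup>+ \<xi>. emeasure (count_space UNIV) {j. \<xi> j > 0} \<partial>\<nu>) > 1"
    and "\<P>(\<xi> in \<nu>. \<xi> 0 = 1) < 1"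
    and "malthusian_exponent \<nu> \<beta>"
    and "abscissa \<nu> < ereal \<beta>"
    and "(\<integral>\<^sup>+ \<xi>. (\<Sum>j. ennreal (\<xi> j powr \<beta>))\<^sup>2 \<partial>\<nu>) < \<infinity>"
    and "\<not> arithmetic (structural_measure \<nu>)"
    and "prob_space \<rho>"
    and "sets \<rho> = sets (restrict_space borel {0<..})"
    and "\<And>k::nat. k \<ge> 1 \<Longrightarrow>
           has_bochner_integral \<rho> (\<lambda>x. x powr (real k * \<alpha>))
             (fact (k - 1) / (\<alpha> * deriv (psi \<nu>) \<beta>) *
               (\<Prod>j=1..k-1. 1 / psi \<nu> (\<beta> + \<alpha> * real j)))"
    and "continuous_on {0<..} f"
    and "bounded (f ` {0<..})"
  shows "L2_tendsto M
           (\<lambda>t. config_sum \<alpha> \<eta> e t (\<lambda>x. x powr \<beta> * f (t powr (1 / \<alpha>) * x)))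
           (\<lambda>\<omega>. terminal_value \<eta> \<beta> \<omega> * (\<integral>x. f x \<partial>\<rho>))
           at_top"
proof -
  note \<alpha> = assms(1) and unit = assms(3) and \<rho> = assms(10) and sets_\<rho> = assms(11) and mom\<rho> = assms(12)
  interpret O: offspring_and_lifetimes M \<nu> \<eta> e by (rule assms(2))
  have \<beta>: "0 < \<beta>" and "char_fun \<nu> \<beta> = 1" using assms(6) by (auto simp: malthusian_exponent_def)
  then have malthus: "(\<integral>\<^sup>+\<xi>. (\<Sum>j. ennreal (\<xi> j powr \<beta>)) \<partial>\<nu>) = 1"
    by (simp add: O.reproduction.char_fun_eq[OF unit])
  interpret fragmentation_law \<nu> \<alpha> \<beta> by unfold_locales (fact \<alpha> \<beta> unit malthus)+
  interpret L2_fragmentation_law \<nu> \<alpha> \<beta>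
    by unfold_locales (rule assms(8), rule tag_nonarithmeticI[OF assms(9)])
  obtain p where p: "0 < p" "p < \<alpha>" "integrable tag (\<lambda>z. z powr (- p))" using abscissa_tag[OF assms(7)] by blast
  have mom: "has_bochner_integral \<rho> (\<lambda>x. x powr (real k * \<alpha>)) (1 / (\<alpha> * deriv (psi \<nu>) \<beta>) * frag.rho_moment k)" if "1 \<le> k" for k
    using mom\<rho>[OF that] by (simp add: frag.rho_moment_def frag.psi0_def psi_tag)
  obtain B where B: "\<And>x. 0 < x \<Longrightarrow> \<bar>f x\<bar> \<le> B" using assms(14) by (auto simp: bounded_iff)
  \<comment> \<open>Outside the open half-line f is arbitrary. Its zero extension is Borel and
    globally bounded, and it agrees with f at all sizes that occur and on the space of
    \<rho>.\<close>
  define g where "g x = (if x \<in> {0<..} then f x else 0)" for x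
  have gB: "\<bar>g x\<bar> \<le> B" for x using B[of x] B[of 1] by (auto simp: g_def)
  have gm[measurable]: "g \<in> borel_measurable borel"
    unfolding g_def by (rule borel_measurable_continuous_on_if) (use assms(13) in auto)
  have gc: "continuous_on {0<..} g" using assms(13) by (subst continuous_on_cong[of _ "{0<..}" g f]) (auto simp: g_def)
  define c where "c = (\<integral>x. g x \<partial>\<rho>)"
  have c: "(\<integral>x. f x \<partial>\<rho>) = c"
    unfolding c_def using sets_eq_imp_space_eq[OF sets_\<rho>]
    by (intro Bochner_Integration.integral_cong) (auto simp: g_def space_restrict_space)
  have means: "(\<lambda>n. \<integral>y. g (r n * y) \<partial>law (T n)) \<longlonglongrightarrow> c"
    if "filterlim T at_top sequentially" "(\<lambda>n. r n / T n powr (1 / \<alpha>)) \<longlonglongrightarrow> 1" for T r :: "nat \<Rightarrow> real"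
    unfolding c_def by (rule frag.means_converge[OF \<rho> sets_\<rho> mom p gm gc gB that])
  define \<Theta> where "\<Theta> \<omega> v = (\<eta> v \<omega>, e v \<omega>)" for \<omega> v
  have \<Theta>_law: "distr M P \<Theta> = P" unfolding \<Theta>_def[abs_def] by (rule O.tree_distribution)
  have \<Theta>_m[measurable]: "\<Theta> \<in> measurable M P"
  proof -
    have "(\<lambda>\<omega>. \<Theta> \<omega> v) \<in> measurable M N" for v
      unfolding \<Theta>_def by (subst measurable_cong_sets[OF refl sets_N]) measurable
    then show ?thesis
      unfolding tree_law_def by (intro measurable_PiM_single') (auto simp: PiE_iff dest: measurable_space)
  qed
  have transfer: "(\<integral>\<^sup>+\<omega>. ennreal (h (\<Theta> \<omega>)) \<partial>M) = (\<integral>\<^sup>+\<theta>. ennreal (h \<theta>) \<partial>P)" if [measurable]: "h \<in> borel_measurable P" for h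
    using nn_integral_distr[OF \<Theta>_m, of "\<lambda>\<theta>. ennreal (h \<theta>)"] unfolding \<Theta>_law by simp
  \<comment> \<open>\<open>config_sum\<close> falls back to 0 where the sum is not absolutely
    convergent. Building this null event into W makes \<open>Y\<close> equal to W at every sample
    point, so that measurability of \<open>Y\<close> follows.\<close>
  define finite_sum where "finite_sum t \<theta> \<longleftrightarrow>
    alive_sum \<alpha> \<infinity> (\<lambda>x. ennreal \<bar>x powr \<beta> * g (t powr (1 / \<alpha>) * x)\<bar>) t \<theta> < \<infinity>" for t \<theta>
  define W where "W t \<theta> = (if finite_sum t \<theta> then weighted_sum \<infinity> g t (t powr (1 / \<alpha>)) \<theta> else 0)" for t \<theta>
  note [measurable] = weighted_measurable[OF gm gB]
  have Wm[measurable]: "W t \<in> borel_measurable P" for t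
  proof -
    have [measurable]: "(\<lambda>\<theta>. alive_sum \<alpha> \<infinity> (\<lambda>x. ennreal \<bar>x powr \<beta> * g (t powr (1 / \<alpha>) * x)\<bar>) t \<theta>) \<in> borel_measurable P"
      by (rule alive_sum_measurable) measurable
    show ?thesis unfolding W_def[abs_def] finite_sum_def by measurable
  qed
  have W_AE: "AE \<theta> in P. W t \<theta> = weighted_sum \<infinity> g t (t powr (1 / \<alpha>)) \<theta>" for t
    using AE_mass_finite[of \<infinity> t]
  proof eventually_elim
    case (elim \<theta>)
    have "alive_sum \<alpha> \<infinity> (\<lambda>x. ennreal \<bar>x powr \<beta> * g (t powr (1 / \<alpha>) * x)\<bar>) t \<theta>
        = alive_sum \<alpha> \<infinity> (\<lambda>x. ennreal (x powr \<beta> * \<bar>g (t powr (1 / \<alpha>) * x)\<bar>)) t \<theta>"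
      by (simp add: abs_mult)
    also have "\<dots> \<le> ennreal B * mass_sum \<infinity> t \<theta>"
      by (rule alive_sum_le_mass) (use gB B_nonneg[OF gm gB] in auto)
    also have "\<dots> < \<infinity>" using elim by (simp add: ennreal_mult_less_top)
    finally show ?case by (simp add: W_def finite_sum_def)
  qed
  define Y where "Y t = config_sum \<alpha> \<eta> e t (\<lambda>x. x powr \<beta> * f (t powr (1 / \<alpha>) * x))" for t
  define Z where "Z \<omega> = terminal_value \<eta> \<beta> \<omega> * (\<integral>x. f x \<partial>\<rho>)" for \<omega>
  have Y: "Y t \<omega> = W t (\<Theta> \<omega>)" if "0 < t" for t \<omega>
  proof -
    have "Y t \<omega> = config_sum \<alpha> \<eta> e t (\<lambda>x. x powr \<beta> * g (t powr (1 / \<alpha>) * x)) \<omega>"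
      unfolding Y_def config_sum_def
      by (rule infsum_cong) (use that in \<open>auto simp: alive_def g_def zero_less_mult_iff\<close>)
    then show ?thesis unfolding config_sum_marks W_def finite_sum_def \<Theta>_def .
  qed
  have Z: "Z \<omega> = c * mart_lim (\<Theta> \<omega>)" for \<omega>
    unfolding Z_def c terminal_value_def mart_lim_def mart_def \<Theta>_def intrinsic_martingale_marks[where e = e]
    by (rule mult.commute)
  have Z_L2: "in_L2 M Z"
  proof -
    have "(\<integral>\<^sup>+\<omega>. ennreal ((c * mart_lim (\<Theta> \<omega>))\<^sup>2) \<partial>M) = (\<integral>\<^sup>+\<theta>. ennreal ((c * mart_lim \<theta>)\<^sup>2) \<partial>P)"
      by (rule transfer) measurable
    also have "\<dots> = (\<integral>\<^sup>+\<theta>. ennreal (c\<^sup>2) * ennreal ((mart_lim \<theta>)\<^sup>2) \<partial>P)"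
      by (simp add: power_mult_distrib ennreal_mult)
    also have "\<dots> = ennreal (c\<^sup>2) * (\<integral>\<^sup>+\<theta>. ennreal ((mart_lim \<theta>)\<^sup>2) \<partial>P)" by (rule nn_integral_cmult) measurable
    also have "\<dots> < \<infinity>" using mart_lim_second_moment by (simp add: ennreal_mult_less_top)
    finally have fin: "(\<integral>\<^sup>+\<omega>. ennreal ((c * mart_lim (\<Theta> \<omega>))\<^sup>2) \<partial>M) < \<infinity>" .
    have "(\<lambda>\<omega>. (c * mart_lim (\<Theta> \<omega>))\<^sup>2) \<in> borel_measurable M" by measurable
    then have "integrable M (\<lambda>\<omega>. (c * mart_lim (\<Theta> \<omega>))\<^sup>2)" by (rule integrableI_bounded) (use fin in simp)
    then show ?thesis unfolding in_L2_def Z by simp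
  qed
  have Y_L2: "in_L2 M (Y t)" if "0 < t" for t
  proof -
    have "(\<integral>\<^sup>+\<omega>. ennreal ((W t (\<Theta> \<omega>))\<^sup>2) \<partial>M) = (\<integral>\<^sup>+\<theta>. ennreal ((W t \<theta>)\<^sup>2) \<partial>P)"
      by (rule transfer) measurable
    also have "\<dots> = (\<integral>\<^sup>+\<theta>. ennreal ((weighted_sum \<infinity> g t (t powr (1 / \<alpha>)) \<theta>)\<^sup>2) \<partial>P)"
      by (rule nn_integral_cong_AE) (use W_AE[of t] in \<open>eventually_elim, simp\<close>)
    also have "\<dots> < \<infinity>" using weighted_second_moment[OF gm gB] by (rule le_less_trans) simp
    finally have fin: "(\<integral>\<^sup>+\<omega>. ennreal ((W t (\<Theta> \<omega>))\<^sup>2) \<partial>M) < \<infinity>" .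
    have "(\<lambda>\<omega>. (W t (\<Theta> \<omega>))\<^sup>2) \<in> borel_measurable M" by measurable
    then have "integrable M (\<lambda>\<omega>. (W t (\<Theta> \<omega>))\<^sup>2)" by (rule integrableI_bounded) (use fin in simp)
    then show ?thesis unfolding in_L2_def by (simp add: Y[OF that] cong: measurable_cong)
  qed
  have lim: "((\<lambda>t. \<integral>\<omega>. (Y t \<omega> - Z \<omega>)\<^sup>2 \<partial>M) \<longlongrightarrow> 0) at_top"
  proof (rule tendsto_at_topI_sequentially)
    \<comment> \<open>A limit at infinity of a real variable is tested along sequences; the exact
      scale X^(1/\<alpha>) forms an admissible pair with X, the quotient being 1 once X is
      positive.\<close>
    fix X :: "nat \<Rightarrow> real" assume X: "filterlim X at_top sequentially"
    have X0: "\<forall>\<^sub>F n in sequentially. 0 < X n" using X unfolding filterlim_at_top_dense by blast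
    have "\<forall>\<^sub>F n in sequentially. 1 = X n powr (1 / \<alpha>) / X n powr (1 / \<alpha>)"
      using X0 by eventually_elim simp
    then have "(\<lambda>n. X n powr (1 / \<alpha>) / X n powr (1 / \<alpha>)) \<longlonglongrightarrow> 1" by (rule Lim_transform_eventually[OF tendsto_const])
    from weighted_sum_L2_limit[OF gm gB means X this]
    have "(\<lambda>n. \<integral>\<^sup>+\<theta>. ennreal ((weighted_sum \<infinity> g (X n) (X n powr (1 / \<alpha>)) \<theta> - c * mart_lim \<theta>)\<^sup>2) \<partial>P) \<longlonglongrightarrow> 0"
      by simp
    then have "(\<lambda>n. enn2real (\<integral>\<^sup>+\<theta>. ennreal ((weighted_sum \<infinity> g (X n) (X n powr (1 / \<alpha>)) \<theta> - c * mart_lim \<theta>)\<^sup>2) \<partial>P)) \<longlonglongrightarrow> enn2real 0"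
      by (intro tendsto_enn2real) auto
    then have "(\<lambda>n. enn2real (\<integral>\<^sup>+\<theta>. ennreal ((weighted_sum \<infinity> g (X n) (X n powr (1 / \<alpha>)) \<theta> - c * mart_lim \<theta>)\<^sup>2) \<partial>P)) \<longlonglongrightarrow> 0"
      by simp
    moreover have "\<forall>\<^sub>F n in sequentially.
      enn2real (\<integral>\<^sup>+\<theta>. ennreal ((weighted_sum \<infinity> g (X n) (X n powr (1 / \<alpha>)) \<theta> - c * mart_lim \<theta>)\<^sup>2) \<partial>P) = (\<integral>\<omega>. (Y (X n) \<omega> - Z \<omega>)\<^sup>2 \<partial>M)"
      using X0
    proof eventually_elim
      case (elim n)
      have m: "(\<lambda>\<omega>. (W (X n) (\<Theta> \<omega>) - c * mart_lim (\<Theta> \<omega>))\<^sup>2) \<in> borel_measurable M" by measurable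
      have "(\<integral>\<omega>. (Y (X n) \<omega> - Z \<omega>)\<^sup>2 \<partial>M) = enn2real (\<integral>\<^sup>+\<omega>. ennreal ((W (X n) (\<Theta> \<omega>) - c * mart_lim (\<Theta> \<omega>))\<^sup>2) \<partial>M)"
        unfolding Y[OF elim] Z by (rule integral_eq_nn_integral[OF m]) simp
      also have "(\<integral>\<^sup>+\<omega>. ennreal ((W (X n) (\<Theta> \<omega>) - c * mart_lim (\<Theta> \<omega>))\<^sup>2) \<partial>M)
          = (\<integral>\<^sup>+\<theta>. ennreal ((W (X n) \<theta> - c * mart_lim \<theta>)\<^sup>2) \<partial>P)"
        by (rule transfer) measurable
      also have "\<dots> = (\<integral>\<^sup>+\<theta>. ennreal ((weighted_sum \<infinity> g (X n) (X n powr (1 / \<alpha>)) \<theta> - c * mart_lim \<theta>)\<^sup>2) \<partial>P)"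
        by (rule nn_integral_cong_AE) (use W_AE[of "X n"] in \<open>eventually_elim, simp\<close>)
      finally show ?case by simp
    qed
    ultimately show "(\<lambda>n. \<integral>\<omega>. (Y (X n) \<omega> - Z \<omega>)\<^sup>2 \<partial>M) \<longlonglongrightarrow> 0" by (rule Lim_transform_eventually)
  qed
  have "\<forall>\<^sub>F t in at_top. in_L2 M (Y t)"
    using eventually_gt_at_top[of 0] by eventually_elim (rule Y_L2)
  then show ?thesis
    using Z_L2 lim unfolding L2_tendsto_def Y_def Z_def by blast
qed

end
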